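(* Let $H$ be a quasi-Hopf algebra over a field $k$ with bijective antipode, let ${}_H\mathcal{M}$ be the category of left $H$-modules, ${}^H_H\mathcal{YD}$ the category of Yetter-Drinfeld $H$-modules (of the second kind), and $F:{}^H_H\mathcal{YD}\to{}_H\mathcal{M}$ the forgetful functor. For $V\in{}_H\mathcal{M}$ let $R(V)$ be the vector space $H\otimes V$ with the $H$-action and second kind coaction $$h\triangleright(a\otimes v)=h_{(1,1)}\,a\,S(h_{(2)})\otimes h_{(1,2)}v,\qquad \delta_{R(V)}(a\otimes v)=\omega_1a_{(1)}\omega_5\otimes\bigl(\omega_2a_{(2)}\omega_4\otimes\omega_3v\bigr)\quad(a,h\in H,\ v\in V).$$ (It is a Yetter-Drinfeld module of the second kind: the free left $H$-comodule on $V$ in the left ${}_H\mathcal{M}_H$-module category ${}_H\mathcal{M}$.) Then the assignment $V\mapsto R(V)$ extends to a functor $R:{}_H\mathcal{M}\to{}^H_H\mathcal{YD}$. This functor is right adjoint to $F$ with the unit $\eta$ and the counit $\varepsilon$ given by $$\eta_M:M\to RF(M),\quad m\mapsto m_{[-1]}\otimes m_{[0]}\quad(m\in M\in{}^H_H\mathcal{YD}),$$ $$\varepsilon_V:FR(V)\to V,\quad a\otimes v\mapsto\epsilon(a)v\quad(a\in H,\ v\in V\in{}_H\mathcal{M}).$$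
   Context: Conventions. $k$ is a field, $\otimes=\otimes_k$. For a $k$-algebra $A$, $x\in A^{\otimes n}$ is written $x=x_1\otimes\cdots\otimes x_n$ (summation understood), and $x^{-1}=\overline{x}_1\otimes\cdots\otimes\overline{x}_n$ if $x$ is invertible. A quasi-Hopf algebra is $(H,\Delta,\epsilon,\phi,S,\alpha,\beta)$ with $H$ a $k$-algebra, algebra maps $\Delta:H\to H\otimes H$ (written $\Delta(h)=h_{(1)}\otimes h_{(2)}$), $\epsilon:H\to k$, an invertible $\phi\in H^{\otimes3}$, an anti-algebra map $S:H\to H$ and $\alpha,\beta\in H$ such that for all $h\in H$: $h_{(1)}\otimes\Delta(h_{(2)})=\phi(\Delta(h_{(1)})\otimes h_{(2)})\phi^{-1}$; $\epsilon(h_{(1)})h_{(2)}=h=h_{(1)}\epsilon(h_{(2)})$; $(\mathrm{id}\otimes\mathrm{id}\otimes\Delta)(\phi)(\Delta\otimes\mathrm{id}\otimes\mathrm{id})(\phi)=(1\otimes\phi)(\mathrm{id}\otimes\Delta\otimes\mathrm{id})(\phi)(\phi\otimes1)$; $(\mathrm{id}\otimes\epsilon\otimes\mathrm{id})(\phi)=1\otimes1$; $S(h_{(1)})\alpha h_{(2)}=\epsilon(h)\alpha$, $h_{(1)}\beta S(h_{(2)})=\epsilon(h)\beta$; $\phi_1\beta S(\phi_2)\alpha\phi_3=1=S(\overline\phi_1)\alpha\overline\phi_2\beta S(\overline\phi_3)$; and (standing normalization) $\epsilon(\alpha)=\epsilon(\beta)=1$. $\overline S$ is the inverse of $S$. $\Delta(h_{(1)})\otimes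 h_{(2)}=h_{(1,1)}\otimes h_{(1,2)}\otimes h_{(2)}$, $h_{(1)}\otimes\Delta(h_{(2)})=h_{(1)}\otimes h_{(2,1)}\otimes h_{(2,2)}$; $\Delta^{\mathrm{cop}}(h)=h_{(2)}\otimes h_{(1)}$. Drinfeld's element: $p^R=\overline\phi_1\otimes\overline\phi_2\beta S(\overline\phi_3)$, $\mathbf{a}=S(\overline\phi_1\phi_2)\alpha\overline\phi_2\phi_{3(1)}\otimes S(\phi_1)\alpha\overline\phi_3\phi_{3(2)}$, and $\mathbf f=(S\otimes S)(\Delta^{\mathrm{cop}}(p^R_1))\cdot\mathbf a\cdot\Delta(p^R_2)\in H\otimes H$, which is invertible. $\chi=(\phi\otimes1)\cdot(\Delta\otimes\mathrm{id}\otimes\mathrm{id})(\phi^{-1})\in H^{\otimes4}$ and $\omega=(1\otimes1\otimes1\otimes\overline{\mathbf f}_2\otimes\overline{\mathbf f}_1)\cdot(\mathrm{id}\otimes\Delta\otimes S\otimes S)(\chi)\cdot(\phi\otimes1\otimes1)\in H^{\otimes5}$. A Yetter-Drinfeld module of the second kind is a left $H$-module $V$ with a linear map $\delta_V:V\to H\otimes V$, $v\mapsto v_{[-1]}\otimes v_{[0]}$, such that $v_{[-1]}\otimes v_{[0][-1]}\otimes v_{[0][0]}=\omega_1(v_{[-1]})_{(1)}\omega_5\otimes\omega_2(v_{[-1]})_{(2)}\omega_4\otimes\omega_3v_{[0]}$, $\epsilon(v_{[-1]})v_{[0]}=v$ and $\delta_V(hv)=h_{(1,1)}v_{[-1]}S(h_{(2)})\otimes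 h_{(1,2)}v_{[0]}$ for all $h\in H$, $v\in V$. Morphisms in ${}^H_H\mathcal{YD}$ are linear maps preserving the action and the coaction. (In the parenthetical remark: ${}_H\mathcal{M}_H$ is the category of $H$-bimodules; it acts on ${}_H\mathcal M$ by $(M,V)\mapsto M\otimes V$ with $h\cdot(m\otimes v)=h_{(1,1)}mS(h_{(2)})\otimes h_{(1,2)}v$.) *)

theory Defs
  imports Complex_Main "HOL-Library.Function_Algebras" "HOL-Library.FuncSet"
begin

section \<open>Tensor products of vector spaces over a field\<close>

text \<open>
  A vector space over the field \<open>'k\<close> is a linear subspace of a type \<open>'v\<close> of class
  \<open>ab_group_add\<close> that carries a scalar multiplication (locale \<open>vector_space\<close>).

  The tensor product \<open>X1 \<otimes> ... \<otimes> Xn\<close> is realised inside the dual of the space of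
  multilinear forms on \<open>X1 \<times> ... \<times> Xn\<close>: the pure tensor \<open>x1 \<otimes> ... \<otimes> xn\<close> is the
  functional \<open>g \<mapsto> g (x1, ..., xn)\<close>, and the tensor product is the linear span of the pure
  tensors.  Over a field this is the tensor product; its universal property is proved below
  (\<open>tensor_universal\<close>, \<open>tensor_universal_bilinear\<close>).

  A \<open>mspace\<close> records the points \<open>(x1, ..., xn)\<close> and the multilinear forms; \<open>vsp s V\<close> is the
  case of one factor, and \<open>\<boxtimes>\<close> adjoins a factor.  Tuples associate to the right, and so does
  \<open>\<boxtimes>\<close>, so no associativity isomorphism of vector spaces is ever needed.
\<close>

type_synonym ('k, 'a) tensor = "('a \<Rightarrow> 'k) \<Rightarrow> 'k"

record ('k, 'a) mspace =
  points :: "'a set"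
  forms :: "('a \<Rightarrow> 'k) set"

definition linear_on ::
  "('k::field \<Rightarrow> 'v::ab_group_add \<Rightarrow> 'v) \<Rightarrow> ('k \<Rightarrow> 'w::ab_group_add \<Rightarrow> 'w) \<Rightarrow> 'v set \<Rightarrow> ('v \<Rightarrow> 'w) \<Rightarrow> bool"
  where "linear_on s s' V f \<longleftrightarrow>
    (\<forall>x\<in>V. \<forall>y\<in>V. f (x + y) = f x + f y) \<and> (\<forall>c. \<forall>x\<in>V. f (s c x) = s' c (f x))"

definition vsp :: "('k::field \<Rightarrow> 'v::ab_group_add \<Rightarrow> 'v) \<Rightarrow> 'v set \<Rightarrow> ('k, 'v) mspace"
  where "vsp s V = \<lparr>points = V, forms = {g. linear_on s (*) V g}\<rparr>"

definition mprod :: "('k, 'a) mspace \<Rightarrow> ('k, 'b) mspace \<Rightarrow> ('k, 'a \<times> 'b) mspace" (infixr "\<boxtimes>" 80)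
  where "X \<boxtimes> Y = \<lparr>points = points X \<times> points Y,
    forms = {g. (\<forall>a\<in>points X. (\<lambda>b. g (a, b)) \<in> forms Y) \<and>
                (\<forall>b\<in>points Y. (\<lambda>a. g (a, b)) \<in> forms X)}\<rparr>"

text \<open>\<open>pt X (x1, ..., xn)\<close> is the pure tensor \<open>x1 \<otimes> ... \<otimes> xn\<close>.  Only multilinear forms are
  of interest; setting the value to \<open>0\<close> elsewhere makes equality of functionals the equality
  of tensors.\<close>

definition pt :: "('k::field, 'a) mspace \<Rightarrow> 'a \<Rightarrow> ('k, 'a) tensor"
  where "pt X x = (\<lambda>g. if g \<in> forms X then g x else 0)"

definition tscale :: "'k::field \<Rightarrow> ('k, 'a) tensor \<Rightarrow> ('k, 'a) tensor"
  where "tscale c t = (\<lambda>g. c * t g)"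

definition tens :: "('k::field, 'a) mspace \<Rightarrow> ('k, 'a) tensor set"
  where "tens X = module.span tscale (pt X ` points X)"

text \<open>Linear extension (Sweedler notation): for multilinear \<open>f\<close> with values in tensors,
  \<open>tsum t f\<close> is the image of \<open>t\<close> under the linear map \<open>x1 \<otimes> ... \<otimes> xn \<mapsto> f (x1, ..., xn)\<close>,
  i.e. \<open>f (t1, ..., tn)\<close> with summation understood; see \<open>tsum_linear\<close> and \<open>tsum_pt\<close>.\<close>

definition tsum :: "('k, 'a) tensor \<Rightarrow> ('a \<Rightarrow> ('k, 'b) tensor) \<Rightarrow> ('k, 'b) tensor"
  where "tsum t f = (\<lambda>g. t (\<lambda>x. f x g))"

text \<open>For a single factor, \<open>v \<mapsto> pt (vsp s V) v\<close> is an isomorphism of \<open>V\<close> onto \<open>tens (vsp s V)\<close>;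
  this is its inverse.\<close>

definition tval :: "('k::field, 'v) mspace \<Rightarrow> ('k, 'v) tensor \<Rightarrow> 'v"
  where "tval X t = (THE v. v \<in> points X \<and> pt X v = t)"

subsection \<open>Sanity checks\<close>

lemma vector_space_tscale: "vector_space (tscale :: 'k::field \<Rightarrow> ('k, 'a) tensor \<Rightarrow> _)"
  by unfold_locales (auto simp: tscale_def algebra_simps fun_eq_iff)

lemma tsum_pt:
  assumes "\<And>g. (\<lambda>x. f x g) \<in> forms X"
  shows "tsum (pt X x) f = f x"
  using assms by (simp add: tsum_def pt_def)

lemma tsum_linear:
  "tsum (t + u) f = tsum t f + tsum u f" "tsum (tscale c t) f = tscale c (tsum t f)"
  by (auto simp: tsum_def tscale_def)

lemma linear_forms_separate:
  assumes vs: "vector_space (s :: 'k::field \<Rightarrow> 'v::ab_group_add \<Rightarrow> 'v)"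
    and eq: "\<And>g. linear_on s (*) UNIV g \<Longrightarrow> g x = g y"
  shows "x = y"
proof (rule ccontr)
  interpret vector_space s by (fact vs)
  assume ne: "x \<noteq> y"
  define u where "u = x - y"
  have ind: "independent {u}" using ne by (simp add: u_def)
  define B where "B = extend_basis {u}"
  have B: "independent B" "span B = UNIV" "u \<in> B"
    using independent_extend_basis[OF ind] span_extend_basis[OF ind] extend_basis_superset[OF ind]
    by (auto simp: B_def)
  define g where "g = (\<lambda>v. representation B v u)"
  have "linear_on s (*) UNIV g"
    using B by (auto simp: linear_on_def g_def representation_add representation_scale)
  moreover from this have "g x = g y" by (rule eq)
  moreover have "x = y + u" by (simp add: u_def)
  ultimately have "g u = 0" by (auto simp: linear_on_def)
  moreover have "g u = 1" using B by (simp add: g_def representation_basis)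
  ultimately show False by simp
qed

lemma tval_pt:
  assumes "vector_space s" "v \<in> V"
  shows "tval (vsp s V) (pt (vsp s V) v) = v"
  unfolding tval_def
proof (rule the_equality)
  fix w assume w: "w \<in> points (vsp s V) \<and> pt (vsp s V) w = pt (vsp s V) v"
  show "w = v"
  proof (rule linear_forms_separate[OF assms(1)])
    fix g assume "linear_on s (*) UNIV g"
    then have "g \<in> forms (vsp s V)" by (simp add: vsp_def linear_on_def)
    moreover have "pt (vsp s V) w g = pt (vsp s V) v g" using w by simp
    ultimately show "g w = g v" by (simp add: pt_def)
  qed
qed (use assms in \<open>simp add: vsp_def\<close>)

text \<open>Every map that is multilinear (as tested by linear forms) factors uniquely through \<open>tens X\<close>.\<close>

theorem tensor_universal:
  fixes f :: "'a \<Rightarrow> 'u::ab_group_add" and s :: "'k::field \<Rightarrow> 'u \<Rightarrow> 'u"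
  assumes vs: "vector_space s"
    and f: "\<And>g. linear_on s (*) UNIV g \<Longrightarrow> (\<lambda>x. g (f x)) \<in> forms X"
  shows "\<exists>!F. F \<in> extensional (tens X) \<and> linear_on tscale s (tens X) F \<and>
    (\<forall>x\<in>points X. F (pt X x) = f x)"
proof -
  interpret U: vector_space s by (fact vs)
  interpret T: vector_space "tscale :: 'k \<Rightarrow> ('k, 'a) tensor \<Rightarrow> _" by (fact vector_space_tscale)
  define P where "P t u \<longleftrightarrow> (\<forall>g. linear_on s (*) UNIV g \<longrightarrow> g u = t (\<lambda>x. g (f x)))" for t u
  have uniq: "u = u'" if "P t u" "P t u'" for t u u'
    using that by (intro linear_forms_separate[OF vs]) (auto simp: P_def)
  have P0: "P 0 0"
  proof -
    have "g 0 = 0" if "linear_on s (*) UNIV g" for g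
      using that unfolding linear_on_def by (metis UNIV_I add_cancel_right_right)
    then show ?thesis by (auto simp: P_def)
  qed
  have Ppt: "P (pt X x) (f x)" for x
    using f by (auto simp: P_def pt_def)
  have Padd: "P (t + t') (u + u')" if "P t u" "P t' u'" for t t' u u'
    using that by (auto simp: P_def linear_on_def)
  have Psc: "P (tscale c t) (s c u)" if "P t u" for c t u
    using that by (auto simp: P_def linear_on_def tscale_def)
  have ex: "\<exists>u. P t u" if "t \<in> tens X" for t
    using that unfolding tens_def
  proof (induction rule: T.span_induct_alt)
    case base
    then show ?case using P0 by blast
  next
    case (step c x y)
    then show ?case using Ppt Padd Psc by blast
  qed
  define F where "F = restrict (\<lambda>t. THE u. P t u) (tens X)"
  have FP: "P t (F t)" if "t \<in> tens X" for t
    using theI'[of "P t"] ex[OF that] uniq that by (auto simp: F_def)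
  have F_eq: "F t = u" if "t \<in> tens X" "P t u" for t u
    using FP that uniq by blast
  have pt_in: "pt X x \<in> tens X" if "x \<in> points X" for x
    unfolding tens_def using that by (intro T.span_base) auto
  have add_in: "t + t' \<in> tens X" if "t \<in> tens X" "t' \<in> tens X" for t t'
    using that unfolding tens_def by (rule T.span_add)
  have sc_in: "tscale c t \<in> tens X" if "t \<in> tens X" for c t
    using that unfolding tens_def by (rule T.span_scale)
  show ?thesis
  proof (rule ex1I[of _ F])
    have "F \<in> extensional (tens X)" by (simp add: F_def)
    moreover have "linear_on tscale s (tens X) F"
      unfolding linear_on_def by (intro conjI ballI allI F_eq add_in sc_in Padd Psc FP)
    moreover have "\<forall>x\<in>points X. F (pt X x) = f x"
      by (intro ballI F_eq pt_in Ppt)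
    ultimately show "F \<in> extensional (tens X) \<and> linear_on tscale s (tens X) F \<and>
      (\<forall>x\<in>points X. F (pt X x) = f x)" by blast
  next
    fix G assume G: "G \<in> extensional (tens X) \<and> linear_on tscale s (tens X) G \<and>
      (\<forall>x\<in>points X. G (pt X x) = f x)"
    have "P t (G t) \<and> t \<in> tens X" if "t \<in> tens X" for t
      using that unfolding tens_def
    proof (induction rule: T.span_induct_alt)
      case base
      have z: "0 \<in> tens X" unfolding tens_def by (rule T.span_zero)
      then have "G (0 + 0) = G 0 + G 0" using G unfolding linear_on_def by blast
      then have "G 0 = 0" by (metis add_0 add_cancel_right_right)
      then show ?case using P0 z unfolding tens_def by metis
    next
      case (step c x y)
      then obtain p where p: "p \<in> points X" "x = pt X p" by blast
      have in1: "y \<in> tens X" "tscale c x \<in> tens X" "x \<in> tens X"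
        using step p by (auto simp: tens_def[symmetric] intro: sc_in pt_in)
      then have "G (tscale c x + y) = s c (f p) + G y"
        using G p unfolding linear_on_def by metis
      moreover have "P (tscale c x + y) (s c (f p) + G y)"
        using step p(2) in1 by (intro Padd Psc) (simp_all add: Ppt tens_def[symmetric])
      ultimately show ?case
        using add_in[OF in1(2,1)] unfolding tens_def by metis
    qed
    then have "G t = F t" if "t \<in> tens X" for t
      using that F_eq by metis
    then show "G = F"
      using G by (intro extensionalityI[of _ "tens X"]) (auto simp: F_def)
  qed
qed

corollary tensor_universal_bilinear:
  fixes f :: "'v::ab_group_add \<times> 'w::ab_group_add \<Rightarrow> 'u::ab_group_add"
    and r :: "'k::field \<Rightarrow> 'u \<Rightarrow> 'u"
  assumes "vector_space r"
    and "\<And>v. v \<in> V \<Longrightarrow> linear_on t r W (\<lambda>w. f (v, w))"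
    and "\<And>w. w \<in> W \<Longrightarrow> linear_on s r V (\<lambda>v. f (v, w))"
  shows "\<exists>!F. F \<in> extensional (tens (vsp s V \<boxtimes> vsp t W)) \<and>
    linear_on tscale r (tens (vsp s V \<boxtimes> vsp t W)) F \<and>
    (\<forall>v\<in>V. \<forall>w\<in>W. F (pt (vsp s V \<boxtimes> vsp t W) (v, w)) = f (v, w))"
proof -
  have "(\<lambda>x. g (f x)) \<in> forms (vsp s V \<boxtimes> vsp t W)" if "linear_on r (*) UNIV g" for g
    using assms(2,3) that by (auto simp: mprod_def vsp_def linear_on_def)
  moreover have "(\<forall>x\<in>points (vsp s V \<boxtimes> vsp t W). F (pt (vsp s V \<boxtimes> vsp t W) x) = f x) \<longleftrightarrow>
      (\<forall>v\<in>V. \<forall>w\<in>W. F (pt (vsp s V \<boxtimes> vsp t W) (v, w)) = f (v, w))" for F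
  proof -
    have "points (vsp s V \<boxtimes> vsp t W) = V \<times> W" by (simp add: mprod_def vsp_def)
    then show ?thesis by auto
  qed
  ultimately show ?thesis using tensor_universal[OF assms(1), of f "vsp s V \<boxtimes> vsp t W"] by simp
qed

section \<open>Quasi-Hopf algebras\<close>

definition k_algebra :: "('k::field \<Rightarrow> 'h::ring_1 \<Rightarrow> 'h) \<Rightarrow> bool"
  where "k_algebra s \<longleftrightarrow> vector_space s \<and>
    (\<forall>c x y. s c (x * y) = s c x * y \<and> s c (x * y) = x * s c y)"

definition comp_op :: "('a \<Rightarrow> 'a \<Rightarrow> 'a) \<Rightarrow> ('b \<Rightarrow> 'b \<Rightarrow> 'b) \<Rightarrow> 'a \<times> 'b \<Rightarrow> 'a \<times> 'b \<Rightarrow> 'a \<times> 'b"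
  where "comp_op p q x y = (p (fst x) (fst y), q (snd x) (snd y))"

definition tmult :: "('k::field, 'a) mspace \<Rightarrow> ('a \<Rightarrow> 'a \<Rightarrow> 'a) \<Rightarrow>
    ('k, 'a) tensor \<Rightarrow> ('k, 'a) tensor \<Rightarrow> ('k, 'a) tensor"
  where "tmult X m t u = tsum t (\<lambda>x. tsum u (\<lambda>y. pt X (m x y)))"

definition is_tinv :: "('k::field, 'a) mspace \<Rightarrow> ('a \<Rightarrow> 'a \<Rightarrow> 'a) \<Rightarrow> 'a \<Rightarrow>
    ('k, 'a) tensor \<Rightarrow> ('k, 'a) tensor \<Rightarrow> bool"
  where "is_tinv X m e t u \<longleftrightarrow> u \<in> tens X \<and> tmult X m t u = pt X e \<and> tmult X m u t = pt X e"

definition tinv :: "('k::field, 'a) mspace \<Rightarrow> ('a \<Rightarrow> 'a \<Rightarrow> 'a) \<Rightarrow> 'a \<Rightarrow>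
    ('k, 'a) tensor \<Rightarrow> ('k, 'a) tensor"
  where "tinv X m e t = (THE u. is_tinv X m e t u)"

text \<open>The algebra \<open>H\<close> is the whole type \<open>'h\<close>.\<close>

record ('k, 'h) qha =
  scal :: "'k \<Rightarrow> 'h \<Rightarrow> 'h"
  Delta :: "'h \<Rightarrow> ('k, 'h \<times> 'h) tensor"
  eps :: "'h \<Rightarrow> 'k"
  phi :: "('k, 'h \<times> 'h \<times> 'h) tensor"
  anti :: "'h \<Rightarrow> 'h"
  alpha :: 'h
  beta :: 'h

abbreviation H1 :: "('k::field, 'h::ring_1) qha \<Rightarrow> ('k, 'h) mspace"
  where "H1 Q \<equiv> vsp (scal Q) UNIV"
abbreviation H2 :: "('k::field, 'h::ring_1) qha \<Rightarrow> ('k, 'h \<times> 'h) mspace"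
  where "H2 Q \<equiv> H1 Q \<boxtimes> H1 Q"
abbreviation H3 :: "('k::field, 'h::ring_1) qha \<Rightarrow> ('k, 'h \<times> 'h \<times> 'h) mspace"
  where "H3 Q \<equiv> H1 Q \<boxtimes> H2 Q"
abbreviation H4 :: "('k::field, 'h::ring_1) qha \<Rightarrow> ('k, 'h \<times> 'h \<times> 'h \<times> 'h) mspace"
  where "H4 Q \<equiv> H1 Q \<boxtimes> H3 Q"
abbreviation H5 :: "('k::field, 'h::ring_1) qha \<Rightarrow> ('k, 'h \<times> 'h \<times> 'h \<times> 'h \<times> 'h) mspace"
  where "H5 Q \<equiv> H1 Q \<boxtimes> H4 Q"

abbreviation m2 :: "'h::ring_1 \<times> 'h \<Rightarrow> 'h \<times> 'h \<Rightarrow> 'h \<times> 'h"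
  where "m2 \<equiv> comp_op (*) (*)"
abbreviation m3 :: "'h::ring_1 \<times> 'h \<times> 'h \<Rightarrow> 'h \<times> 'h \<times> 'h \<Rightarrow> 'h \<times> 'h \<times> 'h"
  where "m3 \<equiv> comp_op (*) m2"
abbreviation m4 :: "'h::ring_1 \<times> 'h \<times> 'h \<times> 'h \<Rightarrow> 'h \<times> 'h \<times> 'h \<times> 'h \<Rightarrow> 'h \<times> 'h \<times> 'h \<times> 'h"
  where "m4 \<equiv> comp_op (*) m3"
abbreviation m5 :: "'h::ring_1 \<times> 'h \<times> 'h \<times> 'h \<times> 'h \<Rightarrow> 'h \<times> 'h \<times> 'h \<times> 'h \<times> 'h \<Rightarrow> 'h \<times> 'h \<times> 'h \<times> 'h \<times> 'h"
  where "m5 \<equiv> comp_op (*) m4"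

definition phi_inv :: "('k::field, 'h::ring_1) qha \<Rightarrow> ('k, 'h \<times> 'h \<times> 'h) tensor"
  where "phi_inv Q = tinv (H3 Q) m3 (1, 1, 1) (phi Q)"

text \<open>Equations between elements of \<open>H\<close> that involve a summation are stated in \<open>tens (H1 Q)\<close>,
  which is \<open>H\<close> (see \<open>tval_pt\<close>).\<close>

definition quasi_hopf :: "('k::field, 'h::ring_1) qha \<Rightarrow> bool"
  where "quasi_hopf Q \<longleftrightarrow>
    k_algebra (scal Q) \<and>
    \<comment> \<open>\<open>\<Delta>\<close> and \<open>\<epsilon>\<close> are algebra maps\<close>
    (\<forall>h. Delta Q h \<in> tens (H2 Q)) \<and>
    linear_on (scal Q) tscale UNIV (Delta Q) \<and>
    Delta Q 1 = pt (H2 Q) (1, 1) \<and>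
    (\<forall>g h. Delta Q (g * h) = tmult (H2 Q) m2 (Delta Q g) (Delta Q h)) \<and>
    linear_on (scal Q) (*) UNIV (eps Q) \<and>
    eps Q 1 = 1 \<and>
    (\<forall>g h. eps Q (g * h) = eps Q g * eps Q h) \<and>
    \<comment> \<open>\<open>\<phi>\<close> is an invertible element of \<open>H \<otimes> H \<otimes> H\<close>\<close>
    phi Q \<in> tens (H3 Q) \<and>
    (\<exists>u. is_tinv (H3 Q) m3 (1, 1, 1) (phi Q) u) \<and>
    \<comment> \<open>\<open>S\<close> is an anti-algebra map\<close>
    linear_on (scal Q) (scal Q) UNIV (anti Q) \<and>
    anti Q 1 = 1 \<and>
    (\<forall>g h. anti Q (g * h) = anti Q h * anti Q g) \<and>
    \<comment> \<open>quasi-coassociativity\<close>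
    (\<forall>h. tsum (Delta Q h) (\<lambda>(a, b). tsum (Delta Q b) (\<lambda>(c, d). pt (H3 Q) (a, c, d))) =
      tmult (H3 Q) m3
        (tmult (H3 Q) m3 (phi Q)
          (tsum (Delta Q h) (\<lambda>(a, b). tsum (Delta Q a) (\<lambda>(c, d). pt (H3 Q) (c, d, b)))))
        (phi_inv Q)) \<and>
    \<comment> \<open>counit\<close>
    (\<forall>h. tsum (Delta Q h) (\<lambda>(a, b). pt (H1 Q) (scal Q (eps Q a) b)) = pt (H1 Q) h) \<and>
    (\<forall>h. tsum (Delta Q h) (\<lambda>(a, b). pt (H1 Q) (scal Q (eps Q b) a)) = pt (H1 Q) h) \<and>
    \<comment> \<open>pentagon: \<open>(id \<otimes> id \<otimes> \<Delta>)(\<phi>) (\<Delta> \<otimes> id \<otimes> id)(\<phi>) = (1 \<otimes> \<phi>) (id \<otimes> \<Delta> \<otimes> id)(\<phi>) (\<phi> \<otimes> 1)\<close>\<close>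
    tmult (H4 Q) m4
      (tsum (phi Q) (\<lambda>(x, y, z). tsum (Delta Q z) (\<lambda>(a, b). pt (H4 Q) (x, y, a, b))))
      (tsum (phi Q) (\<lambda>(x, y, z). tsum (Delta Q x) (\<lambda>(a, b). pt (H4 Q) (a, b, y, z)))) =
    tmult (H4 Q) m4
      (tmult (H4 Q) m4
        (tsum (phi Q) (\<lambda>(x, y, z). pt (H4 Q) (1, x, y, z)))
        (tsum (phi Q) (\<lambda>(x, y, z). tsum (Delta Q y) (\<lambda>(a, b). pt (H4 Q) (x, a, b, z)))))
      (tsum (phi Q) (\<lambda>(x, y, z). pt (H4 Q) (x, y, z, 1))) \<and>
    tsum (phi Q) (\<lambda>(x, y, z). pt (H2 Q) (x, scal Q (eps Q y) z)) = pt (H2 Q) (1, 1) \<and>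
    \<comment> \<open>antipode\<close>
    (\<forall>h. tsum (Delta Q h) (\<lambda>(a, b). pt (H1 Q) (anti Q a * alpha Q * b)) =
      pt (H1 Q) (scal Q (eps Q h) (alpha Q))) \<and>
    (\<forall>h. tsum (Delta Q h) (\<lambda>(a, b). pt (H1 Q) (a * beta Q * anti Q b)) =
      pt (H1 Q) (scal Q (eps Q h) (beta Q))) \<and>
    tsum (phi Q) (\<lambda>(x, y, z). pt (H1 Q) (x * beta Q * anti Q y * alpha Q * z)) = pt (H1 Q) 1 \<and>
    tsum (phi_inv Q) (\<lambda>(x, y, z). pt (H1 Q) (anti Q x * alpha Q * y * beta Q * anti Q z)) =
      pt (H1 Q) 1 \<and>
    eps Q (alpha Q) = 1 \<and>
    eps Q (beta Q) = 1"

text \<open>Drinfeld's element \<open>f\<close>.\<close>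

definition pR :: "('k::field, 'h::ring_1) qha \<Rightarrow> ('k, 'h \<times> 'h) tensor"
  where "pR Q = tsum (phi_inv Q) (\<lambda>(x, y, z). pt (H2 Q) (x, y * beta Q * anti Q z))"

text \<open>Here \<open>x\<close> runs over \<open>\<phi>\<close> and \<open>y\<close> over \<open>\<phi>\<^sup>-\<^sup>1\<close>.\<close>

definition elt_a :: "('k::field, 'h::ring_1) qha \<Rightarrow> ('k, 'h \<times> 'h) tensor"
  where "elt_a Q =
    tsum (phi Q) (\<lambda>(x1, x2, x3). tsum (phi_inv Q) (\<lambda>(y1, y2, y3). tsum (Delta Q x3) (\<lambda>(c, d).
      pt (H2 Q) (anti Q (y1 * x2) * alpha Q * y2 * c, anti Q x1 * alpha Q * y3 * d))))"

definition drinfeld :: "('k::field, 'h::ring_1) qha \<Rightarrow> ('k, 'h \<times> 'h) tensor"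
  where "drinfeld Q = tsum (pR Q) (\<lambda>(p, q).
    tmult (H2 Q) m2
      (tmult (H2 Q) m2
        (tsum (Delta Q p) (\<lambda>(c, d). pt (H2 Q) (anti Q d, anti Q c)))
        (elt_a Q))
      (Delta Q q))"

definition drinfeld_inv :: "('k::field, 'h::ring_1) qha \<Rightarrow> ('k, 'h \<times> 'h) tensor"
  where "drinfeld_inv Q = tinv (H2 Q) m2 (1, 1) (drinfeld Q)"

text \<open>\<open>\<chi> = (\<phi> \<otimes> 1) (\<Delta> \<otimes> id \<otimes> id)(\<phi>\<^sup>-\<^sup>1)\<close>\<close>

definition chi :: "('k::field, 'h::ring_1) qha \<Rightarrow> ('k, 'h \<times> 'h \<times> 'h \<times> 'h) tensor"
  where "chi Q = tmult (H4 Q) m4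
    (tsum (phi Q) (\<lambda>(x, y, z). pt (H4 Q) (x, y, z, 1)))
    (tsum (phi_inv Q) (\<lambda>(x, y, z). tsum (Delta Q x) (\<lambda>(a, b). pt (H4 Q) (a, b, y, z))))"

definition omega :: "('k::field, 'h::ring_1) qha \<Rightarrow> ('k, 'h \<times> 'h \<times> 'h \<times> 'h \<times> 'h) tensor"
  where "omega Q = tmult (H5 Q) m5
    (tmult (H5 Q) m5
      (tsum (drinfeld_inv Q) (\<lambda>(x, y). pt (H5 Q) (1, 1, 1, y, x)))
      (tsum (chi Q) (\<lambda>(a, b, c, d). tsum (Delta Q b) (\<lambda>(x, y).
        pt (H5 Q) (a, x, y, anti Q c, anti Q d)))))
    (tsum (phi Q) (\<lambda>(x, y, z). pt (H5 Q) (x, y, z, 1, 1)))"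

section \<open>Left modules and Yetter--Drinfeld modules of the second kind\<close>

record ('k, 'h, 'v) hmod =
  carrier :: "'v set"
  scale :: "'k \<Rightarrow> 'v \<Rightarrow> 'v"
  act :: "'h \<Rightarrow> 'v \<Rightarrow> 'v"

record ('k, 'h, 'v) ydmod = "('k, 'h, 'v) hmod" +
  coact :: "'v \<Rightarrow> ('k, 'h \<times> 'v) tensor"

abbreviation msp :: "('k::field, 'h, 'v::ab_group_add, 'z) hmod_scheme \<Rightarrow> ('k, 'v) mspace"
  where "msp V \<equiv> vsp (scale V) (carrier V)"

definition left_module :: "('k::field, 'h::ring_1) qha \<Rightarrow> ('k, 'h, 'v::ab_group_add) hmod \<Rightarrow> bool"
  where "left_module Q V \<longleftrightarrow>
    vector_space (scale V) \<and>
    module.subspace (scale V) (carrier V) \<and>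
    (\<forall>h. \<forall>v\<in>carrier V. act V h v \<in> carrier V) \<and>
    (\<forall>h. linear_on (scale V) (scale V) (carrier V) (act V h)) \<and>
    (\<forall>v\<in>carrier V. linear_on (scal Q) (scale V) UNIV (\<lambda>h. act V h v)) \<and>
    (\<forall>v\<in>carrier V. act V 1 v = v) \<and>
    (\<forall>g h. \<forall>v\<in>carrier V. act V (g * h) v = act V g (act V h v))"

text \<open>The forgetful functor on objects; on morphisms it is the identity.\<close>

definition forget :: "('k, 'h, 'v) ydmod \<Rightarrow> ('k, 'h, 'v) hmod"
  where "forget M = \<lparr>carrier = carrier M, scale = scale M, act = act M\<rparr>"

definition yd_module :: "('k::field, 'h::ring_1) qha \<Rightarrow> ('k, 'h, 'v::ab_group_add) ydmod \<Rightarrow> bool"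
  where "yd_module Q M \<longleftrightarrow>
    left_module Q (forget M) \<and>
    (\<forall>v\<in>carrier M. coact M v \<in> tens (H1 Q \<boxtimes> msp M)) \<and>
    linear_on (scale M) tscale (carrier M) (coact M) \<and>
    (\<forall>v\<in>carrier M.
      tsum (coact M v) (\<lambda>(a, w). tsum (coact M w) (\<lambda>(b, u). pt (H1 Q \<boxtimes> H1 Q \<boxtimes> msp M) (a, b, u))) =
      tsum (omega Q) (\<lambda>(o1, o2, o3, o4, o5). tsum (coact M v) (\<lambda>(a, w). tsum (Delta Q a) (\<lambda>(a1, a2).
        pt (H1 Q \<boxtimes> H1 Q \<boxtimes> msp M) (o1 * a1 * o5, o2 * a2 * o4, act M o3 w))))) \<and>
    (\<forall>v\<in>carrier M. tsum (coact M v) (\<lambda>(a, w). pt (msp M) (scale M (eps Q a) w)) = pt (msp M) v) \<and>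
    (\<forall>h. \<forall>v\<in>carrier M. coact M (act M h v) =
      tsum (Delta Q h) (\<lambda>(h1, h2). tsum (Delta Q h1) (\<lambda>(h11, h12). tsum (coact M v) (\<lambda>(a, w).
        pt (H1 Q \<boxtimes> msp M) (h11 * a * anti Q h2, act M h12 w)))))"

text \<open>Morphisms are extensional functions, so equality of morphisms is equality of functions;
  composition is \<open>compose\<close> and the identity of \<open>V\<close> is \<open>\<lambda>v\<in>carrier V. v\<close>.\<close>

definition hom_H :: "('k::field, 'h, 'v::ab_group_add) hmod \<Rightarrow> ('k, 'h, 'w::ab_group_add) hmod \<Rightarrow> ('v \<Rightarrow> 'w) set"
  where "hom_H V W = {f \<in> carrier V \<rightarrow>\<^sub>E carrier W.
    linear_on (scale V) (scale W) (carrier V) f \<and>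
    (\<forall>h. \<forall>v\<in>carrier V. f (act V h v) = act W h (f v))}"

definition hom_YD :: "('k::field, 'h::ring_1) qha \<Rightarrow> ('k, 'h, 'v::ab_group_add) ydmod \<Rightarrow>
    ('k, 'h, 'w::ab_group_add) ydmod \<Rightarrow> ('v \<Rightarrow> 'w) set"
  where "hom_YD Q M N = {f \<in> hom_H (forget M) (forget N).
    \<forall>v\<in>carrier M. coact N (f v) = tsum (coact M v) (\<lambda>(a, w). pt (H1 Q \<boxtimes> msp N) (a, f w))}"

section \<open>The functor \<open>R\<close>, the unit and the counit\<close>

definition R_obj :: "('k::field, 'h::ring_1) qha \<Rightarrow> ('k, 'h, 'v::ab_group_add) hmod \<Rightarrow>
    ('k, 'h, ('k, 'h \<times> 'v) tensor) ydmod"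
  where "R_obj Q V = \<lparr>
    carrier = tens (H1 Q \<boxtimes> msp V),
    scale = tscale,
    act = (\<lambda>h t. tsum t (\<lambda>(a, v). tsum (Delta Q h) (\<lambda>(h1, h2). tsum (Delta Q h1) (\<lambda>(h11, h12).
      pt (H1 Q \<boxtimes> msp V) (h11 * a * anti Q h2, act V h12 v))))),
    coact = (\<lambda>t. tsum t (\<lambda>(a, v). tsum (omega Q) (\<lambda>(o1, o2, o3, o4, o5). tsum (Delta Q a) (\<lambda>(a1, a2).
      pt (H1 Q \<boxtimes> vsp tscale (tens (H1 Q \<boxtimes> msp V)))
        (o1 * a1 * o5, pt (H1 Q \<boxtimes> msp V) (o2 * a2 * o4, act V o3 v))))))\<rparr>"

text \<open>\<open>R(f) = id \<otimes> f\<close>\<close>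

definition R_map :: "('k::field, 'h::ring_1) qha \<Rightarrow> ('k, 'h, 'v::ab_group_add) hmod \<Rightarrow>
    ('k, 'h, 'w::ab_group_add) hmod \<Rightarrow> ('v \<Rightarrow> 'w) \<Rightarrow> ('k, 'h \<times> 'v) tensor \<Rightarrow> ('k, 'h \<times> 'w) tensor"
  where "R_map Q V W f =
    (\<lambda>t\<in>tens (H1 Q \<boxtimes> msp V). tsum t (\<lambda>(a, v). pt (H1 Q \<boxtimes> msp W) (a, f v)))"

definition unit_R :: "('k, 'h, 'v) ydmod \<Rightarrow> 'v \<Rightarrow> ('k, 'h \<times> 'v) tensor"
  where "unit_R M = (\<lambda>m\<in>carrier M. coact M m)"

definition counit_R :: "('k::field, 'h::ring_1) qha \<Rightarrow> ('k, 'h, 'v::ab_group_add) hmod \<Rightarrow>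
    ('k, 'h \<times> 'v) tensor \<Rightarrow> 'v"
  where "counit_R Q V = (\<lambda>t\<in>tens (H1 Q \<boxtimes> msp V).
    tval (msp V) (tsum t (\<lambda>(a, v). pt (msp V) (scale V (eps Q a) v))))"

end

theory Submission
  imports Defs
begin

text \<open>
  The point is that \<open>\<delta>\<close> on \<open>R(V)\<close> is a coaction.  All tensor powers of \<open>H\<close> are placed in one algebra, in
  which the pentagon implies Mac Lane's coherence theorem: a product of associators depends only on the
  bracketings that it relates.  Drinfeld's element \<open>f\<close> compares two antipodes for the algebra map
  \<open>\<Delta> : H \<rightarrow> H \<otimes> H\<close>, namely \<open>(\<Delta> S, \<Delta> \<alpha>, \<Delta> \<beta>)\<close> and one built from \<open>(S \<otimes> S) \<Delta>\<^sup>c\<^sup>o\<^sup>p\<close>.  An element comparing two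
  antipodes exists, is unique and is invertible; this gives \<open>f \<Delta>(S h) f\<^sup>-\<^sup>1 = (S \<otimes> S) \<Delta>\<^sup>c\<^sup>o\<^sup>p(h)\<close> and, applied to
  antipodes for \<open>H \<rightarrow> H \<otimes> H \<otimes> H\<close>, the compatibility of \<open>f\<close> with \<open>\<phi>\<close>.  With these, coassociativity of \<open>\<delta>\<close> and
  its compatibility with the action become instances of coherence.

  The adjunction is then formal: coassociativity of the coaction of \<open>M\<close> says that it is a morphism
  \<open>M \<rightarrow> R(F(M))\<close>, and the triangle identities are the counit laws.
\<close>

section \<open>Multilinear maps and linear extension\<close>

text \<open>The obstacle is the antipode: it reverses products, so a formula such as that of
  \<omega> mixes slots multiplied in the usual order with slots multiplied in the opposite order,
  and coherence says nothing about it. The remedy is to postpone S. Every formula is written as a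
  word in coproducts of \<open>\<phi>\<close> and \<open>\<phi>'\<close>, in which no antipode
  occurs, followed by one slotwise linear map (\<open>Ep\<close>, \<open>K6\<close>,
  \<open>T6\<close>, \<open>M5\<close>, \<open>M7\<close>) that applies S to some slots and
  multiplies slots together. Since S also reverses the order of the legs, slots that meet are nested
  like brackets, and the word becomes an arrow between bracketings. What coherence cannot supply is
  the cancellation of antipodes. It comes from factoring a word through \<open>D i y\<close>, where
  slots \<open>i\<close> and \<open>Suc i\<close> meet around \<alpha> or \<beta>: the coproduct
  disappears and leaves the counit of \<open>y\<close>. Such factorizations are found by choosing
  the intermediate bracketings; they are the identities \<open>C1\<close>, \<open>C1_inverse\<close>
  and \<open>C2\<close>, while \<open>C3\<close> is coassociativity itself, cleared of
  antipodes.\<close>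

definition good :: "('k::field, 'a) mspace \<Rightarrow> bool"
  where "good X \<longleftrightarrow> (\<lambda>_. 0) \<in> forms X \<and>
    (\<forall>f\<in>forms X. \<forall>g\<in>forms X. (\<lambda>x. f x + g x) \<in> forms X) \<and>
    (\<forall>c. \<forall>f\<in>forms X. (\<lambda>x. c * f x) \<in> forms X) \<and>
    (\<forall>f g. f \<in> forms X \<longrightarrow> (\<forall>x\<in>points X. f x = g x) \<longrightarrow> g \<in> forms X)"

lemma good_zero: "good X \<Longrightarrow> (\<lambda>_. 0) \<in> forms X"
  and good_add: "good X \<Longrightarrow> f \<in> forms X \<Longrightarrow> g \<in> forms X \<Longrightarrow> (\<lambda>x. f x + g x) \<in> forms X"
  and good_scale: "good X \<Longrightarrow> f \<in> forms X \<Longrightarrow> (\<lambda>x. c * f x) \<in> forms X"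
  by (simp_all add: good_def)

text \<open>Forms are total functions, whereas multilinearity is a condition on the points only;
  values elsewhere are arbitrary and must not matter.\<close>

lemma good_cong: "good X \<Longrightarrow> (\<And>x. x \<in> points X \<Longrightarrow> f x = g x) \<Longrightarrow> f \<in> forms X \<longleftrightarrow> g \<in> forms X"
  unfolding good_def by metis

lemma good_sum: "good X \<Longrightarrow> (\<And>i. i < n \<Longrightarrow> f i \<in> forms X) \<Longrightarrow> (\<lambda>x. \<Sum>i<(n::nat). c i * f i x) \<in> forms X"
proof (induction n)
  case (Suc n)
  then show ?case
    using good_add[of X "\<lambda>x. \<Sum>i<n. c i * f i x" "\<lambda>x. c n * f n x"] by (simp add: good_scale)
qed (simp add: good_zero)

lemma good_vsp:
  assumes "vector_space s" "module.subspace s V"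
  shows "good (vsp s V)"
proof -
  interpret vector_space s by fact
  have add: "x + y \<in> V" if "x \<in> V" "y \<in> V" for x y using assms(2) that by (rule subspace_add)
  have sc: "s c x \<in> V" if "x \<in> V" for x c using assms(2) that by (rule subspace_scale)
  show ?thesis
    by (auto simp: good_def vsp_def linear_on_def algebra_simps add sc)
qed

lemma good_vsp_UNIV: "vector_space s \<Longrightarrow> good (vsp s UNIV)"
  by (rule good_vsp) (auto simp: module.subspace_def module_def vector_space_def)

lemma good_mprod:
  assumes X: "good X" and Y: "good Y" shows "good (X \<boxtimes> Y)"
  unfolding good_def
proof (intro conjI ballI allI impI)
  fix f g assume f: "f \<in> forms (X \<boxtimes> Y)" and eq: "\<forall>x\<in>points (X \<boxtimes> Y). f x = g x"
  have "(\<lambda>b. g (a, b)) \<in> forms Y" if "a \<in> points X" for a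
    using good_cong[OF Y, of "\<lambda>b. f (a, b)" "\<lambda>b. g (a, b)"] f eq that by (auto simp: mprod_def)
  moreover have "(\<lambda>a. g (a, b)) \<in> forms X" if "b \<in> points Y" for b
    using good_cong[OF X, of "\<lambda>a. f (a, b)" "\<lambda>a. g (a, b)"] f eq that by (auto simp: mprod_def)
  ultimately show "g \<in> forms (X \<boxtimes> Y)" by (simp add: mprod_def)
qed (use assms in \<open>auto simp: mprod_def intro: good_zero good_add good_scale\<close>)

interpretation tensor: vector_space "tscale :: 'k::field \<Rightarrow> ('k, 'a) tensor \<Rightarrow> _"
  by (fact vector_space_tscale)

lemma tens_pt [simp, intro]: "x \<in> points X \<Longrightarrow> pt X x \<in> tens X"
  unfolding tens_def by (intro tensor.span_base) auto
lemma tens_zero [simp, intro]: "0 \<in> tens X"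
  unfolding tens_def by (rule tensor.span_zero)
lemma tens_add [simp, intro]: "t \<in> tens X \<Longrightarrow> u \<in> tens X \<Longrightarrow> t + u \<in> tens X"
  unfolding tens_def by (rule tensor.span_add)
lemma tens_scale [simp, intro]: "t \<in> tens X \<Longrightarrow> tscale c t \<in> tens X"
  unfolding tens_def by (rule tensor.span_scale)

lemma tens_induct [consumes 1, case_names zero step]:
  assumes "t \<in> tens X" "P 0"
    and "\<And>c x u. x \<in> points X \<Longrightarrow> u \<in> tens X \<Longrightarrow> P u \<Longrightarrow> P (tscale c (pt X x) + u)"
  shows "P t"
proof -
  have "t \<in> module.span tscale (pt X ` points X)" using assms(1) by (simp add: tens_def)
  then have "P t \<and> t \<in> tens X"
  proof (rule tensor.span_induct_alt[of t _ "\<lambda>t. P t \<and> t \<in> tens X"])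
    show "P 0 \<and> 0 \<in> tens X" using assms(2) tens_zero by blast
  next
    fix c x y assume x: "x \<in> pt X ` points X" and y: "P y \<and> y \<in> tens X"
    then obtain z where z: "z \<in> points X" "x = pt X z" by blast
    have "P (tscale c x + y)" unfolding z(2) using y by (intro assms(3) z(1)) auto
    moreover have "tscale c x + y \<in> tens X" unfolding z(2) using y z(1) by (intro tens_add tens_scale tens_pt) auto
    ultimately show "P (tscale c x + y) \<and> tscale c x + y \<in> tens X" ..
  qed
  then show ?thesis ..
qed

text \<open>A tensor is a functional on all functions, so a concrete finite expression is wanted
  whenever it is applied to a function that is itself built from another tensor. The value 0 off the
  forms matches the convention in \<open>pt\<close>.\<close>

lemma tens_repr:
  assumes "t \<in> tens X"
  obtains n :: nat and c x where "\<And>i. i < n \<Longrightarrow> x i \<in> points X"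
    "\<And>g. t g = (if g \<in> forms X then \<Sum>i<n. c i * g (x i) else 0)"
proof -
  have "\<exists>(n::nat) c x. (\<forall>i<n. x i \<in> points X) \<and> (\<forall>g. t g = (if g \<in> forms X then \<Sum>i<n. c i * g (x i) else 0))"
    using assms
  proof (induction rule: tens_induct)
    case zero
    show ?case by (rule exI[of _ 0]) auto
  next
    case (step c y u)
    then obtain n d x where *: "\<forall>i<n. x i \<in> points X"
      "\<forall>g. u g = (if g \<in> forms X then \<Sum>i<(n::nat). d i * g (x i) else 0)" by blast
    show ?case
      by (rule exI[of _ "Suc n"], rule exI[of _ "d(n := c)"], rule exI[of _ "x(n := y)"])
        (use * step(1) in \<open>auto simp: tscale_def pt_def less_Suc_eq\<close>)
  qed
  with that show ?thesis by blast
qed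

lemma tens_not_form: "t \<in> tens X \<Longrightarrow> g \<notin> forms X \<Longrightarrow> t g = 0"
  by (erule tens_repr) simp

lemma tens_form_zero: "t \<in> tens X \<Longrightarrow> t (\<lambda>_. 0) = 0"
  by (erule tens_repr) simp

lemma tens_form_add:
  "good X \<Longrightarrow> t \<in> tens X \<Longrightarrow> f \<in> forms X \<Longrightarrow> g \<in> forms X \<Longrightarrow> t (\<lambda>x. f x + g x) = t f + t g"
  by (erule tens_repr) (simp add: good_add sum.distrib algebra_simps)

lemma tens_form_scale: "good X \<Longrightarrow> t \<in> tens X \<Longrightarrow> f \<in> forms X \<Longrightarrow> t (\<lambda>x. c * f x) = c * t f"
  by (erule tens_repr) (simp add: good_scale sum_distrib_left algebra_simps)

lemma tens_form_cong:
  assumes "good X" "t \<in> tens X" "\<And>x. x \<in> points X \<Longrightarrow> f x = g x" shows "t f = t g"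
  using assms(2) by (rule tens_repr) (use good_cong[OF assms(1,3)] assms(3) in simp)

text \<open>Linearity of a tensor-valued map is tested coordinate by coordinate, because addition
  and scaling of tensors are pointwise. The quantifier runs over all \<open>g\<close>, multilinear
  or not, since tensors are functions on all of them.\<close>

definition multilin :: "('k::field, 'a) mspace \<Rightarrow> ('a \<Rightarrow> ('k, 'b) tensor) \<Rightarrow> bool"
  where "multilin X F \<longleftrightarrow> (\<forall>g. (\<lambda>x. F x g) \<in> forms X)"

lemma multilinD: "multilin X F \<Longrightarrow> (\<lambda>x. F x g) \<in> forms X"
  by (simp add: multilin_def)

lemma tsum_pt_multilin: "multilin X F \<Longrightarrow> tsum (pt X x) F = F x"
  by (rule tsum_pt) (rule multilinD)

lemma tsum_tsum: "tsum (tsum t F) G = tsum t (\<lambda>x. tsum (F x) G)"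
  by (simp add: tsum_def)

lemma tsum_zero [simp]: "tsum 0 F = 0"
  by (simp add: tsum_def fun_eq_iff)

lemma tsum_cong:
  assumes "good X" "t \<in> tens X" "\<And>x. x \<in> points X \<Longrightarrow> F x = G x" shows "tsum t F = tsum t G"
  unfolding tsum_def by (rule ext, rule tens_form_cong[OF assms(1,2)]) (simp add: assms(3))

lemma multilin_pt: "good X \<Longrightarrow> multilin X (pt X)"
  unfolding multilin_def pt_def
proof
  fix g assume "good X"
  then show "(\<lambda>x. if g \<in> forms X then g x else 0) \<in> forms X"
    by (cases "g \<in> forms X") (simp_all add: good_zero)
qed

lemma tsum_pt_right: assumes "t \<in> tens X" shows "tsum t (pt X) = t"
proof
  fix g show "tsum t (pt X) g = t g"
    using tens_form_zero[OF assms] tens_not_form[OF assms, of g]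
    by (cases "g \<in> forms X") (auto simp: tsum_def pt_def)
qed

lemma multilin_tsum1: "multilin X F \<Longrightarrow> multilin X (\<lambda>x. tsum (F x) G)"
  by (simp add: multilin_def tsum_def)

text \<open>The finite expression of \<open>u\<close> does not depend on \<open>x\<close>, so each
  coordinate of the sum is a fixed linear combination of forms.\<close>

lemma multilin_tsum2:
  assumes "good X" "good Y" "u \<in> tens Y" "\<And>y. y \<in> points Y \<Longrightarrow> multilin X (\<lambda>x. F x y)"
    and "\<And>x. x \<in> points X \<Longrightarrow> multilin Y (F x)"
  shows "multilin X (\<lambda>x. tsum u (F x))"
  unfolding multilin_def
proof
  fix g
  obtain n c y where u: "\<And>i. i < n \<Longrightarrow> y i \<in> points Y"
    "\<And>g. u g = (if g \<in> forms Y then \<Sum>i<(n::nat). c i * g (y i) else 0)" using tens_repr[OF assms(3)] by metis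
  have "(\<lambda>x. \<Sum>i<n. c i * F x (y i) g) \<in> forms X"
    using assms(4) u(1) by (intro good_sum assms(1)) (simp add: multilin_def)
  then show "(\<lambda>x. tsum u (F x) g) \<in> forms X"
    by (subst good_cong[OF assms(1), of _ "\<lambda>x. \<Sum>i<n. c i * F x (y i) g"])
      (use assms(5) in \<open>auto simp: tsum_def u(2) multilin_def\<close>)
qed

text \<open>Fubini for Sweedler sums: both tensors are finite sums, and multilinearity in each
  variable ensures that the intermediate functions are forms, on which those finite expressions are
  valid.\<close>

lemma tsum_swap:
  assumes "good X" "good Y" "t \<in> tens X" "u \<in> tens Y" "\<And>y. y \<in> points Y \<Longrightarrow> multilin X (\<lambda>x. F x y)"
    and "\<And>x. x \<in> points X \<Longrightarrow> multilin Y (F x)"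
  shows "tsum t (\<lambda>x. tsum u (F x)) = tsum u (\<lambda>y. tsum t (\<lambda>x. F x y))"
proof
  fix g
  have 1: "(\<lambda>x. u (\<lambda>y. F x y g)) \<in> forms X"
    using multilin_tsum2[OF assms(1,2,4-6)] by (auto simp: multilin_def tsum_def)
  have 2: "(\<lambda>y. t (\<lambda>x. F x y g)) \<in> forms Y"
    using multilin_tsum2[OF assms(2,1,3,6,5)] by (auto simp: multilin_def tsum_def)
  obtain n c y where u: "\<And>i. i < n \<Longrightarrow> y i \<in> points Y"
    "\<And>g. u g = (if g \<in> forms Y then \<Sum>i<(n::nat). c i * g (y i) else 0)" using tens_repr[OF assms(4)] by metis
  obtain m d x where t: "\<And>i. i < m \<Longrightarrow> x i \<in> points X"
    "\<And>g. t g = (if g \<in> forms X then \<Sum>i<(m::nat). d i * g (x i) else 0)" using tens_repr[OF assms(3)] by metis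
  have "t (\<lambda>x. u (\<lambda>y. F x y g)) = (\<Sum>i<m. d i * (\<Sum>j<n. c j * F (x i) (y j) g))"
    using 1 assms(6) t(1) by (subst t(2)) (auto simp: u(2) multilin_def intro!: sum.cong)
  moreover have "u (\<lambda>y. t (\<lambda>x. F x y g)) = (\<Sum>j<n. c j * (\<Sum>i<m. d i * F (x i) (y j) g))"
    using 2 assms(5) u(1) by (subst u(2)) (auto simp: t(2) multilin_def intro!: sum.cong)
  moreover have "(\<Sum>i<m. d i * (\<Sum>j<n. c j * F (x i) (y j) g)) = (\<Sum>j<n. c j * (\<Sum>i<m. d i * F (x i) (y j) g))"
    by (simp add: sum_distrib_left algebra_simps) (rule sum.swap)
  ultimately show "tsum t (\<lambda>x. tsum u (F x)) g = tsum u (\<lambda>y. tsum t (\<lambda>x. F x y)) g"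
    by (simp add: tsum_def)
qed

text \<open>The generating set is left open so that the argument serves both for all of
  \<open>tens X\<close> and for tensors that are continued by 1 from some slot on
  (\<open>tsum_W\<close>).\<close>

lemma tsum_in_span:
  assumes "t \<in> module.span tscale (pt X ` P)" "multilin X F" "\<And>x. x \<in> P \<Longrightarrow> F x \<in> module.span tscale B"
  shows "tsum t F \<in> module.span tscale B"
  using assms(1)
proof (induction rule: tensor.span_induct_alt)
  case base
  have "tsum 0 F \<in> module.span tscale B" by (simp only: tsum_zero tensor.span_zero)
  then show ?case by (simp add: zero_fun_def)
next
  case (step c x y)
  then obtain z where z: "z \<in> P" "x = pt X z" by blast
  have "tsum (tscale c x + y) F = tscale c (F z) + tsum y F"
    unfolding z(2) by (simp only: tsum_linear tsum_pt_multilin[OF assms(2)])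
  also have "\<dots> \<in> module.span tscale B"
    by (intro tensor.span_add tensor.span_scale assms(3) z(1)) (rule step)
  finally show ?case by (simp add: plus_fun_def)
qed

lemma tsum_in:
  "t \<in> tens X \<Longrightarrow> multilin X F \<Longrightarrow> (\<And>x. x \<in> points X \<Longrightarrow> F x \<in> tens Y) \<Longrightarrow> tsum t F \<in> tens Y"
  unfolding tens_def by (rule tsum_in_span)

section \<open>Linear maps on tensors and their equality on generators\<close>

definition lin :: "('k::field, 'a) mspace \<Rightarrow> (('k, 'a) tensor \<Rightarrow> ('k, 'b) tensor) \<Rightarrow> bool"
  where "lin X L \<longleftrightarrow> linear_on tscale tscale (tens X) L"

lemma lin_tsum: "lin X L \<Longrightarrow> lin X (\<lambda>t. tsum (L t) F)"
  by (simp add: lin_def linear_on_def tsum_linear)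
lemma lin_id: "lin X (\<lambda>t. t)"
  by (simp add: lin_def linear_on_def)

lemma lin_tsum2:
  assumes "good Y" "u \<in> tens Y" "\<And>y. y \<in> points Y \<Longrightarrow> lin X (\<lambda>t. L t y)"
    "\<And>t. t \<in> tens X \<Longrightarrow> multilin Y (L t)"
  shows "lin X (\<lambda>t. tsum u (L t))"
  unfolding lin_def linear_on_def
proof (intro conjI ballI allI)
  fix t t' assume t: "t \<in> tens X" "t' \<in> tens X"
  show "tsum u (L (t + t')) = tsum u (L t) + tsum u (L t')"
  proof
    fix g
    have "u (\<lambda>y. L (t + t') y g) = u (\<lambda>y. L t y g + L t' y g)"
      using assms(3) t by (intro tens_form_cong[OF assms(1,2)]) (auto simp: lin_def linear_on_def)
    also have "\<dots> = u (\<lambda>y. L t y g) + u (\<lambda>y. L t' y g)"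
      using assms(4) t tens_form_add[OF assms(1,2)] by (simp add: multilin_def)
    finally show "tsum u (L (t + t')) g = (tsum u (L t) + tsum u (L t')) g" by (simp add: tsum_def)
  qed
next
  fix c t assume t: "t \<in> tens X"
  show "tsum u (L (tscale c t)) = tscale c (tsum u (L t))"
  proof
    fix g
    have "u (\<lambda>y. L (tscale c t) y g) = u (\<lambda>y. c * L t y g)"
      using assms(3) t by (intro tens_form_cong[OF assms(1,2)]) (auto simp: lin_def linear_on_def tscale_def)
    also have "\<dots> = c * u (\<lambda>y. L t y g)"
      using assms(4) t tens_form_scale[OF assms(1,2)] by (simp add: multilin_def)
    finally show "tsum u (L (tscale c t)) g = tscale c (tsum u (L t)) g" by (simp add: tsum_def tscale_def)
  qed
qed

text \<open>The standard way of proving an identity of tensors below: both sides are linear in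
  \<open>t\<close>, so pure tensors from the chosen generating set suffice. Identities with several
  arguments use it once for each argument.\<close>

lemma lin_ext_span:
  fixes t :: "('k::field, 'a) tensor"
  assumes "t \<in> module.span tscale (pt X ` P)" "P \<subseteq> points X" "lin X L" "lin X R"
    and "\<And>x. x \<in> P \<Longrightarrow> L (pt X x) = R (pt X x)"
  shows "L t = R t"
proof -
  have L: "L 0 = 0" "R 0 = 0"
    using assms(3,4) tens_zero[of X] tensor.scale_zero_left[of "0 :: ('k, 'a) tensor"]
      tensor.scale_zero_left[of "L 0"] tensor.scale_zero_left[of "R 0"]
    unfolding lin_def linear_on_def by metis+
  have "L t = R t \<and> t \<in> tens X"
  proof (rule tensor.span_induct_alt[OF assms(1), of "\<lambda>t. L t = R t \<and> t \<in> tens X"])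
    show "L 0 = R 0 \<and> 0 \<in> tens X" using L tens_zero[of X] by simp
  next
    fix c x u assume x: "x \<in> pt X ` P" and u: "L u = R u \<and> u \<in> tens X"
    then obtain z where z: "z \<in> P" "x = pt X z" by blast
    have t: "x \<in> tens X" "tscale c x \<in> tens X" using z assms(2) tens_pt tens_scale by blast+
    have "L (tscale c x + u) = tscale c (L x) + L u" "R (tscale c x + u) = tscale c (R x) + R u"
      using assms(3,4) u t unfolding lin_def linear_on_def by simp_all
    moreover have "tscale c x + u \<in> tens X" using t u tens_add by blast
    ultimately show "L (tscale c x + u) = R (tscale c x + u) \<and> tscale c x + u \<in> tens X"
      using u assms(5)[OF z(1)] unfolding z(2)[symmetric] by simp
  qed
  then show ?thesis ..
qed

lemma lin_ext:
  assumes "t \<in> tens X" "lin X L" "lin X R" "\<And>x. x \<in> points X \<Longrightarrow> L (pt X x) = R (pt X x)"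
  shows "L t = R t"
  using assms(1) unfolding tens_def by (rule lin_ext_span) (use assms in auto)

lemma multilin_vsp: "multilin (vsp s V) F \<longleftrightarrow> linear_on s tscale V F"
  by (auto simp: multilin_def vsp_def linear_on_def fun_eq_iff tscale_def)

lemma multilin_mprod:
  "multilin (X \<boxtimes> Y) F \<longleftrightarrow> (\<forall>a\<in>points X. multilin Y (\<lambda>b. F (a, b))) \<and> (\<forall>b\<in>points Y. multilin X (\<lambda>a. F (a, b)))"
  by (auto simp: multilin_def mprod_def)

lemma multilin_comp:
  assumes "multilin (vsp s V) F" "linear_on s' s W f" "\<And>x. x \<in> W \<Longrightarrow> f x \<in> V"
  shows "multilin (vsp s' W) (\<lambda>x. F (f x))"
  using assms by (auto simp: multilin_vsp linear_on_def)

section \<open>Tensor products of algebras\<close>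

text \<open>Multiplication is given on the arguments of pure tensors, and its bilinearity is the
  condition that translating a form by \<open>m\<close> on either side gives a form. In this shape
  the notion covers finite tuples and infinite sequences alike.\<close>

definition talg :: "('k::field, 'a) mspace \<Rightarrow> ('a \<Rightarrow> 'a \<Rightarrow> 'a) \<Rightarrow> 'a \<Rightarrow> bool"
  where "talg X m e \<longleftrightarrow> good X \<and> points X = UNIV \<and>
    (\<forall>g\<in>forms X. \<forall>y. (\<lambda>x. g (m x y)) \<in> forms X \<and> (\<lambda>x. g (m y x)) \<in> forms X) \<and>
    (\<forall>x y z. m (m x y) z = m x (m y z)) \<and> (\<forall>x. m e x = x \<and> m x e = x)"

lemma talg_mprod: "talg X m e \<Longrightarrow> talg Y m' e' \<Longrightarrow> talg (X \<boxtimes> Y) (comp_op m m') (e, e')"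
  by (auto simp: talg_def good_mprod comp_op_def) (auto simp: mprod_def)

lemma talg_good: "talg X m e \<Longrightarrow> good X"
  and talg_points: "talg X m e \<Longrightarrow> points X = UNIV"
  by (simp_all add: talg_def)

lemma talg_multilin:
  fixes X :: "('k::field, 'a) mspace"
  assumes "talg X m e"
  shows "multilin X (\<lambda>x. pt X (m x y))" "multilin X (\<lambda>x. pt X (m y x))"
proof -
  \<comment> \<open>\<open>pt\<close> is 0 at a function that is not a form, so both cases of its
    definition have to be multilinear in \<open>x\<close>.\<close>
  have *: "(\<lambda>x. if c then g x else (0::'k)) \<in> forms X" if "c \<Longrightarrow> g \<in> forms X" for c and g :: "'a \<Rightarrow> 'k"
    using that good_zero[of X] assms by (cases c) (auto simp: talg_def)
  show "multilin X (\<lambda>x. pt X (m x y))" "multilin X (\<lambda>x. pt X (m y x))"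
    using assms by (auto simp: talg_def multilin_def pt_def intro!: *)
qed

context
  fixes X :: "('k::field, 'a) mspace" and m e
  assumes X: "talg X m e"
begin

lemma tmult_in: "t \<in> tens X \<Longrightarrow> u \<in> tens X \<Longrightarrow> tmult X m t u \<in> tens X"
  unfolding tmult_def using X
  by (intro tsum_in[where X = X] multilin_tsum2[where Y = X] talg_multilin[OF X] talg_good[OF X]) (auto simp: talg_def)

lemma tmult_pt: "tmult X m (pt X x) (pt X y) = pt X (m x y)"
  unfolding tmult_def
  by (subst tsum_pt_multilin)
    (auto simp: tsum_pt_multilin talg_multilin[OF X])

lemma tmult_pt_left: "tmult X m (pt X x) u = tsum u (\<lambda>y. pt X (m x y))" if "u \<in> tens X"
  unfolding tmult_def
  by (subst tsum_pt_multilin) (use that in \<open>auto intro!: multilin_tsum2[where Y = X] talg_multilin[OF X] talg_good[OF X]\<close>)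

lemma tmult_pt_right: "tmult X m t (pt X y) = tsum t (\<lambda>x. pt X (m x y))"
  unfolding tmult_def
  by (subst tsum_pt_multilin) (auto intro!: talg_multilin[OF X])

lemma lin_tmult_left: "lin Z L \<Longrightarrow> lin Z (\<lambda>t. tmult X m (L t) u)"
  unfolding tmult_def by (rule lin_tsum)

lemma lin_tmult_right: "u \<in> tens X \<Longrightarrow> lin Z L \<Longrightarrow> (\<And>t. t \<in> tens Z \<Longrightarrow> L t \<in> tens X) \<Longrightarrow> lin Z (\<lambda>t. tmult X m u (L t))"
  unfolding tmult_def
  by (rule lin_tsum2[where Y = X])
    (auto intro!: lin_tsum multilin_tsum2[where Y = X] talg_multilin[OF X] talg_good[OF X])

lemma tmult_assoc:
  assumes "t \<in> tens X" "u \<in> tens X" "v \<in> tens X"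
  shows "tmult X m (tmult X m t u) v = tmult X m t (tmult X m u v)"
proof (rule lin_ext[OF assms(1)])
  fix x
  show "tmult X m (tmult X m (pt X x) u) v = tmult X m (pt X x) (tmult X m u v)"
  proof (rule lin_ext[OF assms(2)])
    fix y
    show "tmult X m (tmult X m (pt X x) (pt X y)) v = tmult X m (pt X x) (tmult X m (pt X y) v)"
      by (rule lin_ext[OF assms(3)])
       (use X in \<open>auto intro!: lin_tmult_left lin_tmult_right lin_id tmult_in simp: talg_points[OF X] tmult_pt, simp add: talg_def\<close>)
  qed (use assms in \<open>auto intro!: lin_tmult_left lin_tmult_right lin_id tmult_in simp: talg_points[OF X]\<close>)
qed (use assms in \<open>auto intro!: lin_tmult_left lin_tmult_right lin_id tmult_in simp: talg_points[OF X]\<close>)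

lemma tmult_one_left: "t \<in> tens X \<Longrightarrow> tmult X m (pt X e) t = t"
  by (subst tmult_pt_left) (use X in \<open>simp_all add: talg_def tsum_pt_right\<close>)

lemma tmult_one_right: "t \<in> tens X \<Longrightarrow> tmult X m t (pt X e) = t"
  by (subst tmult_pt_right) (use X in \<open>simp_all add: talg_def tsum_pt_right\<close>)

lemma tinv_eq:
  assumes "t \<in> tens X" "is_tinv X m e t u" shows "tinv X m e t = u"
  unfolding tinv_def
proof (rule the_equality)
  fix v assume "is_tinv X m e t v"
  with assms show "v = u"
    unfolding is_tinv_def by (metis tmult_assoc tmult_one_left tmult_one_right)
qed fact

lemma tinv_is_tinv: "t \<in> tens X \<Longrightarrow> is_tinv X m e t u \<Longrightarrow> is_tinv X m e t (tinv X m e t)"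
  using tinv_eq by metis

end

section \<open>Coherence\<close>

text \<open>A bracketing of a product of \<open>nodes t + 1\<close> factors, read at the same time
  as an iterated coproduct: an inner node splits a slot in two, and a leaf leaves it alone.\<close>

datatype tree = Lf | Nd tree tree

fun nodes :: "tree \<Rightarrow> nat" where
  "nodes Lf = 0"
| "nodes (Nd l r) = nodes l + nodes r + 1"

fun comb :: "nat \<Rightarrow> tree" where
  "comb 0 = Lf"
| "comb (Suc n) = Nd Lf (comb n)"

lemma nodes_comb [simp]: "nodes (comb n) = n"
  by (induction n) auto

text \<open>The structure on the tensor powers that coherence uses: \<open>W n\<close> is the part
  living in the first \<open>n\<close> slots, \<open>D i\<close> the coproduct in slot
  \<open>i\<close>, and \<open>s\<close> the shift by one slot with a 1 in front.
  \<open>comm\<close> expresses that factors in disjoint slots commute, \<open>D_0_s\<close> that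
  the coproduct of 1 is 1 \<otimes> 1, and \<open>inter\<close> is quasi-coassociativity in slot
  \<open>i\<close>, multiplied by the associator on the right so that no inverse appears.\<close>

locale coherence =
  fixes A :: "'a set" and mul :: "'a \<Rightarrow> 'a \<Rightarrow> 'a" (infixl "\<bullet>" 70) and one :: 'a ("\<one>")
    and W :: "nat \<Rightarrow> 'a set" and D :: "nat \<Rightarrow> 'a \<Rightarrow> 'a" and s :: "'a \<Rightarrow> 'a" and f f' :: 'a
  assumes W_A: "x \<in> W n \<Longrightarrow> x \<in> A"
    and W_Suc: "x \<in> W n \<Longrightarrow> x \<in> W (Suc n)"
    and mul_A [simp, intro]: "x \<in> A \<Longrightarrow> y \<in> A \<Longrightarrow> x \<bullet> y \<in> A"
    and mul_W [simp, intro]: "x \<in> W n \<Longrightarrow> y \<in> W n \<Longrightarrow> x \<bullet> y \<in> W n"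
    and one_W [simp, intro]: "\<one> \<in> W n"
    and assoc: "x \<in> A \<Longrightarrow> y \<in> A \<Longrightarrow> z \<in> A \<Longrightarrow> x \<bullet> y \<bullet> z = x \<bullet> (y \<bullet> z)"
    and one_left [simp]: "x \<in> A \<Longrightarrow> \<one> \<bullet> x = x"
    and one_right [simp]: "x \<in> A \<Longrightarrow> x \<bullet> \<one> = x"
    and D_A [simp, intro]: "x \<in> A \<Longrightarrow> D i x \<in> A"
    and D_W [intro]: "x \<in> W n \<Longrightarrow> D i x \<in> W (Suc n)"
    and D_triv: "x \<in> W n \<Longrightarrow> n \<le> i \<Longrightarrow> D i x = x"
    and s_A [simp, intro]: "x \<in> A \<Longrightarrow> s x \<in> A"
    and s_W [intro]: "x \<in> W n \<Longrightarrow> s x \<in> W (Suc n)"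
    and D_mul: "x \<in> A \<Longrightarrow> y \<in> A \<Longrightarrow> D i (x \<bullet> y) = D i x \<bullet> D i y"
    and s_mul: "x \<in> A \<Longrightarrow> y \<in> A \<Longrightarrow> s (x \<bullet> y) = s x \<bullet> s y"
    and D_one [simp]: "D i \<one> = \<one>" and s_one [simp]: "s \<one> = \<one>"
    and comm: "x \<in> W n \<Longrightarrow> y \<in> A \<Longrightarrow> x \<bullet> (s ^^ n) y = (s ^^ n) y \<bullet> x"
    and D_D: "x \<in> A \<Longrightarrow> i < j \<Longrightarrow> D i (D j x) = D (Suc j) (D i x)"
    and D_s: "x \<in> A \<Longrightarrow> D (Suc i) (s x) = s (D i x)"
    and D_0_s: "x \<in> A \<Longrightarrow> D 0 (s x) = s (s x)"
    and f_W: "f \<in> W 3" and f'_W: "f' \<in> W 3"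
    and f_f': "f \<bullet> f' = \<one>" and f'_f: "f' \<bullet> f = \<one>"
    and inter: "x \<in> A \<Longrightarrow> (s ^^ i) f \<bullet> D i (D i x) = D (Suc i) (D i x) \<bullet> (s ^^ i) f"
    and pentagon: "D 2 f \<bullet> D 0 f = s f \<bullet> D 1 f \<bullet> f"
begin

lemma one_A [simp]: "\<one> \<in> A" and f_A [simp]: "f \<in> A" and f'_A [simp]: "f' \<in> A"
  using W_A one_W f_W f'_W by blast+

lemma W_mono: "x \<in> W m \<Longrightarrow> m \<le> n \<Longrightarrow> x \<in> W n"
  by (induction n) (auto simp: le_Suc_eq intro: W_Suc)

lemma sp_A [simp, intro]: "x \<in> A \<Longrightarrow> (s ^^ k) x \<in> A"
  by (induction k) auto
lemma sp_W: "x \<in> W n \<Longrightarrow> (s ^^ k) x \<in> W (k + n)"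
  by (induction k) auto
lemma sp_mul: "x \<in> A \<Longrightarrow> y \<in> A \<Longrightarrow> (s ^^ k) (x \<bullet> y) = (s ^^ k) x \<bullet> (s ^^ k) y"
  by (induction k) (auto simp: s_mul)
lemma sp_one [simp]: "(s ^^ k) \<one> = \<one>"
  by (induction k) auto
lemma sp_sp: "(s ^^ k) ((s ^^ l) x) = (s ^^ (k + l)) x"
  by (simp add: funpow_add)
lemma D_sp: "x \<in> A \<Longrightarrow> D (k + i) ((s ^^ k) x) = (s ^^ k) (D i x)"
  by (induction k arbitrary: i) (auto simp: D_s)

text \<open>The coproduct of shape \<open>t\<close> in slot \<open>i\<close>. The right subtree is
  expanded before the left one, since expanding the left one would move the slot
  \<open>Suc i\<close>.\<close>

fun E :: "tree \<Rightarrow> nat \<Rightarrow> 'a \<Rightarrow> 'a" where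
  "E Lf i x = x"
| "E (Nd l r) i x = E l i (E r (Suc i) (D i x))"

lemma E_A [simp, intro]: "x \<in> A \<Longrightarrow> E t i x \<in> A"
  by (induction t arbitrary: i x) auto
lemma E_mul: "x \<in> A \<Longrightarrow> y \<in> A \<Longrightarrow> E t i (x \<bullet> y) = E t i x \<bullet> E t i y"
  by (induction t arbitrary: i x y) (auto simp: D_mul)
lemma E_one [simp]: "E t i \<one> = \<one>"
  by (induction t arbitrary: i) auto
lemma E_sp: "x \<in> A \<Longrightarrow> E t (k + i) ((s ^^ k) x) = (s ^^ k) (E t i x)"
  by (induction t arbitrary: i x) (auto simp: D_sp simp flip: add_Suc_right)
lemma E_s: "x \<in> A \<Longrightarrow> E t (Suc i) (s x) = s (E t i x)"
  using E_sp[of x t 1 i] by simp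
lemma E_W: "x \<in> W n \<Longrightarrow> E t i x \<in> W (n + nodes t)"
proof (induction t arbitrary: i x n)
  case (Nd l r)
  have "E r (Suc i) (D i x) \<in> W (Suc n + nodes r)" by (intro Nd.IH(2) D_W Nd.prems)
  from Nd.IH(1)[OF this, of i] show ?case by (simp add: add_ac)
qed auto
lemma E_triv: "x \<in> W n \<Longrightarrow> n \<le> i \<Longrightarrow> E t i x = x"
  by (induction t arbitrary: i) (auto simp: D_triv)

lemma D_E: "x \<in> A \<Longrightarrow> i < j \<Longrightarrow> D i (E u j x) = E u (Suc j) (D i x)"
  by (induction u arbitrary: j x) (auto simp: D_D)

lemma E_D: "x \<in> A \<Longrightarrow> i < j \<Longrightarrow> E t i (D j x) = D (j + nodes t) (E t i x)"
proof (induction t arbitrary: i j x)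
  case (Nd l r)
  then show ?case using Nd.IH(2)[of "D i x" "Suc i" "Suc j"] by (simp add: D_D add_ac)
qed auto

lemma E_E: "x \<in> A \<Longrightarrow> i < j \<Longrightarrow> E t i (E u j x) = E u (j + nodes t) (E t i x)"
  by (induction u arbitrary: j x) (auto simp: E_D)

text \<open>\<open>merge m n\<close> rebrackets a product of two combs into a comb, and \<open>kap t\<close> rebrackets
  \<open>t\<close> into the comb with the same leaves.\<close>

fun merge :: "nat \<Rightarrow> nat \<Rightarrow> 'a" where
  "merge 0 n = \<one>"
| "merge (Suc m) n = s (merge m n) \<bullet> E (comb m) 1 (E (comb n) 2 f)"

fun kap :: "tree \<Rightarrow> 'a" where
  "kap Lf = \<one>"
| "kap (Nd l r) = merge (nodes l) (nodes r) \<bullet> kap l \<bullet> (s ^^ Suc (nodes l)) (kap r)"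

lemma merge_W: "merge m n \<in> W (m + n + 2)"
proof (induction m)
  case (Suc m)
  have "E (comb m) 1 (E (comb n) 2 f) \<in> W (3 + n + m)"
    using E_W[OF E_W[OF f_W], of "comb m" 1 "comb n" 2] by simp
  then show ?case using s_W[OF Suc] by (auto simp: numeral_eq_Suc add_ac)
qed auto

lemma merge_A [simp, intro]: "merge m n \<in> A"
  using merge_W W_A by blast

lemma kap_W: "kap t \<in> W (Suc (nodes t))"
proof (induction t)
  case (Nd l r)
  have 1: "(s ^^ Suc (nodes l)) (kap r) \<in> W (Suc (nodes (Nd l r)))"
    using sp_W[OF Nd(2), of "Suc (nodes l)"] by (simp add: add_ac)
  have 2: "kap l \<in> W (Suc (nodes (Nd l r)))" by (rule W_mono[OF Nd(1)]) simp
  have 3: "merge (nodes l) (nodes r) \<in> W (Suc (nodes (Nd l r)))" using merge_W by simp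
  show ?case unfolding kap.simps by (intro mul_W 1 2 3)
qed auto

lemma kap_A [simp, intro]: "kap t \<in> A"
  using kap_W W_A by blast

text \<open>Quasi-coassociativity for a bracketing made of two combs. In the induction the last
  factor of \<open>merge\<close> carries one split across by \<open>inter\<close>, transported by
  the expansions of the remaining slots, and the induction hypothesis in slot \<open>Suc i\<close>
  does the rest.\<close>

lemma merge_inter:
  "x \<in> A \<Longrightarrow> (s ^^ i) (merge m n) \<bullet> E (comb m) i (E (comb n) (Suc i) (D i x)) =
    E (comb (m + n + 1)) i x \<bullet> (s ^^ i) (merge m n)"
proof (induction m arbitrary: i x)
  case (Suc m)
  let ?E = "\<lambda>y. E (comb m) (Suc i) (E (comb n) (i + 2) y)"
  have 1: "(s ^^ i) (E (comb m) 1 (E (comb n) 2 f)) = ?E ((s ^^ i) f)"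
    using E_sp[of "E (comb n) 2 f" "comb m" i 1] E_sp[of f "comb n" i 2] by simp
  have 2: "E (comb (Suc m)) i (E (comb n) (Suc i) (D i x)) = ?E (D i (D i x))"
    using Suc.prems by (simp add: D_E)
  have 3: "?E ((s ^^ i) f) \<bullet> ?E (D i (D i x)) = ?E (D (Suc i) (D i x)) \<bullet> ?E ((s ^^ i) f)"
    using Suc.prems by (simp add: inter flip: E_mul)
  have "(s ^^ i) (merge (Suc m) n) \<bullet> E (comb (Suc m)) i (E (comb n) (Suc i) (D i x)) =
    (s ^^ Suc i) (merge m n) \<bullet> (?E ((s ^^ i) f) \<bullet> ?E (D i (D i x)))"
    unfolding 2 using Suc.prems by (simp add: sp_mul 1[simplified] assoc funpow_swap1)
  also have "\<dots> = (s ^^ Suc i) (merge m n) \<bullet> E (comb m) (Suc i) (E (comb n) (Suc (Suc i)) (D (Suc i) (D i x))) \<bullet> ?E ((s ^^ i) f)"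
    unfolding 3 using Suc.prems by (simp add: assoc)
  also have "\<dots> = E (comb (m + n + 1)) (Suc i) (D i x) \<bullet> (s ^^ Suc i) (merge m n) \<bullet> ?E ((s ^^ i) f)"
    using Suc.prems by (subst Suc.IH) auto
  also have "\<dots> = E (comb (Suc m + n + 1)) i x \<bullet> (s ^^ i) (merge (Suc m) n)"
    using Suc.prems by (simp add: sp_mul 1[simplified] assoc funpow_swap1)
  finally show ?case .
qed simp

text \<open>Naturality of rebracketing: each subtree is brought to a comb by induction, and the two
  resulting combs are joined by \<open>merge_inter\<close>.\<close>

lemma kap_inter: "x \<in> A \<Longrightarrow> (s ^^ i) (kap t) \<bullet> E t i x = E (comb (nodes t)) i x \<bullet> (s ^^ i) (kap t)"
proof (induction t arbitrary: i x)
  case (Nd l r)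
  let ?m = "nodes l" and ?n = "nodes r"
  let ?k = "(s ^^ i) (kap l)" and ?k' = "(s ^^ (Suc i + ?m)) (kap r)" and ?M = "(s ^^ i) (merge ?m ?n)"
  have e: "E (Nd l r) i x = E r (Suc i + ?m) (E l i (D i x))"
    using Nd.prems by (simp add: E_E)
  have "(s ^^ i) (kap (Nd l r)) = ?M \<bullet> ?k \<bullet> ?k'"
    by (simp add: sp_mul sp_sp funpow_swap1)
  then have "(s ^^ i) (kap (Nd l r)) \<bullet> E (Nd l r) i x = ?M \<bullet> (?k \<bullet> (?k' \<bullet> E r (Suc i + ?m) (E l i (D i x))))"
    using Nd.prems unfolding e by (simp add: assoc)
  also have "?k' \<bullet> E r (Suc i + ?m) (E l i (D i x)) = E l i (E (comb ?n) (Suc i) (D i x)) \<bullet> ?k'"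
    using Nd.prems by (subst Nd.IH(2)) (auto simp: E_E)
  also have "?k \<bullet> (E l i (E (comb ?n) (Suc i) (D i x)) \<bullet> ?k') =
      E (comb ?m) i (E (comb ?n) (Suc i) (D i x)) \<bullet> (?k \<bullet> ?k')"
    using Nd.prems Nd.IH(1)[of "E (comb ?n) (Suc i) (D i x)" i] by (simp flip: assoc)
  also have "?M \<bullet> \<dots> = E (comb (?m + ?n + 1)) i x \<bullet> ?M \<bullet> (?k \<bullet> ?k')"
    using Nd.prems merge_inter[of x i ?m ?n] by (simp flip: assoc)
  also have "\<dots> = E (comb (nodes (Nd l r))) i x \<bullet> (s ^^ i) (kap (Nd l r))"
    using Nd.prems by (simp add: sp_mul sp_sp funpow_swap1 assoc)
  finally show ?case .
qed simp

lemma kap_inter0: "x \<in> A \<Longrightarrow> kap t \<bullet> E t 0 x = E (comb (nodes t)) 0 x \<bullet> kap t"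
  using kap_inter[of x 0] by simp

text \<open>The case \<open>l = 1\<close>, \<open>m = n = 0\<close> is the pentagon, and this is the
  only place where the coherence theorem uses it. In the induction on \<open>l\<close> the factors
  are brought together by naturality (\<open>e1\<close>, \<open>e4\<close>), the pentagon is applied
  under the expansions \<open>?E\<close>, and the factor in \<open>s\<close> is the induction
  hypothesis shifted by one slot.\<close>

lemma merge_assoc:
  "merge l (m + n + 1) \<bullet> (s ^^ Suc l) (merge m n) \<bullet> E (comb l) 0 (E (comb m) 1 (E (comb n) 2 f)) =
    merge (l + m + 1) n \<bullet> merge l m"
proof (induction l)
  case (Suc l)
  let ?E = "\<lambda>x. E (comb l) 1 (E (comb m) 2 (E (comb n) 3 x))"
  have f3: "E (comb n) 3 f = f" by (rule E_triv[OF f_W]) simp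
  have e1: "E (comb l) 1 (E (comb (m + n + 1)) 2 f) \<bullet> (s ^^ (l + 2)) (merge m n) =
      (s ^^ (l + 2)) (merge m n) \<bullet> ?E (D 2 f)"
  proof -
    have a: "E (comb l) 1 (E (comb k) 2 f) = E (comb k) (l + 2) (E (comb l) 1 f)" for k
      by (simp add: E_E add.commute)
    have b: "?E (D 2 f) = E (comb m) (l + 2) (E (comb n) (Suc (l + 2)) (D (l + 2) (E (comb l) 1 f)))"
      by (simp add: E_E E_D add_ac numeral_eq_Suc)
    show ?thesis unfolding a b by (rule merge_inter[symmetric]) simp
  qed
  have e2: "E (comb (Suc l)) 0 (E (comb m) 1 (E (comb n) 2 f)) = ?E (D 0 f)"
    by (simp add: D_E numeral_eq_Suc)
  have e3: "?E (s f) = s (E (comb l) 0 (E (comb m) 1 (E (comb n) 2 f)))"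
    by (simp add: E_s numeral_eq_Suc)
  have e4: "E (comb (l + m + 1)) 1 (E (comb n) 2 f) \<bullet> s (merge l m) = s (merge l m) \<bullet> ?E (D 1 f)"
  proof -
    have "?E (D 1 f) = E (comb l) 1 (E (comb m) 2 (D 1 (E (comb n) 2 f)))"
      by (simp add: D_E numeral_eq_Suc)
    then show ?thesis
      using merge_inter[of "E (comb n) 2 f" 1 l m] by (simp add: numeral_eq_Suc)
  qed
  have "merge (Suc l) (m + n + 1) \<bullet> (s ^^ Suc (Suc l)) (merge m n) \<bullet>
      E (comb (Suc l)) 0 (E (comb m) 1 (E (comb n) 2 f)) =
    s (merge l (m + n + 1)) \<bullet> (E (comb l) 1 (E (comb (m + n + 1)) 2 f) \<bullet> (s ^^ (l + 2)) (merge m n)) \<bullet> ?E (D 0 f)"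
    unfolding e2 by (simp add: assoc)
  also have "\<dots> = s (merge l (m + n + 1)) \<bullet> (s ^^ (l + 2)) (merge m n) \<bullet> (?E (D 2 f) \<bullet> ?E (D 0 f))"
    unfolding e1 by (simp add: assoc)
  also have "?E (D 2 f) \<bullet> ?E (D 0 f) = ?E (s f) \<bullet> ?E (D 1 f) \<bullet> ?E f"
    by (simp add: pentagon flip: E_mul)
  also have "s (merge l (m + n + 1)) \<bullet> (s ^^ (l + 2)) (merge m n) \<bullet> (?E (s f) \<bullet> ?E (D 1 f) \<bullet> ?E f) =
      s (merge l (m + n + 1) \<bullet> (s ^^ Suc l) (merge m n) \<bullet> E (comb l) 0 (E (comb m) 1 (E (comb n) 2 f)))
      \<bullet> ?E (D 1 f) \<bullet> ?E f"
    unfolding e3 by (simp add: assoc s_mul)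
  also have "\<dots> = s (merge (l + m + 1) n) \<bullet> (s (merge l m) \<bullet> ?E (D 1 f)) \<bullet> ?E f"
    unfolding Suc by (simp add: assoc s_mul)
  also have "\<dots> = merge (Suc l + m + 1) n \<bullet> merge (Suc l) m"
    unfolding e4[symmetric] f3 by (simp add: assoc)
  finally show ?case .
qed simp

text \<open>\<open>path t t' x\<close>: the element \<open>x\<close> rebrackets \<open>t\<close> into \<open>t'\<close>.  As \<open>kap t'\<close> is
  invertible, \<open>x\<close> is determined by \<open>t\<close> and \<open>t'\<close>; this is Mac Lane's coherence theorem.\<close>

definition path :: "tree \<Rightarrow> tree \<Rightarrow> 'a \<Rightarrow> bool"
  where "path t t' x \<longleftrightarrow> x \<in> W (Suc (nodes t)) \<and> nodes t = nodes t' \<and> kap t' \<bullet> x = kap t"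

lemma path_A: "path t t' x \<Longrightarrow> x \<in> A"
  unfolding path_def using W_A by blast

lemma path_trans: "path t t' x \<Longrightarrow> path t' t'' y \<Longrightarrow> path t t'' (y \<bullet> x)"
  using path_A[of t t' x] path_A[of t' t'' y] by (auto simp: path_def simp flip: assoc)

text \<open>An associator with legs expanded by \<open>a\<close>, \<open>b\<close>, \<open>c\<close>
  is an arrow of bracketings: the normalizations of the three subtrees pass through it and turn the
  expansions into combs (\<open>n1\<close>, \<open>n2\<close>, \<open>n3\<close>), where
  \<open>merge_assoc\<close> finishes.\<close>

lemma path_f: "path (Nd (Nd a b) c) (Nd a (Nd b c)) (E a 0 (E b 1 (E c 2 f)))"
proof -
  let ?a = "nodes a" and ?b = "nodes b" and ?c = "nodes c"
  let ?x = "E a 0 (E b 1 (E c 2 f))"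
  let ?y = "E (comb ?a) 0 (E (comb ?b) 1 (E (comb ?c) 2 f))"
  let ?ka = "kap a" and ?kb = "(s ^^ Suc ?a) (kap b)" and ?kc = "(s ^^ (?a + ?b + 2)) (kap c)"
  let ?m = "(s ^^ Suc ?a) (merge ?b ?c)"
  have W: "?x \<in> W (Suc (nodes (Nd (Nd a b) c)))"
    using E_W[OF E_W[OF E_W[OF f_W]], of a 0 b 1 c 2] by (simp add: add_ac numeral_eq_Suc)
  have c: "?ka \<bullet> ?m = ?m \<bullet> ?ka" by (rule comm[OF kap_W]) simp
  have k1: "kap (Nd a (Nd b c)) = merge ?a (?b + ?c + 1) \<bullet> ?m \<bullet> (?ka \<bullet> ?kb \<bullet> ?kc)"
    using c by (simp add: sp_mul sp_sp assoc s_mul funpow_swap1) (simp flip: assoc)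
  have k2: "kap (Nd (Nd a b) c) = merge (?a + ?b + 1) ?c \<bullet> merge ?a ?b \<bullet> (?ka \<bullet> ?kb \<bullet> ?kc)"
    by (simp add: assoc)
  have n1: "?ka \<bullet> E a 0 z = E (comb ?a) 0 z \<bullet> ?ka" if "z \<in> A" for z
    using kap_inter0 that by simp
  have n2: "?kb \<bullet> E a 0 (E b 1 z) = E a 0 (E (comb ?b) 1 z) \<bullet> ?kb" if "z \<in> A" for z
    using kap_inter[of "E a 0 z" "Suc ?a" b] that by (simp add: E_E)
  have n3: "?kc \<bullet> E a 0 (E b 1 (E c 2 z)) = E a 0 (E b 1 (E (comb ?c) 2 z)) \<bullet> ?kc" if "z \<in> A" for z
    using kap_inter[of "E a 0 (E b 1 z)" "?a + ?b + 2" c] that by (simp add: E_E add_ac)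
  have "?ka \<bullet> ?kb \<bullet> ?kc \<bullet> ?x = ?y \<bullet> (?ka \<bullet> ?kb \<bullet> ?kc)"
  proof -
    have "?ka \<bullet> ?kb \<bullet> ?kc \<bullet> ?x = ?ka \<bullet> (?kb \<bullet> E a 0 (E b 1 (E (comb ?c) 2 f))) \<bullet> ?kc"
      using n3[of f] by (simp add: assoc del: funpow.simps)
    also have "\<dots> = (?ka \<bullet> E a 0 (E (comb ?b) 1 (E (comb ?c) 2 f))) \<bullet> ?kb \<bullet> ?kc"
      using n2[of "E (comb ?c) 2 f"] by (simp add: assoc del: funpow.simps)
    also have "\<dots> = ?y \<bullet> ?ka \<bullet> ?kb \<bullet> ?kc"
      using n1[of "E (comb ?b) 1 (E (comb ?c) 2 f)"] by simp
    finally show ?thesis by (simp add: assoc)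
  qed
  then have "kap (Nd a (Nd b c)) \<bullet> ?x = merge ?a (?b + ?c + 1) \<bullet> ?m \<bullet> ?y \<bullet> (?ka \<bullet> ?kb \<bullet> ?kc)"
    unfolding k1 by (simp add: assoc del: funpow.simps)
  also have "\<dots> = kap (Nd (Nd a b) c)" unfolding merge_assoc k2 ..
  finally show ?thesis using W by (auto simp: path_def)
qed

text \<open>The element \<open>x\<close> lives in the leaves of \<open>l\<close>, hence commutes
  with the part of \<open>kap\<close> that rebrackets \<open>r\<close>.\<close>

lemma path_left: "path l l' x \<Longrightarrow> path (Nd l r) (Nd l' r) x"
  using comm[of x "Suc (nodes l)" "kap r"] path_A[of l l' x] W_mono[of x "Suc (nodes l)" "Suc (nodes (Nd l r))"]
  by (auto simp: path_def assoc) (metis assoc kap_A s_A sp_A)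

lemma path_right: "path r r' x \<Longrightarrow> path (Nd l r) (Nd l r') ((s ^^ Suc (nodes l)) x)"
  using path_A[of r r' x] sp_W[of x "Suc (nodes r)" "Suc (nodes l)"]
  by (auto simp: path_def assoc add_ac simp flip: sp_mul s_mul)

section \<open>Invertibility and uniqueness of arrows\<close>

definition invertible :: "'a \<Rightarrow> bool"
  where "invertible x \<longleftrightarrow> (\<exists>y\<in>A. x \<bullet> y = \<one> \<and> y \<bullet> x = \<one>)"

lemma invertible_mul: "x \<in> A \<Longrightarrow> y \<in> A \<Longrightarrow> invertible x \<Longrightarrow> invertible y \<Longrightarrow> invertible (x \<bullet> y)"
proof -
  assume a: "x \<in> A" "y \<in> A" "invertible x" "invertible y"
  then obtain x' y' where "x' \<in> A" "y' \<in> A" "x \<bullet> x' = \<one>" "x' \<bullet> x = \<one>" "y \<bullet> y' = \<one>" "y' \<bullet> y = \<one>"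
    by (auto simp: invertible_def)
  with a have "x \<bullet> y \<bullet> (y' \<bullet> x') = \<one>" "y' \<bullet> x' \<bullet> (x \<bullet> y) = \<one>"
    by (metis assoc mul_A one_right)+
  then show ?thesis using \<open>x' \<in> A\<close> \<open>y' \<in> A\<close> by (auto simp: invertible_def)
qed

lemma invertible_one: "invertible \<one>"
  by (auto simp: invertible_def)
lemma invertible_f: "invertible f"
  using f_f' f'_f by (auto simp: invertible_def)
lemma invertible_s: "x \<in> A \<Longrightarrow> invertible x \<Longrightarrow> invertible (s x)"
  unfolding invertible_def by (metis s_A s_mul s_one)
lemma invertible_sp: "x \<in> A \<Longrightarrow> invertible x \<Longrightarrow> invertible ((s ^^ k) x)"
  by (induction k) (auto intro: invertible_s)
lemma invertible_E: "x \<in> A \<Longrightarrow> invertible x \<Longrightarrow> invertible (E t i x)"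
  unfolding invertible_def by (metis E_A E_mul E_one)

lemma invertible_merge: "invertible (merge m n)"
  by (induction m) (auto intro!: invertible_mul invertible_s invertible_E invertible_f invertible_one)
lemma invertible_kap: "invertible (kap t)"
  by (induction t) (auto intro!: invertible_mul invertible_sp invertible_s invertible_merge invertible_one)

lemma cancel_left:
  assumes "invertible z" "z \<in> A" "x \<in> A" "y \<in> A" "z \<bullet> x = z \<bullet> y" shows "x = y"
proof -
  obtain z' where z': "z' \<in> A" "z' \<bullet> z = \<one>" using assms(1) by (auto simp: invertible_def)
  have "z' \<bullet> z \<bullet> x = z' \<bullet> z \<bullet> y"
    unfolding assoc[OF z'(1) assms(2,3)] assoc[OF z'(1) assms(2,4)] assms(5) ..
  with z' assms show ?thesis by simp
qed

theorem path_unique: "path t t' x \<Longrightarrow> path t t' y \<Longrightarrow> x = y"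
  by (rule cancel_left[OF invertible_kap[of t']]) (auto simp: path_def dest: W_A)

lemma path_inv: "path t t' x \<Longrightarrow> y \<in> W (Suc (nodes t)) \<Longrightarrow> x \<bullet> y = \<one> \<Longrightarrow> path t' t y"
  using W_A[of y] path_A[of t t' x] by (auto simp: path_def) (metis assoc kap_A one_right)

lemma path_f': "path (Nd a (Nd b c)) (Nd (Nd a b) c) (E a 0 (E b 1 (E c 2 f')))"
proof (rule path_inv[OF path_f])
  show "E a 0 (E b 1 (E c 2 f')) \<in> W (Suc (nodes (Nd (Nd a b) c)))"
    using E_W[OF E_W[OF E_W[OF f'_W]], of a 0 b 1 c 2] by (simp add: add_ac numeral_eq_Suc)
qed (simp add: f_f' flip: E_mul)

text \<open>As arrows of bracketings, \<open>\<theta>\<close> goes from (ab)(cd) to a((bc)d) and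
  \<open>\<Omega>\<close> from ((ab)c)(de) to (a((bc)d))e. The word \<open>\<theta>\<close> is the
  one inside \<open>elt_a\<close>, and \<open>\<Omega>\<close> the one inside \<open>omega\<close>,
  with antipodes, \<alpha> and the inverse of f removed. The other words are chosen for the
  factorizations below: \<open>\<upsilon>\<close>, \<open>\<nu>\<close>, \<open>\<upsilon>'\<close>,
  \<open>\<nu>'\<close> and \<open>\<kappa>\<close> are the parts to which a coproduct is applied
  there.\<close>

definition \<theta> where "\<theta> = s f' \<bullet> D 2 f"
definition \<theta>' where "\<theta>' = D 2 f' \<bullet> s f"
definition \<Omega> where "\<Omega> = D 1 (f \<bullet> D 0 f') \<bullet> f"
definition \<upsilon> where "\<upsilon> = D 3 (D 2 f') \<bullet> s (D 2 f)"
definition \<nu> where "\<nu> = s (D 1 f) \<bullet> D 2 (D 1 f) \<bullet> s f \<bullet> D 1 f \<bullet> D 1 (D 0 f')"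
definition \<upsilon>' where "\<upsilon>' = s (D 2 f') \<bullet> D 3 (D 2 f)"
definition \<nu>' where "\<nu>' = D 1 (D 0 f) \<bullet> D 1 f' \<bullet> s f' \<bullet> D 2 (D 1 f') \<bullet> s (D 1 f')"
definition \<kappa> where "\<kappa> = s (D 1 f') \<bullet> s (s f') \<bullet> D 3 (D 2 f)"

lemma D_s_pos: "x \<in> A \<Longrightarrow> 0 < i \<Longrightarrow> D i (s x) = s (D (i - 1) x)"
  using D_s[of x "i - 1"] by simp

text \<open>Sorting coproducts by \<open>words\<close> can leave one in a slot beyond the support of
  the word; it acts on a 1 there and disappears.\<close>

lemma f_triv: "D 4 (D 1 f) = D 1 f" "D (Suc (Suc (Suc (Suc 0)))) (D (Suc 0) f) = D (Suc 0) f"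
  "D (Suc (Suc (Suc (Suc (Suc 0))))) (D 0 f) = D 0 f"
  "D (Suc (Suc (Suc (Suc (Suc 0))))) (D (Suc (Suc 0)) (D 0 f)) = D (Suc (Suc 0)) (D 0 f)"
  using D_triv[OF D_W[OF f_W, of 1], of 4] D_triv[OF D_W[OF f_W, of 0], of 5]
    D_triv[OF D_W[OF D_W[OF f_W, of 0], of 2], of 5] by (simp_all add: eval_nat_numeral)

lemmas words = \<theta>_def \<theta>'_def \<Omega>_def \<upsilon>_def \<nu>_def \<upsilon>'_def \<nu>'_def \<kappa>_def D_mul s_mul D_D D_0_s D_s_pos assoc eval_nat_numeral

text \<open>Both sides rebracket (a((bc)d))(ef) as (ab)(c((de)f)). The left side is what the
  antipode identity for the twofold coproduct produces; the right side is a detour with a coproduct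
  at either end, in slots 3 and 1, where the antipode axioms can remove it.\<close>

lemma C1:
  "s (s \<theta>) \<bullet> D 0 (D 1 (D 2 f)) \<bullet> \<theta>' =
    D 3 \<upsilon> \<bullet> D 1 \<nu>"
proof -
  have p0: "path (Nd (Nd Lf (Nd (Nd Lf Lf) Lf)) (Nd Lf Lf)) (Nd (Nd Lf (Nd Lf (Nd Lf Lf))) (Nd Lf Lf)) (s f)"
    using path_left[OF path_right[OF path_f[of "Lf" "Lf" "Lf"], of "Lf"], of "(Nd Lf Lf)"] by (simp add: words)
  have p1: "path (Nd (Nd Lf (Nd Lf (Nd Lf Lf))) (Nd Lf Lf)) (Nd (Nd (Nd Lf Lf) (Nd Lf Lf)) (Nd Lf Lf)) (D 2 f')"
    using path_left[OF path_f'[of "Lf" "Lf" "(Nd Lf Lf)"], of "(Nd Lf Lf)"] by (simp add: words)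
  have p2: "path (Nd (Nd (Nd Lf Lf) (Nd Lf Lf)) (Nd Lf Lf)) (Nd (Nd Lf Lf) (Nd (Nd Lf Lf) (Nd Lf Lf))) (D 0 (D 1 (D 2 f)))"
    using path_f[of "(Nd Lf Lf)" "(Nd Lf Lf)" "(Nd Lf Lf)"] by (simp add: words)
  have p3: "path (Nd (Nd Lf Lf) (Nd (Nd Lf Lf) (Nd Lf Lf))) (Nd (Nd Lf Lf) (Nd Lf (Nd Lf (Nd Lf Lf)))) (s (s (D 2 f)))"
    using path_right[OF path_f[of "Lf" "Lf" "(Nd Lf Lf)"], of "(Nd Lf Lf)"] by (simp add: words)
  have p4: "path (Nd (Nd Lf Lf) (Nd Lf (Nd Lf (Nd Lf Lf)))) (Nd (Nd Lf Lf) (Nd Lf (Nd (Nd Lf Lf) Lf))) (s (s (s f')))"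
    using path_right[OF path_right[OF path_f'[of "Lf" "Lf" "Lf"], of "Lf"], of "(Nd Lf Lf)"] by (simp add: words)
  note p = path_trans[OF path_trans[OF path_trans[OF path_trans[OF p0 p1] p2] p3] p4]
  have q0: "path (Nd (Nd Lf (Nd (Nd Lf Lf) Lf)) (Nd Lf Lf)) (Nd (Nd (Nd Lf (Nd (Nd Lf Lf) Lf)) Lf) Lf) (D 1 (D 1 (D 0 f')))"
    using path_f'[of "(Nd Lf (Nd (Nd Lf Lf) Lf))" "Lf" "Lf"] by (simp add: words)
  have q1: "path (Nd (Nd (Nd Lf (Nd (Nd Lf Lf) Lf)) Lf) Lf) (Nd (Nd Lf (Nd (Nd (Nd Lf Lf) Lf) Lf)) Lf) (D 1 (D 1 f))"
    using path_left[OF path_f[of "Lf" "(Nd (Nd Lf Lf) Lf)" "Lf"], of "Lf"] by (simp add: words)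
  have q2: "path (Nd (Nd Lf (Nd (Nd (Nd Lf Lf) Lf) Lf)) Lf) (Nd (Nd Lf (Nd (Nd Lf Lf) (Nd Lf Lf))) Lf) (s (D 0 f))"
    using path_left[OF path_right[OF path_f[of "(Nd Lf Lf)" "Lf" "Lf"], of "Lf"], of "Lf"] by (simp add: words)
  have q3: "path (Nd (Nd Lf (Nd (Nd Lf Lf) (Nd Lf Lf))) Lf) (Nd Lf (Nd (Nd (Nd Lf Lf) (Nd Lf Lf)) Lf)) (D 1 (D 2 (D 1 f)))"
    using path_f[of "Lf" "(Nd (Nd Lf Lf) (Nd Lf Lf))" "Lf"] by (simp add: words)
  have q4: "path (Nd Lf (Nd (Nd (Nd Lf Lf) (Nd Lf Lf)) Lf)) (Nd Lf (Nd (Nd Lf Lf) (Nd (Nd Lf Lf) Lf))) (s (D 0 (D 1 f)))"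
    using path_right[OF path_f[of "(Nd Lf Lf)" "(Nd Lf Lf)" "Lf"], of "Lf"] by (simp add: words)
  have q5: "path (Nd Lf (Nd (Nd Lf Lf) (Nd (Nd Lf Lf) Lf))) (Nd Lf (Nd Lf (Nd Lf (Nd (Nd Lf Lf) Lf)))) (s (D 2 (D 2 f)))"
    using path_right[OF path_f[of "Lf" "Lf" "(Nd (Nd Lf Lf) Lf)"], of "Lf"] by (simp add: words)
  have q6: "path (Nd Lf (Nd Lf (Nd Lf (Nd (Nd Lf Lf) Lf)))) (Nd (Nd Lf Lf) (Nd Lf (Nd (Nd Lf Lf) Lf))) (D 3 (D 3 (D 2 f')))"
    using path_f'[of "Lf" "Lf" "(Nd Lf (Nd (Nd Lf Lf) Lf))"] by (simp add: words)
  note q = path_trans[OF path_trans[OF path_trans[OF path_trans[OF path_trans[OF path_trans[OF q0 q1] q2] q3] q4] q5] q6]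
  from path_unique[OF p q] show ?thesis
    by (simp add: words f_triv)
qed

text \<open>The reverse arrow between the same bracketings, for the other antipode identity; the
  coproducts at the ends are now in slots 1 and 3.\<close>

lemma C1_inverse:
  "\<theta> \<bullet> D 0 (D 1 (D 2 f')) \<bullet> s (s \<theta>') =
    D 1 \<nu>' \<bullet> D 3 \<upsilon>'"
proof -
  have p0: "path (Nd (Nd Lf Lf) (Nd Lf (Nd (Nd Lf Lf) Lf))) (Nd (Nd Lf Lf) (Nd Lf (Nd Lf (Nd Lf Lf)))) (s (s (s f)))"
    using path_right[OF path_right[OF path_f[of "Lf" "Lf" "Lf"], of "Lf"], of "(Nd Lf Lf)"] by (simp add: words)
  have p1: "path (Nd (Nd Lf Lf) (Nd Lf (Nd Lf (Nd Lf Lf)))) (Nd (Nd Lf Lf) (Nd (Nd Lf Lf) (Nd Lf Lf))) (s (s (D 2 f')))"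
    using path_right[OF path_f'[of "Lf" "Lf" "(Nd Lf Lf)"], of "(Nd Lf Lf)"] by (simp add: words)
  have p2: "path (Nd (Nd Lf Lf) (Nd (Nd Lf Lf) (Nd Lf Lf))) (Nd (Nd (Nd Lf Lf) (Nd Lf Lf)) (Nd Lf Lf)) (D 0 (D 1 (D 2 f')))"
    using path_f'[of "(Nd Lf Lf)" "(Nd Lf Lf)" "(Nd Lf Lf)"] by (simp add: words)
  have p3: "path (Nd (Nd (Nd Lf Lf) (Nd Lf Lf)) (Nd Lf Lf)) (Nd (Nd Lf (Nd Lf (Nd Lf Lf))) (Nd Lf Lf)) (D 2 f)"
    using path_left[OF path_f[of "Lf" "Lf" "(Nd Lf Lf)"], of "(Nd Lf Lf)"] by (simp add: words)
  have p4: "path (Nd (Nd Lf (Nd Lf (Nd Lf Lf))) (Nd Lf Lf)) (Nd (Nd Lf (Nd (Nd Lf Lf) Lf)) (Nd Lf Lf)) (s f')"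
    using path_left[OF path_right[OF path_f'[of "Lf" "Lf" "Lf"], of "Lf"], of "(Nd Lf Lf)"] by (simp add: words)
  note p = path_trans[OF path_trans[OF path_trans[OF path_trans[OF p0 p1] p2] p3] p4]
  have q0: "path (Nd (Nd Lf Lf) (Nd Lf (Nd (Nd Lf Lf) Lf))) (Nd Lf (Nd Lf (Nd Lf (Nd (Nd Lf Lf) Lf)))) (D 3 (D 3 (D 2 f)))"
    using path_f[of "Lf" "Lf" "(Nd Lf (Nd (Nd Lf Lf) Lf))"] by (simp add: words)
  have q1: "path (Nd Lf (Nd Lf (Nd Lf (Nd (Nd Lf Lf) Lf)))) (Nd Lf (Nd (Nd Lf Lf) (Nd (Nd Lf Lf) Lf))) (s (D 2 (D 2 f')))"
    using path_right[OF path_f'[of "Lf" "Lf" "(Nd (Nd Lf Lf) Lf)"], of "Lf"] by (simp add: words)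
  have q2: "path (Nd Lf (Nd (Nd Lf Lf) (Nd (Nd Lf Lf) Lf))) (Nd Lf (Nd (Nd (Nd Lf Lf) (Nd Lf Lf)) Lf)) (s (D 0 (D 1 f')))"
    using path_right[OF path_f'[of "(Nd Lf Lf)" "(Nd Lf Lf)" "Lf"], of "Lf"] by (simp add: words)
  have q3: "path (Nd Lf (Nd (Nd (Nd Lf Lf) (Nd Lf Lf)) Lf)) (Nd (Nd Lf (Nd (Nd Lf Lf) (Nd Lf Lf))) Lf) (D 1 (D 2 (D 1 f')))"
    using path_f'[of "Lf" "(Nd (Nd Lf Lf) (Nd Lf Lf))" "Lf"] by (simp add: words)
  have q4: "path (Nd (Nd Lf (Nd (Nd Lf Lf) (Nd Lf Lf))) Lf) (Nd (Nd Lf (Nd (Nd (Nd Lf Lf) Lf) Lf)) Lf) (s (D 0 f'))"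
    using path_left[OF path_right[OF path_f'[of "(Nd Lf Lf)" "Lf" "Lf"], of "Lf"], of "Lf"] by (simp add: words)
  have q5: "path (Nd (Nd Lf (Nd (Nd (Nd Lf Lf) Lf) Lf)) Lf) (Nd (Nd (Nd Lf (Nd (Nd Lf Lf) Lf)) Lf) Lf) (D 1 (D 1 f'))"
    using path_left[OF path_f'[of "Lf" "(Nd (Nd Lf Lf) Lf)" "Lf"], of "Lf"] by (simp add: words)
  have q6: "path (Nd (Nd (Nd Lf (Nd (Nd Lf Lf) Lf)) Lf) Lf) (Nd (Nd Lf (Nd (Nd Lf Lf) Lf)) (Nd Lf Lf)) (D 1 (D 1 (D 0 f)))"
    using path_f[of "(Nd Lf (Nd (Nd Lf Lf) Lf))" "Lf" "Lf"] by (simp add: words)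
  note q = path_trans[OF path_trans[OF path_trans[OF path_trans[OF path_trans[OF path_trans[OF q0 q1] q2] q3] q4] q5] q6]
  from path_unique[OF p q] show ?thesis
    by (simp add: words f_triv)
qed

text \<open>Both sides rebracket ((ab)c)((de)f) as a((b((cd)e))f). The detour on the left has a
  coproduct in slot 2 in front, and the counit of \<open>\<kappa>\<close> in that slot is
  \<open>\<theta>\<close>.\<close>

lemma C2:
  "D 2 \<kappa> \<bullet> D 0 (D 3 \<theta>) \<bullet> s (s (s f)) =
    s \<theta> \<bullet> D 1 (D 2 \<theta>) \<bullet> f"
proof -
  have p0: "path (Nd (Nd (Nd Lf Lf) Lf) (Nd (Nd Lf Lf) Lf)) (Nd (Nd (Nd Lf Lf) Lf) (Nd Lf (Nd Lf Lf))) (s (s (s f)))"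
    using path_right[OF path_f[of "Lf" "Lf" "Lf"], of "(Nd (Nd Lf Lf) Lf)"] by (simp add: words)
  have p1: "path (Nd (Nd (Nd Lf Lf) Lf) (Nd Lf (Nd Lf Lf))) (Nd (Nd Lf Lf) (Nd Lf (Nd Lf (Nd Lf Lf)))) (D 0 (D 3 (D 2 f)))"
    using path_f[of "(Nd Lf Lf)" "Lf" "(Nd Lf (Nd Lf Lf))"] by (simp add: words)
  have p2: "path (Nd (Nd Lf Lf) (Nd Lf (Nd Lf (Nd Lf Lf)))) (Nd (Nd Lf Lf) (Nd (Nd Lf Lf) (Nd Lf Lf))) (s (s (D 2 f')))"
    using path_right[OF path_f'[of "Lf" "Lf" "(Nd Lf Lf)"], of "(Nd Lf Lf)"] by (simp add: words)
  have p3: "path (Nd (Nd Lf Lf) (Nd (Nd Lf Lf) (Nd Lf Lf))) (Nd Lf (Nd Lf (Nd (Nd Lf Lf) (Nd Lf Lf)))) (D 2 (D 3 (D 2 f)))"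
    using path_f[of "Lf" "Lf" "(Nd (Nd Lf Lf) (Nd Lf Lf))"] by (simp add: words)
  have p4: "path (Nd Lf (Nd Lf (Nd (Nd Lf Lf) (Nd Lf Lf)))) (Nd Lf (Nd Lf (Nd (Nd (Nd Lf Lf) Lf) Lf))) (s (s (D 0 f')))"
    using path_right[OF path_right[OF path_f'[of "(Nd Lf Lf)" "Lf" "Lf"], of "Lf"], of "Lf"] by (simp add: words)
  have p5: "path (Nd Lf (Nd Lf (Nd (Nd (Nd Lf Lf) Lf) Lf))) (Nd Lf (Nd (Nd Lf (Nd (Nd Lf Lf) Lf)) Lf)) (s (D 1 (D 1 f')))"
    using path_right[OF path_f'[of "Lf" "(Nd (Nd Lf Lf) Lf)" "Lf"], of "Lf"] by (simp add: words)
  note p = path_trans[OF path_trans[OF path_trans[OF path_trans[OF path_trans[OF p0 p1] p2] p3] p4] p5]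
  have q0: "path (Nd (Nd (Nd Lf Lf) Lf) (Nd (Nd Lf Lf) Lf)) (Nd (Nd Lf (Nd Lf Lf)) (Nd (Nd Lf Lf) Lf)) f"
    using path_left[OF path_f[of "Lf" "Lf" "Lf"], of "(Nd (Nd Lf Lf) Lf)"] by (simp add: words)
  have q1: "path (Nd (Nd Lf (Nd Lf Lf)) (Nd (Nd Lf Lf) Lf)) (Nd Lf (Nd (Nd Lf Lf) (Nd (Nd Lf Lf) Lf))) (D 1 (D 2 (D 2 f)))"
    using path_f[of "Lf" "(Nd Lf Lf)" "(Nd (Nd Lf Lf) Lf)"] by (simp add: words)
  have q2: "path (Nd Lf (Nd (Nd Lf Lf) (Nd (Nd Lf Lf) Lf))) (Nd Lf (Nd (Nd (Nd Lf Lf) (Nd Lf Lf)) Lf)) (s (D 0 (D 1 f')))"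
    using path_right[OF path_f'[of "(Nd Lf Lf)" "(Nd Lf Lf)" "Lf"], of "Lf"] by (simp add: words)
  have q3: "path (Nd Lf (Nd (Nd (Nd Lf Lf) (Nd Lf Lf)) Lf)) (Nd Lf (Nd (Nd Lf (Nd Lf (Nd Lf Lf))) Lf)) (s (D 2 f))"
    using path_right[OF path_left[OF path_f[of "Lf" "Lf" "(Nd Lf Lf)"], of "Lf"], of "Lf"] by (simp add: words)
  have q4: "path (Nd Lf (Nd (Nd Lf (Nd Lf (Nd Lf Lf))) Lf)) (Nd Lf (Nd (Nd Lf (Nd (Nd Lf Lf) Lf)) Lf)) (s (s f'))"
    using path_right[OF path_left[OF path_right[OF path_f'[of "Lf" "Lf" "Lf"], of "Lf"], of "Lf"], of "Lf"] by (simp add: words)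
  note q = path_trans[OF path_trans[OF path_trans[OF path_trans[OF q0 q1] q2] q3] q4]
  from path_unique[OF p q] show ?thesis
    by (simp add: words f_triv)
qed

text \<open>Both sides rebracket (((ab)c)d)(e(fg)) as (a((b((cd)e))f))g. The letters a, b, c stand
  for the three comodule legs, d acts on the module, and e, f, g will be put under S.\<close>

lemma C3:
  "s \<Omega> \<bullet> D 1 (D 3 \<Omega>) \<bullet> f \<bullet> s (s (s (s f'))) =
    D 2 (D 2 \<Omega>) \<bullet> D 0 (D 4 \<Omega>)"
proof -
  have p0: "path (Nd (Nd (Nd (Nd Lf Lf) Lf) Lf) (Nd Lf (Nd Lf Lf))) (Nd (Nd (Nd (Nd Lf Lf) Lf) Lf) (Nd (Nd Lf Lf) Lf)) (s (s (s (s f'))))"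
    using path_right[OF path_f'[of "Lf" "Lf" "Lf"], of "(Nd (Nd (Nd Lf Lf) Lf) Lf)"] by (simp add: words)
  have p1: "path (Nd (Nd (Nd (Nd Lf Lf) Lf) Lf) (Nd (Nd Lf Lf) Lf)) (Nd (Nd (Nd Lf (Nd Lf Lf)) Lf) (Nd (Nd Lf Lf) Lf)) f"
    using path_left[OF path_left[OF path_f[of "Lf" "Lf" "Lf"], of "Lf"], of "(Nd (Nd Lf Lf) Lf)"] by (simp add: words)
  have p2: "path (Nd (Nd (Nd Lf (Nd Lf Lf)) Lf) (Nd (Nd Lf Lf) Lf)) (Nd (Nd Lf (Nd (Nd Lf Lf) Lf)) (Nd (Nd Lf Lf) Lf)) (D 1 f)"
    using path_left[OF path_f[of "Lf" "(Nd Lf Lf)" "Lf"], of "(Nd (Nd Lf Lf) Lf)"] by (simp add: words)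
  have p3: "path (Nd (Nd Lf (Nd (Nd Lf Lf) Lf)) (Nd (Nd Lf Lf) Lf)) (Nd (Nd (Nd Lf (Nd (Nd Lf Lf) Lf)) (Nd Lf Lf)) Lf) (D 1 (D 1 (D 0 (D 1 f'))))"
    using path_f'[of "(Nd Lf (Nd (Nd Lf Lf) Lf))" "(Nd Lf Lf)" "Lf"] by (simp add: words)
  have p4: "path (Nd (Nd (Nd Lf (Nd (Nd Lf Lf) Lf)) (Nd Lf Lf)) Lf) (Nd (Nd Lf (Nd (Nd (Nd Lf Lf) Lf) (Nd Lf Lf))) Lf) (D 1 (D 1 (D 2 f)))"
    using path_left[OF path_f[of "Lf" "(Nd (Nd Lf Lf) Lf)" "(Nd Lf Lf)"], of "Lf"] by (simp add: words)
  have p5: "path (Nd (Nd Lf (Nd (Nd (Nd Lf Lf) Lf) (Nd Lf Lf))) Lf) (Nd (Nd Lf (Nd (Nd Lf (Nd Lf Lf)) (Nd Lf Lf))) Lf) (s f)"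
    using path_left[OF path_right[OF path_left[OF path_f[of "Lf" "Lf" "Lf"], of "(Nd Lf Lf)"], of "Lf"], of "Lf"] by (simp add: words)
  have p6: "path (Nd (Nd Lf (Nd (Nd Lf (Nd Lf Lf)) (Nd Lf Lf))) Lf) (Nd (Nd Lf (Nd (Nd (Nd Lf (Nd Lf Lf)) Lf) Lf)) Lf) (s (D 1 (D 0 f')))"
    using path_left[OF path_right[OF path_f'[of "(Nd Lf (Nd Lf Lf))" "Lf" "Lf"], of "Lf"], of "Lf"] by (simp add: words)
  have p7: "path (Nd (Nd Lf (Nd (Nd (Nd Lf (Nd Lf Lf)) Lf) Lf)) Lf) (Nd (Nd Lf (Nd (Nd Lf (Nd (Nd Lf Lf) Lf)) Lf)) Lf) (s (D 1 f))"
    using path_left[OF path_right[OF path_left[OF path_f[of "Lf" "(Nd Lf Lf)" "Lf"], of "Lf"], of "Lf"], of "Lf"] by (simp add: words)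
  note p = path_trans[OF path_trans[OF path_trans[OF path_trans[OF path_trans[OF path_trans[OF path_trans[OF p0 p1] p2] p3] p4] p5] p6] p7]
  have q0: "path (Nd (Nd (Nd (Nd Lf Lf) Lf) Lf) (Nd Lf (Nd Lf Lf))) (Nd (Nd (Nd Lf Lf) (Nd Lf Lf)) (Nd Lf (Nd Lf Lf))) (D 0 f)"
    using path_left[OF path_f[of "(Nd Lf Lf)" "Lf" "Lf"], of "(Nd Lf (Nd Lf Lf))"] by (simp add: words)
  have q1: "path (Nd (Nd (Nd Lf Lf) (Nd Lf Lf)) (Nd Lf (Nd Lf Lf))) (Nd (Nd (Nd (Nd Lf Lf) (Nd Lf Lf)) Lf) (Nd Lf Lf)) (D 0 (D 1 (D 0 (D 2 f'))))"
    using path_f'[of "(Nd (Nd Lf Lf) (Nd Lf Lf))" "Lf" "(Nd Lf Lf)"] by (simp add: words)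
  have q2: "path (Nd (Nd (Nd (Nd Lf Lf) (Nd Lf Lf)) Lf) (Nd Lf Lf)) (Nd (Nd (Nd Lf Lf) (Nd (Nd Lf Lf) Lf)) (Nd Lf Lf)) (D 0 (D 1 f))"
    using path_left[OF path_f[of "(Nd Lf Lf)" "(Nd Lf Lf)" "Lf"], of "(Nd Lf Lf)"] by (simp add: words)
  have q3: "path (Nd (Nd (Nd Lf Lf) (Nd (Nd Lf Lf) Lf)) (Nd Lf Lf)) (Nd (Nd Lf (Nd Lf (Nd (Nd Lf Lf) Lf))) (Nd Lf Lf)) (D 2 (D 2 f))"
    using path_left[OF path_f[of "Lf" "Lf" "(Nd (Nd Lf Lf) Lf)"], of "(Nd Lf Lf)"] by (simp add: words)
  have q4: "path (Nd (Nd Lf (Nd Lf (Nd (Nd Lf Lf) Lf))) (Nd Lf Lf)) (Nd (Nd (Nd Lf (Nd Lf (Nd (Nd Lf Lf) Lf))) Lf) Lf) (D 2 (D 2 (D 1 (D 0 f'))))"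
    using path_f'[of "(Nd Lf (Nd Lf (Nd (Nd Lf Lf) Lf)))" "Lf" "Lf"] by (simp add: words)
  have q5: "path (Nd (Nd (Nd Lf (Nd Lf (Nd (Nd Lf Lf) Lf))) Lf) Lf) (Nd (Nd Lf (Nd (Nd Lf (Nd (Nd Lf Lf) Lf)) Lf)) Lf) (D 2 (D 2 (D 1 f)))"
    using path_left[OF path_f[of "Lf" "(Nd Lf (Nd (Nd Lf Lf) Lf))" "Lf"], of "Lf"] by (simp add: words)
  note q = path_trans[OF path_trans[OF path_trans[OF path_trans[OF path_trans[OF q0 q1] q2] q3] q4] q5]
  from path_unique[OF p q] show ?thesis
    by (simp add: words f_triv)
qed

end

section \<open>The algebra of tensors with infinitely many slots\<close>

text \<open>As simplification rules these would rewrite eta-expanded sums and products of functions.\<close>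

declare plus_fun_apply [simp del] zero_fun_apply [simp del] times_fun_apply [simp del] one_fun_apply [simp del]

lemmas pointwise = plus_fun_apply zero_fun_apply times_fun_apply one_fun_apply

text \<open>Tensor powers of all orders live in one algebra: its forms are linear in each of infinitely many
  slots, and a tensor with finitely many factors is continued by \<open>1\<close>.\<close>

definition HN :: "('k::field \<Rightarrow> 'h::ring_1 \<Rightarrow> 'h) \<Rightarrow> ('k, nat \<Rightarrow> 'h) mspace"
  where "HN s = \<lparr>points = UNIV, forms = {g. \<forall>x i. linear_on s (*) UNIV (\<lambda>a. g (x(i := a)))}\<rparr>"

lemma points_HN [simp]: "points (HN s) = UNIV"
  by (simp add: HN_def)

lemma points_vsp [simp]: "points (vsp s V) = V"
  by (simp add: vsp_def)

lemma points_mprod [simp]: "points (X \<boxtimes> Y) = points X \<times> points Y"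
  by (simp add: mprod_def)

lemma good_HN: "good (HN s)"
  by (auto simp: good_def HN_def linear_on_def algebra_simps)

lemma multilin_HN: "multilin (HN s) F \<longleftrightarrow> (\<forall>x i. multilin (vsp s UNIV) (\<lambda>a. F (x(i := a))))"
  by (auto simp: multilin_def HN_def vsp_def)

text \<open>Each input slot enters one output slot, linearly and without influence on the others;
  this is enough for \<open>pN (T x)\<close> to be multilinear in \<open>x\<close>. Several input
  slots may enter the same output slot, so products such as S(x1) \<alpha> x2 are covered.\<close>

definition slin :: "('k::field \<Rightarrow> 'h::ring_1 \<Rightarrow> 'h) \<Rightarrow> ((nat \<Rightarrow> 'h) \<Rightarrow> nat \<Rightarrow> 'h) \<Rightarrow> bool"
  where "slin s T \<longleftrightarrow> (\<exists>p. \<forall>x i. (\<forall>a j. j \<noteq> p i \<longrightarrow> T (x(i := a)) j = T x j) \<and>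
    linear_on s s UNIV (\<lambda>a. T (x(i := a)) (p i)))"

lemma slin_comp:
  assumes "slin s T" "slin s T'" shows "slin s (\<lambda>x. T (T' x))"
proof -
  obtain p where p: "\<And>x i a j. j \<noteq> p i \<Longrightarrow> T (x(i := a)) j = T x j"
    "\<And>x i. linear_on s s UNIV (\<lambda>a. T (x(i := a)) (p i))"
    using assms(1) unfolding slin_def by blast
  obtain q where q: "\<And>x i a j. j \<noteq> q i \<Longrightarrow> T' (x(i := a)) j = T' x j"
    "\<And>x i. linear_on s s UNIV (\<lambda>a. T' (x(i := a)) (q i))"
    using assms(2) unfolding slin_def by blast
  have eq: "T' (x(i := a)) = (T' x)(q i := T' (x(i := a)) (q i))" for x i a
    using q(1) by auto
  have 1: "T (T' (x(i := a))) j = T (T' x) j" if "j \<noteq> p (q i)" for x i a j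
    by (subst eq) (rule p(1)[OF that])
  have 2: "linear_on s s UNIV (\<lambda>a. T (T' (x(i := a))) (p (q i)))" for x i
    using p(2)[of "T' x" "q i"] q(2)[of x i] by (subst eq) (auto simp: linear_on_def)
  show ?thesis unfolding slin_def by (rule exI[of _ "\<lambda>i. p (q i)"]) (use 1 2 in simp)
qed

section \<open>Prepending and splitting slots\<close>

abbreviation cons :: "'a \<Rightarrow> (nat \<Rightarrow> 'a) \<Rightarrow> nat \<Rightarrow> 'a" (infixr "##" 65)
  where "a ## x \<equiv> case_nat a x"

lemma cons_mult [simp]: "(a ## x) * (b ## y) = (a * b ## x * y :: nat \<Rightarrow> 'h::ring_1)"
  by (auto simp: pointwise fun_eq_iff split: nat.split)
lemma cons_one [simp]: "1 ## 1 = (1 :: nat \<Rightarrow> 'h::ring_1)"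
  by (auto simp: pointwise fun_eq_iff split: nat.split)
lemma cons_upd: "(a ## x)(0 := b) = b ## x" "(a ## x)(Suc i := b) = a ## x(i := b)"
  by (auto simp: pointwise fun_eq_iff split: nat.split)

definition spl :: "nat \<Rightarrow> 'a \<Rightarrow> 'a \<Rightarrow> (nat \<Rightarrow> 'a) \<Rightarrow> nat \<Rightarrow> 'a"
  where "spl i a b x = (\<lambda>j. if j < i then x j else if j = i then a else if j = Suc i then b else x (j - 1))"

lemma spl_upd: "spl i a b x = (spl i c b x)(i := a)" "spl i a b x = (spl i a c x)(Suc i := b)"
  by (auto simp: pointwise spl_def fun_eq_iff)
lemma spl_upd_other: "j \<noteq> i \<Longrightarrow> spl i a b (x(j := c)) = (spl i a b x)((if j < i then j else Suc j) := c)"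
  by (auto simp: pointwise spl_def fun_eq_iff)
lemma spl_0: "spl 0 a b x = a ## b ## (\<lambda>j. x (Suc j))"
  by (auto simp: pointwise spl_def fun_eq_iff split: nat.split)
lemma spl_mult: "spl i a b x * spl i c d y = (spl i (a * c) (b * d) (x * y) :: nat \<Rightarrow> 'h::ring_1)"
  by (auto simp: pointwise spl_def fun_eq_iff)
lemma spl_one: "x i = 1 \<Longrightarrow> (\<And>j. i \<le> j \<Longrightarrow> x j = 1) \<Longrightarrow> spl i 1 1 x = (x :: nat \<Rightarrow> 'h::ring_1)"
  by (auto simp: pointwise spl_def fun_eq_iff)
lemma spl_same: "j < i \<Longrightarrow> spl i a b x j = x j" "i < j \<Longrightarrow> spl i a b x (Suc j) = x j"
  by (auto simp: spl_def)
lemma spl_Suc_cons: "spl (Suc i) a b (c ## x) = c ## spl i a b x"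
  by (auto simp: pointwise spl_def fun_eq_iff split: nat.split)
lemma spl_0_cons: "spl 0 a b (c ## x) = a ## b ## x"
  by (auto simp: pointwise spl_def fun_eq_iff split: nat.split)

lemma spl_at: "spl i a b x i = a" "spl i a b x (Suc i) = b"
  by (auto simp: spl_def)

lemma spl_spl: assumes "i < j" shows "spl i c d (spl j a b x) = spl (Suc j) a b (spl i c d x)"
proof
  fix k
  consider "k < i" | "k = i" | "k = Suc i" | "Suc i < k" by linarith
  then show "spl i c d (spl j a b x) k = spl (Suc j) a b (spl i c d x) k"
    using assms by cases (auto simp: spl_def)
qed

locale quasi_hopf_algebra =
  fixes Q :: "('k::field, 'h::ring_1) qha"
  assumes qh: "quasi_hopf Q"
begin

abbreviation sc where "sc \<equiv> scal Q"
abbreviation \<H> where "\<H> \<equiv> HN (scal Q)"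
abbreviation A where "A \<equiv> tens (HN (scal Q))"
abbreviation pN where "pN \<equiv> pt (HN (scal Q))"
abbreviation mul (infixl "\<bullet>" 70) where "t \<bullet> u \<equiv> tmult (HN (scal Q)) (*) t u"

lemma vs: "vector_space sc" and
  scal_mult: "sc c (x * y) = sc c x * y" "sc c (x * y) = x * sc c y" and
  Delta_in [simp]: "Delta Q h \<in> tens (H2 Q)" and
  linear_Delta: "linear_on sc tscale UNIV (Delta Q)" and
  Delta_one: "Delta Q 1 = pt (H2 Q) (1, 1)" and
  Delta_mult: "Delta Q (g * h) = tmult (H2 Q) m2 (Delta Q g) (Delta Q h)" and
  linear_eps: "linear_on sc (*) UNIV (eps Q)" and
  eps_one [simp]: "eps Q 1 = 1" and
  eps_mult: "eps Q (g * h) = eps Q g * eps Q h" and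
  phi_in: "phi Q \<in> tens (H3 Q)" and
  phi_invertible: "\<exists>u. is_tinv (H3 Q) m3 (1, 1, 1) (phi Q) u" and
  linear_anti: "linear_on sc sc UNIV (anti Q)" and
  anti_one [simp]: "anti Q 1 = 1" and
  anti_mult: "anti Q (g * h) = anti Q h * anti Q g" and
  eps_alpha [simp]: "eps Q (alpha Q) = 1" and
  eps_beta [simp]: "eps Q (beta Q) = 1"
  using qh unfolding quasi_hopf_def k_algebra_def by blast+

lemma scal_mult': "sc c x * y = sc c (x * y)" "x * sc c y = sc c (x * y)"
  by (simp_all only: scal_mult[symmetric])

lemma scal_one [simp]: "sc 1 x = x"
  using vs by (simp add: vector_space_def)

lemma linear_mult: "linear_on sc sc UNIV (\<lambda>a. x * a)" "linear_on sc sc UNIV (\<lambda>a. a * x)"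
  by (auto simp: linear_on_def distrib_left distrib_right scal_mult')

lemma good_H1 [simp]: "good (H1 Q)"
  by (rule good_vsp_UNIV) (rule vs)

lemma good_H2 [simp]: "good (H2 Q)" and good_H3 [simp]: "good (H3 Q)" and good_H4 [simp]: "good (H4 Q)"
  and good_H5 [simp]: "good (H5 Q)"
  by (auto intro!: good_mprod)

lemma talg_H1: "talg (H1 Q) (*) 1"
  using good_H1 by (auto simp: talg_def mult.assoc)
    (auto simp: vsp_def linear_on_def distrib_left distrib_right scal_mult')

lemma talg_H2: "talg (H2 Q) m2 (1, 1)" and talg_H3: "talg (H3 Q) m3 (1, 1, 1)"
  and talg_H4: "talg (H4 Q) m4 (1, 1, 1, 1)" and talg_H5: "talg (H5 Q) m5 (1, 1, 1, 1, 1)"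
  by (auto intro!: talg_mprod talg_H1)

lemma upd_mult: "x(i := a) * y = (x * y)(i := a * y i)" "y * x(i := a) = (y * x)(i := y i * a)"
  for x y :: "nat \<Rightarrow> 'h"
  by (auto simp: pointwise fun_eq_iff)

lemma talg_HN: "talg \<H> (*) 1"
proof -
  have "linear_on sc (*) UNIV (\<lambda>a. g (z(i := a * y)))" "linear_on sc (*) UNIV (\<lambda>a. g (z(i := y * a)))"
    if "\<forall>x i. linear_on sc (*) UNIV (\<lambda>a. g (x(i := a)))" for g :: "(nat \<Rightarrow> 'h) \<Rightarrow> 'k" and z i y
    using that unfolding linear_on_def by (auto simp: distrib_left distrib_right scal_mult')
  then show ?thesis
    using good_HN[of sc] by (auto simp: talg_def mult.assoc) (auto simp: HN_def upd_mult)
qed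

lemmas mul_in [simp, intro] = tmult_in[OF talg_HN]
lemmas mul_assoc = tmult_assoc[OF talg_HN]
lemmas mul_pt = tmult_pt[OF talg_HN]
lemmas lin_mul_left = lin_tmult_left[OF talg_HN]
lemmas lin_mul_right = lin_tmult_right[OF talg_HN]
lemmas mul_one_left [simp] = tmult_one_left[OF talg_HN]
lemmas mul_one_right [simp] = tmult_one_right[OF talg_HN]

lemma pN_in [simp, intro]: "pN x \<in> A" by auto

lemma multilin_pN_upd: "multilin (H1 Q) (\<lambda>a. pN (x(i := a)))"
  using multilin_pt[OF good_HN, of sc] by (simp add: multilin_HN)

lemma multilin_slin: assumes "slin sc T" shows "multilin \<H> (\<lambda>x. pN (T x))"
  unfolding multilin_HN
proof (intro allI)
  fix x i
  from assms obtain p where p: "\<And>x i a j. j \<noteq> p i \<Longrightarrow> T (x(i := a)) j = T x j"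
    "\<And>x i. linear_on sc sc UNIV (\<lambda>a. T (x(i := a)) (p i))" unfolding slin_def by blast
  have eq: "T (x(i := a)) = (T x)(p i := T (x(i := a)) (p i))" for a using p(1) by auto
  show "multilin (H1 Q) (\<lambda>a. pN (T (x(i := a))))"
    by (subst eq) (rule multilin_comp[OF multilin_pN_upd p(2)], simp)
qed

lemma multilin_upd2:
  assumes "\<And>a b c. T a b = (T c b)(i := a)" "\<And>a b c. T a b = (T a c)(j := b)"
  shows "multilin (H2 Q) (\<lambda>z. pN (T (fst z) (snd z)))"
  unfolding multilin_mprod
proof (intro conjI ballI)
  fix a show "multilin (H1 Q) (\<lambda>b. pN (T (fst (a, b)) (snd (a, b))))"
    using multilin_pN_upd[of "T a undefined" j] by (simp add: assms(2)[of a _ undefined, symmetric])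
next
  fix b show "multilin (H1 Q) (\<lambda>a. pN (T (fst (a, b)) (snd (a, b))))"
    using multilin_pN_upd[of "T undefined b" i] by (simp add: assms(1)[of _ b undefined, symmetric])
qed

lemma multilin_spl: "multilin (H2 Q) (\<lambda>z. pN (spl i (fst z) (snd z) x))"
  by (rule multilin_upd2) (rule spl_upd)+

definition mapt where "mapt T t = tsum t (\<lambda>x. pN (T x))"

lemma mapt_pt: "slin sc T \<Longrightarrow> mapt T (pN x) = pN (T x)"
  unfolding mapt_def by (rule tsum_pt_multilin) (rule multilin_slin)
lemma mapt_in [simp, intro]: "slin sc T \<Longrightarrow> t \<in> A \<Longrightarrow> mapt T t \<in> A"
  unfolding mapt_def by (rule tsum_in) (auto intro: multilin_slin)
lemma lin_mapt: "lin X L \<Longrightarrow> lin X (\<lambda>t. mapt T (L t))"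
  unfolding mapt_def by (rule lin_tsum)
lemma mapt_tsum: "mapt T (tsum t F) = tsum t (\<lambda>x. mapt T (F x))"
  unfolding mapt_def by (rule tsum_tsum)

text \<open>Slot \<open>i\<close> of \<open>x\<close> makes room for the two legs of
  \<open>p\<close>; the entry \<open>x i\<close> itself is dropped and matters only through the
  choice of \<open>p\<close>.\<close>

definition dk where "dk i p x = tsum p (\<lambda>z. pN (spl i (fst z) (snd z) x))"

text \<open>\<open>D i\<close> applies \<open>\<Delta>\<close> to slot \<open>i\<close> and shifts the later slots.\<close>

definition D where "D i t = tsum t (\<lambda>x. dk i (Delta Q (x i)) x)"

lemma dk_pt: "dk i (pt (H2 Q) z) x = pN (spl i (fst z) (snd z) x)"
  unfolding dk_def by (rule tsum_pt_multilin) (rule multilin_spl)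

lemma dk_in [simp, intro]: "p \<in> tens (H2 Q) \<Longrightarrow> dk i p x \<in> A"
  unfolding dk_def by (rule tsum_in) (auto intro: multilin_spl)

text \<open>If the updated slot is the one that is split, linearity is that of the coproduct;
  otherwise the update merely reappears in another slot of the split sequence.\<close>

lemma multilin_dk: "multilin \<H> (\<lambda>x. dk i (Delta Q (x i)) x)"
  unfolding multilin_HN
proof (intro allI)
  fix x :: "nat \<Rightarrow> 'h" and j
  show "multilin (H1 Q) (\<lambda>a. dk i (Delta Q ((x(j := a)) i)) (x(j := a)))"
  proof (cases "j = i")
    case True
    have "spl i c d (x(i := a)) = spl i c d x" for a c d by (auto simp: pointwise spl_def fun_eq_iff)
    then show ?thesis using True linear_Delta by (auto simp: dk_def multilin_vsp[symmetric] intro!: multilin_tsum1)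
  next
    case False
    then show ?thesis unfolding dk_def
      by (auto simp: spl_upd_other intro!: multilin_tsum2[where Y = "H2 Q"] multilin_pN_upd)
        (use spl_upd_other[OF False, symmetric, where x = x] in \<open>auto simp del: fun_upd_apply split: if_splits intro!: multilin_spl\<close>)
  qed
qed

lemma D_pt: "D i (pN x) = dk i (Delta Q (x i)) x"
  unfolding D_def by (rule tsum_pt_multilin) (rule multilin_dk)
lemma D_in [simp, intro]: "t \<in> A \<Longrightarrow> D i t \<in> A"
  unfolding D_def by (rule tsum_in) (auto intro: multilin_dk)
lemma lin_D: "lin X L \<Longrightarrow> lin X (\<lambda>t. D i (L t))"
  unfolding D_def by (rule lin_tsum)
lemma D_tsum: "D i (tsum t F) = tsum t (\<lambda>x. D i (F x))"
  unfolding D_def by (rule tsum_tsum)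

lemmas lins = lin_id lin_mul_left lin_mul_right lin_D lin_mapt lin_tsum

lemma dk_mult:
  assumes "p \<in> tens (H2 Q)" "q \<in> tens (H2 Q)"
  shows "dk i (tmult (H2 Q) m2 p q) (x * y) = dk i p x \<bullet> dk i q y"
proof (rule lin_ext[OF assms(1)])
  fix u
  show "dk i (tmult (H2 Q) m2 (pt (H2 Q) u) q) (x * y) = dk i (pt (H2 Q) u) x \<bullet> dk i q y"
  proof (rule lin_ext[OF assms(2)])
    fix v show "dk i (tmult (H2 Q) m2 (pt (H2 Q) u) (pt (H2 Q) v)) (x * y) = dk i (pt (H2 Q) u) x \<bullet> dk i (pt (H2 Q) v) y"
      by (simp add: dk_def tmult_pt[OF talg_H2] tsum_pt_multilin[OF multilin_spl] mul_pt comp_op_def spl_mult)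
  qed (use assms in \<open>auto simp: dk_def[abs_def] intro!: lins lin_tmult_right[OF talg_H2] tsum_in multilin_spl\<close>)
qed (use assms in \<open>auto simp: dk_def[abs_def] intro!: lins lin_tmult_left[OF talg_H2]\<close>)

lemma D_mul: assumes "t \<in> A" "u \<in> A" shows "D i (t \<bullet> u) = D i t \<bullet> D i u"
proof (rule lin_ext[OF assms(1)])
  fix x
  show "D i (pN x \<bullet> u) = D i (pN x) \<bullet> D i u"
    by (rule lin_ext[OF assms(2)]) (auto intro!: lins simp: mul_pt D_pt Delta_mult dk_mult times_fun_apply[of x _ i])
qed (use assms in \<open>auto intro!: lins\<close>)

lemma D_one: "D i (pN 1) = pN 1"
  by (simp add: D_pt Delta_one dk_def tsum_pt_multilin[OF multilin_spl] spl_one one_fun_apply)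

text \<open>The slot \<open>i\<close> of \<open>x\<close> is replaced by the three entries of \<open>z\<close>.\<close>

definition r3 :: "nat \<Rightarrow> 'h \<times> 'h \<times> 'h \<Rightarrow> (nat \<Rightarrow> 'h) \<Rightarrow> nat \<Rightarrow> 'h"
  where "r3 i z x = spl (Suc i) (fst (snd z)) (snd (snd z)) (spl i (fst z) 0 x)"

lemma r3_upd: "r3 i (a, b, c) x = (r3 i (a', b, c) x)(i := a)" "r3 i (a, b, c) x = (r3 i (a, b', c) x)(Suc i := b)"
  "r3 i (a, b, c) x = (r3 i (a, b, c') x)(Suc (Suc i) := c)"
  by (auto simp: r3_def spl_def fun_eq_iff)

lemma r3_mult: "r3 i z x * r3 i w y = r3 i (m3 z w) (x * y)"
  by (auto simp: r3_def spl_mult comp_op_def)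
lemma r3_L: "spl (Suc i) a b (spl i c d x) = r3 i (c, a, b) x"
  by (auto simp: r3_def spl_def fun_eq_iff)
lemma r3_R: "spl i a b (spl i c d x) = r3 i (a, b, d) x"
  by (auto simp: r3_def spl_def fun_eq_iff)
lemma r3_Suc: "1 ## r3 i z 1 = r3 (Suc i) z 1"
  by (auto simp: r3_def spl_def fun_eq_iff pointwise split: nat.split)
lemma r3_0: "r3 0 z 1 = fst z ## fst (snd z) ## snd (snd z) ## 1"
  by (auto simp: r3_def spl_def fun_eq_iff pointwise split: nat.split)

lemma multilin_r3: "multilin (H3 Q) (\<lambda>z. pN (r3 i z x))"
  unfolding multilin_mprod
proof (intro conjI ballI)
  fix a b c :: 'h and v :: "'h \<times> 'h"
  obtain b' c' where v: "v = (b', c')" by (cases v)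
  show "multilin (H1 Q) (\<lambda>c. pN (r3 i (a, b, c) x))"
    using multilin_pN_upd[of "r3 i (a, b, 0) x" "Suc (Suc i)"] by (simp add: r3_upd(3)[of i a b _ x 0, symmetric])
  show "multilin (H1 Q) (\<lambda>b. pN (r3 i (a, b, c) x))"
    using multilin_pN_upd[of "r3 i (a, 0, c) x" "Suc i"] by (simp add: r3_upd(2)[of i a _ c x 0, symmetric])
  show "multilin (H1 Q) (\<lambda>a. pN (r3 i (a, v) x))"
    using multilin_pN_upd[of "r3 i (0, v) x" i] by (simp add: v r3_upd(1)[of i _ b' c' x 0, symmetric])
qed

text \<open>Carries statements about \<open>phi Q\<close> into the common algebra: a threefold
  tensor replaces slot \<open>i\<close> of \<open>x\<close>.\<close>

definition k3 where "k3 i p x = tsum p (\<lambda>z. pN (r3 i z x))"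

lemma k3_pt: "k3 i (pt (H3 Q) z) x = pN (r3 i z x)"
  unfolding k3_def by (rule tsum_pt_multilin) (rule multilin_r3)

lemma k3_in [simp, intro]: "p \<in> tens (H3 Q) \<Longrightarrow> k3 i p x \<in> A"
  unfolding k3_def by (rule tsum_in) (auto intro: multilin_r3)
lemma lin_k3: "lin X L \<Longrightarrow> lin X (\<lambda>t. k3 i (L t) x)"
  unfolding k3_def by (rule lin_tsum)
lemma k3_tsum: "k3 i (tsum p F) x = tsum p (\<lambda>z. k3 i (F z) x)"
  unfolding k3_def by (rule tsum_tsum)

lemma k3_mult:
  assumes "p \<in> tens (H3 Q)" "q \<in> tens (H3 Q)"
  shows "k3 i (tmult (H3 Q) m3 p q) (x * y) = k3 i p x \<bullet> k3 i q y"
proof (rule lin_ext[OF assms(1)])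
  fix u
  show "k3 i (tmult (H3 Q) m3 (pt (H3 Q) u) q) (x * y) = k3 i (pt (H3 Q) u) x \<bullet> k3 i q y"
  proof (rule lin_ext[OF assms(2)])
    fix v show "k3 i (tmult (H3 Q) m3 (pt (H3 Q) u) (pt (H3 Q) v)) (x * y) = k3 i (pt (H3 Q) u) x \<bullet> k3 i (pt (H3 Q) v) y"
      by (simp add: k3_pt tmult_pt[OF talg_H3] mul_pt r3_mult)
  qed (auto intro!: lins lin_k3 lin_tmult_right[OF talg_H3])
qed (use assms in \<open>auto intro!: lins lin_k3 lin_tmult_left[OF talg_H3]\<close>)

section \<open>The shift and the associator in the common algebra\<close>

definition s where "s t = mapt (\<lambda>x. 1 ## x) t"

lemma slin_cons: "slin sc (\<lambda>x. c ## x)"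
  unfolding slin_def
  by (rule exI[of _ Suc]) (auto simp: linear_on_def split: nat.split)

lemma s_pt: "s (pN x) = pN (1 ## x)"
  unfolding s_def by (rule mapt_pt) (rule slin_cons)
lemma s_in [simp, intro]: "t \<in> A \<Longrightarrow> s t \<in> A"
  unfolding s_def by (intro mapt_in slin_cons)
lemma lin_s: "lin X L \<Longrightarrow> lin X (\<lambda>t. s (L t))"
  unfolding s_def by (rule lin_mapt)
lemma s_tsum: "s (tsum t F) = tsum t (\<lambda>x. s (F x))"
  unfolding s_def by (rule mapt_tsum)

lemma s_k3: "s (k3 i p 1) = k3 (Suc i) p 1"
  by (simp add: k3_def s_tsum s_pt r3_Suc)
lemma sp_k3: "(s ^^ i) (k3 0 p 1) = k3 i p 1"
  by (induction i) (auto simp: s_k3)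
lemma sp_in [simp, intro]: "t \<in> A \<Longrightarrow> (s ^^ i) t \<in> A"
  by (induction i) auto
lemma lin_sp: "lin X L \<Longrightarrow> lin X (\<lambda>t. (s ^^ i) (L t))"
  by (induction i) (auto intro: lin_s)

definition \<phi> where "\<phi> = k3 0 (phi Q) 1"
definition \<phi>' where "\<phi>' = k3 0 (phi_inv Q) 1"

lemma phi_inv: "phi_inv Q \<in> tens (H3 Q)" "tmult (H3 Q) m3 (phi Q) (phi_inv Q) = pt (H3 Q) (1, 1, 1)"
  "tmult (H3 Q) m3 (phi_inv Q) (phi Q) = pt (H3 Q) (1, 1, 1)"
  using phi_invertible tinv_is_tinv[OF talg_H3 phi_in] unfolding phi_inv_def is_tinv_def by blast+

lemma phi_A [simp, intro]: "\<phi> \<in> A" "\<phi>' \<in> A"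
  by (auto simp: \<phi>_def \<phi>'_def phi_in phi_inv)

lemma phi_phi': "\<phi> \<bullet> \<phi>' = pN 1" "\<phi>' \<bullet> \<phi> = pN 1"
  using k3_mult[OF phi_in phi_inv(1), of 0 1 1] k3_mult[OF phi_inv(1) phi_in, of 0 1 1]
  by (simp_all add: \<phi>_def \<phi>'_def phi_inv k3_pt r3_0)

definition coL where "coL h = tsum (Delta Q h) (\<lambda>z. tsum (Delta Q (snd z)) (\<lambda>w. pt (H3 Q) (fst z, w)))"
definition coR where "coR h = tsum (Delta Q h) (\<lambda>z. tsum (Delta Q (fst z)) (\<lambda>w. pt (H3 Q) (fst w, snd w, snd z)))"

lemma multilin_Delta: "multilin (H1 Q) (\<lambda>a. tsum (Delta Q a) F)"
  using linear_Delta by (auto simp: multilin_vsp[symmetric] intro: multilin_tsum1)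

lemma coR_in: "coR h \<in> tens (H3 Q)"
proof -
  have m: "multilin (H2 Q) (\<lambda>w. pt (H3 Q) (fst w, snd w, b))" "multilin (H1 Q) (\<lambda>b. pt (H3 Q) (fst w, snd w, b))" for b w
    using multilin_pt[OF good_H3] by (simp_all add: multilin_mprod)
  have "multilin (H2 Q) (\<lambda>z. tsum (Delta Q (fst z)) (\<lambda>w. pt (H3 Q) (fst w, snd w, snd z)))"
    unfolding multilin_mprod[of "H1 Q" "H1 Q"] by (auto intro!: multilin_Delta multilin_tsum2[where Y = "H2 Q"] m)
  then show ?thesis unfolding coR_def by (rule tsum_in[OF Delta_in]) (auto intro!: tsum_in[OF Delta_in] m)
qed

lemma coassoc: "coL h = tmult (H3 Q) m3 (tmult (H3 Q) m3 (phi Q) (coR h)) (phi_inv Q)"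
  using qh unfolding quasi_hopf_def coL_def coR_def split_def by simp

lemma D_Suc_D_pt: "D (Suc i) (D i (pN x)) = k3 i (coL (x i)) x"
  by (simp add: D_pt dk_def D_tsum coL_def k3_tsum k3_pt spl_at r3_L)

lemma D_D_pt: "D i (D i (pN x)) = k3 i (coR (x i)) x"
  by (simp add: D_pt dk_def D_tsum coR_def k3_tsum k3_pt spl_at r3_R)

lemma D_D: assumes "t \<in> A" "i < j" shows "D i (D j t) = D (Suc j) (D i t)"
proof (rule lin_ext[OF assms(1)])
  fix x
  have "D i (D j (pN x)) = tsum (Delta Q (x j)) (\<lambda>z. tsum (Delta Q (x i)) (\<lambda>w.
      pN (spl i (fst w) (snd w) (spl j (fst z) (snd z) x))))"
    using assms(2) by (simp add: D_pt dk_def D_tsum spl_same)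
  also have "\<dots> = tsum (Delta Q (x i)) (\<lambda>w. tsum (Delta Q (x j)) (\<lambda>z.
      pN (spl i (fst w) (snd w) (spl j (fst z) (snd z) x))))"
    by (rule tsum_swap[where X = "H2 Q" and Y = "H2 Q"])
      (simp_all add: multilin_spl, simp add: multilin_spl spl_spl[OF assms(2)])
  also have "\<dots> = D (Suc j) (D i (pN x))"
    using assms(2) by (simp add: D_pt dk_def D_tsum spl_same spl_spl)
  finally show "D i (D j (pN x)) = D (Suc j) (D i (pN x))" .
qed (auto intro!: lins)

text \<open>The copy of the \<open>n\<close>-fold tensor power in the common algebra. It is a span
  of pure tensors, so that \<open>lin_ext_W\<close> may assume all later entries to be 1; many
  identities below are checked under this assumption.\<close>

definition W :: "nat \<Rightarrow> ('k, nat \<Rightarrow> 'h) tensor set"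
  where "W n = module.span tscale (pN ` {x. \<forall>j\<ge>n. x j = 1})"

lemma W_A: "t \<in> W n \<Longrightarrow> t \<in> A"
  unfolding W_def tens_def by (rule subsetD[OF tensor.span_mono]) auto

lemma W_mono: "t \<in> W m \<Longrightarrow> m \<le> n \<Longrightarrow> t \<in> W n"
  unfolding W_def by (erule subsetD[OF tensor.span_mono, rotated]) auto

lemma pN_W: "(\<And>j. n \<le> j \<Longrightarrow> x j = 1) \<Longrightarrow> pN x \<in> W n"
  unfolding W_def by (rule tensor.span_base) auto

lemma tsum_W: "t \<in> W n \<Longrightarrow> multilin \<H> F \<Longrightarrow> (\<And>x. (\<And>j. n \<le> j \<Longrightarrow> x j = 1) \<Longrightarrow> F x \<in> W m) \<Longrightarrow> tsum t F \<in> W m"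
  unfolding W_def by (rule tsum_in_span) auto

lemma tsum_W': "t \<in> tens X \<Longrightarrow> multilin X F \<Longrightarrow> (\<And>x. F x \<in> W m) \<Longrightarrow> tsum t F \<in> W m"
  unfolding W_def tens_def by (rule tsum_in_span) auto

lemma lin_ext_W:
  assumes "t \<in> W n" "lin \<H> L" "lin \<H> R" "\<And>x. (\<And>j. n \<le> j \<Longrightarrow> x j = 1) \<Longrightarrow> L (pN x) = R (pN x)"
  shows "L t = R t"
  using assms(1) unfolding W_def by (rule lin_ext_span) (use assms(2-4) in \<open>simp_all\<close>)

lemma mul_W: assumes "t \<in> W n" "u \<in> W n" shows "t \<bullet> u \<in> W n"
proof -
  have *: "multilin \<H> (\<lambda>x. tsum u (\<lambda>y. pN (x * y)))"
    using assms by (intro multilin_tsum2[where Y = \<H>] good_HN talg_multilin[OF talg_HN]) (auto intro: W_A)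
  show ?thesis unfolding tmult_def
    by (rule tsum_W[OF assms(1) *], rule tsum_W[OF assms(2)])
      (auto intro!: talg_multilin[OF talg_HN] pN_W simp: pointwise)
qed

lemma mapt_W: "t \<in> W n \<Longrightarrow> slin sc T \<Longrightarrow> (\<And>x j. (\<And>j. n \<le> j \<Longrightarrow> x j = 1) \<Longrightarrow> m \<le> j \<Longrightarrow> T x j = 1) \<Longrightarrow> mapt T t \<in> W m"
  unfolding mapt_def by (erule tsum_W) (auto intro!: multilin_slin pN_W)

lemma s_W: "t \<in> W n \<Longrightarrow> s t \<in> W (Suc n)"
  unfolding s_def by (erule mapt_W) (auto intro: slin_cons split: nat.split)

lemma D_triv: "t \<in> W n \<Longrightarrow> n \<le> i \<Longrightarrow> D i t = t"
  by (erule lin_ext_W) (auto intro!: lins simp: D_pt Delta_one dk_def tsum_pt_multilin[OF multilin_spl] spl_one)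

lemma D_W: assumes "t \<in> W n" shows "D i t \<in> W (Suc n)"
proof (cases "i < n")
  case True
  show ?thesis unfolding D_def dk_def
    by (rule tsum_W[OF assms multilin_dk[unfolded dk_def]], rule tsum_W'[OF Delta_in multilin_spl])
      (use True in \<open>auto intro!: pN_W simp: spl_def\<close>)
next
  case False
  then show ?thesis using D_triv[OF assms] W_mono[OF assms] by simp
qed

lemma s_mul: assumes "t \<in> A" "u \<in> A" shows "s (t \<bullet> u) = s t \<bullet> s u"
proof (rule lin_ext[OF assms(1)])
  fix x
  show "s (pN x \<bullet> u) = s (pN x) \<bullet> s u"
    by (rule lin_ext[OF assms(2)]) (auto intro!: lins lin_s simp: mul_pt s_pt)
qed (use assms in \<open>auto intro!: lins lin_s\<close>)

lemma sp_pt: "(s ^^ n) (pN x) = pN (\<lambda>j. if j < n then 1 else x (j - n))"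
proof (induction n)
  case (Suc n)
  have "1 ## (\<lambda>j. if j < n then 1 else x (j - n)) = (\<lambda>j. if j < Suc n then 1 else x (j - Suc n))"
    by (auto simp: fun_eq_iff split: nat.split)
  then show ?case by (simp add: Suc s_pt)
qed simp

text \<open>\<open>t\<close> has entries 1 from slot \<open>n\<close> on and the shifted
  \<open>u\<close> has entries 1 before it, so in each slot one of the two factors is 1.\<close>

lemma comm: assumes "t \<in> W n" "u \<in> A" shows "t \<bullet> (s ^^ n) u = (s ^^ n) u \<bullet> t"
proof (rule lin_ext_W[OF assms(1)])
  fix x :: "nat \<Rightarrow> 'h" assume x: "\<And>j. n \<le> j \<Longrightarrow> x j = 1"
  show "pN x \<bullet> (s ^^ n) u = (s ^^ n) u \<bullet> pN x"
  proof (rule lin_ext[OF assms(2)])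
    fix y :: "nat \<Rightarrow> 'h"
    have "x * (\<lambda>j. if j < n then 1 else y (j - n)) = (\<lambda>j. if j < n then 1 else y (j - n)) * x"
      using x by (auto simp: fun_eq_iff pointwise)
    then show "pN x \<bullet> (s ^^ n) (pN y) = (s ^^ n) (pN y) \<bullet> pN x"
      by (simp add: sp_pt mul_pt)
  qed (auto intro!: lins lin_sp)
qed (use assms in \<open>auto intro!: lins\<close>)

lemma D_s: assumes "t \<in> A" shows "D (Suc i) (s t) = s (D i t)"
  by (rule lin_ext[OF assms]) (auto intro!: lins lin_s simp: s_pt D_pt dk_def s_tsum spl_Suc_cons)

lemma D_0_s: assumes "t \<in> A" shows "D 0 (s t) = s (s t)"
  by (rule lin_ext[OF assms])
    (auto intro!: lins lin_s simp: s_pt D_pt Delta_one dk_pt spl_0_cons)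

lemma k3_W: "p \<in> tens (H3 Q) \<Longrightarrow> k3 0 p 1 \<in> W 3"
  unfolding k3_def by (erule tsum_W', rule multilin_r3, rule pN_W) (simp add: r3_def spl_def pointwise)

text \<open>Multiplying the axiom by \<open>phi Q\<close> on the right removes the inverse
  associator; \<open>k3\<close> then places the equation in slot \<open>i\<close> of an arbitrary
  pure tensor.\<close>

lemma inter: assumes "t \<in> A" shows "(s ^^ i) \<phi> \<bullet> D i (D i t) = D (Suc i) (D i t) \<bullet> (s ^^ i) \<phi>"
proof (rule lin_ext[OF assms])
  fix x
  note R = coR_in
  have "tmult (H3 Q) m3 (coL (x i)) (phi Q) = tmult (H3 Q) m3 (phi Q) (coR (x i))"
    unfolding coassoc using R
    by (simp add: tmult_assoc[OF talg_H3] tmult_in[OF talg_H3] phi_in phi_inv tmult_one_right[OF talg_H3])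
  moreover have "coL (x i) \<in> tens (H3 Q)" unfolding coassoc using R
    by (simp add: tmult_in[OF talg_H3] phi_in phi_inv)
  ultimately show "(s ^^ i) \<phi> \<bullet> D i (D i (pN x)) = D (Suc i) (D i (pN x)) \<bullet> (s ^^ i) \<phi>"
    using k3_mult[OF phi_in R[of "x i"], of i 1 x] k3_mult[OF _ phi_in, of "coL (x i)" i x 1]
    by (simp add: \<phi>_def sp_k3 D_Suc_D_pt D_D_pt)
qed (auto intro!: lins)

definition e4 where "e4 p = tsum p (\<lambda>(a, b, c, d). pN (a ## b ## c ## d ## 1))"

lemma multilin_e4: "multilin (H4 Q) (\<lambda>(a, b, c, d). pN (a ## b ## c ## d ## 1))"
  unfolding multilin_mprod
proof (intro conjI ballI)
  fix a b c :: 'h and u :: "'h \<times> 'h \<times> 'h" and v :: "'h \<times> 'h"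
  show "multilin (H1 Q) (\<lambda>d. case (a, b, c, d) of (a, b, c, d) \<Rightarrow> pN (a ## b ## c ## d ## 1))" for d :: 'h
    using multilin_pN_upd[of "a ## b ## c ## d ## 1" 3] by (simp add: cons_upd numeral_3_eq_3)
  show "multilin (H1 Q) (\<lambda>c. case (a, b, c, d) of (a, b, c, d) \<Rightarrow> pN (a ## b ## c ## d ## 1))" for d :: 'h
    using multilin_pN_upd[of "a ## b ## c ## d ## 1" 2] by (simp add: cons_upd numeral_2_eq_2)
  show "multilin (H1 Q) (\<lambda>b. case (a, b, v) of (a, b, c, d) \<Rightarrow> pN (a ## b ## c ## d ## 1))"
    using multilin_pN_upd[of "a ## b ## fst v ## snd v ## 1" 1] by (simp add: cons_upd split_def)
  show "multilin (H1 Q) (\<lambda>a. case (a, u) of (a, b, c, d) \<Rightarrow> pN (a ## b ## c ## d ## 1))"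
    using multilin_pN_upd[of "a ## fst u ## fst (snd u) ## snd (snd u) ## 1" 0] by (simp add: cons_upd split_def)
qed

lemma e4_pt: "e4 (pt (H4 Q) (a, b, c, d)) = pN (a ## b ## c ## d ## 1)"
  unfolding e4_def by (subst tsum_pt_multilin[OF multilin_e4]) simp
lemma e4_pt': "e4 (pt (H4 Q) u) = pN (fst u ## fst (snd u) ## fst (snd (snd u)) ## snd (snd (snd u)) ## 1)"
  by (cases u) (simp add: e4_pt)
lemma e4_tsum: "e4 (tsum p F) = tsum p (\<lambda>z. e4 (F z))"
  unfolding e4_def by (rule tsum_tsum)
lemma lin_e4: "lin X L \<Longrightarrow> lin X (\<lambda>t. e4 (L t))"
  unfolding e4_def by (rule lin_tsum)
lemma e4_in: "p \<in> tens (H4 Q) \<Longrightarrow> e4 p \<in> A"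
  unfolding e4_def by (erule tsum_in) (auto intro: multilin_e4)

lemma e4_mult:
  assumes "p \<in> tens (H4 Q)" "q \<in> tens (H4 Q)"
  shows "e4 (tmult (H4 Q) m4 p q) = e4 p \<bullet> e4 q"
proof (rule lin_ext[OF assms(1)])
  fix u
  show "e4 (tmult (H4 Q) m4 (pt (H4 Q) u) q) = e4 (pt (H4 Q) u) \<bullet> e4 q"
  proof (rule lin_ext[OF assms(2)])
    fix v show "e4 (tmult (H4 Q) m4 (pt (H4 Q) u) (pt (H4 Q) v)) = e4 (pt (H4 Q) u) \<bullet> e4 (pt (H4 Q) v)"
      by (cases u; cases v) (simp add: e4_pt tmult_pt[OF talg_H4] mul_pt comp_op_def)
  qed (auto intro!: lins lin_e4 lin_tmult_right[OF talg_H4] e4_in)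
qed (use assms in \<open>auto intro!: lins lin_e4 lin_tmult_left[OF talg_H4]\<close>)

lemma phi_tsum: "\<phi> = tsum (phi Q) (\<lambda>z. pN (fst z ## fst (snd z) ## snd (snd z) ## 1))"
  by (simp add: \<phi>_def k3_def r3_0)

text \<open>Each of the five factors is the image under \<open>e4\<close> of the corresponding
  factor of the axiom, and \<open>e4\<close> is multiplicative.\<close>

lemma pentagon: "D 2 \<phi> \<bullet> D 0 \<phi> = s \<phi> \<bullet> D 1 \<phi> \<bullet> \<phi>"
proof -
  let ?a = "tsum (phi Q) (\<lambda>z. tsum (Delta Q (snd (snd z))) (\<lambda>w. pt (H4 Q) (fst z, fst (snd z), fst w, snd w)))"
  let ?b = "tsum (phi Q) (\<lambda>z. tsum (Delta Q (fst z)) (\<lambda>w. pt (H4 Q) (fst w, snd w, fst (snd z), snd (snd z))))"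
  let ?c = "tsum (phi Q) (\<lambda>z. pt (H4 Q) (1, fst z, fst (snd z), snd (snd z)))"
  let ?d = "tsum (phi Q) (\<lambda>z. tsum (Delta Q (fst (snd z))) (\<lambda>w. pt (H4 Q) (fst z, fst w, snd w, snd (snd z))))"
  let ?e = "tsum (phi Q) (\<lambda>z. pt (H4 Q) (fst z, fst (snd z), snd (snd z), 1))"
  note m = multilin_pt[OF good_H4, unfolded multilin_mprod]
  have in4: "?a \<in> tens (H4 Q)" "?b \<in> tens (H4 Q)" "?c \<in> tens (H4 Q)" "?d \<in> tens (H4 Q)" "?e \<in> tens (H4 Q)"
    using m by (auto intro!: tsum_in[OF phi_in] tsum_in[OF Delta_in] multilin_Delta multilin_tsum2[where Y = "H2 Q"] simp: multilin_mprod)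
  have e: "e4 ?a = D 2 \<phi>" "e4 ?b = D 0 \<phi>" "e4 ?c = s \<phi>" "e4 ?d = D 1 \<phi>" "e4 ?e = \<phi>"
    by (simp_all add: phi_tsum D_tsum s_tsum s_pt D_pt dk_def e4_tsum e4_pt' numeral_2_eq_2 spl_Suc_cons spl_0_cons)
  have "tmult (H4 Q) m4 ?a ?b = tmult (H4 Q) m4 (tmult (H4 Q) m4 ?c ?d) ?e"
    using qh unfolding quasi_hopf_def split_def by blast
  then have "e4 (tmult (H4 Q) m4 ?a ?b) = e4 (tmult (H4 Q) m4 (tmult (H4 Q) m4 ?c ?d) ?e)" by (rule arg_cong)
  then show ?thesis
    by (simp only: e4_mult in4 e tmult_in[OF talg_H4])
qed

lemma phi_W: "\<phi> \<in> W 3" "\<phi>' \<in> W 3"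
  by (simp_all add: \<phi>_def \<phi>'_def k3_W phi_in phi_inv)

sublocale coherence A "tmult (HN (scal Q)) (*)" "pN 1" W D s \<phi> \<phi>'
proof unfold_locales
  show "s (pN 1) = pN 1" by (simp add: s_pt)
  show "pN 1 \<in> W n" for n by (rule pN_W) (simp add: one_fun_apply)
  show "\<phi> \<bullet> \<phi>' = pN 1" "\<phi>' \<bullet> \<phi> = pN 1" by (fact phi_phi')+
qed (auto simp: mul_assoc D_mul s_mul D_one D_D D_s D_0_s D_triv inter pentagon phi_W
      intro: W_A W_mono mul_W D_W s_W comm)

end

section \<open>Uniqueness of antipodes\<close>

context quasi_hopf_algebra begin

lemma good_\<H> [simp]: "good \<H>"
  by (rule good_HN)

lemma tscale_pN: "tscale c (pN (x(i := a))) = pN (x(i := sc c a))"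
  using multilin_pN_upd[of x i] by (simp add: multilin_vsp linear_on_def)

lemma multilin_tscale: "good X \<Longrightarrow> multilin X F \<Longrightarrow> multilin X (\<lambda>x. tscale c (F x))"
  by (simp add: multilin_def tscale_def good_scale)

lemma lin_tscale: "lin X L \<Longrightarrow> lin X (\<lambda>t. tscale c (L t))"
  by (simp add: lin_def linear_on_def tensor.scale_right_distrib mult.commute)

lemma tsum_tscale: "tsum (tscale c t) F = tscale c (tsum t F)"
  by (simp add: tsum_linear)

lemma mul_tscale: "tscale c t \<bullet> u = tscale c (t \<bullet> u)"
  by (simp add: tmult_def tsum_linear)

section \<open>Counits in a slot\<close>

definition del :: "nat \<Rightarrow> (nat \<Rightarrow> 'a) \<Rightarrow> nat \<Rightarrow> 'a" where "del i x = (\<lambda>j. if j < i then x j else x (Suc j))"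
definition ins :: "nat \<Rightarrow> (nat \<Rightarrow> 'h) \<Rightarrow> nat \<Rightarrow> 'h"
  where "ins i x = (\<lambda>j. if j < i then x j else if j = i then 1 else x (j - 1))"

definition ck where "ck i x = tscale (eps Q (x i)) (pN (del i x))"
definition Ce where "Ce i t = tsum t (ck i)"

lemma del_upd: "del i (x(j := a)) = (if j = i then del i x else (del i x)((if j < i then j else j - 1) := a))"
  by (auto simp: del_def fun_eq_iff)

lemma multilin_ck: "multilin \<H> (ck i)"
  unfolding multilin_HN
proof (intro allI)
  fix x :: "nat \<Rightarrow> 'h" and j
  show "multilin (H1 Q) (\<lambda>a. ck i (x(j := a)))"
  proof (cases "j = i")
    case True
    then show ?thesis using linear_eps
      by (simp add: ck_def del_upd multilin_vsp linear_on_def) (simp add: fun_eq_iff tscale_def plus_fun_apply distrib_right)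
  next
    case False
    then show ?thesis by (auto simp: ck_def del_upd intro!: multilin_tscale multilin_pN_upd good_H1)
  qed
qed

lemma Ce_pt: "Ce i (pN x) = ck i x"
  unfolding Ce_def by (rule tsum_pt_multilin) (rule multilin_ck)
lemma lin_Ce: "lin X L \<Longrightarrow> lin X (\<lambda>t. Ce i (L t))"
  unfolding Ce_def by (rule lin_tsum)
lemma Ce_tsum: "Ce i (tsum t F) = tsum t (\<lambda>x. Ce i (F x))"
  unfolding Ce_def by (rule tsum_tsum)
lemma Ce_tscale: "Ce i (tscale c t) = tscale c (Ce i t)"
  unfolding Ce_def by (rule tsum_tscale)
lemma Ce_in [simp, intro]: "t \<in> A \<Longrightarrow> Ce i t \<in> A"
  unfolding Ce_def by (erule tsum_in) (auto intro!: multilin_ck simp: ck_def)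

lemma mul_tscale_right: "u \<in> A \<Longrightarrow> t \<in> A \<Longrightarrow> u \<bullet> tscale c t = tscale c (u \<bullet> t)"
  using lin_mul_right[OF _ lin_id] by (simp add: lin_def linear_on_def)

lemma Ce_mul: assumes "t \<in> A" "u \<in> A" shows "Ce i (t \<bullet> u) = Ce i t \<bullet> Ce i u"
proof (rule lin_ext[OF assms(1)])
  fix x
  show "Ce i (pN x \<bullet> u) = Ce i (pN x) \<bullet> Ce i u"
  proof (rule lin_ext[OF assms(2)])
    fix y :: "nat \<Rightarrow> 'h"
    have "del i (x * y) = del i x * del i y" by (auto simp: del_def pointwise fun_eq_iff)
    then show "Ce i (pN x \<bullet> pN y) = Ce i (pN x) \<bullet> Ce i (pN y)"
      by (simp add: mul_pt Ce_pt ck_def times_fun_apply[of x y] eps_mult mul_tscale mul_tscale_right)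
  qed (auto intro!: lins lin_Ce)
qed (use assms in \<open>auto intro!: lins lin_Ce\<close>)

lemma Ce_one [simp]: "Ce i (pN 1) = pN 1"
proof -
  have "del i 1 = (1 :: nat \<Rightarrow> 'h)" by (auto simp: del_def pointwise fun_eq_iff)
  then show ?thesis by (simp add: Ce_pt ck_def one_fun_apply)
qed

lemma counit: "tsum (Delta Q h) (\<lambda>z. tscale (eps Q (fst z)) (pN (x(i := snd z)))) = pN (x(i := h))"
    "tsum (Delta Q h) (\<lambda>z. tscale (eps Q (snd z)) (pN (x(i := fst z)))) = pN (x(i := h))"
proof -
  have 1: "tsum (Delta Q h) (\<lambda>z. pt (H1 Q) (sc (eps Q (fst z)) (snd z))) = pt (H1 Q) h"
    "tsum (Delta Q h) (\<lambda>z. pt (H1 Q) (sc (eps Q (snd z)) (fst z))) = pt (H1 Q) h"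
    using qh unfolding quasi_hopf_def split_def by simp_all
  show "tsum (Delta Q h) (\<lambda>z. tscale (eps Q (fst z)) (pN (x(i := snd z)))) = pN (x(i := h))"
    "tsum (Delta Q h) (\<lambda>z. tscale (eps Q (snd z)) (pN (x(i := fst z)))) = pN (x(i := h))"
    using arg_cong[OF 1(1), of "\<lambda>t. tsum t (\<lambda>a. pN (x(i := a)))"]
      arg_cong[OF 1(2), of "\<lambda>t. tsum t (\<lambda>a. pN (x(i := a)))"]
    by (simp_all add: tsum_tsum tsum_pt_multilin[OF multilin_pN_upd] tscale_pN)
qed

lemma del_spl: "del i (spl i a b x) = x(i := b)" "del (Suc i) (spl i a b x) = x(i := a)"
  by (auto simp: del_def spl_def fun_eq_iff)

lemma Ce_D_same: assumes "t \<in> A" shows "Ce i (D i t) = t" "Ce (Suc i) (D i t) = t"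
proof -
  show "Ce i (D i t) = t"
    by (rule lin_ext[OF assms])
      (auto intro!: lins lin_Ce simp: D_pt dk_def Ce_tsum Ce_pt ck_def spl_at del_spl counit)
  show "Ce (Suc i) (D i t) = t"
    by (rule lin_ext[OF assms])
      (auto intro!: lins lin_Ce simp: D_pt dk_def Ce_tsum Ce_pt ck_def spl_at del_spl counit)
qed

lemma D_tscale: "D i (tscale c t) = tscale c (D i t)"
  unfolding D_def by (rule tsum_tscale)

lemma tsum_tscale_right:
  "good X \<Longrightarrow> t \<in> tens X \<Longrightarrow> multilin X F \<Longrightarrow> tsum t (\<lambda>x. tscale c (F x)) = tscale c (tsum t F)"
  by (rule ext) (simp add: tsum_def tscale_def tens_form_scale[of X t] multilin_def)

text \<open>Together with \<open>Ce_D_same\<close>, \<open>Ce_D_gt\<close> and \<open>D_D\<close>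
  these are the cosimplicial identities, except that for two equal slots \<open>D_D\<close> is
  replaced by \<open>inter\<close>.\<close>

lemma Ce_D_lt: assumes "t \<in> A" "i \<le> j" shows "Ce i (D (Suc j) t) = D j (Ce i t)"
proof (rule lin_ext[OF assms(1)])
  fix x :: "nat \<Rightarrow> 'h"
  have *: "del i (spl (Suc j) a b x) = spl j a b (del i x)" for a b :: 'h
    using assms(2) by (auto simp: del_def spl_def fun_eq_iff)
  have **: "del i x j = x (Suc j)" using assms(2) by (simp add: del_def)
  show "Ce i (D (Suc j) (pN x)) = D j (Ce i (pN x))"
    using assms(2) by (simp add: D_pt dk_def Ce_tsum Ce_pt ck_def spl_same * ** D_tscale tsum_tscale_right[OF good_H2] multilin_spl)
qed (auto intro!: lins lin_Ce)

lemma Ce_D_gt: assumes "t \<in> A" "j < i" shows "Ce (Suc i) (D j t) = D j (Ce i t)"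
proof (rule lin_ext[OF assms(1)])
  fix x :: "nat \<Rightarrow> 'h"
  have *: "del (Suc i) (spl j a b x) = spl j a b (del i x)" for a b :: 'h
    using assms(2) by (auto simp: del_def spl_def fun_eq_iff)
  have **: "del i x j = x j" using assms(2) by (simp add: del_def)
  show "Ce (Suc i) (D j (pN x)) = D j (Ce i (pN x))"
    using assms(2) by (simp add: D_pt dk_def Ce_tsum Ce_pt ck_def spl_same * ** D_tscale tsum_tscale_right[OF good_H2] multilin_spl)
qed (auto intro!: lins lin_Ce)

lemma del_cons: "del 0 (a ## x) = x" "del (Suc i) (a ## x) = a ## del i x"
  by (auto simp: del_def fun_eq_iff split: nat.split)

lemma s_tscale: "s (tscale c t) = tscale c (s t)"
  unfolding s_def mapt_def by (rule tsum_tscale)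

lemma Ce_0_s: assumes "t \<in> A" shows "Ce 0 (s t) = t"
  by (rule lin_ext[OF assms]) (auto intro!: lins lin_Ce lin_s simp: s_pt Ce_pt ck_def del_cons)
lemma Ce_Suc_s: assumes "t \<in> A" shows "Ce (Suc i) (s t) = s (Ce i t)"
  by (rule lin_ext[OF assms]) (auto intro!: lins lin_Ce lin_s simp: s_pt Ce_pt ck_def del_cons s_tscale)

lemma dk_tsum: "dk i (tsum p F) x = tsum p (\<lambda>z. dk i (F z) x)"
  unfolding dk_def by (rule tsum_tsum)

lemma Ce_phi1: "Ce 1 \<phi> = pN 1"
proof -
  have 1: "tsum (phi Q) (\<lambda>z. pt (H2 Q) (fst z, sc (eps Q (fst (snd z))) (snd (snd z)))) = pt (H2 Q) (1, 1)"
    using qh unfolding quasi_hopf_def split_def by blast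
  have 2: "spl 0 a b 1 = a ## b ## 1" for a b :: 'h by (simp add: spl_0 one_fun_def)
  have 3: "tscale c (pN (a ## b ## 1)) = pN (a ## sc c b ## 1)" for a b c
    using tscale_pN[of c "a ## b ## 1" 1 b] by (simp add: cons_upd)
  have "dk 0 (pt (H2 Q) (1, 1)) 1 = pN 1" by (simp add: dk_pt 2)
  then show ?thesis
    unfolding 1[symmetric] by (simp add: dk_tsum dk_pt 2 phi_tsum Ce_tsum Ce_pt ck_def del_cons 3)
qed

lemmas Ce_words = Ce_mul Ce_D_same Ce_D_lt Ce_D_gt Ce_0_s Ce_Suc_s

text \<open>A counit in slot 1 turns the pentagon into
  \<open>\<phi> = s (Ce 0 \<phi>) \<bullet> \<phi>\<close>, since the axiom \<open>Ce_phi1\<close>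
  removes \<open>D 2 \<phi>\<close> and the last factor \<open>\<phi>\<close>; then
  \<open>\<phi>\<close> cancels.\<close>

lemma Ce_phi0: "Ce 0 \<phi> = pN 1"
proof -
  have "Ce 1 (D 2 \<phi> \<bullet> D 0 \<phi>) = Ce 1 (s \<phi> \<bullet> D 1 \<phi> \<bullet> \<phi>)" by (simp only: pentagon)
  then have "\<phi> = s (Ce 0 \<phi>) \<bullet> \<phi>"
    using Ce_D_lt[of \<phi> 1 1] Ce_phi1 by (simp add: Ce_words numeral_2_eq_2 D_one)
  then have "\<phi> \<bullet> \<phi>' = s (Ce 0 \<phi>) \<bullet> (\<phi> \<bullet> \<phi>')" by (simp flip: mul_assoc)
  then have "s (Ce 0 \<phi>) = pN 1" by (simp add: phi_phi')
  \<comment> \<open>The shift has the left inverse \<open>Ce 0\<close>.\<close>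
  then have "Ce 0 (s (Ce 0 \<phi>)) = Ce 0 (pN 1)" by simp
  then show ?thesis by (simp add: Ce_0_s)
qed

text \<open>The same argument with a counit in slot 2, which leaves
  \<open>\<phi> = \<phi> \<bullet> Ce 2 \<phi>\<close>.\<close>

lemma Ce_phi2: "Ce 2 \<phi> = pN 1"
proof -
  have "Ce 2 (D 2 \<phi> \<bullet> D 0 \<phi>) = Ce 2 (s \<phi> \<bullet> D 1 \<phi> \<bullet> \<phi>)" by (simp only: pentagon)
  then have "\<phi> = \<phi> \<bullet> Ce 2 \<phi>"
    using Ce_phi1 by (simp add: Ce_words numeral_2_eq_2 D_one)
  then have "\<phi>' \<bullet> \<phi> = \<phi>' \<bullet> \<phi> \<bullet> Ce 2 \<phi>" by (metis mul_assoc phi_A Ce_in)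
  then show ?thesis by (simp add: phi_phi')
qed

lemma Ce_inv: "t \<in> A \<Longrightarrow> u \<in> A \<Longrightarrow> t \<bullet> u = pN 1 \<Longrightarrow> Ce i t = pN 1 \<Longrightarrow> Ce i u = pN 1"
  by (metis Ce_mul Ce_one Ce_in mul_one_left)

lemma Ce_phi: "Ce 0 \<phi> = pN 1" "Ce (Suc 0) \<phi> = pN 1" "Ce (Suc (Suc 0)) \<phi> = pN 1"
  "Ce 0 \<phi>' = pN 1" "Ce (Suc 0) \<phi>' = pN 1" "Ce (Suc (Suc 0)) \<phi>' = pN 1"
  using Ce_phi0 Ce_phi1 Ce_phi2 Ce_inv[OF phi_A(1) phi_A(2) phi_phi'(1)] by (simp_all add: numeral_2_eq_2)

text \<open>When an antipode axiom absorbs the coproduct in \<open>D i y\<close>, what remains is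
  the counit \<open>Ce i y\<close>. Two entries 1 are put back in its place, so that the slot
  numbers of the surrounding word do not change.\<close>

definition I2 where "I2 i t = mapt (\<lambda>x. ins i (ins i x)) t"

lemma slin_ins: "slin sc (ins i)"
  unfolding slin_def
  by (rule exI[of _ "\<lambda>j. if j < i then j else Suc j"]) (auto simp: ins_def linear_on_def)

lemma slin_ins2: "slin sc (\<lambda>x. ins i (ins i x))"
  by (rule slin_comp[OF slin_ins slin_ins])

lemma I2_in [simp, intro]: "t \<in> A \<Longrightarrow> I2 i t \<in> A"
  unfolding I2_def by (intro mapt_in slin_ins2)

lemma lin_I2: "lin X L \<Longrightarrow> lin X (\<lambda>t. I2 i (L t))"
  unfolding I2_def by (rule lin_mapt)

lemma I2_pt: "I2 i (pN x) = pN (ins i (ins i x))"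
  unfolding I2_def by (rule mapt_pt) (rule slin_ins2)

lemma I2_one [simp]: "I2 i (pN 1) = pN 1"
proof -
  have "ins i 1 = 1" by (auto simp: ins_def fun_eq_iff one_fun_def)
  then show ?thesis by (simp add: I2_pt)
qed

lemma I2_0: assumes "t \<in> A" shows "I2 0 t = s (s t)"
proof -
  have "ins 0 (ins 0 x) = 1 ## 1 ## x" for x
    by (auto simp: ins_def fun_eq_iff split: nat.split)
  then show ?thesis using lin_ext[OF assms, of "I2 0" "\<lambda>t. s (s t)"]
    by (simp add: lins lin_I2 lin_s I2_pt s_pt)
qed

lemma I2_tscale: "I2 i (tscale c t) = tscale c (I2 i t)"
  unfolding I2_def mapt_def by (rule tsum_tscale)

lemma ins_del: "ins i (ins i (del i x)) = spl i 1 1 x"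
  by (auto simp: ins_def del_def spl_def fun_eq_iff intro!: arg_cong[of _ _ x])

section \<open>Absorption of a coproduct by an antipode axiom\<close>

lemma mul_tsum_left: "tsum t F \<bullet> u = tsum t (\<lambda>x. F x \<bullet> u)"
  by (simp add: tmult_def tsum_tsum)

lemma multilin_mul_left: "multilin X F \<Longrightarrow> multilin X (\<lambda>a. F a \<bullet> u)"
  unfolding tmult_def by (rule multilin_tsum1)

lemma multilin_mul_pN: "u \<in> A \<Longrightarrow> multilin \<H> (\<lambda>x. tsum u (\<lambda>y. pN (x * y)))"
  by (intro multilin_tsum2[where Y = \<H>] talg_multilin[OF talg_HN] good_HN)

lemma multilin_mul_right:
  "good X \<Longrightarrow> u \<in> A \<Longrightarrow> multilin X F \<Longrightarrow> (\<And>x. x \<in> points X \<Longrightarrow> F x \<in> A) \<Longrightarrow> multilin X (\<lambda>a. u \<bullet> F a)"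
  unfolding tmult_def
  by (rule multilin_tsum2[where Y = \<H>]) (auto intro: multilin_tsum1 multilin_mul_pN)

lemma mul_tsum_right:
  assumes "good X" "t \<in> tens X" "u \<in> A" "multilin X F" "\<And>x. x \<in> points X \<Longrightarrow> F x \<in> A"
  shows "u \<bullet> tsum t F = tsum t (\<lambda>x. u \<bullet> F x)"
  unfolding tmult_def tsum_tsum using assms
  by (intro tsum_swap[where Y = X and X = \<H>]) (auto intro: multilin_tsum1 multilin_mul_pN)

text \<open>The engine of all cancellations: if \<open>G\<close> absorbs the coproduct of any
  \<open>h\<close> multiplied from the left into slots \<open>i\<close> and \<open>Suc i\<close>, it
  absorbs the one in \<open>D i y\<close>, because slot \<open>i\<close> of \<open>y\<close> enters
  only through its coproduct.\<close>

lemma collapse_left: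
  assumes G: "multilin \<H> G"
    and inv: "\<And>w h. tsum (Delta Q h) (\<lambda>z. G (spl i (fst z) (snd z) 1 * w)) = tscale (eps Q h) (G w)"
    and y: "y \<in> A" and u: "u \<in> A"
  shows "tsum (D i y \<bullet> u) G = tsum (I2 i (Ce i y) \<bullet> u) G"
proof (rule lin_ext[OF y])
  fix x
  show "tsum (D i (pN x) \<bullet> u) G = tsum (I2 i (Ce i (pN x)) \<bullet> u) G"
  proof (rule lin_ext[OF u])
    fix w
    \<comment> \<open>The split slot is separated from the other entries of \<open>x\<close>, which
      join \<open>w\<close>.\<close>
    have eq: "spl i a b x * w = spl i a b 1 * (spl i 1 1 x * w)" for a b
      unfolding mult.assoc[of "spl i a b 1" "spl i 1 1 x" w, symmetric] by (simp add: spl_mult)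
    have "tsum (D i (pN x) \<bullet> pN w) G =
        tsum (Delta Q (x i)) (\<lambda>z. G (spl i (fst z) (snd z) 1 * (spl i 1 1 x * w)))"
      by (simp only: D_pt dk_def mul_tsum_left mul_pt tsum_tsum tsum_pt_multilin[OF G] eq[symmetric])
    also have "\<dots> = tsum (I2 i (Ce i (pN x)) \<bullet> pN w) G"
      unfolding inv by (simp only: Ce_pt ck_def I2_tscale I2_pt ins_del mul_tscale tsum_tscale mul_pt tsum_pt_multilin[OF G])
    finally show "tsum (D i (pN x) \<bullet> pN w) G = tsum (I2 i (Ce i (pN x)) \<bullet> pN w) G" .
  qed (auto intro!: lins lin_I2 lin_Ce)
qed (use u in \<open>auto intro!: lins lin_I2 lin_Ce\<close>)

lemma collapse_right:
  assumes G: "multilin \<H> G"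
    and inv: "\<And>w h. tsum (Delta Q h) (\<lambda>z. G (w * spl i (fst z) (snd z) 1)) = tscale (eps Q h) (G w)"
    and y: "y \<in> A" and u: "u \<in> A"
  shows "tsum (u \<bullet> D i y) G = tsum (u \<bullet> I2 i (Ce i y)) G"
proof (rule lin_ext[OF u])
  fix w
  show "tsum (pN w \<bullet> D i y) G = tsum (pN w \<bullet> I2 i (Ce i y)) G"
  proof (rule lin_ext[OF y])
    fix x
    have eq: "w * spl i a b x = (w * spl i 1 1 x) * spl i a b 1" for a b
      unfolding mult.assoc[of w "spl i 1 1 x" "spl i a b 1"] by (simp add: spl_mult)
    have eq2: "pN w \<bullet> tsum (Delta Q (x i)) (\<lambda>z. pN (spl i (fst z) (snd z) x)) =
        tsum (Delta Q (x i)) (\<lambda>z. pN (w * spl i (fst z) (snd z) x))"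
      by (subst mul_tsum_right[OF good_H2]) (auto simp: multilin_spl mul_pt)
    have "tsum (pN w \<bullet> D i (pN x)) G =
        tsum (Delta Q (x i)) (\<lambda>z. G ((w * spl i 1 1 x) * spl i (fst z) (snd z) 1))"
      by (simp only: D_pt dk_def eq2 tsum_tsum tsum_pt_multilin[OF G] eq[symmetric])
    also have "\<dots> = tsum (pN w \<bullet> I2 i (Ce i (pN x))) G"
      unfolding inv
      by (simp only: Ce_pt ck_def I2_tscale I2_pt ins_del mul_tscale_right[OF pN_in pN_in] tsum_tscale mul_pt tsum_pt_multilin[OF G])
    finally show "tsum (pN w \<bullet> D i (pN x)) G = tsum (pN w \<bullet> I2 i (Ce i (pN x))) G" .
  qed (auto intro!: lins lin_I2 lin_Ce)
qed (use y in \<open>auto intro!: lins lin_I2 lin_Ce\<close>)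

text \<open>A form must be linear in every slot, so a function of the first \<open>n\<close> slots is
  continued by the counit in the other ones.\<close>

definition tail :: "nat \<Rightarrow> (nat \<Rightarrow> 'h) \<Rightarrow> 'k"
  where "tail n x = (let J = {j. n \<le> j \<and> x j \<noteq> 1} in if finite J then \<Prod>j\<in>J. eps Q (x j) else 0)"

lemma tail_cong: "(\<And>j. n \<le> j \<Longrightarrow> x j = y j) \<Longrightarrow> tail n x = tail n y"
proof -
  assume *: "\<And>j. n \<le> j \<Longrightarrow> x j = y j"
  then have "{j. n \<le> j \<and> x j \<noteq> 1} = {j. n \<le> j \<and> y j \<noteq> 1}" by auto
  with * show ?thesis by (auto simp: tail_def Let_def intro!: prod.cong)
qed

lemma tail_one: "(\<And>j. n \<le> j \<Longrightarrow> x j = 1) \<Longrightarrow> tail n x = 1"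
proof -
  assume "\<And>j. n \<le> j \<Longrightarrow> x j = 1"
  then have *: "{j. n \<le> j \<and> x j \<noteq> 1} = {}" by auto
  show ?thesis unfolding tail_def * Let_def by simp
qed

text \<open>Changing one slot does not decide whether the entries different from 1 are finite in
  number, so the default 0 for an infinite set does not disturb linearity. The entry 1, which is
  left out of the product, is covered by \<open>eps Q 1 = 1\<close>.\<close>

lemma tail_upd: assumes "n \<le> i" shows "tail n (x(i := a)) = eps Q a * tail n (x(i := 1))"
proof -
  let ?J = "{j. n \<le> j \<and> (x(i := 1)) j \<noteq> 1}"
  have i: "i \<notin> ?J" by simp
  show ?thesis
  proof (cases "a = 1")
    case False
    then have "{j. n \<le> j \<and> (x(i := a)) j \<noteq> 1} = insert i ?J" using assms by auto
    moreover have "(\<Prod>j\<in>?J. eps Q ((x(i := a)) j)) = (\<Prod>j\<in>?J. eps Q ((x(i := 1)) j))"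
      by (rule prod.cong) auto
    ultimately show ?thesis using i by (simp add: tail_def Let_def)
  qed simp
qed

text \<open>The first \<open>n\<close> slots are handled by \<open>K\<close>; every other slot
  enters only the tail factor, where the counit is linear.\<close>

lemma multilin_tail:
  assumes "\<And>i x. i < n \<Longrightarrow> multilin (H1 Q) (\<lambda>a. K (x(i := a)))" "\<And>i x a. n \<le> i \<Longrightarrow> K (x(i := a)) = K x"
  shows "multilin \<H> (\<lambda>x. tscale (tail n x) (K x))"
  unfolding multilin_HN
proof (intro allI)
  fix x :: "nat \<Rightarrow> 'h" and i
  show "multilin (H1 Q) (\<lambda>a. tscale (tail n (x(i := a))) (K (x(i := a))))"
  proof (cases "i < n")
    case True
    then have "tail n (x(i := a)) = tail n x" for a by (intro tail_cong) auto
    then show ?thesis using assms(1)[OF True] by (auto intro!: multilin_tscale)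
  next
    case False
    define c where "c = tail n (x(i := 1))"
    have "tail n (x(i := a)) = eps Q a * c" "K (x(i := a)) = K x" for a
      using False assms(2) tail_upd[of n i x a] by (simp_all add: c_def)
    then show ?thesis using linear_eps
      by (simp add: multilin_vsp linear_on_def distrib_right tensor.scale_left_distrib mult.assoc)
  qed
qed

text \<open>The Sweedler sum of \<open>K\<close> over a tensor supported in the first
  \<open>n\<close> slots; by \<open>ev_pt\<close> the tail factor is then 1.\<close>

definition ev where "ev n K t = tsum t (\<lambda>x. tscale (tail n x) (K x))"

lemma ev_pt:
  assumes "multilin \<H> (\<lambda>x. tscale (tail n x) (K x))" "\<And>j. n \<le> j \<Longrightarrow> x j = 1" shows "ev n K (pN x) = K x"
  using assms by (simp add: ev_def tsum_pt_multilin tail_one)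

lemma ev_k3:
  assumes "multilin \<H> (\<lambda>x. tscale (tail n x) (K x))" "3 \<le> n"
  shows "ev n K (k3 0 p 1) = tsum p (\<lambda>z. K (fst z ## fst (snd z) ## snd (snd z) ## 1))"
proof -
  have "tail n (a ## b ## c ## 1) = 1" for a b c
    using assms(2) by (intro tail_one) (auto simp: one_fun_def split: nat.split)
  then show ?thesis
    by (simp add: ev_def k3_def r3_0 tsum_tsum tsum_pt_multilin[OF assms(1)])
qed

lemma lin_ev: "lin X L \<Longrightarrow> lin X (\<lambda>t. ev n K (L t))"
  unfolding ev_def by (rule lin_tsum)

lemma ev_in:
  "multilin \<H> (\<lambda>x. tscale (tail n x) (K x)) \<Longrightarrow> (\<And>x. K x \<in> tens X) \<Longrightarrow> t \<in> A \<Longrightarrow> ev n K t \<in> tens X"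
  unfolding ev_def by (erule tsum_in) auto

text \<open>Since slots \<open>i\<close> and \<open>Suc i\<close> lie below \<open>n\<close>, the
  tail factor is not touched and absorption is a matter of \<open>K\<close> alone.\<close>

lemma ev_collapse_left:
  assumes K: "multilin \<H> (\<lambda>x. tscale (tail n x) (K x))" and i: "Suc i < n"
    and inv: "\<And>w h. tsum (Delta Q h) (\<lambda>z. K (spl i (fst z) (snd z) 1 * w)) = tscale (eps Q h) (K w)"
    and m: "\<And>w. multilin (H2 Q) (\<lambda>z. K (spl i (fst z) (snd z) 1 * w))"
    and y: "y \<in> A" and u: "u \<in> A"
  shows "ev n K (D i y \<bullet> u) = ev n K (I2 i (Ce i y) \<bullet> u)"
  unfolding ev_def
proof (rule collapse_left[OF K _ y u])
  fix w h
  have "tail n (spl i a b 1 * w) = tail n w" for a b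
    using i by (intro tail_cong) (auto simp: spl_def pointwise)
  then show "tsum (Delta Q h) (\<lambda>z. tscale (tail n (spl i (fst z) (snd z) 1 * w)) (K (spl i (fst z) (snd z) 1 * w))) =
      tscale (eps Q h) (tscale (tail n w) (K w))"
    by (simp add: tsum_tscale_right[OF good_H2 Delta_in m] inv mult.commute)
qed

lemma ev_collapse_right:
  assumes K: "multilin \<H> (\<lambda>x. tscale (tail n x) (K x))" and i: "Suc i < n"
    and inv: "\<And>w h. tsum (Delta Q h) (\<lambda>z. K (w * spl i (fst z) (snd z) 1)) = tscale (eps Q h) (K w)"
    and m: "\<And>w. multilin (H2 Q) (\<lambda>z. K (w * spl i (fst z) (snd z) 1))"
    and y: "y \<in> A" and u: "u \<in> A"
  shows "ev n K (u \<bullet> D i y) = ev n K (u \<bullet> I2 i (Ce i y))"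
  unfolding ev_def
proof (rule collapse_right[OF K _ y u])
  fix w h
  have "tail n (w * spl i a b 1) = tail n w" for a b
    using i by (intro tail_cong) (auto simp: spl_def pointwise)
  then show "tsum (Delta Q h) (\<lambda>z. tscale (tail n (w * spl i (fst z) (snd z) 1)) (K (w * spl i (fst z) (snd z) 1))) =
      tscale (eps Q h) (tscale (tail n w) (K w))"
    by (simp add: tsum_tscale_right[OF good_H2 Delta_in m] inv mult.commute)
qed

section \<open>Antipodes relative to an algebra map\<close>

definition lmap where "lmap g \<longleftrightarrow> multilin (H1 Q) g \<and> (\<forall>h. g h \<in> A)"

lemma lmapD: "lmap g \<Longrightarrow> multilin (H1 Q) g" "lmap g \<Longrightarrow> g h \<in> A"
  by (auto simp: lmap_def)

lemmas mlins = multilin_mul_left multilin_mul_right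

lemma multilin_argR: "multilin (H1 Q) F \<Longrightarrow> multilin (H1 Q) (\<lambda>a. F (c * a))"
  by (erule multilin_comp[OF _ linear_mult(1)]) simp
lemma multilin_argL: "multilin (H1 Q) F \<Longrightarrow> multilin (H1 Q) (\<lambda>a. F (a * c))"
  by (erule multilin_comp[OF _ linear_mult(2)]) simp

text \<open>\<open>(g, r, t)\<close> has the properties of \<open>(S, \<alpha>, \<beta>)\<close> relative to an algebra map \<open>f\<close> from \<open>H\<close>;
  \<open>gauge\<close> is the formula for the element comparing two such triples.\<close>

definition antipodal where
  "antipodal f g r t \<longleftrightarrow> lmap f \<and> lmap g \<and> r \<in> A \<and> t \<in> A \<and> f 1 = pN 1 \<and> g 1 = pN 1 \<and>
    (\<forall>a b. f (a * b) = f a \<bullet> f b) \<and> (\<forall>a b. g (a * b) = g b \<bullet> g a) \<and>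
    (\<forall>h. tsum (Delta Q h) (\<lambda>z. g (fst z) \<bullet> (r \<bullet> f (snd z))) = tscale (eps Q h) r) \<and>
    (\<forall>h. tsum (Delta Q h) (\<lambda>z. f (fst z) \<bullet> (t \<bullet> g (snd z))) = tscale (eps Q h) t) \<and>
    tsum (phi Q) (\<lambda>z. f (fst z) \<bullet> (t \<bullet> (g (fst (snd z)) \<bullet> (r \<bullet> f (snd (snd z)))))) = pN 1 \<and>
    tsum (phi_inv Q) (\<lambda>z. g (fst z) \<bullet> (r \<bullet> (f (fst (snd z)) \<bullet> (t \<bullet> g (snd (snd z)))))) = pN 1"

lemma antipodalD:
  assumes "antipodal f g r t"
  shows "lmap f" "lmap g" "r \<in> A" "t \<in> A" "f 1 = pN 1" "g 1 = pN 1"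
    "f (a * b) = f a \<bullet> f b" "g (a * b) = g b \<bullet> g a"
    "tsum (Delta Q h) (\<lambda>z. g (fst z) \<bullet> (r \<bullet> f (snd z))) = tscale (eps Q h) r"
    "tsum (Delta Q h) (\<lambda>z. f (fst z) \<bullet> (t \<bullet> g (snd z))) = tscale (eps Q h) t"
    "tsum (phi Q) (\<lambda>z. f (fst z) \<bullet> (t \<bullet> (g (fst (snd z)) \<bullet> (r \<bullet> f (snd (snd z)))))) = pN 1"
    "tsum (phi_inv Q) (\<lambda>z. g (fst z) \<bullet> (r \<bullet> (f (fst (snd z)) \<bullet> (t \<bullet> g (snd (snd z)))))) = pN 1"
  using assms unfolding antipodal_def by blast+

definition gauge where
  "gauge g' r' f t g = tsum (phi_inv Q) (\<lambda>z. g' (fst z) \<bullet> (r' \<bullet> (f (fst (snd z)) \<bullet> (t \<bullet> g (snd (snd z))))))"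

lemma less3_cases: "(i::nat) < 3 \<Longrightarrow> i = 0 \<or> i = 1 \<or> i = 2"
  by auto

lemma less4_cases: "(i::nat) < 4 \<Longrightarrow> i = 0 \<or> i = 1 \<or> i = 2 \<or> i = 3"
  by auto

lemma spl_num: "spl 0 a b x 0 = a" "spl 0 a b x (Suc 0) = b" "spl 0 a b x (Suc (Suc j)) = x (Suc j)"
  "spl (Suc 0) a b x 0 = x 0" "spl (Suc 0) a b x (Suc 0) = a" "spl (Suc 0) a b x (Suc (Suc 0)) = b"
  "spl (Suc 0) a b x (Suc (Suc (Suc j))) = x (Suc (Suc j))"
  "spl (Suc (Suc 0)) a b x 0 = x 0" "spl (Suc (Suc 0)) a b x (Suc 0) = x (Suc 0)"
  "spl (Suc (Suc 0)) a b x (Suc (Suc 0)) = a" "spl (Suc (Suc 0)) a b x (Suc (Suc (Suc 0))) = b"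
  by (simp_all add: spl_def)

context
  fixes f g g' r t r' t'
  assumes 1: "antipodal f g r t" and 2: "antipodal f g' r' t'"
begin

lemmas A1 = antipodalD[OF 1] and A2 = antipodalD[OF 2]
lemmas AA [simp] = lmapD(2)[OF A1(1)] lmapD(2)[OF A1(2)] lmapD(2)[OF A2(2)] A1(3,4) A2(3,4)
lemmas ml0 = lmapD(1)[OF A1(1)] lmapD(1)[OF A1(2)] lmapD(1)[OF A2(2)]
lemmas ml = ml0 ml0[THEN multilin_argR] ml0[THEN multilin_argL]

text \<open>The absorption axiom with arbitrary factors on both sides, as it occurs inside the
  longer products \<open>K3\<close> and \<open>K4\<close>.\<close>

lemma mid_t: "tsum (Delta Q h) (\<lambda>z. u \<bullet> (f (fst z) \<bullet> (t \<bullet> (g (snd z) \<bullet> v)))) = tscale (eps Q h) (u \<bullet> (t \<bullet> v))"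
  if "u \<in> A" "v \<in> A"
proof -
  have "tsum (Delta Q h) (\<lambda>z. u \<bullet> ((f (fst z) \<bullet> (t \<bullet> g (snd z))) \<bullet> v)) =
      u \<bullet> (tsum (Delta Q h) (\<lambda>z. f (fst z) \<bullet> (t \<bullet> g (snd z))) \<bullet> v)"
    unfolding mul_tsum_left using that
    by (intro mul_tsum_right[OF good_H2 Delta_in, symmetric]) (auto simp: multilin_mprod intro!: mlins ml)
  then show ?thesis using that by (simp add: A1 mul_tscale mul_tscale_right mul_assoc)
qed

lemma mid_r: "tsum (Delta Q h) (\<lambda>z. u \<bullet> (g (fst z) \<bullet> (r \<bullet> (f (snd z) \<bullet> v)))) = tscale (eps Q h) (u \<bullet> (r \<bullet> v))"
  if "u \<in> A" "v \<in> A"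
proof -
  have "tsum (Delta Q h) (\<lambda>z. u \<bullet> ((g (fst z) \<bullet> (r \<bullet> f (snd z))) \<bullet> v)) =
      u \<bullet> (tsum (Delta Q h) (\<lambda>z. g (fst z) \<bullet> (r \<bullet> f (snd z))) \<bullet> v)"
    unfolding mul_tsum_left using that
    by (intro mul_tsum_right[OF good_H2 Delta_in, symmetric]) (auto simp: multilin_mprod intro!: mlins ml)
  then show ?thesis using that by (simp add: A1 mul_tscale mul_tscale_right mul_assoc)
qed

lemma mid_r': "tsum (Delta Q h) (\<lambda>z. u \<bullet> (g' (fst z) \<bullet> (r' \<bullet> (f (snd z) \<bullet> v)))) = tscale (eps Q h) (u \<bullet> (r' \<bullet> v))"
  if "u \<in> A" "v \<in> A"
proof -
  have "tsum (Delta Q h) (\<lambda>z. u \<bullet> ((g' (fst z) \<bullet> (r' \<bullet> f (snd z))) \<bullet> v)) =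
      u \<bullet> (tsum (Delta Q h) (\<lambda>z. g' (fst z) \<bullet> (r' \<bullet> f (snd z))) \<bullet> v)"
    unfolding mul_tsum_left using that
    by (intro mul_tsum_right[OF good_H2 Delta_in, symmetric]) (auto simp: multilin_mprod intro!: mlins ml)
  then show ?thesis using that by (simp add: A2 mul_tscale mul_tscale_right mul_assoc)
qed

text \<open>\<open>K3\<close> is the summand of \<open>gauge\<close>. \<open>K4\<close> continues it
  by \<open>r\<close> and \<open>f\<close>: on a tensor with three slots it gives the gauge times
  \<open>r\<close>, and with a fourth slot it can receive the pentagon.\<close>

definition K3 where "K3 x = g' (x 0) \<bullet> (r' \<bullet> (f (x 1) \<bullet> (t \<bullet> g (x 2))))"
definition K4 where "K4 x = g' (x 0) \<bullet> (r' \<bullet> (f (x 1) \<bullet> (t \<bullet> (g (x 2) \<bullet> (r \<bullet> f (x 3))))))"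

lemma K3_in: "K3 x \<in> A" and K4_in: "K4 x \<in> A"
  by (simp_all add: K3_def K4_def)

lemma K3_m: "multilin \<H> (\<lambda>x. tscale (tail 3 x) (K3 x))"
  by (rule multilin_tail) (auto simp: K3_def dest!: less3_cases intro!: mlins ml)
lemma K4_m: "multilin \<H> (\<lambda>x. tscale (tail 4 x) (K4 x))"
  by (rule multilin_tail) (auto simp: K4_def dest!: less4_cases intro!: mlins ml)

lemma gauge_K3: "gauge g' r' f t g = ev 3 K3 \<phi>'"
  unfolding gauge_def \<phi>'_def by (simp add: ev_k3[OF K3_m]) (simp add: K3_def mul_assoc numeral_2_eq_2)

lemma gauge_in: "gauge g' r' f t g \<in> A"
  unfolding gauge_def by (rule tsum_in[OF phi_inv(1)]) (auto simp: multilin_mprod intro!: mlins ml)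

text \<open>The threefold coproduct of \<open>h\<close> is inserted next to \<open>\<phi>'\<close>.
  On the right, \<open>t\<close> absorbs slots 1 and 2, and \<open>h\<close> remains in slot 0,
  which it leaves as \<open>g' h\<close>. Moved to the left by quasi-coassociativity, it loses slots
  0 and 1 to \<open>r'\<close>, and \<open>h\<close> remains in slot 2, which it leaves as
  \<open>g h\<close>.\<close>

lemma gauge_g: "gauge g' r' f t g \<bullet> g h = g' h \<bullet> gauge g' r' f t g"
proof -
  have j: "I2 1 (pN (h ## 1)) = pN (h ## 1)"
  proof -
    have "ins 1 (ins 1 (h ## 1)) = h ## 1" by (auto simp: ins_def fun_eq_iff one_fun_apply split: nat.split)
    then show ?thesis by (simp add: I2_pt)
  qed
  have c: "D 1 (D 0 (pN (h ## 1))) \<bullet> \<phi> = \<phi> \<bullet> D 0 (D 0 (pN (h ## 1)))"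
    using inter[of "pN (h ## 1)" 0] by simp
  have "\<phi>' \<bullet> D 1 (D 0 (pN (h ## 1))) \<bullet> (\<phi> \<bullet> \<phi>') = \<phi>' \<bullet> (D 1 (D 0 (pN (h ## 1))) \<bullet> \<phi>) \<bullet> \<phi>'"
    by (simp add: mul_assoc)
  also have "\<dots> = \<phi>' \<bullet> \<phi> \<bullet> D 0 (D 0 (pN (h ## 1))) \<bullet> \<phi>'"
    unfolding c by (simp add: mul_assoc)
  finally have co: "\<phi>' \<bullet> D 1 (D 0 (pN (h ## 1))) = D 0 (D 0 (pN (h ## 1))) \<bullet> \<phi>'"
    by (simp add: phi_phi')
  have r: "ev 3 K3 (\<phi>' \<bullet> D 1 (D 0 (pN (h ## 1)))) = ev 3 K3 (\<phi>' \<bullet> pN (h ## 1))"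
  proof (subst ev_collapse_right[OF K3_m])
    show "tsum (Delta Q a) (\<lambda>z. K3 (w * spl 1 (fst z) (snd z) 1)) = tscale (eps Q a) (K3 w)" for w a
      using mid_t[of "g' (w 0) \<bullet> (r' \<bullet> f (w 1))" "g (w 2)" a]
      by (simp add: K3_def numeral_2_eq_2 times_fun_apply spl_num A1 mul_assoc one_fun_apply)
  qed (use Ce_D_same(2)[of "pN (h ## 1)" 0] j in \<open>auto simp: K3_def times_fun_apply spl_def multilin_mprod intro!: mlins ml\<close>)
  have l: "ev 3 K3 (D 0 (D 0 (pN (h ## 1))) \<bullet> \<phi>') = ev 3 K3 (s (s (pN (h ## 1))) \<bullet> \<phi>')"
  proof (subst ev_collapse_left[OF K3_m])
    show "tsum (Delta Q a) (\<lambda>z. K3 (spl 0 (fst z) (snd z) 1 * w)) = tscale (eps Q a) (K3 w)" for w a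
      using mid_r'[of "g' (w 0)" "f (w 1) \<bullet> (t \<bullet> g (w 2))" a]
      by (simp add: K3_def numeral_2_eq_2 times_fun_apply spl_num A1 A2 mul_assoc one_fun_apply)
  qed (use Ce_D_same(1)[of "pN (h ## 1)" 0] in \<open>auto simp: I2_0 K3_def times_fun_apply spl_def multilin_mprod intro!: mlins ml\<close>)
  have e1: "ev 3 K3 (u \<bullet> pN (h ## 1)) = g' h \<bullet> ev 3 K3 u" if "u \<in> W 3" for u
  proof (rule lin_ext_W[OF that])
    fix x :: "nat \<Rightarrow> 'h" assume x: "\<And>j. 3 \<le> j \<Longrightarrow> x j = 1"
    have "ev 3 K3 (pN (x * (h ## 1))) = K3 (x * (h ## 1))"
      by (rule ev_pt[OF K3_m]) (use x in \<open>auto simp: pointwise split: nat.split\<close>)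
    also have "\<dots> = g' h \<bullet> K3 x"
      by (simp add: K3_def times_fun_apply A2 A1 mul_assoc one_fun_def numeral_2_eq_2)
    finally show "ev 3 K3 (pN x \<bullet> pN (h ## 1)) = g' h \<bullet> ev 3 K3 (pN x)"
      using x by (simp add: mul_pt ev_pt[OF K3_m])
  qed (auto intro!: lins lin_ev ev_in[OF K3_m] K3_in)
  have e2: "ev 3 K3 (s (s (pN (h ## 1))) \<bullet> u) = ev 3 K3 u \<bullet> g h" if "u \<in> W 3" for u
  proof (rule lin_ext_W[OF that])
    fix x :: "nat \<Rightarrow> 'h" assume x: "\<And>j. 3 \<le> j \<Longrightarrow> x j = 1"
    have "ev 3 K3 (pN ((1 ## 1 ## h ## 1) * x)) = K3 ((1 ## 1 ## h ## 1) * x)"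
      by (rule ev_pt[OF K3_m]) (use x in \<open>auto simp: pointwise split: nat.split\<close>)
    also have "\<dots> = K3 x \<bullet> g h"
      by (simp add: K3_def times_fun_apply A2 A1 mul_assoc one_fun_def numeral_2_eq_2)
    finally show "ev 3 K3 (s (s (pN (h ## 1))) \<bullet> pN x) = ev 3 K3 (pN x) \<bullet> g h"
      using x by (simp add: mul_pt s_pt ev_pt[OF K3_m])
  qed (auto intro!: lins lin_ev)
  show ?thesis
    using r l co e1[OF phi_W(2)] e2[OF phi_W(2)] by (simp add: gauge_K3)
qed

text \<open>The pentagon solved for the inverse associator. Every factor except
  \<open>s \<phi>\<close> is a coproduct in a slot where \<open>K4\<close> absorbs it.\<close>

lemma inverse_pentagon: "\<phi>' = D 0 \<phi>' \<bullet> (D 2 \<phi>' \<bullet> (s \<phi> \<bullet> D 1 \<phi>))"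
proof -
  have 1: "D i \<phi>' \<bullet> D i \<phi> = pN 1" for i
    using D_mul[of \<phi>' \<phi> i] by (simp add: phi_phi' D_one)
  have 2: "D i \<phi>' \<bullet> (D i \<phi> \<bullet> u) = u" if "u \<in> A" for u i
    using that 1[of i] by (simp flip: mul_assoc)
  have "D 0 \<phi>' \<bullet> (D 2 \<phi>' \<bullet> (s \<phi> \<bullet> D 1 \<phi>)) = D 0 \<phi>' \<bullet> (D 2 \<phi>' \<bullet> ((s \<phi> \<bullet> D 1 \<phi> \<bullet> \<phi>) \<bullet> \<phi>'))"
    by (simp add: mul_assoc phi_phi')
  also have "\<dots> = D 0 \<phi>' \<bullet> ((D 2 \<phi>' \<bullet> D 2 \<phi>) \<bullet> (D 0 \<phi> \<bullet> \<phi>'))"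
    unfolding pentagon[symmetric] by (simp add: mul_assoc)
  finally show ?thesis by (simp add: 2 mul_assoc)
qed

text \<open>\<open>K4\<close> on \<open>\<phi>'\<close> is the gauge times \<open>r\<close>. In the
  rewritten pentagon the factors \<open>D 0 \<phi>'\<close>, \<open>D 1 \<phi>\<close> and
  \<open>D 2 \<phi>'\<close> are absorbed by \<open>r'\<close>, \<open>t\<close> and
  \<open>r\<close> in turn, and \<open>s \<phi>\<close> leaves \<open>r'\<close> times the identity
  with \<open>phi Q\<close> for the first triple.\<close>

lemma gauge_r: "gauge g' r' f t g \<bullet> r = r'"
proof -
  have e1: "ev 4 K4 u = ev 3 K3 u \<bullet> r" if "u \<in> W 3" for u
  proof (rule lin_ext_W[OF that])
    fix x :: "nat \<Rightarrow> 'h" assume x: "\<And>j. 3 \<le> j \<Longrightarrow> x j = 1"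
    then show "ev 4 K4 (pN x) = ev 3 K3 (pN x) \<bullet> r"
      by (simp add: ev_pt[OF K3_m] ev_pt[OF K4_m]) (simp add: K3_def K4_def A1 mul_assoc x)
  qed (auto intro!: lins lin_ev)
  have n: "multilin (H2 Q) (\<lambda>z. K4 (spl i (fst z) (snd z) 1 * w))" "multilin (H2 Q) (\<lambda>z. K4 (w * spl i (fst z) (snd z) 1))"
    if "i = 0 \<or> i = Suc 0 \<or> i = 2" for i w
    using that by (auto simp: K4_def times_fun_apply spl_def multilin_mprod intro!: mlins ml)
  have "ev 4 K4 \<phi>' = ev 4 K4 (D 0 \<phi>' \<bullet> (D 2 \<phi>' \<bullet> (s \<phi> \<bullet> D 1 \<phi>)))"
    by (rule arg_cong[OF inverse_pentagon])
  also have "\<dots> = ev 4 K4 (D 2 \<phi>' \<bullet> s \<phi> \<bullet> D 1 \<phi>)"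
  proof (subst ev_collapse_left[OF K4_m])
    show "tsum (Delta Q a) (\<lambda>z. K4 (spl 0 (fst z) (snd z) 1 * w)) = tscale (eps Q a) (K4 w)" for w a
      using mid_r'[of "g' (w 0)" "f (w 1) \<bullet> (t \<bullet> (g (w 2) \<bullet> (r \<bullet> f (w 3))))" a]
      by (simp add: K4_def numeral_2_eq_2 numeral_3_eq_3 times_fun_apply spl_num A1 A2 mul_assoc one_fun_apply)
  qed (auto simp: n Ce_phi mul_assoc)
  also have "\<dots> = ev 4 K4 (D 2 \<phi>' \<bullet> s \<phi>)"
  proof (subst ev_collapse_right[OF K4_m])
    show "tsum (Delta Q a) (\<lambda>z. K4 (w * spl 1 (fst z) (snd z) 1)) = tscale (eps Q a) (K4 w)" for w a
      using mid_t[of "g' (w 0) \<bullet> (r' \<bullet> f (w 1))" "g (w 2) \<bullet> (r \<bullet> f (w 3))" a]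
      by (simp add: K4_def numeral_2_eq_2 numeral_3_eq_3 times_fun_apply spl_num A1 A2 mul_assoc one_fun_apply)
  qed (auto simp: n Ce_phi)
  also have "\<dots> = ev 4 K4 (s \<phi>)"
  proof (subst ev_collapse_left[OF K4_m])
    show "tsum (Delta Q a) (\<lambda>z. K4 (spl 2 (fst z) (snd z) 1 * w)) = tscale (eps Q a) (K4 w)" for w a
      using mid_r[of "g' (w 0) \<bullet> (r' \<bullet> (f (w 1) \<bullet> (t \<bullet> g (w 2))))" "f (w 3)" a]
      by (simp add: K4_def numeral_2_eq_2 numeral_3_eq_3 times_fun_apply spl_num A1 A2 mul_assoc one_fun_apply)
  qed (auto simp: n Ce_phi numeral_2_eq_2)
  also have "\<dots> = r' \<bullet> tsum (phi Q) (\<lambda>z. f (fst z) \<bullet> (t \<bullet> (g (fst (snd z)) \<bullet> (r \<bullet> f (snd (snd z))))))"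
  proof -
    have t: "tail 4 (1 ## a ## b ## c ## 1) = 1" for a b c :: 'h
      by (rule tail_one) (auto simp: one_fun_def split: nat.split)
    have "ev 4 K4 (s \<phi>) = tsum (phi Q) (\<lambda>z. r' \<bullet> (f (fst z) \<bullet> (t \<bullet> (g (fst (snd z)) \<bullet> (r \<bullet> f (snd (snd z)))))))"
      by (simp add: phi_tsum s_tsum s_pt ev_def tsum_tsum tsum_pt_multilin[OF K4_m] t)
        (simp add: K4_def A2 numeral_2_eq_2 numeral_3_eq_3)
    also have "\<dots> = r' \<bullet> tsum (phi Q) (\<lambda>z. f (fst z) \<bullet> (t \<bullet> (g (fst (snd z)) \<bullet> (r \<bullet> f (snd (snd z))))))"
      by (rule mul_tsum_right[OF good_H3 phi_in, symmetric]) (auto simp: multilin_mprod intro!: mlins ml)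
    finally show ?thesis .
  qed
  finally show ?thesis using e1[OF phi_W(2)] by (simp add: A1 gauge_K3)
qed

end

text \<open>Pulled into the sum that defines the second gauge, the first one turns \<open>g\<close>
  into \<open>g'\<close> and is used up when it meets \<open>r\<close>, which becomes
  \<open>r'\<close>. What results is the identity with \<open>phi_inv Q\<close> for the second
  triple.\<close>

lemma gauge_inverse:
  assumes 1: "antipodal f g r t" and 2: "antipodal f g' r' t'"
  shows "gauge g' r' f t g \<bullet> gauge g r f t' g' = pN 1"
proof -
  note A1 = antipodalD[OF 1] and A2 = antipodalD[OF 2]
  note AA = lmapD(2)[OF A1(1)] lmapD(2)[OF A1(2)] lmapD(2)[OF A2(2)] A1(3,4) A2(3,4)
  note ml = lmapD(1)[OF A1(1)] lmapD(1)[OF A1(2)] lmapD(1)[OF A2(2)]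
  let ?F = "gauge g' r' f t g"
  have F: "?F \<in> A" by (rule gauge_in[OF 1 2])
  have g: "?F \<bullet> (g h \<bullet> u) = g' h \<bullet> (?F \<bullet> u)" "?F \<bullet> (r \<bullet> u) = r' \<bullet> u" if "u \<in> A" for h u
    using gauge_g[OF 1 2, of h] gauge_r[OF 1 2] that F AA by (simp_all flip: mul_assoc)
  have "?F \<bullet> gauge g r f t' g' = tsum (phi_inv Q) (\<lambda>z. ?F \<bullet> (g (fst z) \<bullet> (r \<bullet> (f (fst (snd z)) \<bullet> (t' \<bullet> g' (snd (snd z)))))))"
    unfolding gauge_def[of g] using F
    by (intro mul_tsum_right[OF good_H3 phi_inv(1)]) (auto simp: multilin_mprod AA intro!: mlins ml)
  then show ?thesis using F by (simp add: g AA A2(12))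
qed

text \<open>Insert 1 in the form of the identity with \<open>phi_inv Q\<close>: \<open>u\<close>
  moves past \<open>g\<close>, and afterwards it occurs only in \<open>u \<bullet> r\<close>. Here
  \<open>g'\<close> is any map into \<open>A\<close>, as the comparison of threefold coproducts
  requires.\<close>

lemma antipodal_unique:
  assumes 1: "antipodal f g r t" and x: "x \<in> A" and y: "y \<in> A"
    and gx: "\<And>h. x \<bullet> g h = g' h \<bullet> x" and gy: "\<And>h. y \<bullet> g h = g' h \<bullet> y" and r: "x \<bullet> r = y \<bullet> r" and g': "\<And>h. g' h \<in> A"
  shows "x = y"
proof -
  note A1 = antipodalD[OF 1]
  note AA = lmapD(2)[OF A1(1)] lmapD(2)[OF A1(2)] A1(3,4)
  note ml = lmapD(1)[OF A1(1)] lmapD(1)[OF A1(2)]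
  have *: "u = tsum (phi_inv Q) (\<lambda>z. g' (fst z) \<bullet> (u \<bullet> r \<bullet> (f (fst (snd z)) \<bullet> (t \<bullet> g (snd (snd z))))))"
    if u: "u \<in> A" and gu: "\<And>h. u \<bullet> g h = g' h \<bullet> u" for u
  proof -
    have "u \<bullet> (g h \<bullet> v) = g' h \<bullet> (u \<bullet> v)" if "v \<in> A" for h v
      using gu[of h] that u AA g' by (simp flip: mul_assoc)
    moreover have "u \<bullet> tsum (phi_inv Q) (\<lambda>z. g (fst z) \<bullet> (r \<bullet> (f (fst (snd z)) \<bullet> (t \<bullet> g (snd (snd z)))))) =
      tsum (phi_inv Q) (\<lambda>z. u \<bullet> (g (fst z) \<bullet> (r \<bullet> (f (fst (snd z)) \<bullet> (t \<bullet> g (snd (snd z)))))))"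
      using u by (intro mul_tsum_right[OF good_H3 phi_inv(1)]) (auto simp: multilin_mprod AA intro!: mlins ml)
    ultimately show ?thesis using u by (simp add: A1(12) AA mul_assoc)
  qed
  show ?thesis using *[OF x gx] *[OF y gy] r by simp
qed

end

section \<open>Drinfeld's triples\<close>

context quasi_hopf_algebra begin

abbreviation S where "S \<equiv> anti Q"
abbreviation \<alpha> where "\<alpha> \<equiv> alpha Q"
abbreviation \<beta> where "\<beta> \<equiv> beta Q"

lemma anti_add: "S (x + y) = S x + S y" and anti_scal: "S (sc c x) = sc c (S x)"
  using linear_anti by (auto simp: linear_on_def)

definition j :: "'h \<Rightarrow> ('k, nat \<Rightarrow> 'h) tensor" where "j h = pN (h ## 1)"

lemma j_in [simp, intro]: "j h \<in> A" and j_W: "j h \<in> W 1"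
  by (auto simp: j_def one_fun_def intro!: pN_W split: nat.split)

lemma cons_1_right [simp]: "(a ## x) * (1 :: nat \<Rightarrow> 'h) = a ## x" "1 * (a ## x) = a ## (x :: nat \<Rightarrow> 'h)"
  by simp_all

lemma j_one [simp]: "j 1 = pN 1"
  by (simp add: j_def)

lemma j_mult: "j (a * b) = j a \<bullet> j b"
  by (simp add: j_def mul_pt)

lemma multilin_cons: "multilin (H1 Q) (\<lambda>a. pN (a ## x))"
  using multilin_pN_upd[of "0 ## x" 0] by (simp add: cons_upd)

lemma multilin_j: "multilin (H1 Q) j"
  using multilin_cons[of 1] by (simp add: j_def[abs_def])

lemma antipode_alpha:
  "multilin (H1 Q) F \<Longrightarrow> tsum (Delta Q h) (\<lambda>z. F (S (fst z) * \<alpha> * snd z)) = tscale (eps Q h) (F \<alpha>)"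
proof -
  assume F: "multilin (H1 Q) F"
  have "tsum (Delta Q h) (\<lambda>z. pt (H1 Q) (S (fst z) * \<alpha> * snd z)) = pt (H1 Q) (sc (eps Q h) \<alpha>)"
    using qh unfolding quasi_hopf_def split_def by blast
  from arg_cong[OF this, of "\<lambda>t. tsum t F"] show ?thesis
    using F by (simp add: tsum_tsum tsum_pt_multilin[OF F]) (simp add: multilin_vsp linear_on_def)
qed

lemma antipode_beta:
  "multilin (H1 Q) F \<Longrightarrow> tsum (Delta Q h) (\<lambda>z. F (fst z * \<beta> * S (snd z))) = tscale (eps Q h) (F \<beta>)"
proof -
  assume F: "multilin (H1 Q) F"
  have "tsum (Delta Q h) (\<lambda>z. pt (H1 Q) (fst z * \<beta> * S (snd z))) = pt (H1 Q) (sc (eps Q h) \<beta>)"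
    using qh unfolding quasi_hopf_def split_def by blast
  from arg_cong[OF this, of "\<lambda>t. tsum t F"] show ?thesis
    using F by (simp add: tsum_tsum tsum_pt_multilin[OF F]) (simp add: multilin_vsp linear_on_def)
qed

lemma antipode_phi:
  assumes F: "multilin (H1 Q) F"
  shows "tsum (phi Q) (\<lambda>z. F (fst z * \<beta> * S (fst (snd z)) * \<alpha> * snd (snd z))) = F 1"
    "tsum (phi_inv Q) (\<lambda>z. F (S (fst z) * \<alpha> * fst (snd z) * \<beta> * S (snd (snd z)))) = F 1"
proof -
  have 1: "tsum (phi Q) (\<lambda>z. pt (H1 Q) (fst z * \<beta> * S (fst (snd z)) * \<alpha> * snd (snd z))) = pt (H1 Q) 1"
    "tsum (phi_inv Q) (\<lambda>z. pt (H1 Q) (S (fst z) * \<alpha> * fst (snd z) * \<beta> * S (snd (snd z)))) = pt (H1 Q) 1"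
    using qh unfolding quasi_hopf_def split_def by blast+
  show "tsum (phi Q) (\<lambda>z. F (fst z * \<beta> * S (fst (snd z)) * \<alpha> * snd (snd z))) = F 1"
    "tsum (phi_inv Q) (\<lambda>z. F (S (fst z) * \<alpha> * fst (snd z) * \<beta> * S (snd (snd z)))) = F 1"
    using arg_cong[OF 1(1), of "\<lambda>t. tsum t F"] arg_cong[OF 1(2), of "\<lambda>t. tsum t F"]
    by (simp_all add: tsum_tsum tsum_pt_multilin[OF F])
qed

lemma eps_add: "eps Q (x + y) = eps Q x + eps Q y" and eps_scal: "eps Q (sc c x) = c * eps Q x"
  using linear_eps by (auto simp: linear_on_def)

lemma antipodal_base: "antipodal j (\<lambda>h. j (S h)) (j \<alpha>) (j \<beta>)"
  unfolding antipodal_def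
proof (intro conjI allI)
  show "lmap j" by (simp add: lmap_def multilin_j)
  show "lmap (\<lambda>h. j (S h))"
    by (auto simp: lmap_def intro!: multilin_comp[OF multilin_j linear_anti])
qed (auto simp: anti_mult simp flip: j_mult mult.assoc intro: antipode_alpha[OF multilin_j] antipode_beta[OF multilin_j]
   antipode_phi[OF multilin_j, unfolded j_one])

text \<open>\<open>D i\<close> is an algebra map, so it carries all identities of a triple along;
  this yields the antipodes for twofold and threefold coproducts.\<close>

lemma antipodal_D:
  assumes "antipodal f g r t" shows "antipodal (\<lambda>h. D i (f h)) (\<lambda>h. D i (g h)) (D i r) (D i t)"
proof -
  note A = antipodalD[OF assms]
  note AA [simp] = lmapD(2)[OF A(1)] lmapD(2)[OF A(2)] A(3,4)
  have D: "D i (f a) \<bullet> (D i t \<bullet> D i (g b)) = D i (f a \<bullet> (t \<bullet> g b))"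
    "D i (g a) \<bullet> (D i r \<bullet> D i (f b)) = D i (g a \<bullet> (r \<bullet> f b))"
    "D i (f a) \<bullet> (D i t \<bullet> (D i (g b) \<bullet> (D i r \<bullet> D i (f c)))) = D i (f a \<bullet> (t \<bullet> (g b \<bullet> (r \<bullet> f c))))"
    "D i (g a) \<bullet> (D i r \<bullet> (D i (f b) \<bullet> (D i t \<bullet> D i (g c)))) = D i (g a \<bullet> (r \<bullet> (f b \<bullet> (t \<bullet> g c))))" for a b c
    by (simp_all add: D_mul)
  have "lmap (\<lambda>h. D i (f h))" "lmap (\<lambda>h. D i (g h))"
    using A(1,2) by (auto simp: lmap_def D_def[of i] intro!: multilin_tsum1 D_in[unfolded D_def])
  moreover have "D i (f (a * b)) = D i (f a) \<bullet> D i (f b)" "D i (g (a * b)) = D i (g b) \<bullet> D i (g a)" for a b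
    by (simp_all add: A D_mul)
  moreover have "tsum (Delta Q h) (\<lambda>z. D i (g (fst z)) \<bullet> (D i r \<bullet> D i (f (snd z)))) = tscale (eps Q h) (D i r)"
    "tsum (Delta Q h) (\<lambda>z. D i (f (fst z)) \<bullet> (D i t \<bullet> D i (g (snd z)))) = tscale (eps Q h) (D i t)" for h
    unfolding D(1,2) by (simp_all add: A(9,10) D_tscale flip: D_tsum)
  moreover have "tsum (phi Q) (\<lambda>z. D i (f (fst z)) \<bullet> (D i t \<bullet> (D i (g (fst (snd z))) \<bullet> (D i r \<bullet> D i (f (snd (snd z))))))) = pN 1"
    "tsum (phi_inv Q) (\<lambda>z. D i (g (fst z)) \<bullet> (D i r \<bullet> (D i (f (fst (snd z))) \<bullet> (D i t \<bullet> D i (g (snd (snd z))))))) = pN 1"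
    unfolding D(3,4) by (simp_all add: A(11,12) D_one flip: D_tsum)
  ultimately show ?thesis
    unfolding antipodal_def using D_in[OF A(3)] D_in[OF A(4)] by (simp add: A(5,6) D_one)
qed

text \<open>\<open>mapt rv\<close> is the anti-automorphism \<open>x \<otimes> y \<mapsto> S y \<otimes> S x\<close>.\<close>

definition rv :: "(nat \<Rightarrow> 'h) \<Rightarrow> nat \<Rightarrow> 'h" where "rv x = S (x 1) ## S (x 0) ## (\<lambda>i. x (i + 2))"
text \<open>\<open>Ep\<close> and \<open>Eb\<close> turn \<open>\<theta>\<close> and
  \<open>\<theta>'\<close> into Drinfeld's element for \<alpha> and its counterpart for \<beta>.
  \<open>K6\<close> and \<open>K6'\<close> multiply out the antipode identities with
  \<open>phi Q\<close> and \<open>phi_inv Q\<close>, and \<open>Z0\<close> to \<open>Z1'\<close> are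
  what remains of them once two pairs of slots have been absorbed. Later slots are kept and
  renumbered, so each map acts on the whole algebra.\<close>

definition Ep :: "(nat \<Rightarrow> 'h) \<Rightarrow> nat \<Rightarrow> 'h"
  where "Ep x = S (x 1) * \<alpha> * x 2 ## S (x 0) * \<alpha> * x 3 ## (\<lambda>i. x (i + 4))"
definition Eb :: "(nat \<Rightarrow> 'h) \<Rightarrow> nat \<Rightarrow> 'h"
  where "Eb x = x 0 * \<beta> * S (x 3) ## x 1 * \<beta> * S (x 2) ## (\<lambda>i. x (i + 4))"
definition K6 :: "(nat \<Rightarrow> 'h) \<Rightarrow> nat \<Rightarrow> 'h"
  where "K6 x = x 0 * \<beta> * S (x 3) * \<alpha> * x 4 ## x 1 * \<beta> * S (x 2) * \<alpha> * x 5 ## (\<lambda>i. x (i + 6))"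
definition K6' :: "(nat \<Rightarrow> 'h) \<Rightarrow> nat \<Rightarrow> 'h"
  where "K6' x = S (x 1) * \<alpha> * x 2 * \<beta> * S (x 5) ## S (x 0) * \<alpha> * x 3 * \<beta> * S (x 4) ## (\<lambda>i. x (i + 6))"
definition Z0 :: "(nat \<Rightarrow> 'h) \<Rightarrow> nat \<Rightarrow> 'h"
  where "Z0 x = x 0 * \<beta> * S (x 1) * \<alpha> * x 2 ## x 3 ## (\<lambda>i. x (i + 4))"
definition Z1 :: "(nat \<Rightarrow> 'h) \<Rightarrow> nat \<Rightarrow> 'h"
  where "Z1 x = x 0 ## x 1 * \<beta> * S (x 2) * \<alpha> * x 3 ## (\<lambda>i. x (i + 4))"
definition Z0' :: "(nat \<Rightarrow> 'h) \<Rightarrow> nat \<Rightarrow> 'h"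
  where "Z0' x = S (x 1) * \<alpha> * x 2 * \<beta> * S (x 3) ## S (x 0) ## (\<lambda>i. x (i + 4))"
definition Z1' :: "(nat \<Rightarrow> 'h) \<Rightarrow> nat \<Rightarrow> 'h"
  where "Z1' x = S (x 3) ## S (x 0) * \<alpha> * x 1 * \<beta> * S (x 2) ## (\<lambda>i. x (i + 4))"

lemma slinI:
  assumes "\<And>x i a k. k \<noteq> p i \<Longrightarrow> T (x(i := a)) k = T x k"
    "\<And>x i. linear_on (scal Q) (scal Q) UNIV (\<lambda>a. T (x(i := a)) (p i))"
  shows "slin (scal Q) T"
  unfolding slin_def by (rule exI[of _ p]) (use assms in blast)

lemmas lin_simps = linear_on_def anti_add anti_scal distrib_left distrib_right scal_mult'

lemma nat_cases6:
  obtains "i = 0" | "i = 1" | "i = 2" | "i = 3" | "i = 4" | "i = 5" | n where "i = n + (6::nat)"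
proof -
  have "i = 0 \<or> i = 1 \<or> i = 2 \<or> i = 3 \<or> i = 4 \<or> i = 5 \<or> i = (i - 6) + 6" by linarith
  then show thesis using that by metis
qed

lemma slin_rv: "slin sc rv"
  by (rule slinI[of "\<lambda>i. if i = 0 then 1 else if i = 1 then 0 else i"])
    (auto simp: rv_def lin_simps split: nat.split)
lemma slin_Ep: "slin sc Ep"
  by (rule slinI[of "\<lambda>i. if i = 0 \<or> i = 3 then 1 else if i = 1 \<or> i = 2 then 0 else i - 2"])
    (auto simp: Ep_def lin_simps split: nat.split)
lemma slin_Eb: "slin sc Eb"
  by (rule slinI[of "\<lambda>i. if i = 0 \<or> i = 3 then 0 else if i = 1 \<or> i = 2 then 1 else i - 2"])
    (auto simp: Eb_def lin_simps split: nat.split)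
lemma slin_K6: "slin sc K6"
proof (rule slinI[of "\<lambda>i. if i = 0 \<or> i = 3 \<or> i = 4 then 0 else if i = 1 \<or> i = 2 \<or> i = 5 then 1 else i - 4"])
  fix x :: "nat \<Rightarrow> 'h" and i k :: nat and a
  let ?p = "\<lambda>i. if i = 0 \<or> i = 3 \<or> i = 4 then 0 else if i = 1 \<or> i = 2 \<or> i = 5 then 1 else i - 4"
  show "k \<noteq> ?p i \<Longrightarrow> K6 (x(i := a)) k = K6 x k" "linear_on sc sc UNIV (\<lambda>a. K6 (x(i := a)) (?p i))"
    by (cases i rule: nat_cases6; auto simp: K6_def lin_simps split: nat.split)+
qed
lemma slin_K6': "slin sc K6'"
proof (rule slinI[of "\<lambda>i. if i = 1 \<or> i = 2 \<or> i = 5 then 0 else if i = 0 \<or> i = 3 \<or> i = 4 then 1 else i - 4"])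
  fix x :: "nat \<Rightarrow> 'h" and i k :: nat and a
  let ?p = "\<lambda>i. if i = 1 \<or> i = 2 \<or> i = 5 then 0 else if i = 0 \<or> i = 3 \<or> i = 4 then 1 else i - 4"
  show "k \<noteq> ?p i \<Longrightarrow> K6' (x(i := a)) k = K6' x k" "linear_on sc sc UNIV (\<lambda>a. K6' (x(i := a)) (?p i))"
    by (cases i rule: nat_cases6; auto simp: K6'_def lin_simps split: nat.split)+
qed
lemma slin_Z0: "slin sc Z0"
  by (rule slinI[of "\<lambda>i. if i < 3 then 0 else i - 2"])
    (auto simp: Z0_def lin_simps split: nat.split)
lemma slin_Z1: "slin sc Z1"
  by (rule slinI[of "\<lambda>i. if i = 0 then 0 else if i < 4 then 1 else i - 2"])
    (auto simp: Z1_def lin_simps split: nat.split)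
lemma slin_Z0': "slin sc Z0'"
  by (rule slinI[of "\<lambda>i. if i = 0 then 1 else if i < 4 then 0 else i - 2"])
    (auto simp: Z0'_def lin_simps split: nat.split)
lemma slin_Z1': "slin sc Z1'"
  by (rule slinI[of "\<lambda>i. if i = 3 then 0 else if i < 3 then 1 else i - 2"])
    (auto simp: Z1'_def lin_simps split: nat.split)

lemma collapse_mapt_left:
  assumes T: "slin sc T"
    and inv: "\<And>w h. tsum (Delta Q h) (\<lambda>z. pN (T (spl i (fst z) (snd z) 1 * w))) = tscale (eps Q h) (pN (T w))"
    and "y \<in> A" "u \<in> A"
  shows "mapt T (D i y \<bullet> u) = mapt T (I2 i (Ce i y) \<bullet> u)"
  unfolding mapt_def using assms by (intro collapse_left multilin_slin)

lemma collapse_mapt_right: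
  assumes T: "slin sc T"
    and inv: "\<And>w h. tsum (Delta Q h) (\<lambda>z. pN (T (w * spl i (fst z) (snd z) 1))) = tscale (eps Q h) (pN (T w))"
    and "y \<in> A" "u \<in> A"
  shows "mapt T (u \<bullet> D i y) = mapt T (u \<bullet> I2 i (Ce i y))"
  unfolding mapt_def using assms by (intro collapse_right multilin_slin)

lemma multilin_slot: "multilin (H1 Q) (\<lambda>v. pN (a * v * b ## x))" "multilin (H1 Q) (\<lambda>v. pN (c ## a * v * b ## x))"
proof -
  have l: "linear_on sc sc UNIV (\<lambda>v. a * v * b)" by (simp add: lin_simps)
  show "multilin (H1 Q) (\<lambda>v. pN (a * v * b ## x))"
    by (rule multilin_comp[OF multilin_cons l]) simp
  have "multilin (H1 Q) (\<lambda>v. pN (c ## v ## x))"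
    using multilin_pN_upd[of "c ## 0 ## x" 1] by (simp add: cons_upd)
  from multilin_comp[OF this l] show "multilin (H1 Q) (\<lambda>v. pN (c ## a * v * b ## x))" by simp
qed

text \<open>The antipode axiom for \<alpha> inside the first or the second leg, with further factors
  around it. Products are associated to the right, so that these equations rewrite the normal form
  under \<open>mult.assoc\<close>.\<close>

lemma slot_alpha:
  "tsum (Delta Q h) (\<lambda>z. pN (a * (S (fst z) * (\<alpha> * (snd z * b))) ## x)) = tscale (eps Q h) (pN (a * (\<alpha> * b) ## x))"
  "tsum (Delta Q h) (\<lambda>z. pN (c ## a * (S (fst z) * (\<alpha> * (snd z * b))) ## x)) = tscale (eps Q h) (pN (c ## a * (\<alpha> * b) ## x))"
  using antipode_alpha[OF multilin_slot(1), of h a b x] antipode_alpha[OF multilin_slot(2), of h c a b x]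
  by (simp_all add: mult.assoc)

lemma slot_beta:
  "tsum (Delta Q h) (\<lambda>z. pN (a * (fst z * (\<beta> * (S (snd z) * b))) ## x)) = tscale (eps Q h) (pN (a * (\<beta> * b) ## x))"
  "tsum (Delta Q h) (\<lambda>z. pN (c ## a * (fst z * (\<beta> * (S (snd z) * b))) ## x)) = tscale (eps Q h) (pN (c ## a * (\<beta> * b) ## x))"
  using antipode_beta[OF multilin_slot(1), of h a b x] antipode_beta[OF multilin_slot(2), of h c a b x]
  by (simp_all add: mult.assoc)

lemmas slot_alpha' = slot_alpha[where b = 1, simplified] slot_alpha[where a = 1, simplified] slot_alpha[where a = 1 and b = 1, simplified]
lemmas slot_beta' = slot_beta[where b = 1, simplified] slot_beta[where a = 1, simplified] slot_beta[where a = 1 and b = 1, simplified]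

text \<open>\<open>cop h\<close> is S(h_(2)) \<otimes> S(h_(1)). Together with \<open>ea\<close> and
  \<open>eb\<close> it will be a second antipode for the coproduct.\<close>

definition cop where "cop h = mapt rv (D 0 (j h))"
definition ea where "ea = mapt Ep \<theta>"
definition eb where "eb = mapt Eb \<theta>'"

lemma theta_W: "\<theta> \<in> W 4" "\<theta>' \<in> W 4"
  using s_W[OF phi_W(1)] s_W[OF phi_W(2)] D_W[OF phi_W(1), of 2] D_W[OF phi_W(2), of 2]
  by (simp_all add: \<theta>_def \<theta>'_def eval_nat_numeral)

lemma theta_in [simp, intro]: "\<theta> \<in> A" "\<theta>' \<in> A"
  using theta_W W_A by blast+

lemma phi_cancel: "u \<in> A \<Longrightarrow> \<phi> \<bullet> (\<phi>' \<bullet> u) = u" "u \<in> A \<Longrightarrow> \<phi>' \<bullet> (\<phi> \<bullet> u) = u"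
  by (simp_all add: phi_phi' flip: mul_assoc)

lemma D_cancel: "x \<in> A \<Longrightarrow> y \<in> A \<Longrightarrow> u \<in> A \<Longrightarrow> x \<bullet> y = pN 1 \<Longrightarrow> D i x \<bullet> (D i y \<bullet> u) = u"
  by (metis D_in D_mul D_one mul_assoc mul_one_left)
lemma s_cancel: "x \<in> A \<Longrightarrow> y \<in> A \<Longrightarrow> u \<in> A \<Longrightarrow> x \<bullet> y = pN 1 \<Longrightarrow> s x \<bullet> (s y \<bullet> u) = u"
  by (metis s_in s_mul s_one mul_assoc mul_one_left)
lemma D_cancel0: "x \<in> A \<Longrightarrow> y \<in> A \<Longrightarrow> x \<bullet> y = pN 1 \<Longrightarrow> D i x \<bullet> D i y = pN 1"
  using D_mul[of x y i] by (simp add: D_one)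
lemma s_cancel0: "x \<in> A \<Longrightarrow> y \<in> A \<Longrightarrow> x \<bullet> y = pN 1 \<Longrightarrow> s x \<bullet> s y = pN 1"
  using s_mul[of x y] by (simp add: s_pt)

lemmas cancels = phi_phi' phi_cancel D_cancel s_cancel D_cancel0 s_cancel0

lemma theta_theta': "\<theta> \<bullet> \<theta>' = pN 1" "\<theta>' \<bullet> \<theta> = pN 1"
  by (simp_all add: \<theta>_def \<theta>'_def mul_assoc cancels)

lemma inter_s: "x \<in> A \<Longrightarrow> s \<phi> \<bullet> D 1 (D 1 x) = D 2 (D 1 x) \<bullet> s \<phi>"
  using inter[of x 1] by (simp add: numeral_2_eq_2)
lemma inter_0: "x \<in> A \<Longrightarrow> \<phi> \<bullet> D 0 (D 0 x) = D 1 (D 0 x) \<bullet> \<phi>"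
  using inter[of x 0] by simp

lemma conj_inverse:
  assumes "t \<in> A" "t' \<in> A" "t \<bullet> t' = pN 1" "t' \<bullet> t = pN 1" "x \<in> A" "y \<in> A" "t \<bullet> x = y \<bullet> t"
  shows "t' \<bullet> y = x \<bullet> t'"
proof -
  have "t' \<bullet> (y \<bullet> t) \<bullet> t' = t' \<bullet> (t \<bullet> x) \<bullet> t'" using assms by simp
  moreover have "t' \<bullet> (y \<bullet> t) \<bullet> t' = t' \<bullet> y \<bullet> (t \<bullet> t')" "t' \<bullet> (t \<bullet> x) \<bullet> t' = (t' \<bullet> t) \<bullet> (x \<bullet> t')"
    using assms(1,2,5,6) by (simp_all add: mul_assoc)
  ultimately show ?thesis using assms by simp
qed

text \<open>\<open>\<theta>\<close> goes from (ab)(cd) to a((bc)d), so it conjugates the fourfold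
  coproducts of these two shapes into each other.\<close>

lemma theta_inter:
  assumes "x \<in> A" shows "\<theta> \<bullet> D 0 (D 1 (D 0 x)) = D 1 (D 1 (D 0 x)) \<bullet> \<theta>"
proof -
  have 1: "D 0 (D 1 (D 0 x)) = D 2 (D 0 (D 0 x))"
    using D_D[of "D 0 x" 0 1] assms by (simp add: numeral_2_eq_2)
  have 2: "D 2 \<phi> \<bullet> D 2 (D 0 (D 0 x)) = D 2 (D 1 (D 0 x)) \<bullet> D 2 \<phi>"
    using assms by (simp add: inter_0 flip: D_mul)
  have 3: "s \<phi>' \<bullet> D 2 (D 1 (D 0 x)) = D 1 (D 1 (D 0 x)) \<bullet> s \<phi>'"
    by (rule conj_inverse[OF _ _ _ _ _ _ inter_s[OF D_in[OF assms]]]) (use assms in \<open>simp_all add: cancels\<close>)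
  have "\<theta> \<bullet> D 0 (D 1 (D 0 x)) = s \<phi>' \<bullet> D 2 (D 1 (D 0 x)) \<bullet> D 2 \<phi>"
    unfolding 1 using assms 2 by (simp add: \<theta>_def mul_assoc)
  then show ?thesis unfolding 3 using assms by (simp add: \<theta>_def mul_assoc)
qed

lemma theta'_inter:
  "x \<in> A \<Longrightarrow> \<theta>' \<bullet> D 1 (D 1 (D 0 x)) = D 0 (D 1 (D 0 x)) \<bullet> \<theta>'"
  by (rule conj_inverse[OF _ _ _ _ _ _ theta_inter]) (simp_all add: theta_theta')

text \<open>Only the factor in slots 0 and 1, which \<open>Ep\<close> puts under S, comes out
  reversed and on the left; the factor from slot 2 on stays on the right.\<close>

lemma Ep_mul:
  assumes "t \<in> A" "u \<in> W 2" "v \<in> A"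
  shows "mapt Ep (t \<bullet> (u \<bullet> s (s v))) = mapt rv u \<bullet> (mapt Ep t \<bullet> v)"
proof -
  note [simp] = assms W_A[OF assms(2)] slin_Ep slin_rv
  show ?thesis
  proof (rule lin_ext[OF assms(1)])
    fix x
    show "mapt Ep (pN x \<bullet> (u \<bullet> s (s v))) = mapt rv u \<bullet> (mapt Ep (pN x) \<bullet> v)"
    proof (rule lin_ext_W[OF assms(2)])
      fix y :: "nat \<Rightarrow> 'h" assume y: "\<And>i. 2 \<le> i \<Longrightarrow> y i = 1"
      show "mapt Ep (pN x \<bullet> (pN y \<bullet> s (s v))) = mapt rv (pN y) \<bullet> (mapt Ep (pN x) \<bullet> v)"
      proof (rule lin_ext[OF assms(3)])
        fix z
        have "Ep (x * (y * (1 ## 1 ## z))) = rv y * (Ep x * z)"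
          using y by (auto simp: fun_eq_iff pointwise Ep_def rv_def anti_mult mult.assoc eval_nat_numeral split: nat.split)
        then show "mapt Ep (pN x \<bullet> (pN y \<bullet> s (s (pN z)))) = mapt rv (pN y) \<bullet> (mapt Ep (pN x) \<bullet> pN z)"
          by (simp add: mul_pt s_pt mapt_pt)
      qed (auto intro!: lins lin_s)
    qed (auto intro!: lins lin_s)
  qed (auto intro!: lins lin_s)
qed

lemma Eb_mul:
  assumes "t \<in> W 4" "u \<in> W 2" "v \<in> W 2"
  shows "mapt Eb ((u \<bullet> s (s v)) \<bullet> t) = u \<bullet> (mapt Eb t \<bullet> mapt rv v)"
proof -
  note [simp] = assms W_A[OF assms(1)] W_A[OF assms(2)] W_A[OF assms(3)] slin_Eb slin_rv
  show ?thesis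
  proof (rule lin_ext_W[OF assms(1)])
    fix x :: "nat \<Rightarrow> 'h" assume x: "\<And>i. 4 \<le> i \<Longrightarrow> x i = 1"
    show "mapt Eb ((u \<bullet> s (s v)) \<bullet> pN x) = u \<bullet> (mapt Eb (pN x) \<bullet> mapt rv v)"
    proof (rule lin_ext_W[OF assms(2)])
      fix y :: "nat \<Rightarrow> 'h" assume y: "\<And>i. 2 \<le> i \<Longrightarrow> y i = 1"
      show "mapt Eb ((pN y \<bullet> s (s v)) \<bullet> pN x) = pN y \<bullet> (mapt Eb (pN x) \<bullet> mapt rv v)"
      proof (rule lin_ext_W[OF assms(3)])
        fix z :: "nat \<Rightarrow> 'h" assume z: "\<And>i. 2 \<le> i \<Longrightarrow> z i = 1"
        have "Eb ((y * (1 ## 1 ## z)) * x) = y * (Eb x * rv z)"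
          using x y z by (auto simp: fun_eq_iff pointwise Eb_def rv_def anti_mult mult.assoc eval_nat_numeral split: nat.split)
        then show "mapt Eb ((pN y \<bullet> s (s (pN z))) \<bullet> pN x) = pN y \<bullet> (mapt Eb (pN x) \<bullet> mapt rv (pN z))"
          by (simp add: mul_pt s_pt mapt_pt)
      qed (auto intro!: lins lin_s)
    qed (auto intro!: lins lin_s)
  qed (auto intro!: lins lin_s)
qed

lemma D0_j: "D 0 (j h) = tsum (Delta Q h) (\<lambda>z. pN (fst z ## snd z ## 1))"
  by (simp add: j_def D_pt dk_def spl_0_cons)

lemma D0_j_W: "D 0 (j h) \<in> W 2"
  using D_W[OF j_W, of 0 h] by (simp add: numeral_2_eq_2)

lemma cop_W: "cop h \<in> W 2"
  unfolding cop_def by (rule mapt_W[OF D0_j_W slin_rv]) (auto simp: rv_def split: nat.split)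

lemma cop_in [simp, intro]: "cop h \<in> A"
  using cop_W W_A by blast

lemma ea_W: "ea \<in> W 2" and eb_W: "eb \<in> W 2"
  unfolding ea_def eb_def
  by (rule mapt_W[OF theta_W(1) slin_Ep] mapt_W[OF theta_W(2) slin_Eb]; auto simp: Ep_def Eb_def split: nat.split)+

lemma ea_in [simp, intro]: "ea \<in> A" and eb_in [simp, intro]: "eb \<in> A"
  using ea_W eb_W W_A by blast+

lemma pN_two: "pN (a ## b ## 1) = j a \<bullet> s (j b)"
  by (simp add: j_def s_pt mul_pt)

lemma pN_three: "pN (a ## b ## c ## 1) = j a \<bullet> (s (j b) \<bullet> s (s (j c)))"
  by (simp add: j_def s_pt mul_pt)

lemma D_j: "D (Suc i) (j h) = j h"
  using D_triv[OF j_W, of "Suc i" h] by simp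

lemma DDD_two: "D 0 (D 1 (pN (a ## b ## 1))) = D 0 (j a) \<bullet> s (s (D 0 (j b)))"
  by (simp add: pN_two D_mul D_j D_s D_0_s)

lemma DDD_three: "D 0 (D 1 (D 2 (pN (a ## b ## c ## 1)))) = D 0 (j a) \<bullet> (s (s (D 0 (j b))) \<bullet> s (s (s (s (D 0 (j c))))))"
  by (simp add: pN_three D_mul D_j D_s D_0_s numeral_2_eq_2)

lemma multilin_pair: "multilin (H2 Q) (\<lambda>z. pN (fst z ## snd z ## x))"
  using multilin_spl[of 0 "0 ## x"] by (simp add: spl_0_cons)

text \<open>By \<open>Ep_mul\<close> the sum is \<open>Ep\<close> of \<open>\<theta>\<close> times
  the coproduct of shape (ab)(cd). Moved to the left it has shape a((bc)d), and the antipode axiom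
  for \<alpha> removes the inner pair of slots 1, 2 and then the outer pair 0, 3.\<close>

lemma ea_inv: "tsum (Delta Q h) (\<lambda>z. cop (fst z) \<bullet> (ea \<bullet> D 0 (j (snd z)))) = tscale (eps Q h) ea"
proof -
  have "cop (fst z) \<bullet> (ea \<bullet> D 0 (j (snd z))) = mapt Ep (\<theta> \<bullet> D 0 (D 1 (pN (fst z ## snd z ## 1))))" for z
    unfolding DDD_two cop_def ea_def by (rule Ep_mul[symmetric]) (auto simp: D0_j_W)
  then have "tsum (Delta Q h) (\<lambda>z. cop (fst z) \<bullet> (ea \<bullet> D 0 (j (snd z)))) =
      mapt Ep (tsum (Delta Q h) (\<lambda>z. \<theta> \<bullet> D 0 (D 1 (pN (fst z ## snd z ## 1)))))"
    by (simp add: mapt_tsum)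
  also have "tsum (Delta Q h) (\<lambda>z. \<theta> \<bullet> D 0 (D 1 (pN (fst z ## snd z ## 1)))) =
      \<theta> \<bullet> tsum (Delta Q h) (\<lambda>z. D 0 (D 1 (pN (fst z ## snd z ## 1))))"
    by (rule mul_tsum_right[symmetric]) (auto simp: D_def intro!: multilin_tsum1 multilin_pair tsum_in multilin_dk)
  also have "\<dots> = D 1 (D 1 (D 0 (j h))) \<bullet> \<theta>"
    by (simp add: D0_j[of h, symmetric] theta_inter[of "j h", simplified] flip: D_tsum)
  also have "mapt Ep \<dots> = mapt Ep (I2 1 (D 0 (j h)) \<bullet> \<theta>)"
  proof (subst collapse_mapt_left[OF slin_Ep])
    show "tsum (Delta Q a) (\<lambda>z. pN (Ep (spl 1 (fst z) (snd z) 1 * w))) = tscale (eps Q a) (pN (Ep w))" for w a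
      by (simp add: Ep_def times_fun_apply spl_def one_fun_apply anti_mult mult.assoc slot_alpha slot_alpha')
  qed (auto simp: Ce_D_same)
  also have "\<dots> = tscale (eps Q h) (mapt Ep \<theta>)"
  proof (rule lin_ext[OF theta_in(1)])
    fix w
    have "I2 1 (D 0 (j h)) = tsum (Delta Q h) (\<lambda>z. pN (fst z ## 1 ## 1 ## snd z ## 1))"
    proof -
      have "ins 1 (ins 1 (a ## b ## 1)) = a ## 1 ## 1 ## b ## 1" for a b :: 'h
        by (auto simp: ins_def fun_eq_iff eval_nat_numeral split: nat.split)
      then show ?thesis by (simp add: D0_j I2_def mapt_tsum) (simp add: mapt_pt[OF slin_ins2])
    qed
    then show "mapt Ep (I2 1 (D 0 (j h)) \<bullet> pN w) = tscale (eps Q h) (mapt Ep (pN w))"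
      by (simp add: mul_tsum_left mul_pt mapt_tsum mapt_pt[OF slin_Ep])
        (simp add: Ep_def times_fun_apply anti_mult mult.assoc slot_alpha slot_alpha' eval_nat_numeral pointwise)
  qed (auto intro!: lins lin_tscale)
  finally show ?thesis unfolding ea_def .
qed

lemma multilin_mapt: "multilin X F \<Longrightarrow> multilin X (\<lambda>z. mapt T (F z))"
  unfolding mapt_def by (rule multilin_tsum1)

text \<open>Mirror image of \<open>ea_inv\<close>: the coproduct moves from the left of
  \<open>\<theta>'\<close> to its right, and \<beta> absorbs it there.\<close>

lemma eb_inv: "tsum (Delta Q h) (\<lambda>z. D 0 (j (fst z)) \<bullet> (eb \<bullet> cop (snd z))) = tscale (eps Q h) eb"
proof -
  have "D 0 (j (fst z)) \<bullet> (eb \<bullet> cop (snd z)) = mapt Eb (D 0 (D 1 (pN (fst z ## snd z ## 1))) \<bullet> \<theta>')" for z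
    unfolding DDD_two cop_def eb_def by (rule Eb_mul[symmetric]) (auto simp: D0_j_W theta_W)
  then have "tsum (Delta Q h) (\<lambda>z. D 0 (j (fst z)) \<bullet> (eb \<bullet> cop (snd z))) =
      mapt Eb (D 0 (D 1 (tsum (Delta Q h) (\<lambda>z. pN (fst z ## snd z ## 1)))) \<bullet> \<theta>')"
    by (simp add: mapt_tsum mul_tsum_left D_tsum)
  also have "\<dots> = mapt Eb (\<theta>' \<bullet> D 1 (D 1 (D 0 (j h))))"
    by (simp add: D0_j[of h, symmetric] theta'_inter[of "j h", simplified])
  also have "\<dots> = mapt Eb (\<theta>' \<bullet> I2 1 (D 0 (j h)))"
  proof (subst collapse_mapt_right[OF slin_Eb])
    show "tsum (Delta Q a) (\<lambda>z. pN (Eb (w * spl 1 (fst z) (snd z) 1))) = tscale (eps Q a) (pN (Eb w))" for w a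
      by (simp add: Eb_def times_fun_apply spl_def one_fun_apply anti_mult mult.assoc slot_beta slot_beta')
  qed (auto simp: Ce_D_same)
  also have "\<dots> = tscale (eps Q h) (mapt Eb \<theta>')"
  proof (rule lin_ext[OF theta_in(2)])
    fix w
    have I: "I2 1 (D 0 (j h)) = tsum (Delta Q h) (\<lambda>z. pN (fst z ## 1 ## 1 ## snd z ## 1))"
    proof -
      have "ins 1 (ins 1 (a ## b ## 1)) = a ## 1 ## 1 ## b ## 1" for a b :: 'h
        by (auto simp: ins_def fun_eq_iff eval_nat_numeral split: nat.split)
      then show ?thesis by (simp add: D0_j I2_def mapt_tsum) (simp add: mapt_pt[OF slin_ins2])
    qed
    have "multilin (H2 Q) (\<lambda>z. pN (fst z ## 1 ## 1 ## snd z ## 1))"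
    proof -
      have "ins 1 (ins 1 (a ## b ## 1)) = a ## 1 ## 1 ## b ## 1" for a b :: 'h
        by (auto simp: ins_def fun_eq_iff eval_nat_numeral split: nat.split)
      then show ?thesis
        using multilin_mapt[OF multilin_pair[of 1], of "\<lambda>x. ins 1 (ins 1 x)"] by (simp add: mapt_pt[OF slin_ins2])
    qed
    then have "pN w \<bullet> I2 1 (D 0 (j h)) = tsum (Delta Q h) (\<lambda>z. pN (w * (fst z ## 1 ## 1 ## snd z ## 1)))"
      unfolding I by (subst mul_tsum_right[OF good_H2]) (auto simp: mul_pt)
    then show "mapt Eb (pN w \<bullet> I2 1 (D 0 (j h))) = tscale (eps Q h) (mapt Eb (pN w))"
      by (simp add: mapt_tsum mapt_pt[OF slin_Eb])
        (simp add: Eb_def times_fun_apply anti_mult mult.assoc slot_beta slot_beta' eval_nat_numeral pointwise)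
  qed (auto intro!: lins lin_tscale)
  finally show ?thesis unfolding eb_def .
qed

text \<open>Collects the five factors into one word without antipodes, so that coherence applies to
  it. The factor under S occupies slots 2 and 3, between the two coproduct factors.\<close>

lemma K6_mul:
  assumes "t \<in> W 4" "t' \<in> W 4" "u \<in> W 2" "v \<in> W 2" "w \<in> W 2"
  shows "mapt K6 (s (s t) \<bullet> ((u \<bullet> (s (s v) \<bullet> s (s (s (s w))))) \<bullet> t')) = u \<bullet> (mapt Eb t' \<bullet> (mapt rv v \<bullet> (mapt Ep t \<bullet> w)))"
proof -
  note [simp] = assms assms[THEN W_A] slin_Eb slin_rv slin_Ep slin_K6 slin_K6'
  show ?thesis
  proof (rule lin_ext_W[OF assms(1), where L = "\<lambda>z. mapt K6 (s (s z) \<bullet> ((u \<bullet> (s (s v) \<bullet> s (s (s (s w))))) \<bullet> t'))"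
        and R = "\<lambda>z. u \<bullet> (mapt Eb t' \<bullet> (mapt rv v \<bullet> (mapt Ep z \<bullet> w)))"])
    fix x :: "nat \<Rightarrow> 'h" assume x: "\<And>i. 4 \<le> i \<Longrightarrow> x i = 1"
    show "mapt K6 (s (s (pN x)) \<bullet> ((u \<bullet> (s (s v) \<bullet> s (s (s (s w))))) \<bullet> t')) = u \<bullet> (mapt Eb t' \<bullet> (mapt rv v \<bullet> (mapt Ep (pN x) \<bullet> w)))"
    proof (rule lin_ext_W[OF assms(2), where L = "\<lambda>z. mapt K6 (s (s (pN x)) \<bullet> ((u \<bullet> (s (s v) \<bullet> s (s (s (s w))))) \<bullet> z))"
          and R = "\<lambda>z. u \<bullet> (mapt Eb z \<bullet> (mapt rv v \<bullet> (mapt Ep (pN x) \<bullet> w)))"])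
      fix y :: "nat \<Rightarrow> 'h" assume y: "\<And>i. 4 \<le> i \<Longrightarrow> y i = 1"
      show "mapt K6 (s (s (pN x)) \<bullet> ((u \<bullet> (s (s v) \<bullet> s (s (s (s w))))) \<bullet> (pN y))) = u \<bullet> (mapt Eb (pN y) \<bullet> (mapt rv v \<bullet> (mapt Ep (pN x) \<bullet> w)))"
      proof (rule lin_ext_W[OF assms(3), where L = "\<lambda>z. mapt K6 (s (s (pN x)) \<bullet> ((z \<bullet> (s (s v) \<bullet> s (s (s (s w))))) \<bullet> (pN y)))"
            and R = "\<lambda>z. z \<bullet> (mapt Eb (pN y) \<bullet> (mapt rv v \<bullet> (mapt Ep (pN x) \<bullet> w)))"])
        fix a :: "nat \<Rightarrow> 'h" assume a: "\<And>i. 2 \<le> i \<Longrightarrow> a i = 1"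
        show "mapt K6 (s (s (pN x)) \<bullet> (((pN a) \<bullet> (s (s v) \<bullet> s (s (s (s w))))) \<bullet> (pN y))) = (pN a) \<bullet> (mapt Eb (pN y) \<bullet> (mapt rv v \<bullet> (mapt Ep (pN x) \<bullet> w)))"
        proof (rule lin_ext_W[OF assms(4), where L = "\<lambda>z. mapt K6 (s (s (pN x)) \<bullet> (((pN a) \<bullet> (s (s z) \<bullet> s (s (s (s w))))) \<bullet> (pN y)))"
              and R = "\<lambda>z. (pN a) \<bullet> (mapt Eb (pN y) \<bullet> (mapt rv z \<bullet> (mapt Ep (pN x) \<bullet> w)))"])
          fix b :: "nat \<Rightarrow> 'h" assume b: "\<And>i. 2 \<le> i \<Longrightarrow> b i = 1"
          show "mapt K6 (s (s (pN x)) \<bullet> (((pN a) \<bullet> (s (s (pN b)) \<bullet> s (s (s (s w))))) \<bullet> (pN y))) = (pN a) \<bullet> (mapt Eb (pN y) \<bullet> (mapt rv (pN b) \<bullet> (mapt Ep (pN x) \<bullet> w)))"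
          proof (rule lin_ext_W[OF assms(5), where L = "\<lambda>z. mapt K6 (s (s (pN x)) \<bullet> (((pN a) \<bullet> (s (s (pN b)) \<bullet> s (s (s (s z))))) \<bullet> (pN y)))"
                and R = "\<lambda>z. (pN a) \<bullet> (mapt Eb (pN y) \<bullet> (mapt rv (pN b) \<bullet> (mapt Ep (pN x) \<bullet> z)))"])
            fix c :: "nat \<Rightarrow> 'h" assume c: "\<And>i. 2 \<le> i \<Longrightarrow> c i = 1"
            have "K6 ((1 ## 1 ## x) * ((a * ((1 ## 1 ## b) * (1 ## 1 ## 1 ## 1 ## c))) * y)) = a * (Eb y * (rv b * (Ep x * c)))"
              using x y a b c by (auto simp: fun_eq_iff pointwise K6_def K6'_def Ep_def Eb_def rv_def anti_mult mult.assoc eval_nat_numeral split: nat.split)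
            then show "mapt K6 (s (s (pN x)) \<bullet> (((pN a) \<bullet> (s (s (pN b)) \<bullet> s (s (s (s (pN c)))))) \<bullet> (pN y))) = (pN a) \<bullet> (mapt Eb (pN y) \<bullet> (mapt rv (pN b) \<bullet> (mapt Ep (pN x) \<bullet> (pN c))))"
              by (simp add: mul_pt s_pt mapt_pt del: cons_mult)
          qed (auto intro!: lins lin_s)
        qed (auto intro!: lins lin_s)
      qed (auto intro!: lins lin_s)
    qed (auto intro!: lins lin_s)
  qed (auto intro!: lins lin_s)
qed

lemma K6'_mul:
  assumes "t \<in> W 4" "t' \<in> W 4" "u \<in> W 2" "v \<in> W 2" "w \<in> W 2"
  shows "mapt K6' (t \<bullet> ((u \<bullet> (s (s v) \<bullet> s (s (s (s w))))) \<bullet> s (s t'))) = mapt rv u \<bullet> (mapt Ep t \<bullet> (v \<bullet> (mapt Eb t' \<bullet> mapt rv w)))"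
proof -
  note [simp] = assms assms[THEN W_A] slin_Eb slin_rv slin_Ep slin_K6 slin_K6'
  show ?thesis
  proof (rule lin_ext_W[OF assms(1), where L = "\<lambda>z. mapt K6' (z \<bullet> ((u \<bullet> (s (s v) \<bullet> s (s (s (s w))))) \<bullet> s (s t')))"
        and R = "\<lambda>z. mapt rv u \<bullet> (mapt Ep z \<bullet> (v \<bullet> (mapt Eb t' \<bullet> mapt rv w)))"])
    fix x :: "nat \<Rightarrow> 'h" assume x: "\<And>i. 4 \<le> i \<Longrightarrow> x i = 1"
    show "mapt K6' ((pN x) \<bullet> ((u \<bullet> (s (s v) \<bullet> s (s (s (s w))))) \<bullet> s (s t'))) = mapt rv u \<bullet> (mapt Ep (pN x) \<bullet> (v \<bullet> (mapt Eb t' \<bullet> mapt rv w)))"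
    proof (rule lin_ext_W[OF assms(2), where L = "\<lambda>z. mapt K6' ((pN x) \<bullet> ((u \<bullet> (s (s v) \<bullet> s (s (s (s w))))) \<bullet> s (s z)))"
          and R = "\<lambda>z. mapt rv u \<bullet> (mapt Ep (pN x) \<bullet> (v \<bullet> (mapt Eb z \<bullet> mapt rv w)))"])
      fix y :: "nat \<Rightarrow> 'h" assume y: "\<And>i. 4 \<le> i \<Longrightarrow> y i = 1"
      show "mapt K6' ((pN x) \<bullet> ((u \<bullet> (s (s v) \<bullet> s (s (s (s w))))) \<bullet> s (s (pN y)))) = mapt rv u \<bullet> (mapt Ep (pN x) \<bullet> (v \<bullet> (mapt Eb (pN y) \<bullet> mapt rv w)))"
      proof (rule lin_ext_W[OF assms(3), where L = "\<lambda>z. mapt K6' ((pN x) \<bullet> ((z \<bullet> (s (s v) \<bullet> s (s (s (s w))))) \<bullet> s (s (pN y))))"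
            and R = "\<lambda>z. mapt rv z \<bullet> (mapt Ep (pN x) \<bullet> (v \<bullet> (mapt Eb (pN y) \<bullet> mapt rv w)))"])
        fix a :: "nat \<Rightarrow> 'h" assume a: "\<And>i. 2 \<le> i \<Longrightarrow> a i = 1"
        show "mapt K6' ((pN x) \<bullet> (((pN a) \<bullet> (s (s v) \<bullet> s (s (s (s w))))) \<bullet> s (s (pN y)))) = mapt rv (pN a) \<bullet> (mapt Ep (pN x) \<bullet> (v \<bullet> (mapt Eb (pN y) \<bullet> mapt rv w)))"
        proof (rule lin_ext_W[OF assms(4), where L = "\<lambda>z. mapt K6' ((pN x) \<bullet> (((pN a) \<bullet> (s (s z) \<bullet> s (s (s (s w))))) \<bullet> s (s (pN y))))"
              and R = "\<lambda>z. mapt rv (pN a) \<bullet> (mapt Ep (pN x) \<bullet> (z \<bullet> (mapt Eb (pN y) \<bullet> mapt rv w)))"])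
          fix b :: "nat \<Rightarrow> 'h" assume b: "\<And>i. 2 \<le> i \<Longrightarrow> b i = 1"
          show "mapt K6' ((pN x) \<bullet> (((pN a) \<bullet> (s (s (pN b)) \<bullet> s (s (s (s w))))) \<bullet> s (s (pN y)))) = mapt rv (pN a) \<bullet> (mapt Ep (pN x) \<bullet> ((pN b) \<bullet> (mapt Eb (pN y) \<bullet> mapt rv w)))"
          proof (rule lin_ext_W[OF assms(5), where L = "\<lambda>z. mapt K6' ((pN x) \<bullet> (((pN a) \<bullet> (s (s (pN b)) \<bullet> s (s (s (s z))))) \<bullet> s (s (pN y))))"
                and R = "\<lambda>z. mapt rv (pN a) \<bullet> (mapt Ep (pN x) \<bullet> ((pN b) \<bullet> (mapt Eb (pN y) \<bullet> mapt rv z)))"])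
            fix c :: "nat \<Rightarrow> 'h" assume c: "\<And>i. 2 \<le> i \<Longrightarrow> c i = 1"
            have "K6' (x * ((a * ((1 ## 1 ## b) * (1 ## 1 ## 1 ## 1 ## c))) * (1 ## 1 ## y))) = rv a * (Ep x * (b * (Eb y * rv c)))"
              using x y a b c by (auto simp: fun_eq_iff pointwise K6_def K6'_def Ep_def Eb_def rv_def anti_mult mult.assoc eval_nat_numeral split: nat.split)
            then show "mapt K6' ((pN x) \<bullet> (((pN a) \<bullet> (s (s (pN b)) \<bullet> s (s (s (s (pN c)))))) \<bullet> s (s (pN y)))) = mapt rv (pN a) \<bullet> (mapt Ep (pN x) \<bullet> ((pN b) \<bullet> (mapt Eb (pN y) \<bullet> mapt rv (pN c))))"
              by (simp add: mul_pt s_pt mapt_pt del: cons_mult)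
          qed (auto intro!: lins lin_s)
        qed (auto intro!: lins lin_s)
      qed (auto intro!: lins lin_s)
    qed (auto intro!: lins lin_s)
  qed (auto intro!: lins lin_s)
qed

text \<open>With slots 3, 4 of the left factor and slots 1, 2 of the right factor empty, the two
  zigzags no longer interfere: \<open>u\<close> completes one in the second leg, and
  \<open>v\<close> the other in the first leg.\<close>

lemma K6_zigzag:
  assumes "u \<in> A" "v \<in> W 4"
  shows "mapt K6 (I2 3 u \<bullet> I2 1 v) = mapt Z1 u \<bullet> mapt Z0 v"
proof -
  note [simp] = assms W_A[OF assms(2)] slin_K6 slin_Z0 slin_Z1
  show ?thesis
  proof (rule lin_ext[OF assms(1)])
    fix x
    show "mapt K6 (I2 3 (pN x) \<bullet> I2 1 v) = mapt Z1 (pN x) \<bullet> mapt Z0 v"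
    proof (rule lin_ext_W[OF assms(2)])
      fix y :: "nat \<Rightarrow> 'h" assume y: "\<And>i. 4 \<le> i \<Longrightarrow> y i = 1"
      have "K6 (ins 3 (ins 3 x) * ins 1 (ins 1 y)) = Z1 x * Z0 y"
        using y by (auto simp: fun_eq_iff pointwise K6_def Z1_def Z0_def ins_def anti_mult mult.assoc eval_nat_numeral split: nat.split)
      then show "mapt K6 (I2 3 (pN x) \<bullet> I2 1 (pN y)) = mapt Z1 (pN x) \<bullet> mapt Z0 (pN y)"
        by (simp add: mul_pt I2_pt mapt_pt)
    qed (auto intro!: lins lin_I2)
  qed (auto intro!: lins lin_I2)
qed

lemma K6'_zigzag:
  assumes "u \<in> W 4" "v \<in> W 4"
  shows "mapt K6' (I2 1 u \<bullet> I2 3 v) = mapt Z0' v \<bullet> mapt Z1' u"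
proof -
  note [simp] = assms W_A[OF assms(1)] W_A[OF assms(2)] slin_K6' slin_Z0' slin_Z1'
  show ?thesis
  proof (rule lin_ext_W[OF assms(1)])
    fix x :: "nat \<Rightarrow> 'h" assume x: "\<And>i. 4 \<le> i \<Longrightarrow> x i = 1"
    show "mapt K6' (I2 1 (pN x) \<bullet> I2 3 v) = mapt Z0' v \<bullet> mapt Z1' (pN x)"
    proof (rule lin_ext_W[OF assms(2)])
      fix y :: "nat \<Rightarrow> 'h" assume y: "\<And>i. 4 \<le> i \<Longrightarrow> y i = 1"
      have "K6' (ins 1 (ins 1 x) * ins 3 (ins 3 y)) = Z0' y * Z1' x"
        using x y by (auto simp: fun_eq_iff pointwise K6'_def Z1'_def Z0'_def ins_def anti_mult mult.assoc eval_nat_numeral split: nat.split)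
      then show "mapt K6' (I2 1 (pN x) \<bullet> I2 3 (pN y)) = mapt Z0' (pN y) \<bullet> mapt Z1' (pN x)"
        by (simp add: mul_pt I2_pt mapt_pt)
    qed (auto intro!: lins lin_I2)
  qed (auto intro!: lins lin_I2)
qed

lemma phi_inv_tsum: "\<phi>' = tsum (phi_inv Q) (\<lambda>z. pN (fst z ## fst (snd z) ## snd (snd z) ## 1))"
  by (simp add: \<phi>'_def k3_def r3_0)

lemma multilin_cons2: "multilin (H1 Q) (\<lambda>a. pN (c ## a ## x))"
  using multilin_pN_upd[of "c ## 0 ## x" 1] by (simp add: cons_upd)

lemmas slot_simps = times_fun_apply spl_def one_fun_apply anti_mult mult.assoc slot_beta slot_beta' slot_alpha slot_alpha'

text \<open>\<alpha> absorbs the coproduct in slot 2, and then only the antipode axiom with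
  \<open>phi Q\<close> in the second leg is left.\<close>

lemma Z1_one: "mapt Z1 (D 2 \<phi>' \<bullet> s \<phi>) = pN 1"
proof -
  have "mapt Z1 (D 2 \<phi>' \<bullet> s \<phi>) = mapt Z1 (s \<phi>)"
  proof (subst collapse_mapt_left[OF slin_Z1])
    show "tsum (Delta Q a) (\<lambda>z. pN (Z1 (spl 2 (fst z) (snd z) 1 * w))) = tscale (eps Q a) (pN (Z1 w))" for w a
      using slot_alpha(2)[of a "w 0" "w 1 * \<beta> * S (w 2)" "w 3" "\<lambda>i. w (i + 4)"]
      by (simp add: Z1_def slot_simps)
  qed (auto simp: Ce_phi numeral_2_eq_2)
  also have "\<dots> = tsum (phi Q) (\<lambda>z. pN (1 ## fst z * \<beta> * S (fst (snd z)) * \<alpha> * snd (snd z) ## 1))"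
    by (simp add: phi_tsum s_tsum s_pt mapt_tsum mapt_pt[OF slin_Z1]) (simp add: Z1_def eval_nat_numeral one_fun_def)
  also have "\<dots> = pN 1" by (subst antipode_phi(1)[OF multilin_cons2]) simp
  finally show ?thesis .
qed

lemma Z0_one: "mapt Z0 (D 1 \<phi> \<bullet> \<phi> \<bullet> D 0 \<phi>') = pN 1"
proof -
  have "mapt Z0 (D 1 \<phi> \<bullet> \<phi> \<bullet> D 0 \<phi>') = mapt Z0 (D 1 \<phi> \<bullet> \<phi>)"
  proof (subst collapse_mapt_right[OF slin_Z0])
    show "tsum (Delta Q a) (\<lambda>z. pN (Z0 (w * spl 0 (fst z) (snd z) 1))) = tscale (eps Q a) (pN (Z0 w))" for w a
      by (simp add: Z0_def slot_simps)
  qed (auto simp: Ce_phi)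
  also have "\<dots> = mapt Z0 \<phi>"
  proof (subst collapse_mapt_left[OF slin_Z0])
    show "tsum (Delta Q a) (\<lambda>z. pN (Z0 (spl 1 (fst z) (snd z) 1 * w))) = tscale (eps Q a) (pN (Z0 w))" for w a
      using slot_alpha(1)[of a "w 0 * \<beta> * S (w 1)" "w 2" "w 3 ## (\<lambda>i. w (i + 4))"]
      by (simp add: Z0_def slot_simps)
  qed (auto simp: Ce_phi)
  also have "\<dots> = tsum (phi Q) (\<lambda>z. pN (fst z * \<beta> * S (fst (snd z)) * \<alpha> * snd (snd z) ## 1 ## 1))"
    by (simp add: phi_tsum mapt_tsum mapt_pt[OF slin_Z0]) (simp add: Z0_def eval_nat_numeral one_fun_apply flip: one_fun_def)
  also have "\<dots> = pN 1" by (subst antipode_phi(1)[OF multilin_cons]) simp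
  finally show ?thesis .
qed

lemma Z0'_one: "mapt Z0' (s \<phi>' \<bullet> D 2 \<phi>) = pN 1"
proof -
  have "mapt Z0' (s \<phi>' \<bullet> D 2 \<phi>) = mapt Z0' (s \<phi>')"
  proof (subst collapse_mapt_right[OF slin_Z0'])
    show "tsum (Delta Q a) (\<lambda>z. pN (Z0' (w * spl 2 (fst z) (snd z) 1))) = tscale (eps Q a) (pN (Z0' w))" for w a
      using slot_beta(1)[of a "S (w 1) * \<alpha> * w 2" "S (w 3)" "S (w 0) ## (\<lambda>i. w (i + 4))"]
      by (simp add: Z0'_def slot_simps)
  qed (auto simp: Ce_phi numeral_2_eq_2)
  also have "\<dots> = tsum (phi_inv Q) (\<lambda>z. pN (S (fst z) * \<alpha> * fst (snd z) * \<beta> * S (snd (snd z)) ## 1 ## 1))"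
    by (simp add: phi_inv_tsum s_tsum s_pt mapt_tsum mapt_pt[OF slin_Z0']) (simp add: Z0'_def eval_nat_numeral one_fun_apply flip: one_fun_def)
  also have "\<dots> = pN 1" by (subst antipode_phi(2)[OF multilin_cons]) simp
  finally show ?thesis .
qed

lemma Z1'_one: "mapt Z1' (D 0 \<phi> \<bullet> \<phi>' \<bullet> D 1 \<phi>') = pN 1"
proof -
  have "mapt Z1' (D 0 \<phi> \<bullet> \<phi>' \<bullet> D 1 \<phi>') = mapt Z1' (D 0 \<phi> \<bullet> \<phi>')"
  proof (subst collapse_mapt_right[OF slin_Z1'])
    show "tsum (Delta Q a) (\<lambda>z. pN (Z1' (w * spl 1 (fst z) (snd z) 1))) = tscale (eps Q a) (pN (Z1' w))" for w a
      using slot_beta(2)[of a "S (w 3)" "S (w 0) * \<alpha> * w 1" "S (w 2)" "\<lambda>i. w (i + 4)"]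
      by (simp add: Z1'_def slot_simps)
  qed (auto simp: Ce_phi)
  also have "\<dots> = mapt Z1' \<phi>'"
  proof (subst collapse_mapt_left[OF slin_Z1'])
    show "tsum (Delta Q a) (\<lambda>z. pN (Z1' (spl 0 (fst z) (snd z) 1 * w))) = tscale (eps Q a) (pN (Z1' w))" for w a
      by (simp add: Z1'_def slot_simps)
  qed (auto simp: Ce_phi)
  also have "\<dots> = tsum (phi_inv Q) (\<lambda>z. pN (1 ## S (fst z) * \<alpha> * fst (snd z) * \<beta> * S (snd (snd z)) ## 1))"
    by (simp add: phi_inv_tsum mapt_tsum mapt_pt[OF slin_Z1']) (simp add: Z1'_def eval_nat_numeral one_fun_def)
  also have "\<dots> = pN 1" by (subst antipode_phi(2)[OF multilin_cons2]) simp
  finally show ?thesis .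
qed

lemma upsilon_in [simp, intro]: "\<upsilon> \<in> A" "\<nu> \<in> A" "\<upsilon>' \<in> A" "\<nu>' \<in> A" "\<kappa> \<in> A" "\<Omega> \<in> A"
  by (simp_all add: \<upsilon>_def \<nu>_def \<upsilon>'_def \<nu>'_def \<kappa>_def \<Omega>_def)

lemma Ce_upsilon: "Ce 3 \<upsilon> = D 2 \<phi>' \<bullet> s \<phi>" "Ce 3 \<upsilon>' = s \<phi>' \<bullet> D 2 \<phi>"
  "Ce 1 \<nu> = D 1 \<phi> \<bullet> \<phi> \<bullet> D 0 \<phi>'" "Ce 1 \<nu>' = D 0 \<phi> \<bullet> \<phi>' \<bullet> D 1 \<phi>'"
  using Ce_D_lt[of _ "Suc 0" "Suc 0"]
  by (simp_all add: \<upsilon>_def \<nu>_def \<upsilon>'_def \<nu>'_def Ce_words Ce_phi D_one eval_nat_numeral)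

lemma phi_W4: "D i \<phi> \<in> W 4" "D i \<phi>' \<in> W 4" "\<phi> \<in> W 4" "\<phi>' \<in> W 4" "s \<phi> \<in> W 4" "s \<phi>' \<in> W 4"
  using s_W[OF phi_W(1)] s_W[OF phi_W(2)] D_W[OF phi_W(1), of i] D_W[OF phi_W(2), of i] W_mono[OF phi_W(1), of 4] W_mono[OF phi_W(2), of 4]
  by simp_all

text \<open>\<open>C1\<close> brings \<open>D 3 \<upsilon>\<close> and \<open>D 1 \<nu>\<close> to
  the two ends, where \<alpha> and \<beta> absorb the coproducts; the rest falls apart into two
  independent zigzags.\<close>

lemma K6_one: "mapt K6 (s (s \<theta>) \<bullet> (D 0 (D 1 (D 2 \<phi>)) \<bullet> \<theta>')) = pN 1"
proof -
  have "mapt K6 (s (s \<theta>) \<bullet> (D 0 (D 1 (D 2 \<phi>)) \<bullet> \<theta>')) = mapt K6 (D 3 \<upsilon> \<bullet> D 1 \<nu>)"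
    using C1 by (simp add: mul_assoc)
  also have "\<dots> = mapt K6 (I2 3 (Ce 3 \<upsilon>) \<bullet> D 1 \<nu>)"
  proof (rule collapse_mapt_left[OF slin_K6])
    show "tsum (Delta Q a) (\<lambda>z. pN (K6 (spl 3 (fst z) (snd z) 1 * w))) = tscale (eps Q a) (pN (K6 w))" for w a
      using slot_alpha(1)[of a "w 0 * \<beta> * S (w 3)" "w 4" "w 1 * \<beta> * S (w 2) * \<alpha> * w 5 ## (\<lambda>i. w (i + 6))"]
      by (simp add: K6_def slot_simps)
  qed auto
  also have "\<dots> = mapt K6 (I2 3 (Ce 3 \<upsilon>) \<bullet> I2 1 (Ce 1 \<nu>))"
  proof (rule collapse_mapt_right[OF slin_K6])
    show "tsum (Delta Q a) (\<lambda>z. pN (K6 (w * spl 1 (fst z) (snd z) 1))) = tscale (eps Q a) (pN (K6 w))" for w a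
      by (simp add: K6_def slot_simps)
  qed auto
  also have "\<dots> = mapt Z1 (Ce 3 \<upsilon>) \<bullet> mapt Z0 (Ce 1 \<nu>)"
    unfolding Ce_upsilon by (rule K6_zigzag) (auto intro!: mul_W phi_W4)
  also have "\<dots> = pN 1" unfolding Ce_upsilon Z1_one Z0_one by simp
  finally show ?thesis .
qed

lemma K6'_one: "mapt K6' (\<theta> \<bullet> (D 0 (D 1 (D 2 \<phi>')) \<bullet> s (s \<theta>'))) = pN 1"
proof -
  have "mapt K6' (\<theta> \<bullet> (D 0 (D 1 (D 2 \<phi>')) \<bullet> s (s \<theta>'))) = mapt K6' (D 1 \<nu>' \<bullet> D 3 \<upsilon>')"
    using C1_inverse by (simp add: mul_assoc)
  also have "\<dots> = mapt K6' (I2 1 (Ce 1 \<nu>') \<bullet> D 3 \<upsilon>')"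
  proof (rule collapse_mapt_left[OF slin_K6'])
    show "tsum (Delta Q a) (\<lambda>z. pN (K6' (spl 1 (fst z) (snd z) 1 * w))) = tscale (eps Q a) (pN (K6' w))" for w a
      by (simp add: K6'_def slot_simps)
  qed auto
  also have "\<dots> = mapt K6' (I2 1 (Ce 1 \<nu>') \<bullet> I2 3 (Ce 3 \<upsilon>'))"
  proof (rule collapse_mapt_right[OF slin_K6'])
    show "tsum (Delta Q a) (\<lambda>z. pN (K6' (w * spl 3 (fst z) (snd z) 1))) = tscale (eps Q a) (pN (K6' w))" for w a
      using slot_beta(2)[of a "S (w 1) * \<alpha> * w 2 * \<beta> * S (w 5)" "S (w 0) * \<alpha> * w 3" "S (w 4)" "\<lambda>i. w (i + 6)"]
      by (simp add: K6'_def slot_simps)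
  qed auto
  also have "\<dots> = mapt Z0' (Ce 3 \<upsilon>') \<bullet> mapt Z1' (Ce 1 \<nu>')"
    unfolding Ce_upsilon by (rule K6'_zigzag) (auto intro!: mul_W phi_W4)
  also have "\<dots> = pN 1" unfolding Ce_upsilon Z1'_one Z0'_one by simp
  finally show ?thesis .
qed

definition \<Delta> where "\<Delta> h = D 0 (j h)"

lemma antipodal_Delta: "antipodal \<Delta> (\<lambda>h. \<Delta> (S h)) (\<Delta> \<alpha>) (\<Delta> \<beta>)"
  using antipodal_D[OF antipodal_base, of 0] by (simp add: \<Delta>_def[abs_def])

lemma rv_mult: assumes "u \<in> W 2" "v \<in> W 2" shows "mapt rv (u \<bullet> v) = mapt rv v \<bullet> mapt rv u"
proof -
  note [simp] = assms assms[THEN W_A] slin_rv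
  show ?thesis
  proof (rule lin_ext_W[OF assms(1)])
    fix x :: "nat \<Rightarrow> 'h" assume x: "\<And>i. 2 \<le> i \<Longrightarrow> x i = 1"
    show "mapt rv (pN x \<bullet> v) = mapt rv v \<bullet> mapt rv (pN x)"
    proof (rule lin_ext_W[OF assms(2)])
      fix y :: "nat \<Rightarrow> 'h" assume y: "\<And>i. 2 \<le> i \<Longrightarrow> y i = 1"
      have "rv (x * y) = rv y * rv x"
        using x y by (auto simp: fun_eq_iff pointwise rv_def anti_mult split: nat.split)
      then show "mapt rv (pN x \<bullet> pN y) = mapt rv (pN y) \<bullet> mapt rv (pN x)"
        by (simp add: mul_pt mapt_pt)
    qed (auto intro!: lins)
  qed (auto intro!: lins)
qed

text \<open>The second antipode for the coproduct: absorption is \<open>ea_inv\<close> and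
  \<open>eb_inv\<close>, and the identities with the associator are \<open>K6_one\<close> and
  \<open>K6'_one\<close>, once the products have been collected into words.\<close>

lemma antipodal_cop: "antipodal \<Delta> cop ea eb"
  unfolding antipodal_def
proof (intro conjI allI)
  show "lmap \<Delta>" using antipodalD(1)[OF antipodal_Delta] .
  have "multilin (H1 Q) cop"
    unfolding cop_def[abs_def] D_def by (intro multilin_mapt multilin_tsum1 multilin_j)
  then show "lmap cop" by (simp add: lmap_def)
  show "cop 1 = pN 1"
    by (simp add: cop_def D_one mapt_pt[OF slin_rv]) (simp add: rv_def one_fun_apply flip: one_fun_def)
  show "cop (a * b) = cop b \<bullet> cop a" for a b
    by (simp add: cop_def j_mult D_mul rv_mult D0_j_W)
  show "tsum (Delta Q h) (\<lambda>z. cop (fst z) \<bullet> (ea \<bullet> \<Delta> (snd z))) = tscale (eps Q h) ea" for h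
    unfolding \<Delta>_def by (rule ea_inv)
  show "tsum (Delta Q h) (\<lambda>z. \<Delta> (fst z) \<bullet> (eb \<bullet> cop (snd z))) = tscale (eps Q h) eb" for h
    unfolding \<Delta>_def by (rule eb_inv)
  have m: "multilin (H3 Q) (\<lambda>z. D 0 (D 1 (D 2 (pN (fst z ## fst (snd z) ## snd (snd z) ## 1)))))"
    using multilin_r3[of 0 1] unfolding r3_0 D_def by (intro multilin_tsum1)
  have P: "D 0 (D 1 (D 2 \<phi>)) = tsum (phi Q) (\<lambda>z. D 0 (D 1 (D 2 (pN (fst z ## fst (snd z) ## snd (snd z) ## 1)))))"
    "D 0 (D 1 (D 2 \<phi>')) = tsum (phi_inv Q) (\<lambda>z. D 0 (D 1 (D 2 (pN (fst z ## fst (snd z) ## snd (snd z) ## 1)))))"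
    by (simp_all only: phi_tsum phi_inv_tsum D_tsum)
  have 1: "\<Delta> (fst z) \<bullet> (eb \<bullet> (cop (fst (snd z)) \<bullet> (ea \<bullet> \<Delta> (snd (snd z))))) =
      mapt K6 (s (s \<theta>) \<bullet> (D 0 (D 1 (D 2 (pN (fst z ## fst (snd z) ## snd (snd z) ## 1)))) \<bullet> \<theta>'))" for z
    unfolding DDD_three \<Delta>_def cop_def ea_def eb_def by (rule K6_mul[symmetric]) (auto simp: theta_W D0_j_W)
  have "tsum (phi Q) (\<lambda>z. s (s \<theta>) \<bullet> (D 0 (D 1 (D 2 (pN (fst z ## fst (snd z) ## snd (snd z) ## 1)))) \<bullet> \<theta>')) =
      s (s \<theta>) \<bullet> (D 0 (D 1 (D 2 \<phi>)) \<bullet> \<theta>')"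
    unfolding P(1) mul_tsum_left
    by (rule mul_tsum_right[OF good_H3 phi_in, symmetric]) (auto intro!: multilin_mul_left m[simplified])
  then show "tsum (phi Q) (\<lambda>z. \<Delta> (fst z) \<bullet> (eb \<bullet> (cop (fst (snd z)) \<bullet> (ea \<bullet> \<Delta> (snd (snd z)))))) = pN 1"
    unfolding 1 by (simp add: K6_one[simplified] flip: mapt_tsum)
  have 2: "cop (fst z) \<bullet> (ea \<bullet> (\<Delta> (fst (snd z)) \<bullet> (eb \<bullet> cop (snd (snd z))))) =
      mapt K6' (\<theta> \<bullet> (D 0 (D 1 (D 2 (pN (fst z ## fst (snd z) ## snd (snd z) ## 1)))) \<bullet> s (s \<theta>')))" for z
    unfolding DDD_three \<Delta>_def cop_def ea_def eb_def by (rule K6'_mul[symmetric]) (auto simp: theta_W D0_j_W)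
  have "tsum (phi_inv Q) (\<lambda>z. \<theta> \<bullet> (D 0 (D 1 (D 2 (pN (fst z ## fst (snd z) ## snd (snd z) ## 1)))) \<bullet> s (s \<theta>'))) =
      \<theta> \<bullet> (D 0 (D 1 (D 2 \<phi>')) \<bullet> s (s \<theta>'))"
    unfolding P(2) mul_tsum_left
    by (rule mul_tsum_right[OF good_H3 phi_inv(1), symmetric]) (auto intro!: multilin_mul_left m[simplified])
  then show "tsum (phi_inv Q) (\<lambda>z. cop (fst z) \<bullet> (ea \<bullet> (\<Delta> (fst (snd z)) \<bullet> (eb \<bullet> cop (snd (snd z)))))) = pN 1"
    unfolding 2 by (simp add: K6'_one[simplified] flip: mapt_tsum)
qed (auto simp: antipodalD[OF antipodal_Delta])

end

section \<open>Drinfeld's element\<close>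

context quasi_hopf_algebra begin

lemmas AD = antipodalD[OF antipodal_Delta] and AC = antipodalD[OF antipodal_cop]

lemma Delta_A [simp, intro]: "\<Delta> h \<in> A" by (simp add: \<Delta>_def)
lemma Delta_W: "\<Delta> h \<in> W 2" by (simp add: \<Delta>_def D0_j_W)

text \<open>For these two triples the gauge is the formula of Drinfeld's element with p^R written
  out; exchanging the triples gives the inverse.\<close>

definition \<F> where "\<F> = gauge cop ea \<Delta> (\<Delta> \<beta>) (\<lambda>h. \<Delta> (S h))"
definition \<F>' where "\<F>' = gauge (\<lambda>h. \<Delta> (S h)) (\<Delta> \<alpha>) \<Delta> eb cop"

lemma F_F': "\<F> \<bullet> \<F>' = pN 1" "\<F>' \<bullet> \<F> = pN 1"
  unfolding \<F>_def \<F>'_def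
  by (rule gauge_inverse[OF antipodal_Delta antipodal_cop] gauge_inverse[OF antipodal_cop antipodal_Delta])+

lemma F_g: "\<F> \<bullet> \<Delta> (S h) = cop h \<bullet> \<F>"
  unfolding \<F>_def by (rule gauge_g[OF antipodal_Delta antipodal_cop])
lemma F_r: "\<F> \<bullet> \<Delta> \<alpha> = ea"
  unfolding \<F>_def by (rule gauge_r[OF antipodal_Delta antipodal_cop])

lemma gauge_W:
  assumes "antipodal f g r t" "antipodal f g' r' t'"
    and "\<And>h. f h \<in> W n" "\<And>h. g h \<in> W n" "\<And>h. g' h \<in> W n" "r' \<in> W n" "t \<in> W n"
  shows "gauge g' r' f t g \<in> W n"
proof -
  note A1 = antipodalD[OF assms(1)] and A2 = antipodalD[OF assms(2)]
  note AA = lmapD(2)[OF A1(1)] lmapD(2)[OF A1(2)] lmapD(2)[OF A2(2)] A1(3,4) A2(3,4)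
  note ml = lmapD(1)[OF A1(1)] lmapD(1)[OF A1(2)] lmapD(1)[OF A2(2)]
  show ?thesis unfolding gauge_def
    by (rule tsum_W'[OF phi_inv(1)]) (auto simp: multilin_mprod AA assms intro!: mlins ml mul_W)
qed

lemma F_W: "\<F> \<in> W 2" "\<F>' \<in> W 2"
  unfolding \<F>_def \<F>'_def
  by (rule gauge_W[OF antipodal_Delta antipodal_cop] gauge_W[OF antipodal_cop antipodal_Delta]; simp add: Delta_W cop_W ea_W eb_W)+

lemma F_in [simp, intro]: "\<F> \<in> A" "\<F>' \<in> A"
  using F_W W_A by blast+

text \<open>Threefold versions of \<open>rv\<close> and \<open>Ep\<close>, for comparing the two
  ways of iterating the coproduct.\<close>

definition rv3 :: "(nat \<Rightarrow> 'h) \<Rightarrow> nat \<Rightarrow> 'h" where "rv3 x = S (x 2) ## S (x 1) ## S (x 0) ## (\<lambda>i. x (i + 3))"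
definition T6 :: "(nat \<Rightarrow> 'h) \<Rightarrow> nat \<Rightarrow> 'h"
  where "T6 x = S (x 2) * \<alpha> * x 3 ## S (x 1) * \<alpha> * x 4 ## S (x 0) * \<alpha> * x 5 ## (\<lambda>i. x (i + 6))"

lemma slin_rv3: "slin sc rv3"
  by (rule slinI[of "\<lambda>i. if i = 0 then 2 else if i = 1 then 1 else if i = 2 then 0 else i"])
    (auto simp: rv3_def lin_simps split: nat.split)

lemma slin_T6: "slin sc T6"
proof (rule slinI[of "\<lambda>i. if i = 0 \<or> i = 5 then 2 else if i = 1 \<or> i = 4 then 1 else if i = 2 \<or> i = 3 then 0 else i - 3"])
  fix x :: "nat \<Rightarrow> 'h" and i k :: nat and a
  let ?p = "\<lambda>i::nat. if i = 0 \<or> i = 5 then 2 else if i = 1 \<or> i = 4 then 1 else if i = 2 \<or> i = 3 then 0 else i - 3"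
  show "k \<noteq> ?p i \<Longrightarrow> T6 (x(i := a)) k = T6 x k" "linear_on sc sc UNIV (\<lambda>a. T6 (x(i := a)) (?p i))"
    by (cases i rule: nat_cases6; auto simp: T6_def lin_simps split: nat.split)+
qed

lemma W_ext2:
  assumes "u \<in> W m" "v \<in> W n" "\<And>u. u \<in> W m \<Longrightarrow> lin \<H> (\<lambda>v. L u v)" "\<And>u. u \<in> W m \<Longrightarrow> lin \<H> (\<lambda>v. R u v)"
    "\<And>v. v \<in> A \<Longrightarrow> lin \<H> (\<lambda>u. L u v)" "\<And>v. v \<in> A \<Longrightarrow> lin \<H> (\<lambda>u. R u v)"
    "\<And>x y. (\<And>i. m \<le> i \<Longrightarrow> x i = 1) \<Longrightarrow> (\<And>i. n \<le> i \<Longrightarrow> y i = 1) \<Longrightarrow> L (pN x) (pN y) = R (pN x) (pN y)"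
  shows "L u v = R u v"
proof (rule lin_ext_W[OF assms(1), where L = "\<lambda>u. L u v" and R = "\<lambda>u. R u v"])
  fix x :: "nat \<Rightarrow> 'h" assume x: "\<And>i. m \<le> i \<Longrightarrow> x i = 1"
  show "L (pN x) v = R (pN x) v"
    by (rule lin_ext_W[OF assms(2), where L = "\<lambda>v. L (pN x) v" and R = "\<lambda>v. R (pN x) v"])
      (auto intro!: assms(3,4,7) pN_W x)
qed (auto intro!: assms(5,6) W_A[OF assms(2)])

lemma rv3_mult: assumes "u \<in> W 3" "v \<in> W 3" shows "mapt rv3 (u \<bullet> v) = mapt rv3 v \<bullet> mapt rv3 u"
proof (rule W_ext2[OF assms])
  fix x y :: "nat \<Rightarrow> 'h" assume x: "\<And>i. 3 \<le> i \<Longrightarrow> x i = 1" and y: "\<And>i. 3 \<le> i \<Longrightarrow> y i = 1"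
  have "rv3 (x * y) = rv3 y * rv3 x"
    using x y by (auto simp: fun_eq_iff pointwise rv3_def anti_mult split: nat.split)
  then show "mapt rv3 (pN x \<bullet> pN y) = mapt rv3 (pN y) \<bullet> mapt rv3 (pN x)"
    by (simp add: mul_pt mapt_pt[OF slin_rv3])
qed (auto intro!: lins slin_rv3 dest: W_A)

lemma T6_right: assumes "u \<in> A" "v \<in> A" shows "mapt T6 (u \<bullet> s (s (s v))) = mapt T6 u \<bullet> v"
proof (rule lin_ext[OF assms(1)])
  fix x
  show "mapt T6 (pN x \<bullet> s (s (s v))) = mapt T6 (pN x) \<bullet> v"
  proof (rule lin_ext[OF assms(2)])
    fix y
    have "T6 (x * (1 ## 1 ## 1 ## y)) = T6 x * y"
      by (auto simp: fun_eq_iff pointwise T6_def mult.assoc eval_nat_numeral split: nat.split)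
    then show "mapt T6 (pN x \<bullet> s (s (s (pN y)))) = mapt T6 (pN x) \<bullet> pN y"
      by (simp add: mul_pt s_pt mapt_pt[OF slin_T6])
  qed (auto intro!: lins lin_s slin_T6)
qed (use assms in \<open>auto intro!: lins lin_s slin_T6\<close>)

lemma T6_left: assumes "u \<in> A" "v \<in> W 3" shows "mapt T6 (u \<bullet> v) = mapt rv3 v \<bullet> mapt T6 u"
proof (rule lin_ext[OF assms(1)])
  fix x
  show "mapt T6 (pN x \<bullet> v) = mapt rv3 v \<bullet> mapt T6 (pN x)"
  proof (rule lin_ext_W[OF assms(2)])
    fix y :: "nat \<Rightarrow> 'h" assume y: "\<And>i. 3 \<le> i \<Longrightarrow> y i = 1"
    have "T6 (x * y) = rv3 y * T6 x"
      using y by (auto simp: fun_eq_iff pointwise T6_def rv3_def anti_mult mult.assoc eval_nat_numeral split: nat.split)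
    then show "mapt T6 (pN x \<bullet> pN y) = mapt rv3 (pN y) \<bullet> mapt T6 (pN x)"
      by (simp add: mul_pt mapt_pt[OF slin_T6] mapt_pt[OF slin_rv3])
  qed (auto intro!: lins lin_s slin_T6 slin_rv3)
qed (use assms W_A in \<open>auto intro!: lins lin_s slin_T6 slin_rv3\<close>)

text \<open>The untouched first leg uses the innermost pair of slots 2, 3, so the word
  \<open>t\<close> for the other two legs leaves these slots free by \<open>I2 2\<close>.\<close>

lemma T6_outer:
  assumes "t \<in> W 4" "u \<in> W 2" "v \<in> W 2"
  shows "j (S a * \<alpha> * b) \<bullet> s (mapt rv u \<bullet> (mapt Ep t \<bullet> v)) =
    mapt T6 (I2 2 t \<bullet> (u \<bullet> (s (s (j a)) \<bullet> (s (s (s (j b))) \<bullet> s (s (s (s v)))))))"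
proof -
  let ?l = "\<lambda>t u v. j (S a * \<alpha> * b) \<bullet> s (mapt rv u \<bullet> (mapt Ep t \<bullet> v))"
  let ?r = "\<lambda>t u v. mapt T6 (I2 2 t \<bullet> (u \<bullet> (s (s (j a)) \<bullet> (s (s (s (j b))) \<bullet> s (s (s (s v)))))))"
  show "?l t u v = ?r t u v"
  proof (rule lin_ext_W[OF assms(1), where L = "\<lambda>t. ?l t u v" and R = "\<lambda>t. ?r t u v"])
  note [simp] = assms assms[THEN W_A] slin_rv slin_Ep slin_T6
  fix x :: "nat \<Rightarrow> 'h" assume x: "\<And>i. 4 \<le> i \<Longrightarrow> x i = 1"
  show "?l (pN x) u v = ?r (pN x) u v"
  proof (rule W_ext2[OF assms(2,3), where L = "?l (pN x)" and R = "?r (pN x)"])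
    fix y z :: "nat \<Rightarrow> 'h" assume y: "\<And>i. 2 \<le> i \<Longrightarrow> y i = 1" and z: "\<And>i. 2 \<le> i \<Longrightarrow> z i = 1"
    have "(S a * \<alpha> * b ## 1) * (1 ## (rv y * (Ep x * z))) =
        T6 (ins 2 (ins 2 x) * (y * ((1 ## 1 ## a ## 1) * ((1 ## 1 ## 1 ## b ## 1) * (1 ## 1 ## 1 ## 1 ## z)))))"
      using x y z by (auto simp: fun_eq_iff pointwise T6_def rv_def Ep_def ins_def anti_mult mult.assoc eval_nat_numeral split: nat.split)
    then show "?l (pN x) (pN y) (pN z) = ?r (pN x) (pN y) (pN z)"
      by (simp add: mul_pt s_pt mapt_pt I2_pt j_def del: cons_mult)
  qed (auto intro!: lins lin_s dest: W_A)
qed (use assms[THEN W_A] in \<open>auto intro!: lins lin_s lin_I2 slin_rv slin_Ep slin_T6\<close>)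
qed

text \<open>The untouched last leg uses the outermost pair of slots 0, 5, hence the shift of
  \<open>t\<close> by one slot.\<close>

lemma T6_inner:
  assumes "t \<in> W 4" "u \<in> W 2" "v \<in> W 2"
  shows "mapt rv u \<bullet> (mapt Ep t \<bullet> v) \<bullet> s (s (j (S a * \<alpha> * b))) =
    mapt T6 (s t \<bullet> (j a \<bullet> (s u \<bullet> (s (s (s v)) \<bullet> s (s (s (s (s (j b)))))))))"
proof -
  let ?l = "\<lambda>t u v. mapt rv u \<bullet> (mapt Ep t \<bullet> v) \<bullet> s (s (j (S a * \<alpha> * b)))"
  let ?r = "\<lambda>t u v. mapt T6 (s t \<bullet> (j a \<bullet> (s u \<bullet> (s (s (s v)) \<bullet> s (s (s (s (s (j b)))))))))"
  show "?l t u v = ?r t u v"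
  proof (rule lin_ext_W[OF assms(1), where L = "\<lambda>t. ?l t u v" and R = "\<lambda>t. ?r t u v"])
  note [simp] = assms assms[THEN W_A] slin_rv slin_Ep slin_T6
  fix x :: "nat \<Rightarrow> 'h" assume x: "\<And>i. 4 \<le> i \<Longrightarrow> x i = 1"
  show "?l (pN x) u v = ?r (pN x) u v"
  proof (rule W_ext2[OF assms(2,3), where L = "?l (pN x)" and R = "?r (pN x)"])
    fix y z :: "nat \<Rightarrow> 'h" assume y: "\<And>i. 2 \<le> i \<Longrightarrow> y i = 1" and z: "\<And>i. 2 \<le> i \<Longrightarrow> z i = 1"
    have "rv y * (Ep x * z) * (1 ## 1 ## S a * \<alpha> * b ## 1) =
        T6 ((1 ## x) * ((a ## 1) * ((1 ## y) * ((1 ## 1 ## 1 ## z) * (1 ## 1 ## 1 ## 1 ## 1 ## b ## 1)))))"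
      using x y z by (auto simp: fun_eq_iff pointwise T6_def rv_def Ep_def anti_mult mult.assoc eval_nat_numeral split: nat.split)
    then show "?l (pN x) (pN y) (pN z) = ?r (pN x) (pN y) (pN z)"
      by (simp add: mul_pt s_pt mapt_pt j_def del: cons_mult)
  qed (auto intro!: lins lin_s dest: W_A)
qed (use assms[THEN W_A] in \<open>auto intro!: lins lin_s slin_rv slin_Ep slin_T6\<close>)
qed

lemma F_antipode: "\<F> \<bullet> \<Delta> (S a * \<alpha> * b) = cop a \<bullet> (ea \<bullet> \<Delta> b)"
proof -
  have "\<F> \<bullet> \<Delta> (S a * \<alpha> * b) = (\<F> \<bullet> \<Delta> (S a)) \<bullet> \<Delta> \<alpha> \<bullet> \<Delta> b"
    by (simp add: AD mul_assoc)
  also have "\<dots> = cop a \<bullet> (\<F> \<bullet> \<Delta> \<alpha>) \<bullet> \<Delta> b"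
    unfolding F_g by (simp add: mul_assoc)
  finally show ?thesis unfolding F_r by (simp add: mul_assoc)
qed

lemma pN_four: "pN (a ## b ## c ## d ## 1) = j a \<bullet> (s (j b) \<bullet> (s (s (j c)) \<bullet> s (s (s (j d)))))"
  by (simp add: j_def s_pt mul_pt)

text \<open>By \<open>F_antipode\<close>, \<open>\<F>\<close> trades the coproduct of the second leg
  S(x0) \<alpha> x3 for a product with \<open>cop\<close> and \<open>ea\<close>, in which antipodes
  stand only where \<open>T6\<close> puts them.\<close>

lemma sF_D1_ea: "s \<F> \<bullet> D 1 ea = mapt T6 (I2 2 \<theta> \<bullet> D 0 (D 3 \<theta>))"
  unfolding ea_def
proof (rule lin_ext_W[OF theta_W(1), where L = "\<lambda>t. s \<F> \<bullet> D 1 (mapt Ep t)" and R = "\<lambda>t. mapt T6 (I2 2 \<theta> \<bullet> D 0 (D 3 t))"])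
  fix x :: "nat \<Rightarrow> 'h" assume x: "\<And>i. 4 \<le> i \<Longrightarrow> x i = 1"
  have x4: "x = x 0 ## x 1 ## x 2 ## x 3 ## 1"
    using x by (auto simp: fun_eq_iff one_fun_apply eval_nat_numeral split: nat.split)
  have "Ep x = S (x 1) * \<alpha> * x 2 ## S (x 0) * \<alpha> * x 3 ## 1"
    using x by (auto simp: Ep_def fun_eq_iff one_fun_apply split: nat.split)
  then have "D 1 (mapt Ep (pN x)) = j (S (x 1) * \<alpha> * x 2) \<bullet> s (\<Delta> (S (x 0) * \<alpha> * x 3))"
    by (simp add: mapt_pt[OF slin_Ep] pN_two D_mul D_j D_s \<Delta>_def)
  then have "s \<F> \<bullet> D 1 (mapt Ep (pN x)) = j (S (x 1) * \<alpha> * x 2) \<bullet> s (\<F> \<bullet> \<Delta> (S (x 0) * \<alpha> * x 3))"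
    using comm[OF j_W, of \<F>] by (simp add: s_mul) (simp flip: mul_assoc)
  also have "\<dots> = mapt T6 (I2 2 \<theta> \<bullet> (\<Delta> (x 0) \<bullet> (s (s (j (x 1))) \<bullet> (s (s (s (j (x 2)))) \<bullet> s (s (s (s (\<Delta> (x 3)))))))))"
    unfolding F_antipode cop_def ea_def \<Delta>_def[symmetric] by (rule T6_outer) (auto simp: theta_W Delta_W)
  also have "(\<Delta> (x 0) \<bullet> (s (s (j (x 1))) \<bullet> (s (s (s (j (x 2)))) \<bullet> s (s (s (s (\<Delta> (x 3)))))))) = D 0 (D 3 (pN x))"
    by (subst x4) (simp add: pN_four D_mul D_j D_s_pos D_0_s \<Delta>_def eval_nat_numeral)
  finally show "s \<F> \<bullet> D 1 (mapt Ep (pN x)) = mapt T6 (I2 2 \<theta> \<bullet> D 0 (D 3 (pN x)))" .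
qed (auto intro!: lins slin_Ep slin_T6)

lemma F_D0_ea: "\<F> \<bullet> D 0 ea = mapt T6 (s \<theta> \<bullet> D 1 (D 2 \<theta>))"
  unfolding ea_def
proof (rule lin_ext_W[OF theta_W(1), where L = "\<lambda>t. \<F> \<bullet> D 0 (mapt Ep t)" and R = "\<lambda>t. mapt T6 (s \<theta> \<bullet> D 1 (D 2 t))"])
  fix x :: "nat \<Rightarrow> 'h" assume x: "\<And>i. 4 \<le> i \<Longrightarrow> x i = 1"
  have x4: "x = x 0 ## x 1 ## x 2 ## x 3 ## 1"
    using x by (auto simp: fun_eq_iff one_fun_apply eval_nat_numeral split: nat.split)
  have "Ep x = S (x 1) * \<alpha> * x 2 ## S (x 0) * \<alpha> * x 3 ## 1"
    using x by (auto simp: Ep_def fun_eq_iff one_fun_apply split: nat.split)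
  then have "D 0 (mapt Ep (pN x)) = \<Delta> (S (x 1) * \<alpha> * x 2) \<bullet> s (s (j (S (x 0) * \<alpha> * x 3)))"
    by (simp add: mapt_pt[OF slin_Ep] pN_two D_mul D_0_s \<Delta>_def)
  then have "\<F> \<bullet> D 0 (mapt Ep (pN x)) = cop (x 1) \<bullet> (ea \<bullet> \<Delta> (x 2)) \<bullet> s (s (j (S (x 0) * \<alpha> * x 3)))"
    by (simp flip: F_antipode mul_assoc)
  also have "\<dots> = mapt T6 (s \<theta> \<bullet> (j (x 0) \<bullet> (s (\<Delta> (x 1)) \<bullet> (s (s (s (\<Delta> (x 2)))) \<bullet> s (s (s (s (s (j (x 3))))))))))"
    unfolding cop_def ea_def \<Delta>_def[symmetric] by (rule T6_inner) (auto simp: theta_W Delta_W)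
  also have "j (x 0) \<bullet> (s (\<Delta> (x 1)) \<bullet> (s (s (s (\<Delta> (x 2)))) \<bullet> s (s (s (s (s (j (x 3)))))))) = D 1 (D 2 (pN x))"
    by (subst x4) (simp add: pN_four D_mul D_j D_s_pos D_0_s \<Delta>_def eval_nat_numeral)
  finally show "\<F> \<bullet> D 0 (mapt Ep (pN x)) = mapt T6 (s \<theta> \<bullet> D 1 (D 2 (pN x)))" .
qed (auto intro!: lins slin_Ep slin_T6)

lemma Ce_kappa: "Ce 2 \<kappa> = \<theta>"
  using Ce_D_lt[of _ "Suc 0" "Suc 0"]
  by (simp add: \<kappa>_def \<theta>_def Ce_words Ce_phi eval_nat_numeral s_pt)

text \<open>The two threefold expansions of \<open>ea\<close> differ by the associator: this is
  \<open>C2\<close> read under \<open>T6\<close>.\<close>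

lemma sF_D1_ea_phi: "s \<F> \<bullet> D 1 ea \<bullet> \<phi> = mapt rv3 \<phi> \<bullet> (\<F> \<bullet> D 0 ea)"
proof -
  have "s \<F> \<bullet> D 1 ea \<bullet> \<phi> = mapt T6 (I2 2 \<theta> \<bullet> (D 0 (D 3 \<theta>) \<bullet> s (s (s \<phi>))))"
    unfolding sF_D1_ea using T6_right[of "I2 2 \<theta> \<bullet> D 0 (D 3 \<theta>)" \<phi>] by (simp add: mul_assoc)
  \<comment> \<open>Absorption is used backwards: \<open>I2 2 \<theta>\<close> is
    \<open>I2 2 (Ce 2 \<kappa>)\<close>, and a coproduct is created to make \<open>C2\<close>
    fit.\<close>
  also have "\<dots> = mapt T6 (D 2 \<kappa> \<bullet> (D 0 (D 3 \<theta>) \<bullet> s (s (s \<phi>))))"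
  proof (subst collapse_mapt_left[OF slin_T6])
    show "tsum (Delta Q a) (\<lambda>z. pN (T6 (spl 2 (fst z) (snd z) 1 * w))) = tscale (eps Q a) (pN (T6 w))" for w a
      by (simp add: T6_def slot_simps)
  qed (auto simp: Ce_kappa)
  also have "\<dots> = mapt T6 ((s \<theta> \<bullet> D 1 (D 2 \<theta>)) \<bullet> \<phi>)"
    using C2 by (simp add: mul_assoc)
  also have "\<dots> = mapt rv3 \<phi> \<bullet> mapt T6 (s \<theta> \<bullet> D 1 (D 2 \<theta>))"
    by (rule T6_left) (auto simp: phi_W)
  finally show ?thesis unfolding F_D0_ea .
qed

lemma cop_tsum: "cop h = tsum (Delta Q h) (\<lambda>z. j (S (snd z)) \<bullet> s (j (S (fst z))))"
proof -
  have "rv (a ## b ## 1) = S b ## S a ## 1" for a b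
    by (auto simp: rv_def fun_eq_iff one_fun_apply split: nat.split)
  then show ?thesis
    by (simp add: cop_def D0_j mapt_tsum mapt_pt[OF slin_rv] pN_two[symmetric])
qed

lemma rv3_pair:
  assumes "u \<in> W 2"
  shows "mapt rv3 (u \<bullet> s (s (j b))) = j (S b) \<bullet> s (mapt rv u)" "mapt rv3 (j b \<bullet> s u) = mapt rv u \<bullet> s (s (j (S b)))"
proof -
  have "rv3 (x * (1 ## 1 ## b ## 1)) = (S b ## 1) * (1 ## rv x)" "rv3 ((b ## 1) * (1 ## x)) = rv x * (1 ## 1 ## S b ## 1)"
    if x: "\<And>i. 2 \<le> i \<Longrightarrow> x i = 1" for x
    using x by (auto simp: fun_eq_iff pointwise rv3_def rv_def eval_nat_numeral split: nat.split)
  note eq = this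
  show "mapt rv3 (u \<bullet> s (s (j b))) = j (S b) \<bullet> s (mapt rv u)"
    by (rule lin_ext_W[OF assms])
      (auto intro!: lins lin_s slin_rv simp: j_def s_pt mul_pt mapt_pt[OF slin_rv] mapt_pt[OF slin_rv3] eq simp del: cons_mult)
  show "mapt rv3 (j b \<bullet> s u) = mapt rv u \<bullet> s (s (j (S b)))"
    by (rule lin_ext_W[OF assms])
      (auto intro!: lins lin_s slin_rv simp: j_def s_pt mul_pt mapt_pt[OF slin_rv] mapt_pt[OF slin_rv3] eq simp del: cons_mult)
qed

lemma Delta_tsum: "\<Delta> h = tsum (Delta Q h) (\<lambda>z. j (fst z) \<bullet> s (j (snd z)))"
  by (simp add: \<Delta>_def D0_j pN_two)

lemma multilin_jSS: "multilin (H2 Q) (\<lambda>z. j (S (snd z)) \<bullet> s (j (S (fst z))))"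
proof -
  have *: "multilin (H1 Q) (\<lambda>a. j (S a))" using lmapD(1)[OF antipodalD(2)[OF antipodal_base]] .
  moreover have "multilin (H1 Q) (\<lambda>a. s (j (S a)))" using * unfolding s_def by (rule multilin_mapt)
  ultimately show ?thesis by (auto simp: multilin_mprod intro!: mlins)
qed

lemma multilin_s: "multilin X F \<Longrightarrow> multilin X (\<lambda>z. s (F z))"
  unfolding s_def by (rule multilin_mapt)
lemma multilin_D: "multilin X F \<Longrightarrow> multilin X (\<lambda>z. D i (F z))"
  unfolding D_def by (rule multilin_tsum1)

text \<open>The legs of \<open>cop\<close> are reversed, so splitting its second leg splits the
  first leg of \<open>\<Delta> h\<close>; \<open>F_g\<close> moves the antipode out of that
  coproduct.\<close>

lemma sF_D1_cop: "s \<F> \<bullet> D 1 (cop h) = mapt rv3 (D 0 (\<Delta> h)) \<bullet> s \<F>"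
proof -
  have "s \<F> \<bullet> D 1 (j (S b) \<bullet> s (j (S a))) = mapt rv3 (D 0 (j a \<bullet> s (j b))) \<bullet> s \<F>" for a b
  proof -
    have "s \<F> \<bullet> D 1 (j (S b) \<bullet> s (j (S a))) = (s \<F> \<bullet> j (S b)) \<bullet> s (\<Delta> (S a))"
      by (simp add: D_mul D_j D_s \<Delta>_def mul_assoc)
    also have "s \<F> \<bullet> j (S b) = j (S b) \<bullet> s \<F>"
      using comm[OF j_W, of \<F> "S b"] by simp
    also have "\<dots> \<bullet> s (\<Delta> (S a)) = j (S b) \<bullet> s (\<F> \<bullet> \<Delta> (S a))"
      by (simp add: s_mul mul_assoc)
    also have "\<dots> = j (S b) \<bullet> s (cop a) \<bullet> s \<F>"
      unfolding F_g by (simp add: s_mul mul_assoc)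
    finally show ?thesis
      using rv3_pair(1)[OF Delta_W, of a b] by (simp add: D_mul D_0_s cop_def \<Delta>_def)
  qed
  note eq = this
  have "s \<F> \<bullet> D 1 (cop h) = tsum (Delta Q h) (\<lambda>z. s \<F> \<bullet> D 1 (j (S (snd z)) \<bullet> s (j (S (fst z)))))"
    unfolding cop_tsum D_tsum by (rule mul_tsum_right) (auto intro!: multilin_D[of _ _ "Suc 0"] multilin_jSS)
  also have "\<dots> = mapt rv3 (D 0 (\<Delta> h)) \<bullet> s \<F>"
    unfolding eq Delta_tsum D_tsum mapt_tsum mul_tsum_left ..
  finally show ?thesis .
qed

lemma F_D0_cop: "\<F> \<bullet> D 0 (cop h) = mapt rv3 (D 1 (\<Delta> h)) \<bullet> \<F>"
proof -
  have "\<F> \<bullet> D 0 (j (S b) \<bullet> s (j (S a))) = mapt rv3 (D 1 (j a \<bullet> s (j b))) \<bullet> \<F>" for a b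
  proof -
    have "\<F> \<bullet> D 0 (j (S b) \<bullet> s (j (S a))) = (\<F> \<bullet> \<Delta> (S b)) \<bullet> s (s (j (S a)))"
      by (simp add: D_mul D_0_s \<Delta>_def mul_assoc)
    also have "\<dots> = cop b \<bullet> (s (s (j (S a))) \<bullet> \<F>)"
      unfolding F_g using comm[OF F_W(1), of "j (S a)"] by (simp add: mul_assoc numeral_2_eq_2)
    finally show ?thesis
      using rv3_pair(2)[OF Delta_W, of a b] by (simp add: D_mul D_s D_j cop_def \<Delta>_def mul_assoc slin_rv)
  qed
  note eq = this
  have "\<F> \<bullet> D 0 (cop h) = tsum (Delta Q h) (\<lambda>z. \<F> \<bullet> D 0 (j (S (snd z)) \<bullet> s (j (S (fst z)))))"
    unfolding cop_tsum D_tsum by (rule mul_tsum_right) (auto intro!: multilin_D multilin_jSS)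
  also have "\<dots> = mapt rv3 (D 1 (\<Delta> h)) \<bullet> \<F>"
    unfolding eq Delta_tsum D_tsum mapt_tsum mul_tsum_left ..
  finally show ?thesis .
qed

text \<open>Both sides intertwine the threefold coproduct of S(h) with the reversed image under S
  \<otimes> S \<otimes> S of that of \<open>h\<close>, and they agree after multiplication by the
  threefold coproduct of \<alpha>; \<open>antipodal_unique\<close> makes them equal.\<close>

lemma F_phi: "s \<F> \<bullet> D 1 \<F> \<bullet> \<phi> = mapt rv3 \<phi> \<bullet> \<F> \<bullet> D 0 \<F>"
proof (rule antipodal_unique[OF antipodal_D[OF antipodal_Delta, of 0], where g' = "\<lambda>h. mapt rv3 (D 0 (\<Delta> h))"])
  have W3: "D i (\<Delta> h) \<in> W 3" for i h using D_W[OF Delta_W, of i h] by simp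
  have *: "D 0 \<F> \<bullet> D 0 (\<Delta> (S h)) = D 0 (cop h) \<bullet> D 0 \<F>" "D 1 \<F> \<bullet> D 1 (\<Delta> (S h)) = D 1 (cop h) \<bullet> D 1 \<F>" for h
    by (simp_all add: F_g flip: D_mul)
  have **: "\<phi> \<bullet> D 0 (\<Delta> h) = D 1 (\<Delta> h) \<bullet> \<phi>" for h
    using inter_0[of "j h"] by (simp add: \<Delta>_def)
  fix h
  have "s \<F> \<bullet> D 1 \<F> \<bullet> \<phi> \<bullet> D 0 (\<Delta> (S h)) = s \<F> \<bullet> (D 1 \<F> \<bullet> D 1 (\<Delta> (S h))) \<bullet> \<phi>"
    using **[of "S h"] by (simp add: mul_assoc)
  also have "\<dots> = (s \<F> \<bullet> D 1 (cop h)) \<bullet> D 1 \<F> \<bullet> \<phi>"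
    unfolding * by (simp add: mul_assoc)
  also have "\<dots> = mapt rv3 (D 0 (\<Delta> h)) \<bullet> (s \<F> \<bullet> D 1 \<F> \<bullet> \<phi>)"
    unfolding sF_D1_cop by (simp add: mul_assoc slin_rv3)
  finally show "s \<F> \<bullet> D 1 \<F> \<bullet> \<phi> \<bullet> D 0 (\<Delta> (S h)) = mapt rv3 (D 0 (\<Delta> h)) \<bullet> (s \<F> \<bullet> D 1 \<F> \<bullet> \<phi>)" .
  have "mapt rv3 \<phi> \<bullet> \<F> \<bullet> D 0 \<F> \<bullet> D 0 (\<Delta> (S h)) = mapt rv3 \<phi> \<bullet> (\<F> \<bullet> (D 0 \<F> \<bullet> D 0 (\<Delta> (S h))))"
    by (simp add: mul_assoc slin_rv3)
  also have "\<dots> = mapt rv3 \<phi> \<bullet> ((\<F> \<bullet> D 0 (cop h)) \<bullet> D 0 \<F>)"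
    unfolding * by (simp add: mul_assoc slin_rv3)
  also have "\<dots> = (mapt rv3 \<phi> \<bullet> mapt rv3 (D 1 (\<Delta> h))) \<bullet> (\<F> \<bullet> D 0 \<F>)"
    unfolding F_D0_cop by (simp add: mul_assoc slin_rv3)
  also have "mapt rv3 \<phi> \<bullet> mapt rv3 (D 1 (\<Delta> h)) = mapt rv3 (D 0 (\<Delta> h)) \<bullet> mapt rv3 \<phi>"
    using rv3_mult[OF W3[of 1 h] phi_W(1)] rv3_mult[OF phi_W(1) W3[of 0 h]] ** by simp
  finally show "mapt rv3 \<phi> \<bullet> \<F> \<bullet> D 0 \<F> \<bullet> D 0 (\<Delta> (S h)) = mapt rv3 (D 0 (\<Delta> h)) \<bullet> (mapt rv3 \<phi> \<bullet> \<F> \<bullet> D 0 \<F>)"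
    by (simp add: mul_assoc slin_rv3)
next
  have "\<phi> \<bullet> D 0 (\<Delta> \<alpha>) = D 1 (\<Delta> \<alpha>) \<bullet> \<phi>"
    using inter_0[of "j \<alpha>"] by (simp add: \<Delta>_def)
  then have "s \<F> \<bullet> D 1 \<F> \<bullet> \<phi> \<bullet> D 0 (\<Delta> \<alpha>) = s \<F> \<bullet> (D 1 \<F> \<bullet> D 1 (\<Delta> \<alpha>)) \<bullet> \<phi>"
    by (simp add: mul_assoc)
  also have "\<dots> = s \<F> \<bullet> D 1 ea \<bullet> \<phi>" by (simp add: F_r flip: D_mul)
  also have "\<dots> = mapt rv3 \<phi> \<bullet> \<F> \<bullet> (D 0 \<F> \<bullet> D 0 (\<Delta> \<alpha>))"
    unfolding sF_D1_ea_phi by (simp add: F_r mul_assoc slin_rv3 flip: D_mul)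
  finally show "s \<F> \<bullet> D 1 \<F> \<bullet> \<phi> \<bullet> D 0 (\<Delta> \<alpha>) = mapt rv3 \<phi> \<bullet> \<F> \<bullet> D 0 \<F> \<bullet> D 0 (\<Delta> \<alpha>)"
    by (simp add: mul_assoc slin_rv3)
qed (auto simp: slin_rv3)

lemma F'_phi: "\<phi>' \<bullet> (D 1 \<F>' \<bullet> s \<F>') = D 0 \<F>' \<bullet> (\<F>' \<bullet> mapt rv3 \<phi>')"
proof -
  have r: "mapt rv3 \<phi>' \<bullet> mapt rv3 \<phi> = pN 1"
  proof -
    have "mapt rv3 (pN 1) = pN 1"
      by (simp add: mapt_pt[OF slin_rv3]) (simp add: rv3_def one_fun_apply flip: one_fun_def)
    then show ?thesis using rv3_mult[OF phi_W] by (simp add: phi_phi')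
  qed
  let ?x = "s \<F> \<bullet> D 1 \<F> \<bullet> \<phi>" and ?l = "\<phi>' \<bullet> (D 1 \<F>' \<bullet> s \<F>')" and ?r = "D 0 \<F>' \<bullet> (\<F>' \<bullet> mapt rv3 \<phi>')"
  have "?x \<bullet> ?l = pN 1"
    by (simp add: mul_assoc cancels F_F')
  moreover have "?r \<bullet> ?x = pN 1"
  proof -
    have "mapt rv3 \<phi>' \<bullet> (mapt rv3 \<phi> \<bullet> u) = u" "\<F>' \<bullet> (\<F> \<bullet> u) = u" if "u \<in> A" for u
      using that r F_F' by (simp_all add: slin_rv3 flip: mul_assoc)
    then show ?thesis unfolding F_phi by (simp add: mul_assoc slin_rv3 cancels F_F')
  qed
  \<comment> \<open>\<open>?x\<close> has the right inverse \<open>?l\<close> and the left inverse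
    \<open>?r\<close>, so these coincide.\<close>
  ultimately have "?r \<bullet> (?x \<bullet> ?l) = ?r" "(?r \<bullet> ?x) \<bullet> ?l = ?l" by (simp_all add: slin_rv3)
  moreover have "?r \<bullet> (?x \<bullet> ?l) = (?r \<bullet> ?x) \<bullet> ?l" by (rule mul_assoc[symmetric]) (auto simp: slin_rv3)
  ultimately show ?thesis by simp
qed

end

section \<open>The coaction of a free comodule\<close>

context quasi_hopf_algebra begin

text \<open>\<open>M5\<close> multiplies out \<open>\<omega>\<^sub>1 a\<^sub>1 \<omega>\<^sub>5 \<otimes> \<omega>\<^sub>2 a\<^sub>2 \<omega>\<^sub>4 \<otimes> \<omega>\<^sub>3\<close>: slots 0 to 4 hold \<open>\<omega>\<close> without \<open>S\<close> and
  \<open>f\<^sup>-\<^sup>1\<close>, and slots 5 and 6 hold \<open>\<Delta> a\<close> times \<open>f\<^sup>-\<^sup>1\<close>.\<close>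

definition M5 :: "(nat \<Rightarrow> 'h) \<Rightarrow> nat \<Rightarrow> 'h"
  where "M5 x = x 0 * x 5 * S (x 4) ## x 1 * x 6 * S (x 3) ## x 2 ## (\<lambda>i. x (i + 7))"
text \<open>The counterpart for the coaction applied twice: a word with seven slots in slots 0 to 6,
  and in slots 7 to 9 the threefold coproduct of \<open>a\<close> with its inverse Drinfeld
  factors.\<close>

definition M7 :: "(nat \<Rightarrow> 'h) \<Rightarrow> nat \<Rightarrow> 'h"
  where "M7 x = x 0 * x 7 * S (x 6) ## x 1 * x 8 * S (x 5) ## x 2 * x 9 * S (x 4) ## x 3 ## (\<lambda>i. x (i + 10))"

lemma nat_cases10:
  obtains "i = 0" | "i = 1" | "i = 2" | "i = 3" | "i = 4" | "i = 5" | "i = 6" | "i = 7" | "i = 8" | "i = 9" | n where "i = n + (10::nat)"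
proof -
  have "i = 0 \<or> i = 1 \<or> i = 2 \<or> i = 3 \<or> i = 4 \<or> i = 5 \<or> i = 6 \<or> i = 7 \<or> i = 8 \<or> i = 9 \<or> i = (i - 10) + 10" by presburger
  then show thesis using that by metis
qed

lemma slin_M5: "slin sc M5"
proof (rule slinI[of "\<lambda>i. if i = 0 \<or> i = 4 \<or> i = 5 then 0 else if i = 1 \<or> i = 3 \<or> i = 6 then 1 else if i = 2 then 2 else i - 4"])
  fix x :: "nat \<Rightarrow> 'h" and i k :: nat and a
  let ?p = "\<lambda>i::nat. if i = 0 \<or> i = 4 \<or> i = 5 then 0 else if i = 1 \<or> i = 3 \<or> i = 6 then 1 else if i = 2 then 2 else i - 4"
  show "k \<noteq> ?p i \<Longrightarrow> M5 (x(i := a)) k = M5 x k" "linear_on sc sc UNIV (\<lambda>a. M5 (x(i := a)) (?p i))"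
    by (cases i rule: nat_cases10; auto simp: M5_def lin_simps split: nat.split)+
qed

lemma slin_M7: "slin sc M7"
proof (rule slinI[of "\<lambda>i. if i = 0 \<or> i = 6 \<or> i = 7 then 0 else if i = 1 \<or> i = 5 \<or> i = 8 then 1 else if i = 2 \<or> i = 4 \<or> i = 9 then 2 else if i = 3 then 3 else i - 6"])
  fix x :: "nat \<Rightarrow> 'h" and i k :: nat and a
  let ?p = "\<lambda>i::nat. if i = 0 \<or> i = 6 \<or> i = 7 then 0 else if i = 1 \<or> i = 5 \<or> i = 8 then 1 else if i = 2 \<or> i = 4 \<or> i = 9 then 2 else if i = 3 then 3 else i - 6"
  show "k \<noteq> ?p i \<Longrightarrow> M7 (x(i := a)) k = M7 x k" "linear_on sc sc UNIV (\<lambda>a. M7 (x(i := a)) (?p i))"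
    by (cases i rule: nat_cases10; auto simp: M7_def lin_simps split: nat.split)+
qed

lemma Omega_W: "\<Omega> \<in> W 5"
proof -
  have "\<phi> \<bullet> D 0 \<phi>' \<in> W 4" by (intro mul_W phi_W4)
  from D_W[OF this, of 1] W_mono[OF phi_W(1), of 5] show ?thesis
    by (simp add: \<Omega>_def mul_W)
qed

text \<open>\<open>cfree a\<close> is the coaction of \<open>a \<otimes> v\<close>, with the element acting on \<open>v\<close> in the third slot.\<close>

definition cfree where "cfree a = mapt M5 (\<Omega> \<bullet> (s ^^ 5) (\<Delta> a \<bullet> \<F>'))"

lemma M5_W: assumes "u \<in> W 5" "v \<in> W 2" shows "mapt M5 (u \<bullet> (s ^^ 5) v) \<in> W 3"
proof -
  have "u \<bullet> (s ^^ 5) v \<in> W 7" using sp_W[OF assms(2), of 5] W_mono[OF assms(1), of 7] by (simp add: mul_W)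
  then show ?thesis by (rule mapt_W[OF _ slin_M5]) (auto simp: M5_def eval_nat_numeral split: nat.split)
qed

lemma cfree_W: "cfree a \<in> W 3"
  unfolding cfree_def by (intro M5_W Omega_W mul_W Delta_W F_W)
lemma cfree_in [simp, intro]: "cfree a \<in> A"
  using cfree_W W_A by blast

lemma multilin_cfree: "multilin (H1 Q) cfree"
  unfolding cfree_def[abs_def]
proof (intro multilin_mapt multilin_mul_right)
  have "multilin (H1 Q) (\<lambda>a. \<Delta> a \<bullet> \<F>')" using lmapD(1)[OF AD(1)] by (rule multilin_mul_left)
  then show "multilin (H1 Q) (\<lambda>a. (s ^^ 5) (\<Delta> a \<bullet> \<F>'))" by (simp add: multilin_s eval_nat_numeral)
qed auto

lemma shift_pt: "(s ^^ n) (pN x) = pN (\<lambda>i. if i < n then 1 else x (i - n))"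
  by (rule sp_pt)

text \<open>A factor next to the coproduct of \<open>a\<close> can be handed over to the word: from
  the left it joins slots 0 and 1, and from the right, where it is reversed by \<open>rv\<close>, it
  joins slots 3 and 4.\<close>

lemma M5_move:
  assumes "x \<in> W 5" "y \<in> W 2" "u \<in> W 2" "v \<in> W 2"
  shows "mapt M5 (x \<bullet> (s ^^ 5) (u \<bullet> (y \<bullet> mapt rv v))) = mapt M5 ((x \<bullet> (u \<bullet> s (s (s v)))) \<bullet> (s ^^ 5) y)"
proof -
  let ?l = "\<lambda>x y u v. mapt M5 (x \<bullet> (s ^^ 5) (u \<bullet> (y \<bullet> mapt rv v)))"
  let ?r = "\<lambda>x y u v. mapt M5 ((x \<bullet> (u \<bullet> s (s (s v)))) \<bullet> (s ^^ 5) y)"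
  note [simp] = assms[THEN W_A] slin_M5 slin_rv
  show "?l x y u v = ?r x y u v"
  proof (rule W_ext2[OF assms(1,2), where L = "\<lambda>x y. ?l x y u v" and R = "\<lambda>x y. ?r x y u v"])
    fix p q :: "nat \<Rightarrow> 'h" assume p: "\<And>i. 5 \<le> i \<Longrightarrow> p i = 1" and q: "\<And>i. 2 \<le> i \<Longrightarrow> q i = 1"
    show "?l (pN p) (pN q) u v = ?r (pN p) (pN q) u v"
    proof (rule W_ext2[OF assms(3,4), where L = "?l (pN p) (pN q)" and R = "?r (pN p) (pN q)"])
      fix a b :: "nat \<Rightarrow> 'h" assume a: "\<And>i. 2 \<le> i \<Longrightarrow> a i = 1" and b: "\<And>i. 2 \<le> i \<Longrightarrow> b i = 1"
      have "M5 (p * (\<lambda>i. if i < 5 then 1 else (a * (q * rv b)) (i - 5))) =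
          M5 ((p * (a * (1 ## 1 ## 1 ## b))) * (\<lambda>i. if i < 5 then 1 else q (i - 5)))"
        using p q a b by (auto simp: fun_eq_iff pointwise M5_def rv_def anti_mult mult.assoc eval_nat_numeral split: nat.split)
      then show "?l (pN p) (pN q) (pN a) (pN b) = ?r (pN p) (pN q) (pN a) (pN b)"
        by (simp add: mul_pt s_pt mapt_pt shift_pt del: cons_mult)
    qed (auto intro!: lins lin_s lin_sp dest: W_A)
  qed (auto intro!: lins lin_s lin_sp dest: W_A)
qed

lemma cop_Delta: "cop h = mapt rv (\<Delta> h)"
  by (simp add: cop_def \<Delta>_def)

text \<open>\<open>\<F>'\<close> passes the coproduct of S(c) and turns it into
  \<open>cop c\<close>; the coproducts of \<open>a\<close> and \<open>c\<close> then move into the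
  word, and only that of \<open>b\<close> stays outside.\<close>

lemma cfree_mult: "cfree (a * b * S c) = mapt M5 ((\<Omega> \<bullet> (\<Delta> a \<bullet> s (s (s (\<Delta> c))))) \<bullet> (s ^^ 5) (\<Delta> b \<bullet> \<F>'))"
proof -
  have "\<Delta> (S c) \<bullet> \<F>' = \<F>' \<bullet> (\<F> \<bullet> \<Delta> (S c)) \<bullet> \<F>'"
    by (simp add: F_F' flip: mul_assoc)
  also have "\<dots> = \<F>' \<bullet> cop c" unfolding F_g by (simp add: F_F' mul_assoc)
  finally have "\<Delta> (a * b * S c) \<bullet> \<F>' = \<Delta> a \<bullet> ((\<Delta> b \<bullet> \<F>') \<bullet> mapt rv (\<Delta> c))"
    by (simp add: AD mul_assoc cop_Delta slin_rv)
  then show ?thesis unfolding cfree_def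
    using M5_move[OF Omega_W mul_W[OF Delta_W F_W(2)] Delta_W Delta_W] by simp
qed

lemma multilin_Hn:
  "multilin (H4 Q) G \<Longrightarrow> multilin (H1 Q) (\<lambda>a. G (a, b, c, d))" "multilin (H4 Q) G \<Longrightarrow> multilin (H1 Q) (\<lambda>b. G (a, b, c, d))"
  "multilin (H4 Q) G \<Longrightarrow> multilin (H1 Q) (\<lambda>c. G (a, b, c, d))" "multilin (H4 Q) G \<Longrightarrow> multilin (H1 Q) (\<lambda>d. G (a, b, c, d))"
  by (simp_all add: multilin_mprod)

lemma multilin_H3:
  "multilin (H3 Q) P \<Longrightarrow> multilin (H1 Q) (\<lambda>a. P (a, b, c))" "multilin (H3 Q) P \<Longrightarrow> multilin (H1 Q) (\<lambda>b. P (a, b, c))"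
  "multilin (H3 Q) P \<Longrightarrow> multilin (H1 Q) (\<lambda>c. P (a, b, c))"
  by (simp_all add: multilin_mprod)

lemma less5_cases: "(i::nat) < 5 \<Longrightarrow> i = 0 \<or> i = 1 \<or> i = 2 \<or> i = 3 \<or> i = 4"
  by auto

lemma multilin_H2:
  "multilin (H2 Q) P \<Longrightarrow> multilin (H1 Q) (\<lambda>a. P (a, b))" "multilin (H2 Q) P \<Longrightarrow> multilin (H1 Q) (\<lambda>b. P (a, b))"
  by (simp_all add: multilin_mprod)

lemma multilin_sandwich: "multilin (H1 Q) F \<Longrightarrow> multilin (H1 Q) (\<lambda>a. F (b * a * c))"
  by (erule multilin_comp[of sc UNIV]) (simp_all add: lin_simps)
lemma multilin_sandwichS: "multilin (H1 Q) F \<Longrightarrow> multilin (H1 Q) (\<lambda>a. F (b * S a))" "multilin (H1 Q) F \<Longrightarrow> multilin (H1 Q) (\<lambda>a. F (a * b * c))"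
  by (erule multilin_comp[of sc UNIV]; simp add: lin_simps)+

lemmas mcomps = multilin_argR multilin_argL multilin_sandwich multilin_sandwichS

lemma multilin_ev1: "multilin X F \<Longrightarrow> multilin X (\<lambda>a. ev n K (F a))"
  unfolding ev_def by (rule multilin_tsum1)

lemma multilin_ev2:
  assumes "good X" "t \<in> A" "\<And>y. multilin X (\<lambda>x. K x y)" "\<And>x. x \<in> points X \<Longrightarrow> multilin \<H> (\<lambda>y. tscale (tail n y) (K x y))"
  shows "multilin X (\<lambda>x. ev n (K x) t)"
  unfolding ev_def using assms by (intro multilin_tsum2[where Y = \<H>] multilin_tscale) auto

lemma M5_tail:
  assumes "\<And>i. 5 \<le> i \<Longrightarrow> p i = 1" "\<And>i. 2 \<le> i \<Longrightarrow> q i = 1" "3 \<le> i"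
  shows "M5 (p * (\<lambda>i. if i < 5 then 1 else q (i - 5))) i = 1"
proof -
  define n where "n = i - 3"
  have "i = Suc (Suc (Suc n))" using assms(3) by (simp add: n_def)
  then show ?thesis using assms by (simp add: M5_def pointwise)
qed

lemma M5_entries:
  assumes "\<And>i. 5 \<le> i \<Longrightarrow> p i = 1"
  shows "M5 (p * (\<lambda>i. if i < 5 then 1 else q (i - 5))) 0 = p 0 * q 0 * S (p 4)"
    "M5 (p * (\<lambda>i. if i < 5 then 1 else q (i - 5))) 1 = p 1 * q 1 * S (p 3)"
    "M5 (p * (\<lambda>i. if i < 5 then 1 else q (i - 5))) (Suc 0) = p 1 * q 1 * S (p 3)"
    "M5 (p * (\<lambda>i. if i < 5 then 1 else q (i - 5))) 2 = p 2"
  using assms by (simp_all add: M5_def pointwise numeral_2_eq_2)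

lemma ev_M5:
  assumes "multilin \<H> (\<lambda>x. tscale (tail 3 x) (K x))" "\<And>i. 5 \<le> i \<Longrightarrow> p i = 1" "\<And>i. 2 \<le> i \<Longrightarrow> q i = 1"
  shows "ev 3 K (mapt M5 (pN p \<bullet> (s ^^ 5) (pN q))) = K (M5 (p * (\<lambda>i. if i < 5 then 1 else q (i - 5))))"
proof -
  have "M5 (p * (\<lambda>i. if i < 5 then 1 else q (i - 5))) i = 1" if "3 \<le> i" for i
    by (rule M5_tail) (use assms that in auto)
  then show ?thesis by (simp add: shift_pt mul_pt mapt_pt[OF slin_M5] ev_pt[OF assms(1)])
qed

lemma pN_five: "pN (a ## b ## c ## d ## e ## 1) = j a \<bullet> (s (j b) \<bullet> (s (s (j c)) \<bullet> (s (s (s (j d))) \<bullet> s (s (s (s (j e)))))))"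
  by (simp add: j_def s_pt mul_pt)

section \<open>Coassociativity of the free coaction\<close>

context
  fixes G :: "'h \<times> 'h \<times> 'h \<times> 'h \<Rightarrow> ('k, 'b) tensor"
  assumes G: "multilin (H4 Q) G"
begin

lemmas Gm = multilin_Hn[OF G]

lemma G_inner1: "multilin \<H> (\<lambda>l. tscale (tail 3 l) (G (a, l 0, l 1, l 2 * b)))"
  by (rule multilin_tail) (auto dest!: less3_cases intro!: Gm mcomps)

lemma G_inner2: "multilin \<H> (\<lambda>q. tscale (tail 3 q) (G (a, b, q 0 * c * S (q 2), q 1 * d)))"
  by (rule multilin_tail) (auto dest!: less3_cases intro!: Gm mcomps)

text \<open>The two sides of coassociativity for a \<otimes> v, read through an arbitrary
  \<open>G\<close> whose arguments are the three comodule legs and the element acting on v. In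
  \<open>lhs_k\<close> the coaction is applied again to the second leg; in \<open>rhs_l\<close> the
  third component of \<omega> acts on R(V) through its threefold coproduct.\<close>

definition "lhs_k (k :: nat \<Rightarrow> 'h) = ev 3 (\<lambda>l. G (k 0, l 0, l 1, l 2 * k 2)) (cfree (k 1))"
definition "rhs_l (k :: nat \<Rightarrow> 'h) l = ev 3 (\<lambda>q. G (l 0, l 1, q 0 * k 1 * S (q 2), q 1 * k 2)) (D 0 (\<Delta> (l 2)))"
definition "rhs_k (k :: nat \<Rightarrow> 'h) = ev 3 (rhs_l k) (cfree (k 0))"

lemma lhs_k_m: "multilin \<H> (\<lambda>k. tscale (tail 3 k) (lhs_k k))"
proof (rule multilin_tail)
  fix i :: nat and x :: "nat \<Rightarrow> 'h" assume "i < 3"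
  then show "multilin (H1 Q) (\<lambda>a. lhs_k (x(i := a)))"
    by (auto simp: lhs_k_def dest!: less3_cases intro!: multilin_ev2[OF good_H1 cfree_in] G_inner1[simplified] Gm mcomps multilin_ev1 multilin_cfree)
qed (simp add: lhs_k_def)

lemma rhs_l_m: "multilin \<H> (\<lambda>l. tscale (tail 3 l) (rhs_l k l))"
proof (rule multilin_tail)
  fix i :: nat and x :: "nat \<Rightarrow> 'h" assume "i < 3"
  moreover have "multilin (H1 Q) (\<lambda>a. D 0 (\<Delta> a))" using lmapD(1)[OF AD(1)] by (rule multilin_D)
  ultimately show "multilin (H1 Q) (\<lambda>a. rhs_l k (x(i := a)))"
    by (auto simp: rhs_l_def dest!: less3_cases intro!: multilin_ev2[OF good_H1 D_in[OF Delta_A]] G_inner2[simplified] Gm mcomps multilin_ev1)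
qed (simp add: rhs_l_def)

lemma rhs_k_m: "multilin \<H> (\<lambda>k. tscale (tail 3 k) (rhs_k k))"
proof (rule multilin_tail)
  fix i :: nat and x :: "nat \<Rightarrow> 'h" assume "i < 3"
  then consider "i = 0" | "i = 1 \<or> i = 2" by linarith
  then show "multilin (H1 Q) (\<lambda>a. rhs_k (x(i := a)))"
  proof cases
    case 1
    have "rhs_k (x(0 := a)) = ev 3 (rhs_l x) (cfree a)" for a
      by (simp add: rhs_k_def rhs_l_def[abs_def])
    then show ?thesis using 1 by (simp add: multilin_ev1 multilin_cfree)
  next
    case 2
    then have "multilin (H1 Q) (\<lambda>a. rhs_l (x(i := a)) l)" for l
      by (auto simp: rhs_l_def intro!: multilin_ev2[OF good_H1 D_in[OF Delta_A]] G_inner2[simplified] Gm mcomps)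
    moreover have "rhs_k (x(i := a)) = ev 3 (rhs_l (x(i := a))) (cfree (x 0))" for a
      using 2 by (auto simp: rhs_k_def)
    ultimately show ?thesis by (auto intro!: multilin_ev2 rhs_l_m)
  qed
qed (simp add: rhs_k_def rhs_l_def[abs_def])

definition "G4 x = G (x 0, x 1, x 2, x 3)"

lemma G4_m: "multilin \<H> (\<lambda>x. tscale (tail 4 x) (G4 x))"
  by (rule multilin_tail) (auto simp: G4_def dest!: less4_cases intro!: Gm)

definition "flat X Z = ev 4 G4 (mapt M7 (X \<bullet> (s ^^ 7) Z))"

lemma flat_pt:
  assumes "\<And>i. 7 \<le> i \<Longrightarrow> p i = 1" "\<And>i. 3 \<le> i \<Longrightarrow> q i = 1"
  shows "flat (pN p) (pN q) = G (p 0 * q 0 * S (p 6), p 1 * q 1 * S (p 5), p 2 * q 2 * S (p 4), p 3)"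
proof -
  let ?x = "p * (\<lambda>i. if i < 7 then 1 else q (i - 7))"
  have "M7 ?x i = 1" if "4 \<le> i" for i
  proof -
    have "M7 ?x i = ?x ((i - 4) + 10)"
      using that by (auto simp: M7_def eval_nat_numeral split: nat.split)
    then show ?thesis using assms by (simp add: pointwise)
  qed
  then have "flat (pN p) (pN q) = G4 (M7 ?x)"
    by (simp add: flat_def shift_pt mul_pt mapt_pt[OF slin_M7] ev_pt[OF G4_m])
  then show ?thesis using assms(1)
    by (simp add: G4_def M7_def pointwise eval_nat_numeral)
qed

lemma lin_flat: "Z \<in> A \<Longrightarrow> lin X L \<Longrightarrow> lin X (\<lambda>t. flat (L t) Z)"
  "Y \<in> A \<Longrightarrow> lin X L \<Longrightarrow> (\<And>t. t \<in> tens X \<Longrightarrow> L t \<in> A) \<Longrightarrow> lin X (\<lambda>t. flat Y (L t))"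
  unfolding flat_def by (auto intro!: lin_ev lins lin_sp slin_M7)

text \<open>The inner coaction occupies slots 1 to 5 of the long word, whence \<open>s u\<close>;
  the outer entries go to slots 0 and 6 and, as a right factor, to slot 3, the one acting on
  v.\<close>

lemma lhs_flat:
  fixes x y :: "nat \<Rightarrow> 'h"
  assumes "u \<in> W 5" "v \<in> W 2"
  shows "ev 3 (\<lambda>l. G (x 0 * y 0 * S (x 4), l 0, l 1, l 2 * x 2)) (mapt M5 (u \<bullet> (s ^^ 5) v)) =
    flat (s u \<bullet> (j (x 0) \<bullet> (s (s (s (j (x 2)))) \<bullet> (s ^^ 6) (j (x 4))))) (j (y 0) \<bullet> s v)"
  proof (rule W_ext2[OF assms, where L = "\<lambda>u v. ev 3 (\<lambda>l. G (x 0 * y 0 * S (x 4), l 0, l 1, l 2 * x 2)) (mapt M5 (u \<bullet> (s ^^ 5) v))"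
    and R = "\<lambda>u v. flat (s u \<bullet> (j (x 0) \<bullet> (s (s (s (j (x 2)))) \<bullet> (s ^^ 6) (j (x 4))))) (j (y 0) \<bullet> s v)"])
  fix p q :: "nat \<Rightarrow> 'h" assume p: "\<And>i. 5 \<le> i \<Longrightarrow> p i = 1" and q: "\<And>i. 2 \<le> i \<Longrightarrow> q i = 1"
  have "flat (s (pN p) \<bullet> (j (x 0) \<bullet> (s (s (s (j (x 2)))) \<bullet> (s ^^ 6) (j (x 4))))) (j (y 0) \<bullet> s (pN q)) =
      flat (pN ((1 ## p) * ((x 0 ## 1) * ((1 ## 1 ## 1 ## x 2 ## 1) * (1 ## 1 ## 1 ## 1 ## 1 ## 1 ## x 4 ## 1))))) (pN ((y 0 ## 1) * (1 ## q)))"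
    by (simp add: j_def s_pt mul_pt eval_nat_numeral del: cons_mult)
  also have "\<dots> = G (x 0 * y 0 * S (x 4), p 0 * q 0 * S (p 4), p 1 * q 1 * S (p 3), p 2 * x 2)"
    using p q by (subst flat_pt) (auto simp: pointwise eval_nat_numeral split: nat.split)
  also have "\<dots> = ev 3 (\<lambda>l. G (x 0 * y 0 * S (x 4), l 0, l 1, l 2 * x 2)) (mapt M5 (pN p \<bullet> (s ^^ 5) (pN q)))"
    using ev_M5[OF G_inner1, of p q, OF p q] M5_entries[of p q] p by simp
  finally show "ev 3 (\<lambda>l. G (x 0 * y 0 * S (x 4), l 0, l 1, l 2 * x 2)) (mapt M5 (pN p \<bullet> (s ^^ 5) (pN q))) =
    flat (s (pN p) \<bullet> (j (x 0) \<bullet> (s (s (s (j (x 2)))) \<bullet> (s ^^ 6) (j (x 4))))) (j (y 0) \<bullet> s (pN q))" ..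
qed (auto intro!: lins lin_ev lin_flat lin_s lin_sp slin_M5 dest: W_A)

lemma rhs_flat_pure:
  fixes p q x y :: "nat \<Rightarrow> 'h"
  assumes p: "\<And>i. 5 \<le> i \<Longrightarrow> p i = 1" and q: "\<And>i. 2 \<le> i \<Longrightarrow> q i = 1" and t: "t \<in> W 3"
  shows "ev 3 (\<lambda>z. G (p 0 * q 0 * S (p 4), p 1 * q 1 * S (p 3), z 0 * (x 1 * y 1 * S (x 3)) * S (z 2), z 1 * x 2)) t =
    flat (pN (p 0 ## p 1 ## 1) \<bullet> (s (s t) \<bullet> (s ^^ 5) (pN (p 3 ## p 4 ## 1))) \<bullet>
      (s (s (j (x 1))) \<bullet> (s (s (s (j (x 2)))) \<bullet> (s ^^ 4) (j (x 3))))) (pN q \<bullet> s (s (j (y 1))))"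
proof (rule lin_ext_W[OF t, where R = "\<lambda>t. flat (pN (p 0 ## p 1 ## 1) \<bullet> (s (s t) \<bullet> (s ^^ 5) (pN (p 3 ## p 4 ## 1))) \<bullet>
      (s (s (j (x 1))) \<bullet> (s (s (s (j (x 2)))) \<bullet> (s ^^ 4) (j (x 3))))) (pN q \<bullet> s (s (j (y 1))))"])
  fix z :: "nat \<Rightarrow> 'h" assume z: "\<And>i. 3 \<le> i \<Longrightarrow> z i = 1"
  have "flat (pN (p 0 ## p 1 ## 1) \<bullet> (s (s (pN z)) \<bullet> (s ^^ 5) (pN (p 3 ## p 4 ## 1))) \<bullet>
      (s (s (j (x 1))) \<bullet> (s (s (s (j (x 2)))) \<bullet> (s ^^ 4) (j (x 3))))) (pN q \<bullet> s (s (j (y 1)))) =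
    flat (pN ((p 0 ## p 1 ## 1) * ((1 ## 1 ## z) * (1 ## 1 ## 1 ## 1 ## 1 ## p 3 ## p 4 ## 1)) *
      ((1 ## 1 ## x 1 ## 1) * ((1 ## 1 ## 1 ## x 2 ## 1) * (1 ## 1 ## 1 ## 1 ## x 3 ## 1))))) (pN (q * (1 ## 1 ## y 1 ## 1)))"
    by (simp add: j_def s_pt mul_pt eval_nat_numeral del: cons_mult)
  also have "\<dots> = G (p 0 * q 0 * S (p 4), p 1 * q 1 * S (p 3), z 0 * (x 1 * y 1 * S (x 3)) * S (z 2), z 1 * x 2)"
    using p q z by (subst flat_pt) (auto simp: pointwise anti_mult mult.assoc eval_nat_numeral split: nat.split)
  finally show "ev 3 (\<lambda>z. G (p 0 * q 0 * S (p 4), p 1 * q 1 * S (p 3), z 0 * (x 1 * y 1 * S (x 3)) * S (z 2), z 1 * x 2)) (pN z) =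
    flat (pN (p 0 ## p 1 ## 1) \<bullet> (s (s (pN z)) \<bullet> (s ^^ 5) (pN (p 3 ## p 4 ## 1))) \<bullet>
      (s (s (j (x 1))) \<bullet> (s (s (s (j (x 2)))) \<bullet> (s ^^ 4) (j (x 3))))) (pN q \<bullet> s (s (j (y 1))))"
    using ev_pt[OF G_inner2 z] by simp
qed (auto intro!: lins lin_ev lin_flat lin_s lin_sp)

lemma rhs_inner_m:
  "multilin \<H> (\<lambda>l. tscale (tail 3 l) (ev 3 (\<lambda>q. G (l 0, l 1, q 0 * c * S (q 2), q 1 * d)) (D 0 (\<Delta> (l 2)))))"
  using rhs_l_m[of "1 ## c ## d ## 1"] by (simp add: rhs_l_def numeral_2_eq_2)

text \<open>Slot 2 of \<open>u\<close> acts on R(V) and is therefore expanded threefold, whence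
  \<open>D 2 (D 2 u)\<close>: its middle part acts on v, and its outer parts surround the third
  comodule leg.\<close>

lemma rhs_flat:
  fixes x y :: "nat \<Rightarrow> 'h"
  assumes "u \<in> W 5" "v \<in> W 2"
  shows "ev 3 (\<lambda>l. ev 3 (\<lambda>q. G (l 0, l 1, q 0 * (x 1 * y 1 * S (x 3)) * S (q 2), q 1 * x 2)) (D 0 (\<Delta> (l 2)))) (mapt M5 (u \<bullet> (s ^^ 5) v)) =
    flat (D 2 (D 2 u) \<bullet> (s (s (j (x 1))) \<bullet> (s (s (s (j (x 2)))) \<bullet> (s ^^ 4) (j (x 3))))) (v \<bullet> s (s (j (y 1))))"
  proof (rule W_ext2[OF assms, where L = "\<lambda>u v. ev 3 (\<lambda>l. ev 3 (\<lambda>q. G (l 0, l 1, q 0 * (x 1 * y 1 * S (x 3)) * S (q 2), q 1 * x 2)) (D 0 (\<Delta> (l 2)))) (mapt M5 (u \<bullet> (s ^^ 5) v))"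
    and R = "\<lambda>u v. flat (D 2 (D 2 u) \<bullet> (s (s (j (x 1))) \<bullet> (s (s (s (j (x 2)))) \<bullet> (s ^^ 4) (j (x 3))))) (v \<bullet> s (s (j (y 1))))"])
  fix p q :: "nat \<Rightarrow> 'h" assume p: "\<And>i. 5 \<le> i \<Longrightarrow> p i = 1" and q: "\<And>i. 2 \<le> i \<Longrightarrow> q i = 1"
  have p5: "p = p 0 ## p 1 ## p 2 ## p 3 ## p 4 ## 1"
    using p by (auto simp: fun_eq_iff one_fun_apply eval_nat_numeral split: nat.split)
  have W3: "D 0 (\<Delta> h) \<in> W 3" for h using D_W[OF Delta_W, of 0 h] by simp
  have "D 2 (D 2 (pN p)) = pN (p 0 ## p 1 ## 1) \<bullet> (s (s (D 0 (\<Delta> (p 2)))) \<bullet> (s ^^ 5) (pN (p 3 ## p 4 ## 1)))"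
    by (subst p5) (simp add: pN_five pN_two D_mul s_mul D_j D_s_pos D_0_s \<Delta>_def mul_assoc eval_nat_numeral)
  then show "ev 3 (\<lambda>l. ev 3 (\<lambda>q. G (l 0, l 1, q 0 * (x 1 * y 1 * S (x 3)) * S (q 2), q 1 * x 2)) (D 0 (\<Delta> (l 2)))) (mapt M5 (pN p \<bullet> (s ^^ 5) (pN q))) =
      flat (D 2 (D 2 (pN p)) \<bullet> (s (s (j (x 1))) \<bullet> (s (s (s (j (x 2)))) \<bullet> (s ^^ 4) (j (x 3))))) (pN q \<bullet> s (s (j (y 1))))"
    using ev_M5[OF rhs_inner_m, of p q, OF p q] M5_entries[of p q] p rhs_flat_pure[of p q, OF p q W3, of x y "p 2"] by simp
qed (auto intro!: lins lin_ev lin_flat lin_s lin_sp slin_M5 dest: W_A)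

lemma flat_move:
  assumes "X \<in> W 7" "Z \<in> W 3" "u \<in> W 3" "v \<in> W 3"
  shows "flat X (u \<bullet> (Z \<bullet> mapt rv3 v)) = flat (X \<bullet> (u \<bullet> (s ^^ 4) v)) Z"
  proof -
  let ?l = "\<lambda>X Z u v. flat X (u \<bullet> (Z \<bullet> mapt rv3 v))" and ?r = "\<lambda>X Z u v. flat (X \<bullet> (u \<bullet> (s ^^ 4) v)) Z"
  note [simp] = assms[THEN W_A] slin_rv3
  show "?l X Z u v = ?r X Z u v"
  proof (rule W_ext2[OF assms(1,2), where L = "\<lambda>X Z. ?l X Z u v" and R = "\<lambda>X Z. ?r X Z u v"])
    fix p q :: "nat \<Rightarrow> 'h" assume p: "\<And>i. 7 \<le> i \<Longrightarrow> p i = 1" and q: "\<And>i. 3 \<le> i \<Longrightarrow> q i = 1"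
    show "?l (pN p) (pN q) u v = ?r (pN p) (pN q) u v"
    proof (rule W_ext2[OF assms(3,4), where L = "?l (pN p) (pN q)" and R = "?r (pN p) (pN q)"])
      fix a b :: "nat \<Rightarrow> 'h" assume a: "\<And>i. 3 \<le> i \<Longrightarrow> a i = 1" and b: "\<And>i. 3 \<le> i \<Longrightarrow> b i = 1"
      have "?l (pN p) (pN q) (pN a) (pN b) = flat (pN p) (pN (a * (q * rv3 b)))"
        "?r (pN p) (pN q) (pN a) (pN b) = flat (pN (p * (a * (1 ## 1 ## 1 ## 1 ## b)))) (pN q)"
        by (simp_all add: s_pt mul_pt mapt_pt eval_nat_numeral)
      moreover have "flat (pN p) (pN (a * (q * rv3 b))) = flat (pN (p * (a * (1 ## 1 ## 1 ## 1 ## b)))) (pN q)"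
        using p q a b by (subst flat_pt, simp, force simp: pointwise rv3_def eval_nat_numeral split: nat.split, subst flat_pt)
          (auto simp: pointwise rv3_def anti_mult mult.assoc eval_nat_numeral split: nat.split)
      ultimately show "?l (pN p) (pN q) (pN a) (pN b) = ?r (pN p) (pN q) (pN a) (pN b)" by simp
    qed (auto intro!: lins lin_flat lin_sp dest: W_A)
  qed (auto intro!: lins lin_flat lin_sp dest: W_A)
qed

text \<open>With \<open>?Y\<close> the coproduct of a times the inverse of f, the left side is the
  word \<open>s \<Omega> \<bullet> D 1 (D 3 \<Omega>)\<close> on
  \<open>D 1 ?Y \<bullet> s \<F>'\<close>, and the right side the word
  \<open>D 2 (D 2 \<Omega>) \<bullet> D 0 (D 4 \<Omega>)\<close> on
  \<open>D 0 ?Y \<bullet> \<F>'\<close>. The first expansion is the second one with associators on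
  both sides; handed over to the word, these are the two extra factors in \<open>C3\<close>.\<close>

lemma cfree_coassoc: "ev 3 lhs_k (cfree a) = ev 3 rhs_k (cfree a)"
proof -
  let ?Y = "\<Delta> a \<bullet> \<F>'"
  have Y: "?Y \<in> W 2" by (intro mul_W Delta_W F_W)
  \<comment> \<open>Stated for arbitrary \<open>U\<close> and \<open>V\<close>, so that both may be
    taken pure.\<close>
  have l: "ev 3 lhs_k (mapt M5 (U \<bullet> (s ^^ 5) V)) = flat (s \<Omega> \<bullet> D 1 (D 3 U)) (D 1 V \<bullet> s \<F>')"
    if "U \<in> W 5" "V \<in> W 2" for U V
    proof (rule W_ext2[OF that, where L = "\<lambda>U V. ev 3 lhs_k (mapt M5 (U \<bullet> (s ^^ 5) V))" and R = "\<lambda>U V. flat (s \<Omega> \<bullet> D 1 (D 3 U)) (D 1 V \<bullet> s \<F>')"])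
    fix x y :: "nat \<Rightarrow> 'h" assume x: "\<And>i. 5 \<le> i \<Longrightarrow> x i = 1" and y: "\<And>i. 2 \<le> i \<Longrightarrow> y i = 1"
    have x5: "x = x 0 ## x 1 ## x 2 ## x 3 ## x 4 ## 1"
      using x by (auto simp: fun_eq_iff one_fun_apply eval_nat_numeral split: nat.split)
    have y2: "y = y 0 ## y 1 ## 1"
      using y by (auto simp: fun_eq_iff one_fun_apply eval_nat_numeral split: nat.split)
    have D1: "D 1 (pN y) = j (y 0) \<bullet> s (\<Delta> (y 1))"
      by (subst y2) (simp add: pN_two D_mul D_j D_s \<Delta>_def)
    have c: "j a \<bullet> (s u \<bullet> v) = s u \<bullet> (j a \<bullet> v)" if "u \<in> A" "v \<in> A" for a u v
      using that comm[OF j_W, of u a] by (simp flip: mul_assoc)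
    have c3: "s (s (s (j b))) \<bullet> (s (s (s (s u))) \<bullet> v) = s (s (s (s u))) \<bullet> (s (s (s (j b))) \<bullet> v)" if "u \<in> A" "v \<in> A" for b u v
      using that comm[OF j_W, of u b] by (simp flip: mul_assoc s_mul)
    have D13: "D 1 (D 3 (pN x)) = s (\<Delta> (x 1) \<bullet> s (s (s (\<Delta> (x 3))))) \<bullet> (j (x 0) \<bullet> (s (s (s (j (x 2)))) \<bullet> (s ^^ 6) (j (x 4))))"
      by (subst x5) (simp add: pN_five D_mul s_mul D_j D_s_pos D_0_s \<Delta>_def[symmetric] mul_assoc eval_nat_numeral c c3)
    have u: "\<Omega> \<bullet> (\<Delta> (x 1) \<bullet> s (s (s (\<Delta> (x 3))))) \<in> W 5"
      using sp_W[OF Delta_W, of 3 "x 3"] by (intro mul_W Omega_W W_mono[OF Delta_W]) (auto simp: eval_nat_numeral)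
    have "ev 3 lhs_k (mapt M5 (pN x \<bullet> (s ^^ 5) (pN y))) = ev 3 (\<lambda>l. G (x 0 * y 0 * S (x 4), l 0, l 1, l 2 * x 2)) (cfree (x 1 * y 1 * S (x 3)))"
      using ev_M5[OF lhs_k_m, of x y, OF x y] M5_entries[of x y] x by (simp add: lhs_k_def[abs_def])
    also have "\<dots> = flat (s (\<Omega> \<bullet> (\<Delta> (x 1) \<bullet> s (s (s (\<Delta> (x 3)))))) \<bullet> (j (x 0) \<bullet> (s (s (s (j (x 2)))) \<bullet> (s ^^ 6) (j (x 4))))) (j (y 0) \<bullet> s (\<Delta> (y 1) \<bullet> \<F>'))"
      unfolding cfree_mult by (rule lhs_flat[OF u]) (intro mul_W Delta_W F_W)
    also have "\<dots> = flat (s \<Omega> \<bullet> D 1 (D 3 (pN x))) (D 1 (pN y) \<bullet> s \<F>')"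
      unfolding D1 D13 by (simp add: s_mul mul_assoc)
    finally show "ev 3 lhs_k (mapt M5 (pN x \<bullet> (s ^^ 5) (pN y))) = flat (s \<Omega> \<bullet> D 1 (D 3 (pN x))) (D 1 (pN y) \<bullet> s \<F>')" .
  qed (auto intro!: lins lin_ev lin_flat lin_s lin_sp slin_M5 dest: W_A)
  have r: "ev 3 rhs_k (mapt M5 (U \<bullet> (s ^^ 5) V)) = flat (D 2 (D 2 \<Omega>) \<bullet> D 0 (D 4 U)) (D 0 V \<bullet> \<F>')"
    if "U \<in> W 5" "V \<in> W 2" for U V
    proof (rule W_ext2[OF that, where L = "\<lambda>U V. ev 3 rhs_k (mapt M5 (U \<bullet> (s ^^ 5) V))" and R = "\<lambda>U V. flat (D 2 (D 2 \<Omega>) \<bullet> D 0 (D 4 U)) (D 0 V \<bullet> \<F>')"])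
    fix x y :: "nat \<Rightarrow> 'h" assume x: "\<And>i. 5 \<le> i \<Longrightarrow> x i = 1" and y: "\<And>i. 2 \<le> i \<Longrightarrow> y i = 1"
    have x5: "x = x 0 ## x 1 ## x 2 ## x 3 ## x 4 ## 1"
      using x by (auto simp: fun_eq_iff one_fun_apply eval_nat_numeral split: nat.split)
    have y2: "y = y 0 ## y 1 ## 1"
      using y by (auto simp: fun_eq_iff one_fun_apply eval_nat_numeral split: nat.split)
    have D0: "D 0 (pN y) \<bullet> \<F>' = \<Delta> (y 0) \<bullet> \<F>' \<bullet> s (s (j (y 1)))"
      using comm[OF F_W(2), of "j (y 1)"] by (subst y2) (simp add: pN_two D_mul D_0_s \<Delta>_def mul_assoc numeral_2_eq_2)
    have c: "s t \<bullet> j a = j a \<bullet> s t" if "t \<in> A" for a t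
      using that comm[OF j_W, of t a] by simp
    let ?a = "s (s (j (x 1))) \<bullet> (s (s (s (j (x 2)))) \<bullet> (s ^^ 4) (j (x 3)))" and ?b = "(s ^^ 5) (\<Delta> (x 4))"
    have c1: "?b \<bullet> ?a = ?a \<bullet> ?b"
    proof -
      have "?a \<in> W 5"
        using sp_W[OF j_W, of 2 "x 1"] sp_W[OF j_W, of 3 "x 2"] sp_W[OF j_W, of 4 "x 3"]
        by (intro mul_W) (auto simp: eval_nat_numeral intro: W_mono)
      from comm[OF this, of "\<Delta> (x 4)"] show ?thesis by simp
    qed
    have D04: "D 0 (D 4 (pN x)) = \<Delta> (x 0) \<bullet> (?b \<bullet> ?a)"
      unfolding c1 by (subst x5) (simp add: pN_five D_mul D_j D_s_pos D_0_s \<Delta>_def[symmetric] mul_assoc eval_nat_numeral)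
    have u: "\<Omega> \<bullet> (\<Delta> (x 0) \<bullet> s (s (s (\<Delta> (x 4))))) \<in> W 5"
      using sp_W[OF Delta_W, of 3 "x 4"] by (intro mul_W Omega_W W_mono[OF Delta_W]) (auto simp: eval_nat_numeral)
    have D2: "D 2 (\<Delta> h) = \<Delta> h" for h using D_triv[OF Delta_W, of 2 h] by simp
    have "ev 3 rhs_k (mapt M5 (pN x \<bullet> (s ^^ 5) (pN y))) =
        ev 3 (\<lambda>l. ev 3 (\<lambda>q. G (l 0, l 1, q 0 * (x 1 * y 1 * S (x 3)) * S (q 2), q 1 * x 2)) (D 0 (\<Delta> (l 2)))) (cfree (x 0 * y 0 * S (x 4)))"
      using ev_M5[OF rhs_k_m, of x y, OF x y] M5_entries[of x y] x by (simp add: rhs_k_def[abs_def] rhs_l_def[abs_def])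
    also have "\<dots> = flat (D 2 (D 2 (\<Omega> \<bullet> (\<Delta> (x 0) \<bullet> s (s (s (\<Delta> (x 4))))))) \<bullet> ?a) (\<Delta> (y 0) \<bullet> \<F>' \<bullet> s (s (j (y 1))))"
      unfolding cfree_mult by (rule rhs_flat[OF u]) (intro mul_W Delta_W F_W)
    also have "\<dots> = flat (D 2 (D 2 \<Omega>) \<bullet> D 0 (D 4 (pN x))) (D 0 (pN y) \<bullet> \<F>')"
      unfolding D0 D04 by (simp add: D_mul D2 D_s_pos D_0_s mul_assoc eval_nat_numeral D2[unfolded numeral_2_eq_2])
    finally show "ev 3 rhs_k (mapt M5 (pN x \<bullet> (s ^^ 5) (pN y))) = flat (D 2 (D 2 \<Omega>) \<bullet> D 0 (D 4 (pN x))) (D 0 (pN y) \<bullet> \<F>')" .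
  qed (auto intro!: lins lin_ev lin_flat lin_s lin_sp slin_M5 dest: W_A)
  \<comment> \<open>The point where the compatibility of Drinfeld's element with the associator
    enters the coaction.\<close>
  have D1Y: "D 1 ?Y \<bullet> s \<F>' = \<phi> \<bullet> ((D 0 ?Y \<bullet> \<F>') \<bullet> mapt rv3 \<phi>')"
    proof -
    have 1: "D 1 (\<Delta> a) = \<phi> \<bullet> (D 0 (\<Delta> a) \<bullet> \<phi>')"
      using inter_0[of "j a"] by (simp add: \<Delta>_def phi_phi' flip: mul_assoc) (simp add: mul_assoc phi_phi')
    have "D 1 ?Y \<bullet> s \<F>' = \<phi> \<bullet> (D 0 (\<Delta> a) \<bullet> (\<phi>' \<bullet> (D 1 \<F>' \<bullet> s \<F>')))"
      by (subst D_mul, simp, simp, subst 1) (simp add: mul_assoc)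
    then show ?thesis unfolding F'_phi by (simp add: D_mul mul_assoc slin_rv3)
  qed
  have "ev 3 lhs_k (cfree a) = flat (s \<Omega> \<bullet> D 1 (D 3 \<Omega>)) (\<phi> \<bullet> ((D 0 ?Y \<bullet> \<F>') \<bullet> mapt rv3 \<phi>'))"
    unfolding cfree_def l[OF Omega_W Y] D1Y ..
  also have "\<dots> = flat ((s \<Omega> \<bullet> D 1 (D 3 \<Omega>)) \<bullet> (\<phi> \<bullet> (s ^^ 4) \<phi>')) (D 0 ?Y \<bullet> \<F>')"
    proof (rule flat_move)
    show "s \<Omega> \<bullet> D 1 (D 3 \<Omega>) \<in> W 7"
      using s_W[OF Omega_W] D_W[OF D_W[OF Omega_W, of 3], of 1] by (intro mul_W) (auto simp: eval_nat_numeral intro: W_mono)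
    show "D 0 ?Y \<bullet> \<F>' \<in> W 3"
      using D_W[OF Y, of 0] W_mono[OF F_W(2), of 3] by (intro mul_W) (simp_all add: eval_nat_numeral)
  qed (auto simp: phi_W)
  also have "\<dots> = ev 3 rhs_k (cfree a)"
    using C3 unfolding cfree_def r[OF Omega_W Y] by (simp add: mul_assoc eval_nat_numeral)
  finally show ?thesis .
qed

end

text \<open>\<epsilon> applied to the antipode axiom for \<alpha> gives \<epsilon>(S(h_(1)))
  \<epsilon>(h_(2)) = \<epsilon>(h), because \<epsilon>(\<alpha>) = 1; the counit axiom collapses
  the left side.\<close>

lemma eps_anti: "eps Q (S h) = eps Q h"
proof -
  have f: "eps Q \<in> forms (H1 Q)" "(\<lambda>x. eps Q (S x)) \<in> forms (H1 Q)"
    using linear_eps linear_anti by (auto simp: vsp_def linear_on_def)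
  have "tsum (Delta Q h) (\<lambda>z. pt (H1 Q) (S (fst z) * \<alpha> * snd z)) = pt (H1 Q) (sc (eps Q h) \<alpha>)"
    "tsum (Delta Q h) (\<lambda>z. pt (H1 Q) (sc (eps Q (snd z)) (fst z))) = pt (H1 Q) h"
    using qh unfolding quasi_hopf_def split_def by blast+
  from fun_cong[OF this(1), of "eps Q"] fun_cong[OF this(2), of "\<lambda>x. eps Q (S x)"] show ?thesis
    using f by (simp add: tsum_def pt_def eps_mult eps_scal anti_scal mult.commute)
qed

lemma Ce_triv: "t \<in> W n \<Longrightarrow> n \<le> i \<Longrightarrow> Ce i t = t"
proof (rule lin_ext_W[where L = "Ce i" and R = "\<lambda>t. t"])
  fix x :: "nat \<Rightarrow> 'h" assume "n \<le> i" "\<And>k. n \<le> k \<Longrightarrow> x k = 1"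
  then have "del i x = x" "x i = 1" by (auto simp: del_def fun_eq_iff)
  then show "Ce i (pN x) = pN x" by (simp add: Ce_pt ck_def)
qed (auto intro!: lins lin_Ce)

text \<open>\<open>M5\<close> multiplies slots 0 and 4 of \<open>\<Omega>\<close> into the first
  comodule leg and slots 1 and 3 into the second, so these are the pairs that a counit on a leg
  meets. The higher slot is deleted first, which keeps the lower number valid.\<close>

lemma Ce_Omega: "Ce 0 (Ce 4 \<Omega>) = pN 1" "Ce 1 (Ce 3 \<Omega>) = pN 1"
  using Ce_triv[OF phi_W(1)]
  by (simp_all add: \<Omega>_def Ce_words Ce_phi D_one eval_nat_numeral)

lemma Ce_Delta: "Ce 0 (\<Delta> h) = j h" "Ce 1 (\<Delta> h) = j h"
  using Ce_D_same[of "j h" 0] by (simp_all add: \<Delta>_def)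

lemma Ce_cop: "Ce 0 (cop h) = j (S h)" "Ce 1 (cop h) = j (S h)"
proof -
  have 1: "tsum (Delta Q h) (\<lambda>z. tscale (eps Q (snd z)) (j (S (fst z)))) = j (S h)"
    "tsum (Delta Q h) (\<lambda>z. tscale (eps Q (fst z)) (j (S (snd z)))) = j (S h)"
  proof -
    define T where "T x = S (x 0) ## (\<lambda>i. x (Suc i))" for x :: "nat \<Rightarrow> 'h"
    have T: "slin sc T"
      by (rule slinI[of "\<lambda>i. i"]) (auto simp: T_def lin_simps split: nat.split)
    have Tj: "mapt T (j a) = j (S a)" for a
      by (simp add: j_def mapt_pt[OF T]) (simp add: T_def one_fun_def)
    have sc: "mapt T (tscale c t) = tscale c (mapt T t)" for c t
      unfolding mapt_def by (rule tsum_tscale)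
    show "tsum (Delta Q h) (\<lambda>z. tscale (eps Q (snd z)) (j (S (fst z)))) = j (S h)"
      "tsum (Delta Q h) (\<lambda>z. tscale (eps Q (fst z)) (j (S (snd z)))) = j (S h)"
      using arg_cong[OF counit(2)[of h "0 ## 1" 0], of "mapt T"] arg_cong[OF counit(1)[of h "0 ## 1" 0], of "mapt T"]
      by (simp_all add: cons_upd mapt_tsum sc Tj flip: j_def)
  qed
  show "Ce 0 (cop h) = j (S h)" "Ce 1 (cop h) = j (S h)"
    using 1 by (simp_all add: cop_tsum Ce_tsum Ce_pt ck_def del_cons eps_anti flip: pN_two j_def)
qed

definition Em :: "(nat \<Rightarrow> 'h) \<Rightarrow> nat \<Rightarrow> 'h" where "Em x = S (x 0) * \<alpha> * x 1 ## (\<lambda>i. x (i + 2))"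

lemma slin_Em: "slin sc Em"
  by (rule slinI[of "\<lambda>i. if i < 2 then 0 else i - 1"])
    (auto simp: Em_def lin_simps split: nat.split)

text \<open>A counit on one leg of \<open>ea\<close> applies the counit to two slots of
  \<open>\<theta>\<close>, which becomes trivial; the other leg then reads S(1) \<alpha> 1.\<close>

lemma Ce_ea: "Ce 0 ea = j \<alpha>" "Ce 1 ea = pN 1 \<bullet> j \<alpha>"
proof -
  have del: "del 0 (Ep x) = Em (del 1 (del 2 x))" "del 1 (Ep x) = Em (del 0 (del 3 x))" for x
    by (auto simp: Ep_def Em_def del_def fun_eq_iff eval_nat_numeral split: nat.split)
  have m: "mapt Em (tscale c t) = tscale c (mapt Em t)" for c t
    unfolding mapt_def by (rule tsum_tscale)
  have 1: "Ce 0 (mapt Ep \<theta>) = mapt Em (Ce 1 (Ce 2 \<theta>))"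
  proof (rule lin_ext[OF theta_in(1), where L = "\<lambda>t. Ce 0 (mapt Ep t)" and R = "\<lambda>t. mapt Em (Ce 1 (Ce 2 t))"])
    fix x
    show "Ce 0 (mapt Ep (pN x)) = mapt Em (Ce 1 (Ce 2 (pN x)))"
      by (simp add: mapt_pt[OF slin_Ep] Ce_pt ck_def Ce_tscale m mapt_pt[OF slin_Em] del eps_mult eps_anti)
        (simp add: Ep_def del_def eps_mult eps_anti mult.commute)
  qed (auto intro!: lins lin_Ce)
  have 2: "Ce 1 (mapt Ep \<theta>) = mapt Em (Ce 0 (Ce 3 \<theta>))"
  proof (rule lin_ext[OF theta_in(1), where L = "\<lambda>t. Ce 1 (mapt Ep t)" and R = "\<lambda>t. mapt Em (Ce 0 (Ce 3 t))"])
    fix x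
    show "Ce 1 (mapt Ep (pN x)) = mapt Em (Ce 0 (Ce 3 (pN x)))"
      by (simp add: mapt_pt[OF slin_Ep] Ce_pt ck_def Ce_tscale m mapt_pt[OF slin_Em] del[simplified] eps_mult eps_anti)
        (simp add: Ep_def del_def eps_mult eps_anti mult.commute)
  qed (auto intro!: lins lin_Ce)
  have "mapt Em (pN 1) = j \<alpha>"
    by (simp add: mapt_pt[OF slin_Em]) (simp add: Em_def j_def one_fun_apply flip: one_fun_def)
  moreover have "Ce 1 (Ce 2 \<theta>) = pN 1" "Ce 0 (Ce 3 \<theta>) = pN 1"
    by (simp_all add: \<theta>_def Ce_words Ce_phi D_one s_pt eval_nat_numeral)
  ultimately show "Ce 0 ea = j \<alpha>" "Ce 1 ea = pN 1 \<bullet> j \<alpha>"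
    unfolding ea_def 1 2 by simp_all
qed

text \<open>Under a counit the ingredients of the gauge become S, \<alpha> and \<beta> themselves,
  and the gauge becomes their antipode identity with \<open>phi_inv Q\<close>.\<close>

lemma Ce_F: "Ce 0 \<F> = pN 1" "Ce 1 \<F> = pN 1"
  using antipodalD(12)[OF antipodal_base] Ce_Delta Ce_cop Ce_ea
  by (simp_all add: \<F>_def gauge_def Ce_tsum Ce_mul)

lemma Ce_F': "Ce 0 \<F>' = pN 1" "Ce 1 \<F>' = pN 1"
  using Ce_inv[OF _ _ F_F'(1)] Ce_F by auto

definition M3 :: "(nat \<Rightarrow> 'h) \<Rightarrow> nat \<Rightarrow> 'h" where "M3 x = x 0 * x 3 * S (x 2) ## x 1 ## (\<lambda>i. x (i + 4))"

lemma slin_M3: "slin sc M3"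
  by (rule slinI[of "\<lambda>i. if i = 1 then 1 else if i < 4 then 0 else i - 2"])
    (auto simp: M3_def lin_simps split: nat.split)

lemma Ce_M5:
  assumes "u \<in> W 5" "v \<in> W 2"
  shows "Ce 0 (mapt M5 (u \<bullet> (s ^^ 5) v)) = mapt M3 (Ce 0 (Ce 4 u) \<bullet> (s ^^ 3) (Ce 0 v))"
    "Ce 1 (mapt M5 (u \<bullet> (s ^^ 5) v)) = mapt M3 (Ce 1 (Ce 3 u) \<bullet> (s ^^ 3) (Ce 1 v))"
proof -
  have m: "mapt M3 (tscale c t) = tscale c (mapt M3 t)" for c t
    unfolding mapt_def by (rule tsum_tscale)
  have sp: "(s ^^ 3) (tscale c t) = tscale c ((s ^^ 3) t)" for c t
    by (simp add: eval_nat_numeral s_tscale)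
  note [simp] = slin_M3 slin_M5
  show "Ce 0 (mapt M5 (u \<bullet> (s ^^ 5) v)) = mapt M3 (Ce 0 (Ce 4 u) \<bullet> (s ^^ 3) (Ce 0 v))"
  proof (rule W_ext2[OF assms, where L = "\<lambda>u v. Ce 0 (mapt M5 (u \<bullet> (s ^^ 5) v))" and R = "\<lambda>u v. mapt M3 (Ce 0 (Ce 4 u) \<bullet> (s ^^ 3) (Ce 0 v))"])
    fix p q :: "nat \<Rightarrow> 'h" assume p: "\<And>i. 5 \<le> i \<Longrightarrow> p i = 1" and q: "\<And>i. 2 \<le> i \<Longrightarrow> q i = 1"
    let ?x = "p * (\<lambda>i. if i < 5 then 1 else q (i - 5))"
    have 1: "del 0 (M5 ?x) = M3 (del 0 (del 4 p) * (\<lambda>i. if i < 3 then 1 else del 0 q (i - 3)))"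
      using p q by (auto simp: fun_eq_iff M5_def M3_def del_def pointwise eval_nat_numeral split: nat.split)
    have 2: "M5 ?x 0 = p 0 * q 0 * S (p 4)" using M5_entries[of p q] p by simp
    have 3: "del 4 p 0 = p 0" by (simp add: del_def)
    show "Ce 0 (mapt M5 (pN p \<bullet> (s ^^ 5) (pN q))) = mapt M3 (Ce 0 (Ce 4 (pN p)) \<bullet> (s ^^ 3) (Ce 0 (pN q)))"
      by (simp add: shift_pt mul_pt mapt_pt Ce_pt ck_def 1 2 3 Ce_tscale mul_tscale mul_tscale_right m sp eps_mult eps_anti mult_ac)
  qed (auto intro!: lins lin_Ce lin_sp dest: W_A)
  show "Ce 1 (mapt M5 (u \<bullet> (s ^^ 5) v)) = mapt M3 (Ce 1 (Ce 3 u) \<bullet> (s ^^ 3) (Ce 1 v))"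
  proof (rule W_ext2[OF assms, where L = "\<lambda>u v. Ce 1 (mapt M5 (u \<bullet> (s ^^ 5) v))" and R = "\<lambda>u v. mapt M3 (Ce 1 (Ce 3 u) \<bullet> (s ^^ 3) (Ce 1 v))"])
    fix p q :: "nat \<Rightarrow> 'h" assume p: "\<And>i. 5 \<le> i \<Longrightarrow> p i = 1" and q: "\<And>i. 2 \<le> i \<Longrightarrow> q i = 1"
    let ?x = "p * (\<lambda>i. if i < 5 then 1 else q (i - 5))"
    have 1: "del (Suc 0) (M5 ?x) = M3 (del (Suc 0) (del 3 p) * (\<lambda>i. if i < 3 then 1 else del (Suc 0) q (i - 3)))"
      using p q by (auto simp: fun_eq_iff M5_def M3_def del_def pointwise eval_nat_numeral split: nat.split)
    have 2: "M5 ?x (Suc 0) = p 1 * q 1 * S (p 3)" using M5_entries[of p q] p by simp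
    have 3: "del 3 p (Suc 0) = p 1" by (simp add: del_def)
    show "Ce 1 (mapt M5 (pN p \<bullet> (s ^^ 5) (pN q))) = mapt M3 (Ce 1 (Ce 3 (pN p)) \<bullet> (s ^^ 3) (Ce 1 (pN q)))"
      by (simp add: shift_pt mul_pt mapt_pt Ce_pt ck_def 1 2 3 Ce_tscale mul_tscale mul_tscale_right m sp eps_mult eps_anti mult_ac)
  qed (auto intro!: lins lin_Ce lin_sp dest: W_A)
qed

text \<open>The counit on the first leg gives the counit law of the free coaction, the one on the
  second leg a triangle identity.\<close>

lemma Ce_cfree: "Ce 0 (cfree a) = j a" "Ce 1 (cfree a) = j a"
proof -
  have "mapt M3 ((s ^^ 3) (j a)) = j a"
  proof -
    have "M3 (1 ## 1 ## 1 ## a ## 1) = a ## 1"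
      by (auto simp: M3_def fun_eq_iff one_fun_apply eval_nat_numeral split: nat.split)
    then show ?thesis by (simp add: j_def s_pt mapt_pt[OF slin_M3] eval_nat_numeral)
  qed
  then show "Ce 0 (cfree a) = j a" "Ce 1 (cfree a) = j a"
    using Ce_M5[OF Omega_W mul_W[OF Delta_W F_W(2)], of a] Ce_Omega Ce_F' Ce_Delta
    by (simp_all add: cfree_def Ce_mul)
qed

text \<open>\<open>\<Omega>\<close> goes from ((ab)c)(de) to (a((bc)d))e and hence conjugates the
  fivefold coproducts of these shapes; the proof follows its factors one by one.\<close>

lemma Omega_inter: assumes "x \<in> A" shows "\<Omega> \<bullet> D 0 (D 2 (D 0 (D 0 x))) = D 1 (D 1 (D 0 (D 0 x))) \<bullet> \<Omega>"
proof -
  have 1: "D 0 (D 2 (D 0 (D 0 x))) = D 0 (D 0 (D 1 (D 0 x)))"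
    using assms D_D[of "D 0 x" 0 1] by (simp add: numeral_2_eq_2)
  have 2: "\<phi> \<bullet> D 0 (D 0 (D 1 (D 0 x))) = D 1 (D 0 (D 1 (D 0 x))) \<bullet> \<phi>"
    using assms by (simp add: inter_0)
  have 3: "\<phi>' \<bullet> D 1 (D 0 x) = D 0 (D 0 x) \<bullet> \<phi>'"
    by (rule conj_inverse[OF _ _ _ _ _ _ inter_0[OF assms]]) (use assms in \<open>simp_all add: phi_phi'\<close>)
  have 4: "D 0 \<phi>' \<bullet> D 0 (D 1 (D 0 x)) = D 0 (D 0 (D 0 x)) \<bullet> D 0 \<phi>'"
    using assms 3 D_mul[of "\<phi>'" "D 1 (D 0 x)" 0] D_mul[of "D 0 (D 0 x)" "\<phi>'" 0] by simp
  have 5: "(\<phi> \<bullet> D 0 \<phi>') \<bullet> D 0 (D 1 (D 0 x)) = D 1 (D 0 (D 0 x)) \<bullet> (\<phi> \<bullet> D 0 \<phi>')"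
  proof -
    have "(\<phi> \<bullet> D 0 \<phi>') \<bullet> D 0 (D 1 (D 0 x)) = \<phi> \<bullet> (D 0 \<phi>' \<bullet> D 0 (D 1 (D 0 x)))"
      using assms by (intro mul_assoc) auto
    also have "\<dots> = (\<phi> \<bullet> D 0 (D 0 (D 0 x))) \<bullet> D 0 \<phi>'"
      unfolding 4 using assms by (intro mul_assoc[symmetric]) auto
    also have "\<dots> = (D 1 (D 0 (D 0 x)) \<bullet> \<phi>) \<bullet> D 0 \<phi>'"
      using inter_0[of "D 0 x"] assms by simp
    also have "\<dots> = D 1 (D 0 (D 0 x)) \<bullet> (\<phi> \<bullet> D 0 \<phi>')"
      using assms by (intro mul_assoc) auto
    finally show ?thesis .
  qed
  let ?c = "D 1 (\<phi> \<bullet> D 0 \<phi>')"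
  have "\<Omega> \<bullet> D 0 (D 2 (D 0 (D 0 x))) = ?c \<bullet> (\<phi> \<bullet> D 0 (D 0 (D 1 (D 0 x))))"
    unfolding 1 \<Omega>_def using assms by (intro mul_assoc) auto
  also have "\<dots> = (?c \<bullet> D 1 (D 0 (D 1 (D 0 x)))) \<bullet> \<phi>"
    unfolding 2 using assms by (intro mul_assoc[symmetric]) auto
  also have "?c \<bullet> D 1 (D 0 (D 1 (D 0 x))) = D 1 (D 1 (D 0 (D 0 x))) \<bullet> ?c"
    using assms D_mul[of "\<phi> \<bullet> D 0 \<phi>'" "D 0 (D 1 (D 0 x))" 1] D_mul[of "D 1 (D 0 (D 0 x))" "\<phi> \<bullet> D 0 \<phi>'" 1] 5
    by simp
  also have "\<dots> \<bullet> \<phi> = D 1 (D 1 (D 0 (D 0 x))) \<bullet> \<Omega>"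
    unfolding \<Omega>_def using assms by (intro mul_assoc) auto
  finally show ?thesis .
qed

section \<open>Compatibility of the coaction with the action\<close>

context
  fixes P :: "'h \<times> 'h \<times> 'h \<Rightarrow> ('k, 'b) tensor"
  assumes P: "multilin (H3 Q) P"
begin

lemmas Pm = multilin_H3[OF P]

lemma P_m: "multilin \<H> (\<lambda>k. tscale (tail 3 k) (P (k 0, k 1, k 2 * b)))"
  by (rule multilin_tail) (auto dest!: less3_cases intro!: Pm mcomps)

lemma P_inner: "multilin \<H> (\<lambda>q. tscale (tail 5 q) (P (q 0 * a * S (q 4), q 1 * b * S (q 3), q 2 * c)))"
  by (rule multilin_tail) (auto dest!: less5_cases intro!: Pm mcomps)

lemma P_outer:
  assumes "t \<in> A"
  shows "multilin \<H> (\<lambda>k. tscale (tail 3 k) (ev 5 (\<lambda>q. P (q 0 * k 0 * S (q 4), q 1 * k 1 * S (q 3), q 2 * k 2)) t))"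
  by (rule multilin_tail) (auto dest!: less3_cases intro!: multilin_ev2[OF good_H1 assms] P_inner[simplified] Pm mcomps)

definition "fl X Y = ev 3 (\<lambda>k. P (k 0, k 1, k 2)) (mapt M5 (X \<bullet> (s ^^ 5) Y))"

lemma lin_fl: "Z \<in> A \<Longrightarrow> lin X L \<Longrightarrow> lin X (\<lambda>t. fl (L t) Z)"
  "Y \<in> A \<Longrightarrow> lin X L \<Longrightarrow> (\<And>t. t \<in> tens X \<Longrightarrow> L t \<in> A) \<Longrightarrow> lin X (\<lambda>t. fl Y (L t))"
  unfolding fl_def by (auto intro!: lin_ev lins lin_sp slin_M5)

lemma fl_pt:
  assumes "\<And>i. 5 \<le> i \<Longrightarrow> p i = 1" "\<And>i. 2 \<le> i \<Longrightarrow> q i = 1"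
  shows "fl (pN p) (pN q) = P (p 0 * q 0 * S (p 4), p 1 * q 1 * S (p 3), p 2)"
  using ev_M5[OF P_m[of 1], of p q, OF assms] M5_entries[of p q] assms(1) by (simp add: fl_def)

lemma fl_left:
  assumes "u \<in> W 5" "v \<in> W 2"
  shows "ev 3 (\<lambda>k. P (k 0, k 1, k 2 * b)) (mapt M5 (u \<bullet> (s ^^ 5) v)) = fl (u \<bullet> s (s (j b))) v"
proof (rule W_ext2[OF assms, where L = "\<lambda>u v. ev 3 (\<lambda>k. P (k 0, k 1, k 2 * b)) (mapt M5 (u \<bullet> (s ^^ 5) v))" and R = "\<lambda>u v. fl (u \<bullet> s (s (j b))) v"])
  fix p q :: "nat \<Rightarrow> 'h" assume p: "\<And>i. 5 \<le> i \<Longrightarrow> p i = 1" and q: "\<And>i. 2 \<le> i \<Longrightarrow> q i = 1"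
  have "fl (pN p \<bullet> s (s (j b))) (pN q) = fl (pN (p * (1 ## 1 ## b ## 1))) (pN q)"
    by (simp add: j_def s_pt mul_pt)
  also have "\<dots> = P (p 0 * q 0 * S (p 4), p 1 * q 1 * S (p 3), p 2 * b)"
    using p q by (subst fl_pt) (auto simp: pointwise eval_nat_numeral split: nat.split)
  finally show "ev 3 (\<lambda>k. P (k 0, k 1, k 2 * b)) (mapt M5 (pN p \<bullet> (s ^^ 5) (pN q))) = fl (pN p \<bullet> s (s (j b))) (pN q)"
    using ev_M5[OF P_m[of b], of p q, OF p q] M5_entries[of p q] p by simp
qed (auto intro!: lins lin_ev lin_fl lin_sp slin_M5 dest: W_A)

lemma fl_right:
  assumes "u \<in> W 5" "v \<in> W 2" "t \<in> W 5"
  shows "ev 3 (\<lambda>k. ev 5 (\<lambda>q. P (q 0 * k 0 * S (q 4), q 1 * k 1 * S (q 3), q 2 * k 2)) t) (mapt M5 (u \<bullet> (s ^^ 5) v)) = fl (t \<bullet> u) v"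
proof (rule W_ext2[OF assms(1,2), where R = "\<lambda>u v. fl (t \<bullet> u) v" and
    L = "\<lambda>u v. ev 3 (\<lambda>k. ev 5 (\<lambda>q. P (q 0 * k 0 * S (q 4), q 1 * k 1 * S (q 3), q 2 * k 2)) t) (mapt M5 (u \<bullet> (s ^^ 5) v))"])
  have t: "t \<in> A" using assms(3) by (rule W_A)
  fix p q :: "nat \<Rightarrow> 'h" assume p: "\<And>i. 5 \<le> i \<Longrightarrow> p i = 1" and q: "\<And>i. 2 \<le> i \<Longrightarrow> q i = 1"
  have "ev 5 (\<lambda>r. P (r 0 * (p 0 * q 0 * S (p 4)) * S (r 4), r 1 * (p 1 * q 1 * S (p 3)) * S (r 3), r 2 * p 2)) t = fl (t \<bullet> pN p) (pN q)"
  proof (rule lin_ext_W[OF assms(3), where R = "\<lambda>t. fl (t \<bullet> pN p) (pN q)"])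
    fix r :: "nat \<Rightarrow> 'h" assume r: "\<And>i. 5 \<le> i \<Longrightarrow> r i = 1"
    have "fl (pN r \<bullet> pN p) (pN q) = P (r 0 * (p 0 * q 0 * S (p 4)) * S (r 4), r 1 * (p 1 * q 1 * S (p 3)) * S (r 3), r 2 * p 2)"
      using p q r by (simp add: mul_pt) (subst fl_pt, auto simp: pointwise anti_mult mult.assoc)
    then show "ev 5 (\<lambda>r. P (r 0 * (p 0 * q 0 * S (p 4)) * S (r 4), r 1 * (p 1 * q 1 * S (p 3)) * S (r 3), r 2 * p 2)) (pN r) = fl (pN r \<bullet> pN p) (pN q)"
      using r ev_pt[OF P_inner r] by simp
  qed (auto intro!: lins lin_ev lin_fl)
  then show "ev 3 (\<lambda>k. ev 5 (\<lambda>q. P (q 0 * k 0 * S (q 4), q 1 * k 1 * S (q 3), q 2 * k 2)) t) (mapt M5 (pN p \<bullet> (s ^^ 5) (pN q))) = fl (t \<bullet> pN p) (pN q)"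
    using ev_M5[OF P_outer[OF t], of p q, OF p q] M5_entries[of p q] p by simp
qed (use assms(3) in \<open>auto intro!: lins lin_ev lin_fl lin_sp slin_M5 dest: W_A\<close>)

lemma cfree_P_m: "multilin \<H> (\<lambda>z. tscale (tail 3 z) (ev 3 (\<lambda>k. P (k 0, k 1, k 2 * z 1)) (cfree (z 0 * a * S (z 2)))))"
proof (rule multilin_tail)
  fix i :: nat and x :: "nat \<Rightarrow> 'h" assume "i < 3"
  then show "multilin (H1 Q) (\<lambda>b. ev 3 (\<lambda>k. P (k 0, k 1, k 2 * (x(i := b)) 1)) (cfree ((x(i := b)) 0 * a * S ((x(i := b)) 2))))"
    by (auto dest!: less3_cases intro!: multilin_ev1 multilin_ev2[OF good_H1 cfree_in] mcomps multilin_cfree P_m[simplified] Pm)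
qed auto

text \<open>On the left, \<open>cfree_mult\<close> hands the outer parts of \<open>h\<close> over to
  the word, which becomes \<open>\<Omega>\<close> times a fivefold coproduct; on the right the
  fivefold coproduct multiplies \<open>\<Omega>\<close> from the left. \<open>Omega_inter\<close>
  equates the two.\<close>

lemma cfree_compat:
  "ev 3 (\<lambda>z. ev 3 (\<lambda>k. P (k 0, k 1, k 2 * z 1)) (cfree (z 0 * a * S (z 2)))) (D 0 (\<Delta> h)) =
   ev 3 (\<lambda>k. ev 5 (\<lambda>q. P (q 0 * k 0 * S (q 4), q 1 * k 1 * S (q 3), q 2 * k 2)) (D 1 (D 1 (D 0 (\<Delta> h))))) (cfree a)"
proof -
  let ?Y = "\<Delta> a \<bullet> \<F>'"
  have Y: "?Y \<in> W 2" by (intro mul_W Delta_W F_W)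
  have l: "ev 3 (\<lambda>z. ev 3 (\<lambda>k. P (k 0, k 1, k 2 * z 1)) (cfree (z 0 * a * S (z 2)))) t = fl (\<Omega> \<bullet> D 0 (D 2 t)) ?Y" if "t \<in> W 3" for t
  proof (rule lin_ext_W[OF that, where R = "\<lambda>t. fl (\<Omega> \<bullet> D 0 (D 2 t)) ?Y"])
    fix z :: "nat \<Rightarrow> 'h" assume z: "\<And>i. 3 \<le> i \<Longrightarrow> z i = 1"
    have z3: "z = z 0 ## z 1 ## z 2 ## 1"
      using z by (auto simp: fun_eq_iff one_fun_apply eval_nat_numeral split: nat.split)
    have "s (s (j (z 1))) \<bullet> s (s (s (\<Delta> (z 2)))) = s (s (s (\<Delta> (z 2)))) \<bullet> s (s (j (z 1)))"
      using comm[OF j_W, of "\<Delta> (z 2)" "z 1"] by (simp flip: s_mul)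
    then have D02: "D 0 (D 2 (pN z)) = \<Delta> (z 0) \<bullet> (s (s (s (\<Delta> (z 2)))) \<bullet> s (s (j (z 1))))"
      by (subst z3) (simp add: pN_three D_mul D_j D_s_pos D_0_s \<Delta>_def[symmetric] numeral_2_eq_2)
    have u: "\<Omega> \<bullet> (\<Delta> (z 0) \<bullet> s (s (s (\<Delta> (z 2))))) \<in> W 5"
      using sp_W[OF Delta_W, of 3 "z 2"] by (intro mul_W Omega_W W_mono[OF Delta_W]) (auto simp: eval_nat_numeral)
    have "ev 3 (\<lambda>z. ev 3 (\<lambda>k. P (k 0, k 1, k 2 * z 1)) (cfree (z 0 * a * S (z 2)))) (pN z) =
        ev 3 (\<lambda>k. P (k 0, k 1, k 2 * z 1)) (cfree (z 0 * a * S (z 2)))"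
      by (rule ev_pt[OF cfree_P_m z])
    also have "\<dots> = fl (\<Omega> \<bullet> D 0 (D 2 (pN z))) ?Y"
      unfolding cfree_mult fl_left[OF u Y] D02 by (simp add: mul_assoc)
    finally show "ev 3 (\<lambda>z. ev 3 (\<lambda>k. P (k 0, k 1, k 2 * z 1)) (cfree (z 0 * a * S (z 2)))) (pN z) = fl (\<Omega> \<bullet> D 0 (D 2 (pN z))) ?Y" .
  qed (auto intro!: lins lin_ev lin_fl)
  have W3: "D 0 (\<Delta> h) \<in> W 3" using D_W[OF Delta_W, of 0 h] by simp
  have W5: "D 1 (D 1 (D 0 (\<Delta> h))) \<in> W 5"
    using D_W[OF D_W[OF W3, of 1], of 1] by simp
  have r: "ev 3 (\<lambda>k. ev 5 (\<lambda>q. P (q 0 * k 0 * S (q 4), q 1 * k 1 * S (q 3), q 2 * k 2)) (D 1 (D 1 (D 0 (\<Delta> h))))) (cfree a) =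
      fl (D 1 (D 1 (D 0 (\<Delta> h))) \<bullet> \<Omega>) ?Y"
    unfolding cfree_def by (rule fl_right[OF Omega_W Y W5])
  show ?thesis
    unfolding l[OF W3] r using Omega_inter[of "j h"] by (simp add: \<Delta>_def)
qed

end

end

section \<open>Comparison with the Sweedler formulas\<close>

context quasi_hopf_algebra begin

abbreviation em where "em p \<equiv> dk 0 p 1"

lemma spl_0_1: "spl 0 a b 1 = a ## b ## (1 :: nat \<Rightarrow> 'h)"
  by (simp add: spl_0 one_fun_apply flip: one_fun_def)

lemma em_pt: "em (pt (H2 Q) z) = pN (fst z ## snd z ## 1)"
  by (simp add: dk_pt spl_0_1)
lemma em_Delta: "em (Delta Q h) = \<Delta> h"
  by (simp add: dk_def spl_0_1 \<Delta>_def D0_j)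
lemma em_mult: "p \<in> tens (H2 Q) \<Longrightarrow> q \<in> tens (H2 Q) \<Longrightarrow> em (tmult (H2 Q) m2 p q) = em p \<bullet> em q"
  using dk_mult[of p q 0 1 1] by simp
lemma lin_em: "lin X L \<Longrightarrow> lin X (\<lambda>t. em (L t))"
  unfolding dk_def by (rule lin_tsum)

lemma multilin_H2_pt: "multilin (H1 Q) (\<lambda>a. pt (H2 Q) (a, b))" "multilin (H1 Q) (\<lambda>b. pt (H2 Q) (a, b))"
  using multilin_pt[OF good_H2] by (simp_all add: multilin_mprod)

lemma multilin_anti: "multilin (H1 Q) F \<Longrightarrow> multilin (H1 Q) (\<lambda>a. F (S a))"
  by (erule multilin_comp[OF _ linear_anti]) simp

text \<open>Recovers a tensor in H \<otimes> H from its image in the common algebra, so that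
  \<open>em\<close> is injective and the inverse of Drinfeld's element can be brought back.\<close>

definition proj where "proj t = ev 2 (\<lambda>x. pt (H2 Q) (x 0, x 1)) t"

lemma less2_cases: "(i::nat) < 2 \<Longrightarrow> i = 0 \<or> i = 1"
  by auto

lemma proj_m: "multilin \<H> (\<lambda>x. tscale (tail 2 x) (pt (H2 Q) (x 0, x 1)))"
  by (rule multilin_tail) (auto dest!: less2_cases intro!: multilin_H2_pt)

lemma proj_em: assumes "p \<in> tens (H2 Q)" shows "proj (em p) = p"
proof (rule lin_ext[OF assms, where L = "\<lambda>p. proj (em p)" and R = "\<lambda>p. p"])
  fix z :: "'h \<times> 'h"
  have "ev 2 (\<lambda>x. pt (H2 Q) (x 0, x 1)) (pN (fst z ## snd z ## 1)) = pt (H2 Q) z"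
    by (subst ev_pt[OF proj_m]) (auto simp: one_fun_apply split: nat.split)
  then show "proj (em (pt (H2 Q) z)) = pt (H2 Q) z" by (simp add: proj_def em_pt)
qed (auto simp: proj_def intro!: lin_ev lin_em lin_id)

lemma em_proj: assumes "t \<in> W 2" shows "em (proj t) = t" "proj t \<in> tens (H2 Q)"
proof -
  show "em (proj t) = t"
  proof (rule lin_ext_W[OF assms, where L = "\<lambda>t. em (proj t)" and R = "\<lambda>t. t"])
    fix x :: "nat \<Rightarrow> 'h" assume x: "\<And>i. 2 \<le> i \<Longrightarrow> x i = 1"
    have "x 0 ## x 1 ## 1 = x"
      using x by (auto simp: fun_eq_iff one_fun_apply eval_nat_numeral split: nat.split)
    have "proj (pN x) = pt (H2 Q) (x 0, x 1)"
      unfolding proj_def by (rule ev_pt[OF proj_m x])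
    then show "em (proj (pN x)) = pN x"
      using \<open>x 0 ## x 1 ## 1 = x\<close> by (simp only: em_pt fst_conv snd_conv)
  qed (auto simp: proj_def intro!: lin_ev lin_em lin_id)
  show "proj t \<in> tens (H2 Q)"
    unfolding proj_def by (rule ev_in[OF proj_m]) (use assms W_A in auto)
qed

lemma em_inj: "p \<in> tens (H2 Q) \<Longrightarrow> q \<in> tens (H2 Q) \<Longrightarrow> em p = em q \<Longrightarrow> p = q"
  by (metis proj_em)

abbreviation elt_a_term where
  "elt_a_term x y w \<equiv> pt (H2 Q) (S (fst y * fst (snd x)) * \<alpha> * fst (snd y) * fst w, S (fst x) * \<alpha> * snd (snd y) * snd w)"

lemma elt_a_eq: "elt_a Q = tsum (phi Q) (\<lambda>x. tsum (phi_inv Q) (\<lambda>y. tsum (Delta Q (snd (snd x))) (elt_a_term x y)))"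
  by (simp add: elt_a_def split_def)

lemma elt_a_in: "elt_a Q \<in> tens (H2 Q)"
proof -
  note m = multilin_H2_pt
  have l: "linear_on sc sc UNIV (\<lambda>a. S (b * a) * c)" "linear_on sc sc UNIV (\<lambda>a. S (a * b) * c)"
    "linear_on sc sc UNIV (\<lambda>a. S a * c)" "linear_on sc sc UNIV (\<lambda>a. b * a * c)" "linear_on sc sc UNIV (\<lambda>a. b * a)" for b c
    by (simp_all add: lin_simps)
  have t1: "multilin (H1 Q) (\<lambda>a. pt (H2 Q) (S (b * a) * c1 * c2 * c3, d))" "multilin (H1 Q) (\<lambda>a. pt (H2 Q) (S (a * b) * c1 * c2 * c3, d))"
    "multilin (H1 Q) (\<lambda>a. pt (H2 Q) (d, S a * c1 * c2 * c3))" "multilin (H1 Q) (\<lambda>a. pt (H2 Q) (b * a * c1, d))" "multilin (H1 Q) (\<lambda>a. pt (H2 Q) (d, b * a * c1))"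
    "multilin (H1 Q) (\<lambda>a. pt (H2 Q) (b * a, d))" "multilin (H1 Q) (\<lambda>a. pt (H2 Q) (d, b * a))" for b c1 c2 c3 d
    using multilin_comp[OF m(1) l(1), of b "c1 * c2 * c3" d] multilin_comp[OF m(1) l(2), of b "c1 * c2 * c3" d] multilin_comp[OF m(2) l(3), of "c1 * c2 * c3" d]
      multilin_comp[OF m(1) l(4), of b c1 d] multilin_comp[OF m(2) l(4), of b c1 d] multilin_comp[OF m(1) l(5), of b d] multilin_comp[OF m(2) l(5), of b d]
    by (simp_all add: mult.assoc)
  have w: "multilin (H2 Q) (elt_a_term x y)" for x y
    by (auto simp: multilin_mprod intro!: t1)
  have y: "multilin (H3 Q) (\<lambda>y. tsum (Delta Q h) (elt_a_term x y))" for x h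
    by (rule multilin_tsum2[OF good_H3 good_H2 Delta_in]) (auto simp: w, auto simp: multilin_mprod intro!: t1)
  have x: "multilin (H3 Q) (\<lambda>x. tsum (phi_inv Q) (\<lambda>y. tsum (Delta Q (snd (snd x))) (elt_a_term x y)))"
  proof (rule multilin_tsum2[OF good_H3 good_H3 phi_inv(1)])
    fix y :: "'h \<times> 'h \<times> 'h"
    have "multilin (H1 Q) (\<lambda>a. tsum (Delta Q h) (elt_a_term (a, b, h) y))" for b h
      by (rule multilin_tsum2[OF good_H1 good_H2 Delta_in], simp only: fst_conv snd_conv, rule t1, rule w)
    moreover have "multilin (H1 Q) (\<lambda>b. tsum (Delta Q h) (elt_a_term (a, b, h) y))" for a h
      by (rule multilin_tsum2[OF good_H1 good_H2 Delta_in], simp only: fst_conv snd_conv, rule t1, rule w)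
    ultimately show "multilin (H3 Q) (\<lambda>x. tsum (Delta Q (snd (snd x))) (elt_a_term x y))"
      by (auto simp: multilin_mprod intro!: multilin_Delta)
  qed (rule y)
  show ?thesis unfolding elt_a_eq
    by (rule tsum_in[OF phi_in x], rule tsum_in[OF phi_inv(1) y], rule tsum_in[OF Delta_in w]) auto
qed

text \<open>In the word \<open>s \<phi>' \<bullet> D 2 \<phi>\<close>, \<open>phi_inv Q\<close>
  fills slots 1 to 3 and \<open>phi Q\<close>, with its third leg split, slots 0 to 3; multiplied
  out by \<open>Ep\<close> this is the summand of \<open>elt_a\<close>.\<close>

lemma em_elt_a: "em (elt_a Q) = ea"
proof -
  let ?r = "\<lambda>x :: 'h \<times> 'h \<times> 'h. D 2 (pN (fst x ## fst (snd x) ## snd (snd x) ## 1))"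
  have m: "multilin (H3 Q) ?r"
    using multilin_D[OF multilin_r3[of 0 1], of 2] by (simp only: r3_0)
  have "D 2 \<phi> = tsum (phi Q) ?r"
    by (simp only: phi_tsum D_tsum)
  then have "s \<phi>' \<bullet> D 2 \<phi> = tsum (phi Q) (\<lambda>x. s \<phi>' \<bullet> ?r x)"
    using mul_tsum_right[OF good_H3 phi_in _ m, of "s \<phi>'"] by simp
  then have "ea = mapt Ep (tsum (phi Q) (\<lambda>x. s \<phi>' \<bullet> ?r x))"
    by (simp add: ea_def \<theta>_def)
  also have "\<dots> = em (elt_a Q)"
  proof -
    have t: "s \<phi>' \<bullet> D 2 (pN (a ## b ## c ## 1)) = tsum (phi_inv Q) (\<lambda>y. tsum (Delta Q c) (\<lambda>w.
        pN ((1 ## fst y ## fst (snd y) ## snd (snd y) ## 1) * (a ## b ## fst w ## snd w ## 1))))" for a b c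
    proof -
      have m: "multilin (H2 Q) (\<lambda>w. pN (a ## b ## fst w ## snd w ## 1))"
        using multilin_spl[of 2 "a ## b ## 0 ## 1"] by (simp add: numeral_2_eq_2 spl_Suc_cons spl_0_cons)
      have "D 2 (pN (a ## b ## c ## 1)) = tsum (Delta Q c) (\<lambda>w. pN (a ## b ## fst w ## snd w ## 1))"
        by (simp add: D_pt dk_def numeral_2_eq_2 spl_Suc_cons spl_0_cons)
      then show ?thesis
        by (simp add: phi_inv_tsum s_tsum s_pt mul_tsum_left mul_tsum_right[OF good_H2 Delta_in _ m] mul_pt del: cons_mult)
    qed
    have e: "Ep ((1 ## y1 ## y2 ## y3 ## 1) * (a ## b ## w1 ## w2 ## 1)) =
      S (y1 * b) * \<alpha> * y2 * w1 ## S a * \<alpha> * y3 * w2 ## 1" for y1 y2 y3 a b w1 w2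
      by (auto simp: Ep_def fun_eq_iff one_fun_apply mult.assoc eval_nat_numeral split: nat.split)
    show ?thesis
      unfolding t elt_a_eq
      by (simp add: mapt_tsum mapt_pt[OF slin_Ep] e dk_tsum em_pt del: cons_mult)
  qed
  finally show ?thesis ..
qed

text \<open>Writing out p^R turns the definition into the gauge formula, whose three factors become
  \<open>cop\<close>, \<open>ea\<close> and a coproduct in the common algebra.\<close>

lemma drinfeld_eq: "drinfeld Q = tsum (phi_inv Q) (\<lambda>z. tmult (H2 Q) m2
    (tmult (H2 Q) m2 (tsum (Delta Q (fst z)) (\<lambda>w. pt (H2 Q) (S (snd w), S (fst w)))) (elt_a Q))
    (Delta Q (fst (snd z) * \<beta> * S (snd (snd z)))))"
  and drinfeld_in: "drinfeld Q \<in> tens (H2 Q)" and em_drinfeld: "em (drinfeld Q) = \<F>"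
proof -
  have w: "multilin (H2 Q) (\<lambda>w. pt (H2 Q) (S (snd w), S (fst w)))"
    by (auto simp: multilin_mprod intro!: multilin_anti[of "\<lambda>a. pt (H2 Q) (a, _)"] multilin_anti[of "\<lambda>a. pt (H2 Q) (_, a)"] multilin_H2_pt)
  let ?c = "\<lambda>p. tsum (Delta Q p) (\<lambda>w. pt (H2 Q) (S (snd w), S (fst w)))"
  let ?g = "\<lambda>p q. tmult (H2 Q) m2 (tmult (H2 Q) m2 (?c p) (elt_a Q)) (Delta Q q)"
  have c: "?c p \<in> tens (H2 Q)" for p by (rule tsum_in[OF Delta_in w]) auto
  note t2 = tmult_in[OF talg_H2]
  have m: "multilin (H2 Q) (\<lambda>z. ?g (fst z) (snd z))"
    unfolding multilin_mprod
  proof (intro conjI ballI)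
    fix a :: 'h
    have "multilin (H1 Q) (\<lambda>q. tsum (Delta Q q) F)" for F :: "_ \<Rightarrow> ('k, 'h \<times> 'h) tensor" by (rule multilin_Delta)
    then show "multilin (H1 Q) (\<lambda>q. ?g (fst (a, q)) (snd (a, q)))"
      unfolding fst_conv snd_conv tmult_def[of _ _ _ "Delta Q _"]
      using t2[OF c elt_a_in] talg_multilin[OF talg_H2]
      by (intro multilin_tsum2[OF good_H1 good_H2]) (auto intro!: multilin_tsum2[OF good_H2 good_H2] simp: tsum_pt_right)
  next
    fix b :: 'h
    show "multilin (H1 Q) (\<lambda>p. ?g (fst (p, b)) (snd (p, b)))"
      unfolding fst_conv snd_conv tmult_def by (intro multilin_tsum1 multilin_Delta)
  qed
  have "drinfeld Q = tsum (pR Q) (\<lambda>z. ?g (fst z) (snd z))"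
    by (simp add: drinfeld_def split_def)
  then show eq: "drinfeld Q = tsum (phi_inv Q) (\<lambda>z. ?g (fst z) (fst (snd z) * \<beta> * S (snd (snd z))))"
    by (simp add: pR_def split_def tsum_tsum tsum_pt_multilin[OF m])
  have "pR Q \<in> tens (H2 Q)"
  proof -
    have "multilin (H1 Q) (\<lambda>a. pt (H2 Q) (b, a * \<beta> * c))" "multilin (H1 Q) (\<lambda>a. pt (H2 Q) (b, d * \<beta> * S a))" for b c d
      using multilin_sandwichS(2)[OF multilin_H2_pt(2)] multilin_anti[OF multilin_argR[OF multilin_H2_pt(2)]] by simp_all
    then show ?thesis unfolding pR_def split_def
      by (intro tsum_in[OF phi_inv(1)]) (auto simp: multilin_mprod intro!: multilin_H2_pt)
  qed
  then show "drinfeld Q \<in> tens (H2 Q)"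
    unfolding \<open>drinfeld Q = tsum (pR Q) (\<lambda>z. ?g (fst z) (snd z))\<close>
    by (rule tsum_in[OF _ m]) (auto intro!: t2 c elt_a_in)
  have "em (?c p) = cop p" for p
    by (simp add: dk_tsum em_pt cop_tsum pN_two)
  then have "em (?g p q) = cop p \<bullet> ea \<bullet> \<Delta> q" for p q
    using c elt_a_in by (simp add: em_mult t2 em_elt_a em_Delta)
  then show "em (drinfeld Q) = \<F>"
    unfolding eq dk_tsum \<F>_def gauge_def by (simp add: AD mul_assoc)
qed

text \<open>\<open>drinfeld_inv\<close> is given by a unique description in H \<otimes> H;
  \<open>proj \<F>'\<close> satisfies it because \<open>em\<close> is multiplicative and
  injective.\<close>

lemma drinfeld_inv: "drinfeld_inv Q \<in> tens (H2 Q)" "em (drinfeld_inv Q) = \<F>'"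
proof -
  note t2 = tmult_in[OF talg_H2]
  have F': "proj \<F>' \<in> tens (H2 Q)" "em (proj \<F>') = \<F>'"
    using em_proj F_W by auto
  have "tmult (H2 Q) m2 (drinfeld Q) (proj \<F>') = pt (H2 Q) (1, 1)" "tmult (H2 Q) m2 (proj \<F>') (drinfeld Q) = pt (H2 Q) (1, 1)"
    by (rule em_inj; simp add: t2 F' drinfeld_in em_mult em_drinfeld F_F' em_pt)+
  then have "is_tinv (H2 Q) m2 (1, 1) (drinfeld Q) (proj \<F>')"
    using F' by (simp add: is_tinv_def)
  then have "drinfeld_inv Q = proj \<F>'"
    unfolding drinfeld_inv_def by (rule tinv_eq[OF talg_H2 drinfeld_in])
  then show "drinfeld_inv Q \<in> tens (H2 Q)" "em (drinfeld_inv Q) = \<F>'"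
    using F' by simp_all
qed

lemma multilin_H5:
  assumes "multilin (H5 Q) G"
  shows "multilin (H1 Q) (\<lambda>x. G (x, b, c, d, e))" "multilin (H1 Q) (\<lambda>x. G (a, x, c, d, e))"
    "multilin (H1 Q) (\<lambda>x. G (a, b, x, d, e))" "multilin (H1 Q) (\<lambda>x. G (a, b, c, x, e))" "multilin (H1 Q) (\<lambda>x. G (a, b, c, d, x))"
  using assms by (simp_all add: multilin_mprod)

text \<open>\<omega> is made a function of the inverse of f, of \<chi> and of \<phi>, linear in
  each, so that identities can be checked with pure tensors in place of these three.\<close>

definition om1 where "om1 q = tsum q (\<lambda>z. pt (H5 Q) (1, 1, 1, snd z, fst z))"
definition om2 where "om2 q = tsum q (\<lambda>z. tsum (Delta Q (fst (snd z))) (\<lambda>w.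
  pt (H5 Q) (fst z, fst w, snd w, S (fst (snd (snd z))), S (snd (snd (snd z))))))"
definition om3 where "om3 q = tsum q (\<lambda>z. pt (H5 Q) (fst z, fst (snd z), snd (snd z), 1, 1))"
definition om where "om q c p = tmult (H5 Q) m5 (tmult (H5 Q) m5 (om1 q) (om2 c)) (om3 p)"

lemma omega_om: "omega Q = om (drinfeld_inv Q) (chi Q) (phi Q)"
  by (simp add: omega_def om_def om1_def om2_def om3_def split_def)

lemma multilin_om:
  "multilin (H2 Q) (\<lambda>z. pt (H5 Q) (1, 1, 1, snd z, fst z))"
  "multilin (H2 Q) (\<lambda>w. pt (H5 Q) (a, fst w, snd w, d, e))"
  "multilin (H4 Q) (\<lambda>z. tsum (Delta Q (fst (snd z))) (\<lambda>w.
    pt (H5 Q) (fst z, fst w, snd w, S (fst (snd (snd z))), S (snd (snd (snd z))))))"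
  "multilin (H3 Q) (\<lambda>z. pt (H5 Q) (fst z, fst (snd z), snd (snd z), 1, 1))"
proof -
  note m = multilin_H5[OF multilin_pt[OF good_H5]]
  show "multilin (H2 Q) (\<lambda>z. pt (H5 Q) (1, 1, 1, snd z, fst z))"
    "multilin (H3 Q) (\<lambda>z. pt (H5 Q) (fst z, fst (snd z), snd (snd z), 1, 1))"
    by (auto simp: multilin_mprod intro!: m)
  show w: "multilin (H2 Q) (\<lambda>w. pt (H5 Q) (a, fst w, snd w, d, e))" for a d e
    by (auto simp: multilin_mprod intro!: m)
  have "multilin (H1 Q) (\<lambda>a. tsum (Delta Q h) (\<lambda>w. pt (H5 Q) (a, fst w, snd w, d, e)))"
    "multilin (H1 Q) (\<lambda>x. tsum (Delta Q h) (\<lambda>w. pt (H5 Q) (a, fst w, snd w, S x, e)))"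
    "multilin (H1 Q) (\<lambda>x. tsum (Delta Q h) (\<lambda>w. pt (H5 Q) (a, fst w, snd w, d, S x)))" for a d e h
    by (rule multilin_tsum2[OF good_H1 good_H2 Delta_in _ w]; intro m multilin_anti[of "\<lambda>x. pt (H5 Q) (a, _, _, x, e)"] multilin_anti[of "\<lambda>x. pt (H5 Q) (a, _, _, d, x)"])+
  then show "multilin (H4 Q) (\<lambda>z. tsum (Delta Q (fst (snd z))) (\<lambda>w.
      pt (H5 Q) (fst z, fst w, snd w, S (fst (snd (snd z))), S (snd (snd (snd z))))))"
    by (auto simp: multilin_mprod multilin_Delta)
qed

lemma om_in [simp, intro]:
  "q \<in> tens (H2 Q) \<Longrightarrow> om1 q \<in> tens (H5 Q)" "c \<in> tens (H4 Q) \<Longrightarrow> om2 c \<in> tens (H5 Q)"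
  "p \<in> tens (H3 Q) \<Longrightarrow> om3 p \<in> tens (H5 Q)"
  unfolding om1_def om2_def om3_def
  by (auto intro!: tsum_in[OF _ multilin_om(1)] tsum_in[OF _ multilin_om(3)] tsum_in[OF _ multilin_om(4)] tsum_in[OF Delta_in multilin_om(2)])

lemma om_in' [simp, intro]:
  "q \<in> tens (H2 Q) \<Longrightarrow> c \<in> tens (H4 Q) \<Longrightarrow> p \<in> tens (H3 Q) \<Longrightarrow> om q c p \<in> tens (H5 Q)"
  unfolding om_def by (intro tmult_in[OF talg_H5] om_in)

lemma lin_om:
  "c \<in> tens (H4 Q) \<Longrightarrow> p \<in> tens (H3 Q) \<Longrightarrow> lin (H2 Q) (\<lambda>q. om q c p)"
  "q \<in> tens (H2 Q) \<Longrightarrow> p \<in> tens (H3 Q) \<Longrightarrow> lin (H4 Q) (\<lambda>c. om q c p)"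
  "q \<in> tens (H2 Q) \<Longrightarrow> c \<in> tens (H4 Q) \<Longrightarrow> lin (H3 Q) (\<lambda>p. om q c p)"
proof -
  have "lin (H2 Q) om1" "lin (H4 Q) om2" "lin (H3 Q) om3"
    using lin_tsum[OF lin_id] by (simp_all add: om1_def[abs_def] om2_def[abs_def] om3_def[abs_def])
  then show "c \<in> tens (H4 Q) \<Longrightarrow> p \<in> tens (H3 Q) \<Longrightarrow> lin (H2 Q) (\<lambda>q. om q c p)"
    "q \<in> tens (H2 Q) \<Longrightarrow> p \<in> tens (H3 Q) \<Longrightarrow> lin (H4 Q) (\<lambda>c. om q c p)"
    "q \<in> tens (H2 Q) \<Longrightarrow> c \<in> tens (H4 Q) \<Longrightarrow> lin (H3 Q) (\<lambda>p. om q c p)"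
    unfolding om_def by (auto intro!: lin_tmult_left[OF talg_H5] lin_tmult_right[OF talg_H5] tmult_in[OF talg_H5])
qed

lemma om_pt: "om (pt (H2 Q) q) (pt (H4 Q) c) (pt (H3 Q) p) = tsum (Delta Q (fst (snd c))) (\<lambda>w.
    pt (H5 Q) (fst c * fst p, fst w * fst (snd p), snd w * snd (snd p), snd q * S (fst (snd (snd c))), fst q * S (snd (snd (snd c)))))"
proof -
  have o2: "om2 (pt (H4 Q) c) \<in> tens (H5 Q)" by (rule om_in) (simp add: points_mprod points_vsp)
  have 2: "om2 (pt (H4 Q) c) = tsum (Delta Q (fst (snd c))) (\<lambda>w.
      pt (H5 Q) (fst c, fst w, snd w, S (fst (snd (snd c))), S (snd (snd (snd c)))))"
    unfolding om2_def by (rule tsum_pt_multilin[OF multilin_om(3)])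
  have 1: "om1 (pt (H2 Q) q) = pt (H5 Q) (1, 1, 1, snd q, fst q)"
    unfolding om1_def by (rule tsum_pt_multilin[OF multilin_om(1)])
  have 3: "om3 (pt (H3 Q) p) = pt (H5 Q) (fst p, fst (snd p), snd (snd p), 1, 1)"
    unfolding om3_def by (rule tsum_pt_multilin[OF multilin_om(4)])
  have "tsum (pt (H5 Q) x) (\<lambda>y. pt (H5 Q) (m5 z y)) = pt (H5 Q) (m5 z x)"
    "tsum (pt (H5 Q) x) (\<lambda>y. pt (H5 Q) (m5 y z)) = pt (H5 Q) (m5 x z)" for x z :: "'h \<times> 'h \<times> 'h \<times> 'h \<times> 'h"
    by (rule tsum_pt_multilin, rule talg_multilin[OF talg_H5])+
  note t = this
  show ?thesis
    unfolding om_def 1 3 tmult_pt_left[OF talg_H5 o2] tmult_pt_right[OF talg_H5]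
    unfolding 2 tsum_tsum t by (simp add: comp_op_def)
qed

lemma multilin_omega_arg:
  assumes P: "multilin (H3 Q) P"
  shows "multilin (H5 Q) (\<lambda>x. P (fst x * fst w * snd (snd (snd (snd x))), fst (snd x) * snd w * fst (snd (snd (snd x))), fst (snd (snd x))))"
    "multilin (H2 Q) (\<lambda>w. P (fst x * fst w * snd (snd (snd (snd x))), fst (snd x) * snd w * fst (snd (snd (snd x))), fst (snd (snd x))))"
  by (auto simp: multilin_mprod intro!: multilin_H3[OF P] mcomps)

text \<open>For pure arguments both sides evaluate \<open>P\<close> on the same products, summed
  over the coproduct of the second leg of \<open>c\<close>; linearity in the four arguments gives
  the rest.\<close>

lemma tsum_om:
  assumes P: "multilin (H3 Q) P" and q: "q \<in> tens (H2 Q)" and c: "c \<in> tens (H4 Q)" and p: "p \<in> tens (H3 Q)" and t: "t \<in> tens (H2 Q)"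
  shows "tsum (om q c p) (\<lambda>x. tsum t (\<lambda>w. P (fst x * fst w * snd (snd (snd (snd x))), fst (snd x) * snd w * fst (snd (snd (snd x))), fst (snd (snd x))))) =
    fl P (D 1 (e4 c) \<bullet> k3 0 p 1) (em t \<bullet> em q)"
proof -
  let ?G = "\<lambda>w x. P (fst x * fst w * snd (snd (snd (snd x))), fst (snd x) * snd w * fst (snd (snd (snd x))), fst (snd (snd x)))"
  note Gx = multilin_omega_arg(1)[OF P] and Gw = multilin_omega_arg(2)[OF P]
  have ein: "em z \<in> A" if "z \<in> tens (H2 Q)" for z using that by simp
  note lf = lin_fl[OF P]
  show ?thesis
  proof (rule lin_ext[OF t, where L = "\<lambda>t. tsum (om q c p) (\<lambda>x. tsum t (\<lambda>w. ?G w x))" and R = "\<lambda>t. fl P (D 1 (e4 c) \<bullet> k3 0 p 1) (em t \<bullet> em q)"])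
    fix w :: "'h \<times> 'h"
    have "tsum (om q c p) (?G w) = fl P (D 1 (e4 c) \<bullet> k3 0 p 1) (em (pt (H2 Q) w) \<bullet> em q)"
    proof (rule lin_ext[OF q, where L = "\<lambda>q. tsum (om q c p) (?G w)" and R = "\<lambda>q. fl P (D 1 (e4 c) \<bullet> k3 0 p 1) (em (pt (H2 Q) w) \<bullet> em q)"])
      fix d :: "'h \<times> 'h"
      show "tsum (om (pt (H2 Q) d) c p) (?G w) = fl P (D 1 (e4 c) \<bullet> k3 0 p 1) (em (pt (H2 Q) w) \<bullet> em (pt (H2 Q) d))"
      proof (rule lin_ext[OF c, where L = "\<lambda>c. tsum (om (pt (H2 Q) d) c p) (?G w)" and R = "\<lambda>c. fl P (D 1 (e4 c) \<bullet> k3 0 p 1) (em (pt (H2 Q) w) \<bullet> em (pt (H2 Q) d))"])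
        fix y :: "'h \<times> 'h \<times> 'h \<times> 'h"
        show "tsum (om (pt (H2 Q) d) (pt (H4 Q) y) p) (?G w) = fl P (D 1 (e4 (pt (H4 Q) y)) \<bullet> k3 0 p 1) (em (pt (H2 Q) w) \<bullet> em (pt (H2 Q) d))"
        proof (rule lin_ext[OF p, where L = "\<lambda>p. tsum (om (pt (H2 Q) d) (pt (H4 Q) y) p) (?G w)" and R = "\<lambda>p. fl P (D 1 (e4 (pt (H4 Q) y)) \<bullet> k3 0 p 1) (em (pt (H2 Q) w) \<bullet> em (pt (H2 Q) d))"])
          fix z :: "'h \<times> 'h \<times> 'h"
          have l: "tsum (om (pt (H2 Q) d) (pt (H4 Q) y) (pt (H3 Q) z)) (?G w) = tsum (Delta Q (fst (snd y))) (\<lambda>v. ?G w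
              (fst y * fst z, fst v * fst (snd z), snd v * snd (snd z), snd d * S (fst (snd (snd y))), fst d * S (snd (snd (snd y)))))"
            unfolding om_pt tsum_tsum tsum_pt_multilin[OF Gx] ..
          have "D 1 (e4 (pt (H4 Q) y)) = tsum (Delta Q (fst (snd y))) (\<lambda>v. pN (fst y ## fst v ## snd v ## fst (snd (snd y)) ## snd (snd (snd y)) ## 1))"
            by (simp add: e4_pt' D_pt dk_def spl_Suc_cons spl_0_cons)
          then have "fl P (D 1 (e4 (pt (H4 Q) y)) \<bullet> k3 0 (pt (H3 Q) z) 1) Y = tsum (Delta Q (fst (snd y))) (\<lambda>v.
              fl P (pN (fst y * fst z ## fst v * fst (snd z) ## snd v * snd (snd z) ## fst (snd (snd y)) ## snd (snd (snd y)) ## 1)) Y)" for Y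
            by (simp add: k3_pt r3_0 mul_tsum_left mul_pt fl_def[OF P] mapt_tsum ev_def tsum_tsum)
          then show "tsum (om (pt (H2 Q) d) (pt (H4 Q) y) (pt (H3 Q) z)) (?G w) =
              fl P (D 1 (e4 (pt (H4 Q) y)) \<bullet> k3 0 (pt (H3 Q) z) 1) (em (pt (H2 Q) w) \<bullet> em (pt (H2 Q) d))"
            unfolding l by (simp add: em_pt mul_pt fl_pt[OF P] mult.assoc eval_nat_numeral one_fun_apply split: nat.split)
        qed (auto intro!: lin_tsum lin_om lf lins lin_k3 lin_id ein e4_in)
      qed (use p in \<open>auto intro!: lin_tsum lin_om lf lins lin_e4 lin_id ein e4_in\<close>)
    qed (use c p in \<open>auto intro!: lin_tsum lin_om lf lins lin_em lin_id ein e4_in\<close>)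
    then show "tsum (om q c p) (\<lambda>x. tsum (pt (H2 Q) w) (\<lambda>w. ?G w x)) = fl P (D 1 (e4 c) \<bullet> k3 0 p 1) (em (pt (H2 Q) w) \<bullet> em q)"
      by (simp add: tsum_pt_multilin[OF Gw])
  next
    show "lin (H2 Q) (\<lambda>t. tsum (om q c p) (\<lambda>x. tsum t (\<lambda>w. ?G w x)))"
      by (rule lin_tsum2[OF good_H5 om_in'[OF q c p]]) (auto intro!: lin_tsum lin_id multilin_tsum2[OF good_H5 good_H2] Gx Gw)
  qed (use q c p in \<open>auto intro!: lf lins lin_em lin_id ein e4_in\<close>)
qed

lemma e4_chi: "chi Q \<in> tens (H4 Q)" "e4 (chi Q) = \<phi> \<bullet> D 0 \<phi>'"
proof -
  let ?a = "tsum (phi Q) (\<lambda>z. pt (H4 Q) (fst z, fst (snd z), snd (snd z), 1))"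
  let ?b = "tsum (phi_inv Q) (\<lambda>z. tsum (Delta Q (fst z)) (\<lambda>w. pt (H4 Q) (fst w, snd w, fst (snd z), snd (snd z))))"
  note m = multilin_Hn[OF multilin_pt[OF good_H4]]
  have c: "chi Q = tmult (H4 Q) m4 ?a ?b" by (simp add: chi_def split_def)
  have "multilin (H3 Q) (\<lambda>z. pt (H4 Q) (fst z, fst (snd z), snd (snd z), 1))"
    by (auto simp: multilin_mprod intro!: m)
  then have a: "?a \<in> tens (H4 Q)" by (rule tsum_in[OF phi_in]) auto
  have w: "multilin (H2 Q) (\<lambda>w. pt (H4 Q) (fst w, snd w, a, b))" for a b
    by (auto simp: multilin_mprod intro!: m)
  have "multilin (H1 Q) (\<lambda>b. tsum (Delta Q h) (\<lambda>w. pt (H4 Q) (fst w, snd w, b, c)))"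
    "multilin (H1 Q) (\<lambda>b. tsum (Delta Q h) (\<lambda>w. pt (H4 Q) (fst w, snd w, c, b)))" for c h
    by (rule multilin_tsum2[OF good_H1 good_H2 Delta_in _ w], rule m)+
  then have "multilin (H3 Q) (\<lambda>z. tsum (Delta Q (fst z)) (\<lambda>w. pt (H4 Q) (fst w, snd w, fst (snd z), snd (snd z))))"
    by (auto simp: multilin_mprod multilin_Delta)
  then have b: "?b \<in> tens (H4 Q)" by (rule tsum_in[OF phi_inv(1)]) (auto intro!: tsum_in[OF Delta_in w])
  show "chi Q \<in> tens (H4 Q)" unfolding c using a b by (rule tmult_in[OF talg_H4])
  have ea: "e4 ?a = \<phi>"
    by (simp add: e4_tsum e4_pt phi_tsum)
  have "e4 ?b = D 0 \<phi>'"
    by (simp add: e4_tsum e4_pt' phi_inv_tsum D_tsum D_pt dk_def spl_0_cons)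
  with ea show "e4 (chi Q) = \<phi> \<bullet> D 0 \<phi>'"
    unfolding c e4_mult[OF a b] by (rule arg_cong2)
qed

text \<open>The bridge between the defining formula and the words. \<open>P\<close> is arbitrary,
  and so covers both the coaction on R(V) and the \<omega> in its coassociativity law.\<close>

lemma tsum_omega:
  assumes P: "multilin (H3 Q) P"
  shows "tsum (omega Q) (\<lambda>x. tsum (Delta Q a) (\<lambda>w. P (fst x * fst w * snd (snd (snd (snd x))), fst (snd x) * snd w * fst (snd (snd (snd x))), fst (snd (snd x))))) =
    ev 3 (\<lambda>k. P (k 0, k 1, k 2)) (cfree a)"
proof -
  have "k3 0 (phi Q) 1 = \<phi>" by (simp add: \<phi>_def)
  then show ?thesis
    using tsum_om[OF P drinfeld_inv(1) e4_chi(1) phi_in Delta_in, of a]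
    unfolding omega_om fl_def[OF P] cfree_def \<Omega>_def e4_chi em_Delta drinfeld_inv by simp
qed

lemma omega_in: "omega Q \<in> tens (H5 Q)"
  unfolding omega_om using drinfeld_inv(1) e4_chi(1) phi_in by simp

end

section \<open>The adjunction\<close>

text \<open>H \<otimes> R(V) is built on R(V) as a space of tensors, so Sweedler sums occur inside
  the entries of pure tensors; this takes them out.\<close>

lemma linear_on_push:
  assumes "good Y" "linear_on tscale tscale (tens X) F" "t \<in> tens Y"
    and "multilin Y K" "multilin Y (\<lambda>y. F (K y))" "\<And>y. y \<in> points Y \<Longrightarrow> K y \<in> tens X"
  shows "F (tsum t K) = tsum t (\<lambda>y. F (K y))"
proof (rule lin_ext[OF assms(3), where L = "\<lambda>t. F (tsum t K)" and R = "\<lambda>t. tsum t (\<lambda>y. F (K y))"])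
  have "tsum t K \<in> tens X" if "t \<in> tens Y" for t
    using that assms(4,6) by (rule tsum_in)
  then show "lin Y (\<lambda>t. F (tsum t K))"
    using assms(2) by (auto simp: lin_def linear_on_def tsum_linear)
qed (auto intro: lin_tsum lin_id simp: tsum_pt_multilin assms)

lemma good_tens: "good (vsp tscale (tens X))"
  by (rule good_vsp) (auto simp: tens_def tensor.vector_space_axioms)

text \<open>With one factor, linear combinations of pure tensors are again pure, so
  \<open>tval\<close> is meaningful on the whole span.\<close>

lemma vsp_tens_tval:
  assumes "vector_space s" "module.subspace s V" "u \<in> tens (vsp s V)"
  shows "tval (vsp s V) u \<in> V" "pt (vsp s V) (tval (vsp s V) u) = u"
proof -
  interpret vector_space s by fact
  have add: "pt (vsp s V) (s c x + y) = tscale c (pt (vsp s V) x) + pt (vsp s V) y" if "x \<in> V" "y \<in> V" for c x y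
    using multilin_pt[OF good_vsp[OF assms(1,2)]] that assms(2) by (simp add: multilin_vsp linear_on_def subspace_scale)
  have zero: "pt (vsp s V) 0 = 0"
    using multilin_pt[OF good_vsp[OF assms(1,2)]] subspace_0[OF assms(2)]
    by (auto simp: multilin_vsp linear_on_def) (metis add_cancel_right_right add_0)
  have "\<exists>v\<in>V. pt (vsp s V) v = u"
    using assms(3)
  proof (induction rule: tens_induct)
    case zero
    then show ?case using \<open>pt (vsp s V) 0 = 0\<close> subspace_0[OF assms(2)] by blast
  next
    case (step c x u)
    then obtain v where "v \<in> V" "pt (vsp s V) v = u" by auto
    with step(1) add[of x v c] assms(2) show ?case
      by (intro bexI[of _ "s c x + v"]) (auto intro: subspace_add subspace_scale)
  qed
  then show "tval (vsp s V) u \<in> V" "pt (vsp s V) (tval (vsp s V) u) = u"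
    using tval_pt[OF assms(1)] by auto
qed

context quasi_hopf_algebra begin

lemma tsum_ev: "tsum (ev n K t) F = ev n (\<lambda>x. tsum (K x) F) t"
  by (simp add: ev_def tsum_tsum tsum_tscale)

lemma ev_tsum: "ev n K (tsum t F) = tsum t (\<lambda>x. ev n K (F x))"
  by (simp add: ev_def tsum_tsum)

lemma ev_pts:
  "multilin \<H> (\<lambda>x. tscale (tail 2 x) (K x)) \<Longrightarrow> ev 2 K (pN (a ## b ## 1)) = K (a ## b ## 1)"
  "multilin \<H> (\<lambda>x. tscale (tail 3 x) (K x)) \<Longrightarrow> ev 3 K (pN (a ## b ## c ## 1)) = K (a ## b ## c ## 1)"
  "multilin \<H> (\<lambda>x. tscale (tail 5 x) (K x)) \<Longrightarrow> ev 5 K (pN (a ## b ## c ## d ## e ## 1)) = K (a ## b ## c ## d ## e ## 1)"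
  by (rule ev_pt; auto simp: one_fun_apply eval_nat_numeral split: nat.split)+

lemma multilin_3: "multilin (H3 Q) F \<Longrightarrow> multilin \<H> (\<lambda>x. tscale (tail 3 x) (F (x 0, x 1, x 2)))"
  using P_m[of F 1] by simp

lemma multilin_tail1: "multilin (H1 Q) F \<Longrightarrow> multilin \<H> (\<lambda>x. tscale (tail 1 x) (F (x 0)))"
  by (rule multilin_tail) auto

lemma multilin_tail2: "multilin (H2 Q) F \<Longrightarrow> multilin \<H> (\<lambda>x. tscale (tail 2 x) (F (x 0, x 1)))"
  by (rule multilin_tail) (auto dest!: less2_cases intro!: multilin_H2)

lemma multilin_tail5: "multilin (H5 Q) F \<Longrightarrow> multilin \<H> (\<lambda>x. tscale (tail 5 x) (F (x 0, x 1, x 2, x 3, x 4)))"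
  by (rule multilin_tail) (auto dest!: less5_cases intro!: multilin_H5)

abbreviation \<Delta>3 where "\<Delta>3 h \<equiv> D 0 (\<Delta> h)"

lemma Delta3_in: "\<Delta>3 h \<in> A" "\<Delta>3 h \<in> W 3"
  using D_W[OF Delta_W, of 0 h] by simp_all

lemma multilin_Delta3: "multilin (H1 Q) \<Delta>3"
  using lmapD(1)[OF AD(1)] by (rule multilin_D)

lemma Delta3_mult: "\<Delta>3 (g * h) = \<Delta>3 g \<bullet> \<Delta>3 h"
  by (simp add: AD D_mul)

lemma Delta3_one: "\<Delta>3 1 = pN 1"
proof -
  have "j 1 = pN 1"
    unfolding j_def by (rule arg_cong[of _ _ pN]) (auto simp: one_fun_apply fun_eq_iff split: nat.split)
  then show ?thesis by (simp add: \<Delta>_def D_one)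
qed

text \<open>Translates the nested Sweedler notation of the module action into one evaluation at
  \<open>\<Delta>3 h\<close>.\<close>

lemma tsum_Delta_Delta:
  assumes F: "multilin (H3 Q) F"
  shows "tsum (Delta Q h) (\<lambda>z. tsum (Delta Q (fst z)) (\<lambda>w. F (fst w, snd w, snd z))) = ev 3 (\<lambda>z. F (z 0, z 1, z 2)) (\<Delta>3 h)"
proof -
  have "\<Delta>3 h = tsum (Delta Q h) (\<lambda>z. tsum (Delta Q (fst z)) (\<lambda>w. pN (fst w ## snd w ## snd z ## 1)))"
    unfolding em_Delta[symmetric] by (simp add: dk_def spl_0_1 D_tsum D_pt spl_0_cons)
  moreover have "ev 3 (\<lambda>z. F (z 0, z 1, z 2)) (pN (a ## b ## c ## 1)) = F (a, b, c)" for a b c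
    using ev_pts(2)[OF multilin_3[OF F], of a b c] by (simp add: numeral_2_eq_2)
  ultimately show ?thesis by (simp only: ev_tsum)
qed

text \<open>Expanding the middle leg of a threefold coproduct threefold is \<open>D 1\<close>
  applied twice.\<close>

lemma ev_Delta3:
  assumes F: "multilin (H5 Q) F" and t: "t \<in> W 3"
  shows "ev 3 (\<lambda>z. ev 3 (\<lambda>q. F (z 0, q 0, q 1, q 2, z 2)) (\<Delta>3 (z 1))) t = ev 5 (\<lambda>q. F (q 0, q 1, q 2, q 3, q 4)) (D 1 (D 1 t))"
proof (rule lin_ext_W[OF t, where L = "\<lambda>t. ev 3 (\<lambda>z. ev 3 (\<lambda>q. F (z 0, q 0, q 1, q 2, z 2)) (\<Delta>3 (z 1))) t"
    and R = "\<lambda>t. ev 5 (\<lambda>q. F (q 0, q 1, q 2, q 3, q 4)) (D 1 (D 1 t))"])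
  fix z :: "nat \<Rightarrow> 'h" assume z: "\<And>i. 3 \<le> i \<Longrightarrow> z i = 1"
  have i: "multilin (H3 Q) (\<lambda>q. F (a, fst q, fst (snd q), snd (snd q), b))" for a b
    by (auto simp: multilin_mprod intro!: multilin_H5[OF F])
  have i': "multilin \<H> (\<lambda>q. tscale (tail 3 q) (F (a, q 0, q 1, q 2, b)))" for a b
    using multilin_3[OF i] by simp
  have m: "multilin \<H> (\<lambda>z. tscale (tail 3 z) (ev 3 (\<lambda>q. F (z 0, q 0, q 1, q 2, z 2)) (\<Delta>3 (z 1))))"
  proof (rule multilin_tail)
    fix i :: nat and x :: "nat \<Rightarrow> 'h" assume "i < 3"
    then show "multilin (H1 Q) (\<lambda>a. ev 3 (\<lambda>q. F ((x(i := a)) 0, q 0, q 1, q 2, (x(i := a)) 2)) (\<Delta>3 ((x(i := a)) 1)))"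
      by (auto dest!: less3_cases intro!: multilin_ev1 multilin_Delta3 multilin_ev2[OF good_H1 Delta3_in(1)] i'[simplified] multilin_H5[OF F])
  qed simp
  have d: "D 1 (D 1 (pN (a ## b ## c ## 1))) = tsum (Delta Q b) (\<lambda>w. tsum (Delta Q (fst w)) (\<lambda>v. pN (a ## fst v ## snd v ## snd w ## c ## 1)))" for a b c
    by (simp add: D_pt dk_def D_tsum spl_Suc_cons spl_0_cons)
  have z3: "z = z 0 ## z 1 ## z 2 ## 1"
    using z by (auto simp: fun_eq_iff one_fun_apply eval_nat_numeral split: nat.split)
  have e: "ev 5 (\<lambda>q. F (q 0, q 1, q 2, q 3, q 4)) (pN (a ## b ## c ## d ## e ## 1)) = F (a, b, c, d, e)" for a b c d e
    using ev_pts(3)[OF multilin_tail5[OF F], of a b c d e] by (simp add: eval_nat_numeral)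
  have "ev 3 (\<lambda>z. ev 3 (\<lambda>q. F (z 0, q 0, q 1, q 2, z 2)) (\<Delta>3 (z 1))) (pN z) =
      ev 3 (\<lambda>q. F (z 0, q 0, q 1, q 2, z 2)) (\<Delta>3 (z 1))"
    by (rule ev_pt[OF m z])
  also have "\<dots> = ev 5 (\<lambda>q. F (q 0, q 1, q 2, q 3, q 4)) (D 1 (D 1 (pN (z 0 ## z 1 ## z 2 ## 1))))"
    using tsum_Delta_Delta[OF i[of "z 0" "z 2"], of "z 1"] by (simp only: d ev_tsum e fst_conv snd_conv)
  also have "\<dots> = ev 5 (\<lambda>q. F (q 0, q 1, q 2, q 3, q 4)) (D 1 (D 1 (pN z)))"
    using z3 by simp
  finally show "ev 3 (\<lambda>z. ev 3 (\<lambda>q. F (z 0, q 0, q 1, q 2, z 2)) (\<Delta>3 (z 1))) (pN z) = ev 5 (\<lambda>q. F (q 0, q 1, q 2, q 3, q 4)) (D 1 (D 1 (pN z)))" .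
qed (auto intro!: lins lin_ev)

lemma ev_push:
  assumes "linear_on tscale tscale (tens X) F" "t \<in> A" "multilin \<H> (\<lambda>x. tscale (tail n x) (K x))"
    "multilin \<H> (\<lambda>x. tscale (tail n x) (F (K x)))" "\<And>x. K x \<in> tens X"
  shows "F (ev n K t) = ev n (\<lambda>x. F (K x)) t"
proof -
  have "F (tscale c (K x)) = tscale c (F (K x))" for c x
    using assms(1,5) by (simp add: linear_on_def)
  then show ?thesis
    unfolding ev_def using linear_on_push[OF good_HN assms(1-3)] assms(4,5) by simp
qed

lemma tsum_ev_swap:
  assumes "good X" "t \<in> tens X" "u \<in> A" "\<And>y. multilin X (\<lambda>x. K x y)" "\<And>x. x \<in> points X \<Longrightarrow> multilin \<H> (\<lambda>y. tscale (tail n y) (K x y))"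
  shows "tsum t (\<lambda>x. ev n (K x) u) = ev n (\<lambda>y. tsum t (\<lambda>x. K x y)) u"
  unfolding ev_def
  by (subst tsum_swap[OF assms(1) good_HN assms(2,3)])
    (auto intro!: multilin_tscale assms simp: tsum_tscale_right[OF assms(1,2,4)])

lemma tscale_commute: "tscale a (tscale b t) = tscale b (tscale a t)"
  by (simp add: tscale_def fun_eq_iff)

lemma ev_swap:
  assumes "t \<in> A" "u \<in> A" "\<And>y. multilin \<H> (\<lambda>x. tscale (tail m x) (K x y))" "\<And>x. multilin \<H> (\<lambda>y. tscale (tail n y) (K x y))"
  shows "ev m (\<lambda>x. ev n (K x) u) t = ev n (\<lambda>y. ev m (\<lambda>x. K x y) t) u"
proof -
  have "tscale c (ev n (K x) u) = ev n (\<lambda>y. tscale c (K x y)) u" for c x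
    unfolding ev_def using assms(2,4) by (simp add: mult.commute flip: tsum_tscale_right[OF good_HN])
  moreover have "multilin \<H> (\<lambda>y. tscale (tail n y) (tscale c (K x y)))" for c x
    unfolding tscale_commute[of _ c] by (rule multilin_tscale[OF good_HN assms(4)])
  ultimately show ?thesis
    unfolding ev_def[of m] using tsum_ev_swap[OF good_HN assms(1,2), of "\<lambda>x y. tscale (tail m x) (K x y)"] assms(3) by simp
qed

text \<open>A scalar \<epsilon> of one slot in the summand is a counit applied to the tensor itself,
  with the later slots renumbered.\<close>

lemma ev_Ce:
  fixes K :: "'h \<times> 'h \<Rightarrow> ('k, 'b) tensor" and L :: "'h \<Rightarrow> ('k, 'b) tensor"
  shows
  "multilin (H2 Q) K \<Longrightarrow> t \<in> W 3 \<Longrightarrow> ev 3 (\<lambda>k. tscale (eps Q (k 0)) (K (k 1, k 2))) t = ev 2 (\<lambda>k. K (k 0, k 1)) (Ce 0 t)"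
  "multilin (H2 Q) K \<Longrightarrow> t \<in> W 3 \<Longrightarrow> ev 3 (\<lambda>k. tscale (eps Q (k 1)) (K (k 0, k 2))) t = ev 2 (\<lambda>k. K (k 0, k 1)) (Ce 1 t)"
  "multilin (H1 Q) L \<Longrightarrow> u \<in> W 2 \<Longrightarrow> ev 2 (\<lambda>k. tscale (eps Q (k 1)) (L (k 0))) u = ev 1 (\<lambda>k. L (k 0)) (Ce 1 u)"
proof -
  have sc: "ev n K (tscale c t) = tscale c (ev n K t)" for n c and K :: "(nat \<Rightarrow> 'h) \<Rightarrow> ('k, 'b) tensor" and t
    unfolding ev_def by (rule tsum_tscale)
  have e: "multilin (H1 Q) (\<lambda>a. tscale (eps Q a) x)" for x :: "('k, 'b) tensor"
    by (simp add: multilin_vsp linear_on_def eps_add eps_scal tensor.scale_left_distrib)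
  note s = multilin_tscale[OF good_H1]
  { assume K: "multilin (H2 Q) K" and t: "t \<in> W 3"
    note K' = multilin_tail2[OF K]
    show "ev 3 (\<lambda>k. tscale (eps Q (k 0)) (K (k 1, k 2))) t = ev 2 (\<lambda>k. K (k 0, k 1)) (Ce 0 t)"
    proof (rule lin_ext_W[OF t, where R = "\<lambda>t. ev 2 (\<lambda>k. K (k 0, k 1)) (Ce 0 t)"])
      fix z :: "nat \<Rightarrow> 'h" assume z: "\<And>i. 3 \<le> i \<Longrightarrow> z i = 1"
      have m: "multilin (H3 Q) (\<lambda>k. tscale (eps Q (fst k)) (K (fst (snd k), snd (snd k))))"
        by (auto simp: multilin_mprod intro!: e s multilin_H2[OF K])
      show "ev 3 (\<lambda>k. tscale (eps Q (k 0)) (K (k 1, k 2))) (pN z) = ev 2 (\<lambda>k. K (k 0, k 1)) (Ce 0 (pN z))"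
        using ev_pt[OF multilin_3[OF m] z] ev_pt[OF K', of "del 0 z"] z
        by (simp add: Ce_pt ck_def sc del_def numeral_2_eq_2)
    qed (auto intro!: lin_ev lin_id lin_Ce)
    show "ev 3 (\<lambda>k. tscale (eps Q (k 1)) (K (k 0, k 2))) t = ev 2 (\<lambda>k. K (k 0, k 1)) (Ce 1 t)"
    proof (rule lin_ext_W[OF t, where R = "\<lambda>t. ev 2 (\<lambda>k. K (k 0, k 1)) (Ce 1 t)"])
      fix z :: "nat \<Rightarrow> 'h" assume z: "\<And>i. 3 \<le> i \<Longrightarrow> z i = 1"
      have m: "multilin (H3 Q) (\<lambda>k. tscale (eps Q (fst (snd k))) (K (fst k, snd (snd k))))"
        by (auto simp: multilin_mprod intro!: e s multilin_H2[OF K])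
      show "ev 3 (\<lambda>k. tscale (eps Q (k 1)) (K (k 0, k 2))) (pN z) = ev 2 (\<lambda>k. K (k 0, k 1)) (Ce 1 (pN z))"
        using ev_pt[OF multilin_3[OF m] z] ev_pt[OF K', of "del 1 z"] z
        by (simp add: Ce_pt ck_def sc del_def numeral_2_eq_2)
    qed (auto intro!: lin_ev lin_id lin_Ce) }
  assume L: "multilin (H1 Q) L" and u: "u \<in> W 2"
  show "ev 2 (\<lambda>k. tscale (eps Q (k 1)) (L (k 0))) u = ev 1 (\<lambda>k. L (k 0)) (Ce 1 u)"
  proof (rule lin_ext_W[OF u, where R = "\<lambda>t. ev 1 (\<lambda>k. L (k 0)) (Ce 1 t)"])
    fix z :: "nat \<Rightarrow> 'h" assume z: "\<And>i. 2 \<le> i \<Longrightarrow> z i = 1"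
    have m: "multilin (H2 Q) (\<lambda>k. tscale (eps Q (snd k)) (L (fst k)))"
      by (auto simp: multilin_mprod intro!: e s L)
    show "ev 2 (\<lambda>k. tscale (eps Q (k 1)) (L (k 0))) (pN z) = ev 1 (\<lambda>k. L (k 0)) (Ce 1 (pN z))"
      using ev_pt[OF multilin_tail2[OF m] z] ev_pt[OF multilin_tail1[OF L], of "del 1 z"] z
      by (simp add: Ce_pt ck_def sc del_def)
  qed (auto intro!: lin_ev lin_id lin_Ce)
qed

abbreviation RX where "RX V \<equiv> H1 Q \<boxtimes> msp V"
text \<open>H \<otimes> R(V) is not flattened to H \<otimes> H \<otimes> V: the entries in its
  second place are themselves tensors.\<close>

abbreviation RRX where "RRX V \<equiv> H1 Q \<boxtimes> vsp tscale (tens (H1 Q \<boxtimes> msp V))"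

section \<open>The Yetter-Drinfeld module R(V) and its counit\<close>

context
  fixes V :: "('k, 'h, 'v::ab_group_add) hmod"
  assumes V: "left_module Q V"
begin

lemma lm_facts:
  "vector_space (scale V)" "module.subspace (scale V) (carrier V)"
  "v \<in> carrier V \<Longrightarrow> act V h v \<in> carrier V" "linear_on (scale V) (scale V) (carrier V) (act V h)"
  "v \<in> carrier V \<Longrightarrow> linear_on sc (scale V) UNIV (\<lambda>h. act V h v)"
  "v \<in> carrier V \<Longrightarrow> act V 1 v = v" "v \<in> carrier V \<Longrightarrow> act V (g * h) v = act V g (act V h v)"
  using V unfolding left_module_def by auto

lemma good_V: "good (msp V)" "good (RX V)" "good (RRX V)"
  using good_vsp[OF lm_facts(1,2)] by (auto intro!: good_mprod good_H1 good_tens)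

lemma multilin_act:
  "multilin (msp V) F \<Longrightarrow> multilin (msp V) (\<lambda>v. F (act V h v))"
  "multilin (msp V) F \<Longrightarrow> v \<in> carrier V \<Longrightarrow> multilin (H1 Q) (\<lambda>h. F (act V h v))"
  "multilin (msp V) F \<Longrightarrow> v \<in> carrier V \<Longrightarrow> multilin (H1 Q) (\<lambda>h. F (act V h (act V g v)))"
  "multilin (msp V) F \<Longrightarrow> v \<in> carrier V \<Longrightarrow> multilin (H1 Q) (\<lambda>h. F (act V g (act V h v)))"
proof -
  show "multilin (msp V) F \<Longrightarrow> multilin (msp V) (\<lambda>v. F (act V h v))" for F :: "'v \<Rightarrow> ('k, 'b) tensor" and h
    by (erule multilin_comp[OF _ lm_facts(4,3)])
  then show "multilin (msp V) F \<Longrightarrow> v \<in> carrier V \<Longrightarrow> multilin (H1 Q) (\<lambda>h. F (act V g (act V h v)))"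
    by (rule multilin_comp[OF _ lm_facts(5,3)])
  show *: "multilin (msp V) F \<Longrightarrow> v \<in> carrier V \<Longrightarrow> multilin (H1 Q) (\<lambda>h. F (act V h v))" for v
    by (erule multilin_comp[OF _ lm_facts(5,3)])
  show "multilin (msp V) F \<Longrightarrow> v \<in> carrier V \<Longrightarrow> multilin (H1 Q) (\<lambda>h. F (act V h (act V g v)))"
    using * lm_facts(3) by blast
qed

lemma multilin_RX:
  "multilin (RX V) F \<Longrightarrow> v \<in> carrier V \<Longrightarrow> multilin (H1 Q) (\<lambda>a. F (a, v))"
  "multilin (RX V) F \<Longrightarrow> multilin (msp V) (\<lambda>v. F (a, v))"
  by (simp_all add: multilin_mprod)

lemma multilin_RRX:
  "multilin (RRX V) F \<Longrightarrow> u \<in> tens (RX V) \<Longrightarrow> multilin (H1 Q) (\<lambda>a. F (a, u))"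
  "multilin (RRX V) F \<Longrightarrow> multilin (vsp tscale (tens (RX V))) (\<lambda>u. F (a, u))"
  by (simp_all add: multilin_mprod)

definition Ra where "Ra h x = ev 3 (\<lambda>z. pt (RX V) (z 0 * fst x * S (z 2), act V (z 1) (snd x))) (\<Delta>3 h)"

lemma multilin_Ra_inner:
  assumes "multilin (RX V) F" "v \<in> carrier V"
  shows "multilin (H3 Q) (\<lambda>z. F (fst z * a * S (snd (snd z)), act V (fst (snd z)) v))"
  using assms(2) by (auto simp: multilin_mprod lm_facts intro!: multilin_RX[OF assms(1)] multilin_act mcomps)

lemma multilin_Ra_ev:
  assumes "multilin (RX V) F" "v \<in> carrier V"
  shows "multilin \<H> (\<lambda>z. tscale (tail 3 z) (F (z 0 * a * S (z 2), act V (z 1) v)))"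
  using multilin_3[OF multilin_Ra_inner[OF assms]] by simp

lemma multilin_Ra: "multilin (RX V) (Ra h)"
  unfolding Ra_def[abs_def] multilin_mprod
proof (intro conjI ballI)
  note m = multilin_Ra_ev[OF multilin_pt[OF good_V(2)], simplified]
  note p = multilin_RX[OF multilin_pt[OF good_V(2)]]
  show "multilin (msp V) (\<lambda>b. ev 3 (\<lambda>z. pt (RX V) (z 0 * fst (a, b) * S (z 2), act V (z 1) (snd (a, b)))) (\<Delta>3 h))" for a
    by (rule multilin_ev2[OF good_V(1) Delta3_in(1)]) (auto intro!: p multilin_act m)
  fix b assume "b \<in> points (msp V)"
  then have b: "b \<in> carrier V" by simp
  show "multilin (H1 Q) (\<lambda>a. ev 3 (\<lambda>z. pt (RX V) (z 0 * fst (a, b) * S (z 2), act V (z 1) (snd (a, b)))) (\<Delta>3 h))"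
    by (rule multilin_ev2[OF good_H1 Delta3_in(1)]) (use b in \<open>auto intro!: p mcomps m lm_facts\<close>)
qed

lemma Ra_in: assumes "x \<in> points (RX V)" shows "Ra h x \<in> tens (RX V)"
  unfolding Ra_def
  by (rule ev_in[OF multilin_Ra_ev[OF multilin_pt[OF good_V(2)]] _ Delta3_in(1)]) (use assms in \<open>auto intro!: lm_facts\<close>)

lemma act_R: assumes "t \<in> tens (RX V)" shows "act (R_obj Q V) h t = tsum t (Ra h)"
proof -
  have "tsum (Delta Q h) (\<lambda>z. tsum (Delta Q (fst z)) (\<lambda>w. pt (RX V) (fst w * fst x * S (snd z), act V (snd w) (snd x)))) = Ra h x" if "x \<in> points (RX V)" for x
    using tsum_Delta_Delta[OF multilin_Ra_inner[OF multilin_pt[OF good_V(2)], where v = "snd x" and a = "fst x"], where h = h] that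
    by (simp add: Ra_def mem_Times_iff)
  then show ?thesis
    unfolding R_obj_def by (auto simp: split_def intro!: tsum_cong[OF good_V(2) assms])
qed

lemma act_R_in: "t \<in> tens (RX V) \<Longrightarrow> tsum t (Ra h) \<in> tens (RX V)"
  by (rule tsum_in[OF _ multilin_Ra Ra_in])

lemma tsum_Ra:
  assumes F: "multilin (RX V) F" and x: "x \<in> points (RX V)"
  shows "tsum (Ra h x) F = ev 3 (\<lambda>z. F (z 0 * fst x * S (z 2), act V (z 1) (snd x))) (\<Delta>3 h)"
  unfolding Ra_def tsum_ev by (simp add: tsum_pt_multilin[OF F])

lemma multilin_Ra_h: assumes "t \<in> tens (RX V)" shows "multilin (H1 Q) (\<lambda>h. tsum t (Ra h))"
proof (rule multilin_tsum2[OF good_H1 good_V(2) assms])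
  show "multilin (H1 Q) (\<lambda>h. Ra h x)" for x
    unfolding Ra_def by (intro multilin_ev1 multilin_Delta3)
qed (rule multilin_Ra)

lemma Ra_one: assumes "x \<in> points (RX V)" shows "Ra 1 x = pt (RX V) x"
proof -
  have x: "snd x \<in> carrier V" using assms by auto
  have "ev 3 (\<lambda>z. pt (RX V) (z 0 * fst x * S (z 2), act V (z 1) (snd x))) (pN 1) = pt (RX V) (1 * fst x * S 1, act V 1 (snd x))"
    using ev_pt[OF multilin_Ra_ev[OF multilin_pt[OF good_V(2)] x, where a = "fst x"], where x = 1] by (simp add: one_fun_apply)
  then show ?thesis
    unfolding Ra_def Delta3_one using x by (simp add: lm_facts)
qed

text \<open>Multiplicativity of the threefold coproduct: first legs multiply in order and third legs
  in reversed order under S, which is how two actions nest.\<close>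

lemma Ra_mult: assumes "x \<in> points (RX V)" shows "tsum (Ra h x) (Ra g) = Ra (g * h) x"
proof -
  obtain a v where x: "x = (a, v)" "v \<in> carrier V" using assms by auto
  note p = multilin_RX[OF multilin_pt[OF good_V(2)]]
  have K: "multilin \<H> (\<lambda>z. tscale (tail 3 z) (pt (RX V) (z 0 * b * S (z 2), act V (z 1) w)))" if "w \<in> carrier V" for b w
    using multilin_Ra_ev[OF multilin_pt[OF good_V(2)] that] .
  have o: "multilin \<H> (\<lambda>z. tscale (tail 3 z) (ev 3 (\<lambda>y. pt (RX V) (y 0 * (z 0 * a * S (z 2)) * S (y 2), act V (y 1) (act V (z 1) v))) t))" if "t \<in> A" for t
  proof -
    show ?thesis
    proof (rule multilin_tail)
      fix i :: nat and z :: "nat \<Rightarrow> 'h" assume "i < 3"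
      then show "multilin (H1 Q) (\<lambda>c. ev 3 (\<lambda>y. pt (RX V) (y 0 * ((z(i := c)) 0 * a * S ((z(i := c)) 2)) * S (y 2), act V (y 1) (act V ((z(i := c)) 1) v))) t)"
        using x(2) lm_facts(3)[OF x(2)]
        by (auto dest!: less3_cases intro!: multilin_ev2[OF good_H1 that] K[simplified] p multilin_act mcomps lm_facts
          multilin_comp[of sc UNIV "\<lambda>a. pt (RX V) (a, _)" sc UNIV] simp: lin_simps)
    qed simp
  qed
  have "ev 3 (\<lambda>z. ev 3 (\<lambda>y. pt (RX V) (y 0 * (z 0 * a * S (z 2)) * S (y 2), act V (y 1) (act V (z 1) v))) t) u =
      ev 3 (\<lambda>y. pt (RX V) (y 0 * a * S (y 2), act V (y 1) v)) (t \<bullet> u)" if t: "t \<in> W 3" and u: "u \<in> W 3" for t u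
  proof (rule W_ext2[OF t u, where L = "\<lambda>t u. ev 3 (\<lambda>z. ev 3 (\<lambda>y. pt (RX V) (y 0 * (z 0 * a * S (z 2)) * S (y 2), act V (y 1) (act V (z 1) v))) t) u"
      and R = "\<lambda>t u. ev 3 (\<lambda>y. pt (RX V) (y 0 * a * S (y 2), act V (y 1) v)) (t \<bullet> u)"])
    fix p q :: "nat \<Rightarrow> 'h" assume p: "\<And>i. 3 \<le> i \<Longrightarrow> p i = 1" and q: "\<And>i. 3 \<le> i \<Longrightarrow> q i = 1"
    have "(p * q) i = 1" if "3 \<le> i" for i using p q that by (simp add: pointwise)
    then have r: "ev 3 (\<lambda>y. pt (RX V) (y 0 * a * S (y 2), act V (y 1) v)) (pN (p * q)) =
        pt (RX V) ((p * q) 0 * a * S ((p * q) 2), act V ((p * q) 1) v)"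
      by (rule ev_pt[OF K[OF x(2)]])
    have "ev 3 (\<lambda>z. ev 3 (\<lambda>y. pt (RX V) (y 0 * (z 0 * a * S (z 2)) * S (y 2), act V (y 1) (act V (z 1) v))) (pN p)) (pN q) =
        ev 3 (\<lambda>y. pt (RX V) (y 0 * (q 0 * a * S (q 2)) * S (y 2), act V (y 1) (act V (q 1) v))) (pN p)"
      by (rule ev_pt[OF o[OF pN_in] q])
    also have "\<dots> = pt (RX V) (p 0 * (q 0 * a * S (q 2)) * S (p 2), act V (p 1) (act V (q 1) v))"
      by (rule ev_pt[OF K[OF lm_facts(3)[OF x(2)]] p])
    also have "\<dots> = ev 3 (\<lambda>y. pt (RX V) (y 0 * a * S (y 2), act V (y 1) v)) (pN p \<bullet> pN q)"
      unfolding mul_pt r using x(2) by (simp add: pointwise anti_mult mult.assoc lm_facts)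
    finally show "ev 3 (\<lambda>z. ev 3 (\<lambda>y. pt (RX V) (y 0 * (z 0 * a * S (z 2)) * S (y 2), act V (y 1) (act V (z 1) v))) (pN p)) (pN q) =
        ev 3 (\<lambda>y. pt (RX V) (y 0 * a * S (y 2), act V (y 1) v)) (pN p \<bullet> pN q)" .
  next
    fix u assume "u \<in> A"
    then show "lin \<H> (\<lambda>t. ev 3 (\<lambda>z. ev 3 (\<lambda>y. pt (RX V) (y 0 * (z 0 * a * S (z 2)) * S (y 2), act V (y 1) (act V (z 1) v))) t) u)"
      unfolding ev_def[of _ _ u]
      by (intro lin_tsum2[OF good_HN _ _ o] lin_tscale lin_ev lin_id)
  qed (auto intro!: lin_ev lins dest: W_A)
  from this[OF Delta3_in(2) Delta3_in(2)] show ?thesis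
    unfolding tsum_Ra[OF multilin_Ra assms] unfolding Ra_def Delta3_mult x by simp
qed

lemma left_module_R: "left_module Q (forget (R_obj Q V))"
proof -
  have c: "carrier (R_obj Q V) = tens (RX V)" "scale (R_obj Q V) = tscale"
    by (simp_all add: R_obj_def)
  show ?thesis
    unfolding left_module_def
  proof (intro conjI ballI allI)
    show "vector_space (scale (forget (R_obj Q V)))" "module.subspace (scale (forget (R_obj Q V))) (carrier (forget (R_obj Q V)))"
      by (simp_all add: forget_def c tensor.vector_space_axioms) (simp add: tens_def)
    fix h :: 'h
    show "linear_on (scale (forget (R_obj Q V))) (scale (forget (R_obj Q V))) (carrier (forget (R_obj Q V))) (act (forget (R_obj Q V)) h)"
      by (simp add: forget_def c linear_on_def act_R tsum_linear)
    fix t assume "t \<in> carrier (forget (R_obj Q V))"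
    then have t: "t \<in> tens (RX V)" by (simp add: forget_def c)
    show "act (forget (R_obj Q V)) h t \<in> carrier (forget (R_obj Q V))"
      using act_R_in[OF t] by (simp add: forget_def c act_R t)
    show "linear_on sc (scale (forget (R_obj Q V))) UNIV (\<lambda>h. act (forget (R_obj Q V)) h t)"
      using multilin_Ra_h[OF t] by (simp add: forget_def c act_R t multilin_vsp)
    show "act (forget (R_obj Q V)) 1 t = t"
      using tsum_cong[OF good_V(2) t Ra_one] tsum_pt_right[OF t] by (simp add: forget_def act_R t)
    show "act (forget (R_obj Q V)) (g * h) t = act (forget (R_obj Q V)) g (act (forget (R_obj Q V)) h t)" for g
      using tsum_cong[OF good_V(2) t Ra_mult] by (simp add: forget_def act_R t act_R_in tsum_tsum)
  qed
qed

text \<open>The coaction on a pure tensor, written through \<open>cfree\<close> to make the results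
  on words available; \<open>Rc_omega\<close> identifies it with the defining formula.\<close>

definition Rc where "Rc x = ev 3 (\<lambda>k. pt (RRX V) (k 0, pt (RX V) (k 1, act V (k 2) (snd x)))) (cfree (fst x))"

lemma linear_pt: "linear_on tscale tscale (tens (RX V)) (\<lambda>u. pt (RRX V) (a, u))"
  using multilin_RRX(2)[OF multilin_pt[OF good_V(3)]] by (simp add: multilin_vsp)

lemma multilin_RRX_pt: "multilin (RRX V) F \<Longrightarrow> multilin (RX V) (\<lambda>x. F (b, pt (RX V) x))"
  unfolding multilin_mprod[of "H1 Q" "msp V"]
proof (intro conjI ballI)
  assume F: "multilin (RRX V) F"
  note p = multilin_RX[OF multilin_pt[OF good_V(2)]]
  fix a show "multilin (msp V) (\<lambda>v. F (b, pt (RX V) (a, v)))"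
    by (rule multilin_comp[OF multilin_RRX(2)[OF F]]) (use p(2)[of a] in \<open>auto simp: multilin_vsp\<close>)
next
  assume F: "multilin (RRX V) F"
  note p = multilin_RX[OF multilin_pt[OF good_V(2)]]
  fix v assume v: "v \<in> points (msp V)"
  show "multilin (H1 Q) (\<lambda>a. F (b, pt (RX V) (a, v)))"
    by (rule multilin_comp[OF multilin_RRX(2)[OF F]]) (use v p(1)[of v] in \<open>auto simp: multilin_vsp\<close>)
qed

lemma multilin_Rc_inner:
  assumes "multilin (RRX V) F" "v \<in> carrier V"
  shows "multilin (H3 Q) (\<lambda>k. F (fst k, pt (RX V) (fst (snd k), act V (snd (snd k)) v)))"
  using assms(2) by (auto simp: multilin_mprod[of "H1 Q"] lm_facts
    intro!: multilin_RX[OF multilin_RRX_pt[OF assms(1)]] multilin_RRX(1)[OF assms(1)] multilin_act)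

lemma multilin_Rc_ev:
  assumes "multilin (RRX V) F" "v \<in> carrier V"
  shows "multilin \<H> (\<lambda>k. tscale (tail 3 k) (F (k 0, pt (RX V) (k 1, act V (k 2) v))))"
  using multilin_3[OF multilin_Rc_inner[OF assms]] by simp

lemma multilin_Rc: "multilin (RX V) Rc"
  unfolding Rc_def[abs_def] multilin_mprod[of "H1 Q" "msp V"]
proof (intro conjI ballI)
  note m = multilin_Rc_ev[OF multilin_pt[OF good_V(3)], simplified]
  note p = multilin_RX[OF multilin_RRX_pt[OF multilin_pt[OF good_V(3)]]]
  show "multilin (msp V) (\<lambda>b. ev 3 (\<lambda>k. pt (RRX V) (k 0, pt (RX V) (k 1, act V (k 2) (snd (a, b))))) (cfree (fst (a, b))))" for a
    unfolding fst_conv snd_conv by (rule multilin_ev2[OF good_V(1) cfree_in]) (auto intro!: p multilin_act m)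
  show "multilin (H1 Q) (\<lambda>a. ev 3 (\<lambda>k. pt (RRX V) (k 0, pt (RX V) (k 1, act V (k 2) (snd (a, b))))) (cfree (fst (a, b))))" for b
    unfolding fst_conv snd_conv by (intro multilin_ev1 multilin_cfree)
qed

lemma Rc_in: assumes "x \<in> points (RX V)" shows "Rc x \<in> tens (RRX V)"
  unfolding Rc_def
  by (rule ev_in[OF multilin_Rc_ev[OF multilin_pt[OF good_V(3)]] _ cfree_in]) (use assms in \<open>auto simp: lm_facts intro!: tens_pt\<close>)

lemma Rc_omega:
  assumes "x \<in> points (RX V)"
  shows "Rc x = tsum (omega Q) (\<lambda>z. tsum (Delta Q (fst x)) (\<lambda>w. pt (RRX V)
      (fst z * fst w * snd (snd (snd (snd z))), pt (RX V) (fst (snd z) * snd w * fst (snd (snd (snd z))), act V (fst (snd (snd z))) (snd x)))))"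
  using tsum_omega[OF multilin_Rc_inner[OF multilin_pt[OF good_V(3)], where v = "snd x"], where a = "fst x"] assms
  by (simp add: Rc_def mem_Times_iff)

lemma coact_R: "t \<in> tens (RX V) \<Longrightarrow> coact (R_obj Q V) t = tsum t Rc"
  unfolding R_obj_def by (auto simp: split_def Rc_omega[simplified] intro!: tsum_cong[OF good_V(2)])

lemma coact_R_in: "t \<in> tens (RX V) \<Longrightarrow> tsum t Rc \<in> tens (RRX V)"
  by (rule tsum_in[OF _ multilin_Rc Rc_in])

lemma tsum_Rc:
  assumes F: "multilin (RRX V) F"
  shows "tsum (Rc x) F = ev 3 (\<lambda>k. F (k 0, pt (RX V) (k 1, act V (k 2) (snd x)))) (cfree (fst x))"
  unfolding Rc_def tsum_ev by (simp add: tsum_pt_multilin[OF F])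

text \<open>A counit in the first leg of \<open>cfree a\<close> leaves a \<otimes> 1, by
  \<open>Ce_cfree\<close>. The values lie in R(V), so each step takes place under a further
  \<open>pt\<close>.\<close>

lemma counit_R_coact:
  assumes t: "t \<in> tens (RX V)"
  shows "tsum (tsum t Rc) (\<lambda>y. pt (vsp tscale (tens (RX V))) (tscale (eps Q (fst y)) (snd y))) = pt (vsp tscale (tens (RX V))) t"
proof -
  let ?Z = "vsp tscale (tens (RX V))"
  have p: "multilin ?Z (pt ?Z)" by (rule multilin_pt[OF good_tens])
  then have sc: "pt ?Z (tscale c u) = tscale c (pt ?Z u)" if "u \<in> tens (RX V)" for c u
    using that by (simp add: multilin_vsp linear_on_def)
  have C: "multilin (RRX V) (\<lambda>y. pt ?Z (tscale (eps Q (fst y)) (snd y)))"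
    unfolding multilin_mprod[of "H1 Q" ?Z]
  proof (intro conjI ballI)
    fix a show "multilin ?Z (\<lambda>u. pt ?Z (tscale (eps Q (fst (a, u))) (snd (a, u))))"
      using p by (auto simp: multilin_vsp linear_on_def tensor.scale_right_distrib mult.commute)
  next
    fix u assume "u \<in> points ?Z"
    then show "multilin (H1 Q) (\<lambda>a. pt ?Z (tscale (eps Q (fst (a, u))) (snd (a, u))))"
      by (simp add: sc multilin_vsp linear_on_def eps_add eps_scal tensor.scale_left_distrib)
  qed
  have e: "tsum (Rc x) (\<lambda>y. pt ?Z (tscale (eps Q (fst y)) (snd y))) = pt ?Z (pt (RX V) x)" if "x \<in> points (RX V)" for x
  proof -
    obtain a v where x: "x = (a, v)" "v \<in> carrier V" using \<open>x \<in> points (RX V)\<close> by auto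
    have q: "multilin (RX V) (\<lambda>x. pt ?Z (pt (RX V) x))"
      using multilin_RX[OF multilin_pt[OF good_V(2)]] p by (auto simp: multilin_mprod intro!: multilin_comp[OF p] simp: multilin_vsp[symmetric])
    have K: "multilin (H2 Q) (\<lambda>k. pt ?Z (pt (RX V) (fst k, act V (snd k) v)))"
      using x by (auto simp: multilin_mprod[of "H1 Q" "H1 Q"] intro!: multilin_RX[OF q] multilin_act lm_facts)
    have "tsum (Rc x) (\<lambda>y. pt ?Z (tscale (eps Q (fst y)) (snd y))) =
        ev 3 (\<lambda>k. tscale (eps Q (k 0)) (pt ?Z (pt (RX V) (k 1, act V (k 2) v)))) (cfree a)"
      using x by (simp add: tsum_Rc[OF C] sc lm_facts)
    also have "\<dots> = ev 2 (\<lambda>k. pt ?Z (pt (RX V) (k 0, act V (k 1) v))) (pN (a ## 1 ## 1))"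
      using ev_Ce(1)[OF K cfree_W, of a] by (simp add: Ce_cfree j_def cons_one)
    also have "\<dots> = pt ?Z (pt (RX V) x)"
      using ev_pts(1)[OF multilin_tail2[OF K], of a 1] x by (simp add: lm_facts one_fun_apply)
    finally show ?thesis .
  qed
  have "tsum (tsum t Rc) (\<lambda>y. pt ?Z (tscale (eps Q (fst y)) (snd y))) = tsum t (\<lambda>x. pt ?Z (pt (RX V) x))"
    unfolding tsum_tsum by (rule tsum_cong[OF good_V(2) t e])
  also have "\<dots> = pt ?Z (tsum t (pt (RX V)))"
    by (rule linear_on_push[symmetric, OF good_V(2) _ t multilin_pt[OF good_V(2)]])
      (use p in \<open>auto simp: multilin_mprod[of "H1 Q" "msp V"] multilin_vsp[of tscale] intro!: multilin_comp[OF p] multilin_RX[OF multilin_pt[OF good_V(2)], unfolded multilin_vsp]\<close>)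
  finally show ?thesis using tsum_pt_right[OF t] by simp
qed

text \<open>The \<open>G\<close> for which \<open>cfree_coassoc\<close> becomes coassociativity of
  R(V).\<close>

definition coact_G where "coact_G v q = (case q of (a, b, c, d) \<Rightarrow> pt (H1 Q \<boxtimes> RRX V) (a, b, pt (RX V) (c, act V d v)))"

lemma multilin_RRRX:
  assumes "multilin (H1 Q \<boxtimes> RRX V) F"
  shows "u \<in> tens (RX V) \<Longrightarrow> multilin (H1 Q) (\<lambda>a. F (a, b, u))" "multilin (RRX V) (\<lambda>y. F (a, y))"
  using assms by (simp_all add: multilin_mprod)

lemma good_RRRX: "good (H1 Q \<boxtimes> RRX V)"
  by (rule good_mprod[OF good_H1 good_V(3)])

lemma multilin_coact_G: assumes v: "v \<in> carrier V" shows "multilin (H4 Q) (coact_G v)"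
proof -
  note p = multilin_RRRX[OF multilin_pt[OF good_RRRX]]
  have "multilin (H3 Q) (\<lambda>k. coact_G v (a, k))" for a
    using multilin_Rc_inner[OF p(2) v] by (simp add: coact_G_def split_def)
  moreover have "multilin (H1 Q) (\<lambda>a. coact_G v (a, k))" for k
    using p(1) v by (simp add: coact_G_def split_def lm_facts)
  ultimately show ?thesis by (simp add: multilin_mprod[of _ "H3 Q"])
qed

lemma coassoc_left:
  assumes t: "t \<in> tens (RX V)"
  shows "tsum (tsum t Rc) (\<lambda>x. tsum (coact (R_obj Q V) (snd x)) (\<lambda>y. pt (H1 Q \<boxtimes> RRX V) (fst x, y))) =
    tsum t (\<lambda>x. ev 3 (lhs_k (coact_G (snd x))) (cfree (fst x)))"
proof -
  let ?L = "\<lambda>x. tsum (tsum (snd x) Rc) (\<lambda>y. pt (H1 Q \<boxtimes> RRX V) (fst x, y))"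
  note p = multilin_RRRX[OF multilin_pt[OF good_RRRX]]
  have L: "multilin (RRX V) ?L"
    unfolding multilin_mprod[of "H1 Q" "vsp tscale (tens (RX V))"]
  proof (intro conjI ballI)
    show "multilin (vsp tscale (tens (RX V))) (\<lambda>b. ?L (a, b))" for a
      by (simp add: multilin_vsp linear_on_def tsum_linear)
    fix b assume "b \<in> points (vsp tscale (tens (RX V)))"
    then have b: "tsum b Rc \<in> tens (RRX V)" by (auto intro: coact_R_in)
    show "multilin (H1 Q) (\<lambda>a. ?L (a, b))"
      unfolding fst_conv snd_conv by (rule multilin_tsum2[OF good_H1 good_V(3) b]) (use p in auto)
  qed
  have e: "?L (k 0, pt (RX V) (k 1, act V (k 2) v)) = lhs_k (coact_G v) k" if "v \<in> carrier V" for k v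
    using that unfolding lhs_k_def[OF multilin_coact_G[OF that]] fst_conv snd_conv
    by (simp add: tsum_pt_multilin[OF multilin_Rc] tsum_Rc[OF p(2)] coact_G_def lm_facts)
  have "tsum (tsum t Rc) (\<lambda>x. tsum (coact (R_obj Q V) (snd x)) (\<lambda>y. pt (H1 Q \<boxtimes> RRX V) (fst x, y))) = tsum (tsum t Rc) ?L"
    by (rule tsum_cong[OF good_V(3) coact_R_in[OF t]]) (auto simp: coact_R)
  also have "\<dots> = tsum t (\<lambda>x. ev 3 (lhs_k (coact_G (snd x))) (cfree (fst x)))"
    unfolding tsum_tsum[of t]
  proof (rule tsum_cong[OF good_V(2) t])
    fix x assume "x \<in> points (RX V)"
    then have "snd x \<in> carrier V" by auto
    then show "tsum (Rc x) ?L = ev 3 (lhs_k (coact_G (snd x))) (cfree (fst x))"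
      by (simp only: tsum_Rc[OF L] e)
  qed
  finally show ?thesis .
qed

text \<open>The action on R(V) is a sum inside the second entry of a pure tensor; \<open>F\<close>
  is linear in that entry, so the sum can be taken out.\<close>

lemma tsum_Ra_push:
  assumes F: "multilin (RRX V) F" and x: "x \<in> points (RX V)"
  shows "F (b, Ra h x) = ev 3 (\<lambda>q. F (b, pt (RX V) (q 0 * fst x * S (q 2), act V (q 1) (snd x)))) (\<Delta>3 h)"
proof -
  have v: "snd x \<in> carrier V" using x by auto
  have l: "linear_on tscale tscale (tens (RX V)) (\<lambda>u. F (b, u))"
    using multilin_RRX(2)[OF F] by (simp add: multilin_vsp)
  show ?thesis
    unfolding Ra_def
    by (rule ev_push[where F = "\<lambda>u. F (b, u)", OF l Delta3_in(1)], rule multilin_Ra_ev[OF multilin_pt[OF good_V(2)] v],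
      rule multilin_Ra_ev[where F = "\<lambda>x. F (b, pt (RX V) x)", OF multilin_RRX_pt[OF F] v]) (simp add: v lm_facts)
qed

text \<open>The sum over \<omega> is moved inside the sum over \<open>t\<close>, where
  \<open>tsum_omega\<close> turns it into an evaluation at \<open>cfree\<close>; the action of the
  third component of \<omega> becomes the inner evaluation in \<open>rhs_l\<close>.\<close>

lemma coassoc_right:
  assumes t: "t \<in> tens (RX V)"
  shows "tsum (omega Q) (\<lambda>z. tsum (tsum t Rc) (\<lambda>x. tsum (Delta Q (fst x)) (\<lambda>w. pt (H1 Q \<boxtimes> RRX V)
      (fst z * fst w * snd (snd (snd (snd z))), fst (snd z) * snd w * fst (snd (snd (snd z))), act (R_obj Q V) (fst (snd (snd z))) (snd x))))) =
    tsum t (\<lambda>x. ev 3 (rhs_k (coact_G (snd x))) (cfree (fst x)))"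
proof -
  let ?P = "\<lambda>u q. pt (H1 Q \<boxtimes> RRX V) (fst q, fst (snd q), tsum u (Ra (snd (snd q))))"
  let ?M = "\<lambda>z x. tsum (Delta Q (fst x)) (\<lambda>w. ?P (snd x)
    (fst z * fst w * snd (snd (snd (snd z))), fst (snd z) * snd w * fst (snd (snd (snd z))), fst (snd (snd z))))"
  let ?N = "\<lambda>x. ev 3 (\<lambda>k. ?P (snd x) (k 0, k 1, k 2)) (cfree (fst x))"
  note p = multilin_RRRX[OF multilin_pt[OF good_RRRX]]
  note c = coact_R_in[OF t]
  have P: "multilin (H3 Q) (?P u)" if u: "u \<in> tens (RX V)" for u
    using multilin_RRX(1)[OF p(2) act_R_in[OF u]] p(1)[OF act_R_in[OF u]]
      multilin_comp[OF multilin_RRX(2)[OF p(2)], OF multilin_Ra_h[OF u, unfolded multilin_vsp]] act_R_in[OF u]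
    by (auto simp: multilin_mprod[of "H1 Q" "H2 Q"] multilin_mprod[of "H1 Q" "H1 Q"])
  have Pu: "multilin (vsp tscale (tens (RX V))) (\<lambda>u. ?P u q)" for q
    by (rule multilin_comp[OF multilin_RRX(2)[OF p(2)]]) (auto simp: linear_on_def tsum_linear act_R_in)
  have Mz: "multilin (H5 Q) (\<lambda>z. ?M z x)" if "x \<in> points (RRX V)" for x
  proof (rule multilin_tsum2[OF good_H5 good_H2 Delta_in])
    have u: "snd x \<in> tens (RX V)" using that by auto
    show "multilin (H5 Q) (\<lambda>z. ?P (snd x) (fst z * fst y * snd (snd (snd (snd z))), fst (snd z) * snd y * fst (snd (snd (snd z))), fst (snd (snd z))))" for y
      by (rule multilin_omega_arg(1)[OF P[OF u]])
    show "multilin (H2 Q) (\<lambda>w. ?P (snd x) (fst z * fst w * snd (snd (snd (snd z))), fst (snd z) * snd w * fst (snd (snd (snd z))), fst (snd (snd z))))" for z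
      by (rule multilin_omega_arg(2)[OF P[OF u]])
  qed
  have Mx: "multilin (RRX V) (?M z)" for z
    unfolding multilin_mprod[of "H1 Q" "vsp tscale (tens (RX V))"]
  proof (intro conjI ballI)
    fix u assume "u \<in> points (vsp tscale (tens (RX V)))"
    show "multilin (H1 Q) (\<lambda>a. ?M z (a, u))"
      unfolding fst_conv snd_conv by (rule multilin_Delta)
  next
    fix a
    have w: "multilin (H2 Q) (\<lambda>w. ?P u (fst z * fst w * snd (snd (snd (snd z))), fst (snd z) * snd w * fst (snd (snd (snd z))), fst (snd (snd z))))" if u: "u \<in> tens (RX V)" for u
      by (rule multilin_omega_arg(2)[OF P[OF u]])
    show "multilin (vsp tscale (tens (RX V))) (\<lambda>u. ?M z (a, u))"
      unfolding fst_conv snd_conv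
      by (rule multilin_tsum2[OF good_tens good_H2 Delta_in]) (use w in \<open>simp_all add: Pu[of "(_, _, _)", unfolded fst_conv snd_conv]\<close>)
  qed
  have MN: "tsum (omega Q) (\<lambda>z. ?M z x) = ?N x" if "x \<in> points (RRX V)" for x
    using tsum_omega[OF P[of "snd x"], of "fst x"] that by (simp add: mem_Times_iff)
  \<comment> \<open>Inherited from the sum over \<omega>, with which \<open>?N\<close> agrees on all
    points.\<close>
  have N: "multilin (RRX V) ?N"
  proof -
    have "multilin (RRX V) (\<lambda>x. tsum (omega Q) (\<lambda>z. ?M z x))"
      by (rule multilin_tsum2[OF good_V(3) good_H5 omega_in]) (use Mz Mx in auto)
    then show ?thesis using good_V(3) MN unfolding multilin_def by (metis (no_types, lifting) good_cong)
  qed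
  have e: "?N (k 0, pt (RX V) (k 1, act V (k 2) v)) = rhs_k (coact_G v) k" if v: "v \<in> carrier V" for k v
  proof -
    have x: "(k 1, act V (k 2) v) \<in> points (RX V)" using v by (simp add: lm_facts)
    have "?P (pt (RX V) (k 1, act V (k 2) v)) (l 0, l 1, l 2) = rhs_l (coact_G v) k l" for l :: "nat \<Rightarrow> 'h"
      unfolding rhs_l_def[OF multilin_coact_G[OF v]] fst_conv snd_conv tsum_pt_multilin[OF multilin_Ra]
      using tsum_Ra_push[OF p(2) x, where b = "l 1"] v by (simp add: coact_G_def lm_facts)
    then show ?thesis unfolding rhs_k_def[OF multilin_coact_G[OF v]] by (simp only: fst_conv snd_conv)
  qed
  have "tsum (omega Q) (\<lambda>z. tsum (tsum t Rc) (\<lambda>x. tsum (Delta Q (fst x)) (\<lambda>w. pt (H1 Q \<boxtimes> RRX V)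
      (fst z * fst w * snd (snd (snd (snd z))), fst (snd z) * snd w * fst (snd (snd (snd z))), act (R_obj Q V) (fst (snd (snd z))) (snd x))))) =
    tsum (omega Q) (\<lambda>z. tsum (tsum t Rc) (?M z))"
    by (rule arg_cong[of _ _ "tsum (omega Q)"], rule ext, rule tsum_cong[OF good_V(3) c]) (auto simp: act_R)
  also have "\<dots> = tsum (tsum t Rc) (\<lambda>x. tsum (omega Q) (\<lambda>z. ?M z x))"
    by (rule tsum_swap[OF good_H5 good_V(3) omega_in c]) (use Mz Mx in auto)
  also have "\<dots> = tsum (tsum t Rc) ?N"
    by (rule tsum_cong[OF good_V(3) c MN])
  also have "\<dots> = tsum t (\<lambda>x. ev 3 (rhs_k (coact_G (snd x))) (cfree (fst x)))"
    unfolding tsum_tsum[of t]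
  proof (rule tsum_cong[OF good_V(2) t])
    fix x assume "x \<in> points (RX V)"
    then have "snd x \<in> carrier V" by auto
    then show "tsum (Rc x) ?N = ev 3 (rhs_k (coact_G (snd x))) (cfree (fst x))"
      by (simp only: tsum_Rc[OF N] e)
  qed
  finally show ?thesis .
qed

lemma coassoc_R:
  assumes t: "t \<in> tens (RX V)"
  shows "tsum (tsum t Rc) (\<lambda>x. tsum (coact (R_obj Q V) (snd x)) (\<lambda>y. pt (H1 Q \<boxtimes> RRX V) (fst x, y))) =
    tsum (omega Q) (\<lambda>z. tsum (tsum t Rc) (\<lambda>x. tsum (Delta Q (fst x)) (\<lambda>w. pt (H1 Q \<boxtimes> RRX V)
      (fst z * fst w * snd (snd (snd (snd z))), fst (snd z) * snd w * fst (snd (snd (snd z))), act (R_obj Q V) (fst (snd (snd z))) (snd x)))))"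
  unfolding coassoc_left[OF t] coassoc_right[OF t]
  by (rule tsum_cong[OF good_V(2) t], rule cfree_coassoc[OF multilin_coact_G]) auto

lemma compat_left:
  assumes t: "t \<in> tens (RX V)"
  shows "tsum (tsum t (Ra h)) Rc = tsum t (\<lambda>x. ev 3 (\<lambda>k. ev 5 (\<lambda>q. pt (RRX V)
    (q 0 * k 0 * S (q 4), pt (RX V) (q 1 * k 1 * S (q 3), act V (q 2 * k 2) (snd x)))) (D 1 (D 1 (\<Delta>3 h)))) (cfree (fst x)))"
  unfolding tsum_tsum[of t]
proof (rule tsum_cong[OF good_V(2) t])
  fix x assume x: "x \<in> points (RX V)"
  then have v: "snd x \<in> carrier V" by auto
  note P = multilin_Rc_inner[OF multilin_pt[OF good_V(3)] v]
  have "tsum (Ra h x) Rc = ev 3 (\<lambda>z. Rc (z 0 * fst x * S (z 2), act V (z 1) (snd x))) (\<Delta>3 h)"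
    by (rule tsum_Ra[OF multilin_Rc x])
  also have "\<dots> = ev 3 (\<lambda>z. ev 3 (\<lambda>k. pt (RRX V) (k 0, pt (RX V) (k 1, act V (k 2 * z 1) (snd x)))) (cfree (z 0 * fst x * S (z 2)))) (\<Delta>3 h)"
    by (simp add: Rc_def lm_facts(7)[OF v])
  finally show "tsum (Ra h x) Rc = ev 3 (\<lambda>k. ev 5 (\<lambda>q. pt (RRX V)
    (q 0 * k 0 * S (q 4), pt (RX V) (q 1 * k 1 * S (q 3), act V (q 2 * k 2) (snd x)))) (D 1 (D 1 (\<Delta>3 h)))) (cfree (fst x))"
    unfolding cfree_compat[OF P, unfolded fst_conv snd_conv] .
qed

text \<open>The outer action and the action on R(V) use two threefold coproducts;
  \<open>ev_Delta3\<close> combines them into the fivefold one that also appears in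
  \<open>compat_left\<close>.\<close>

lemma compat_right:
  assumes t: "t \<in> tens (RX V)"
  shows "tsum (Delta Q h) (\<lambda>z. tsum (Delta Q (fst z)) (\<lambda>w. tsum (tsum t Rc) (\<lambda>y. pt (RRX V) (fst w * fst y * S (snd z), act (R_obj Q V) (snd w) (snd y))))) =
    tsum t (\<lambda>x. ev 3 (\<lambda>k. ev 5 (\<lambda>q. pt (RRX V)
    (q 0 * k 0 * S (q 4), pt (RX V) (q 1 * k 1 * S (q 3), act V (q 2 * k 2) (snd x)))) (D 1 (D 1 (\<Delta>3 h)))) (cfree (fst x)))"
proof -
  let ?M = "\<lambda>z y. pt (RRX V) (fst z * fst y * S (snd (snd z)), tsum (snd y) (Ra (fst (snd z))))"
  note p = multilin_RRX[OF multilin_pt[OF good_V(3)]]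
  note c = coact_R_in[OF t]
  have Mz: "multilin (H3 Q) (\<lambda>z. ?M z y)" if y: "y \<in> points (RRX V)" for y
  proof -
    have u: "snd y \<in> tens (RX V)" using y by auto
    note l = multilin_Ra_h[OF u, unfolded multilin_vsp]
    show ?thesis
      by (auto simp: multilin_mprod[of "H1 Q" "H2 Q"] multilin_mprod[of "H1 Q" "H1 Q"]
        intro!: multilin_comp[OF p(2) l act_R_in[OF u]]
          multilin_sandwichS(2)[OF p(1)[OF act_R_in[OF u]]] multilin_sandwichS(1)[OF p(1)[OF act_R_in[OF u]]])
  qed
  have My: "multilin (RRX V) (?M z)" for z
  proof -
    have l: "linear_on tscale tscale (tens (RX V)) (\<lambda>u. tsum u (Ra h))" for h
      by (simp add: linear_on_def tsum_linear)
    show ?thesis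
      by (auto simp: multilin_mprod[of "H1 Q" "vsp tscale (tens (RX V))"]
        intro!: multilin_comp[OF p(2) l act_R_in] multilin_sandwich[OF p(1)[OF act_R_in]])
  qed
  have m: "multilin (H3 Q) (\<lambda>z. tsum (tsum t Rc) (?M z))"
    by (rule multilin_tsum2[OF good_H3 good_V(3) c]) (use Mz My in auto)
  have "tsum (Delta Q h) (\<lambda>z. tsum (Delta Q (fst z)) (\<lambda>w. tsum (tsum t Rc) (\<lambda>y. pt (RRX V) (fst w * fst y * S (snd z), act (R_obj Q V) (snd w) (snd y))))) =
      tsum (Delta Q h) (\<lambda>z. tsum (Delta Q (fst z)) (\<lambda>w. tsum (tsum t Rc) (?M (fst w, snd w, snd z))))"
    by (intro arg_cong2[of _ _ _ _ tsum] refl ext tsum_cong[OF good_V(3) c]) (auto simp: act_R)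
  also have "\<dots> = ev 3 (\<lambda>z. tsum (tsum t Rc) (?M (z 0, z 1, z 2))) (\<Delta>3 h)"
    by (rule tsum_Delta_Delta[OF m])
  also have "\<dots> = ev 3 (\<lambda>z. tsum t (\<lambda>x. tsum (Rc x) (?M (z 0, z 1, z 2)))) (\<Delta>3 h)"
    by (simp only: tsum_tsum)
  also have "\<dots> = tsum t (\<lambda>x. ev 3 (\<lambda>z. tsum (Rc x) (?M (z 0, z 1, z 2))) (\<Delta>3 h))"
  proof (rule tsum_ev_swap[symmetric, OF good_V(2) t Delta3_in(1)])
    show "multilin (RX V) (\<lambda>x. tsum (Rc x) (?M (z 0, z 1, z 2)))" for z :: "nat \<Rightarrow> 'h"
      by (rule multilin_tsum1[OF multilin_Rc])
    fix x assume "x \<in> points (RX V)"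
    from Rc_in[OF this] have "multilin (H3 Q) (\<lambda>z. tsum (Rc x) (?M z))"
      by (rule multilin_tsum2[OF good_H3 good_V(3)]) (use Mz My in auto)
    from multilin_3[OF this] show "multilin \<H> (\<lambda>z. tscale (tail 3 z) (tsum (Rc x) (?M (z 0, z 1, z 2))))" .
  qed
  also have "\<dots> = tsum t (\<lambda>x. ev 3 (\<lambda>k. ev 5 (\<lambda>q. pt (RRX V)
    (q 0 * k 0 * S (q 4), pt (RX V) (q 1 * k 1 * S (q 3), act V (q 2 * k 2) (snd x)))) (D 1 (D 1 (\<Delta>3 h)))) (cfree (fst x)))"
  proof (rule tsum_cong[OF good_V(2) t])
    fix x assume "x \<in> points (RX V)"
    then have v: "snd x \<in> carrier V" by auto
    define P where "P = (\<lambda>k. pt (RRX V) (fst k, pt (RX V) (fst (snd k), act V (snd (snd k)) (snd x))))"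
    have P: "multilin (H3 Q) P"
      unfolding P_def by (rule multilin_Rc_inner[OF multilin_pt[OF good_V(3)] v])
    note Pm = multilin_H3[OF P]
    have F: "multilin (H5 Q) (\<lambda>q. P (fst q * b * S (snd (snd (snd (snd q)))), fst (snd q) * c * S (fst (snd (snd (snd q)))), fst (snd (snd q)) * d))" for b c d
      by (auto simp: multilin_mprod intro!: Pm mcomps)
    have 1: "tsum (Rc x) (?M (z 0, z 1, z 2)) = ev 3 (\<lambda>k. ev 3 (\<lambda>q. P (z 0 * k 0 * S (z 2), q 0 * k 1 * S (q 2), q 1 * k 2)) (\<Delta>3 (z 1))) (cfree (fst x))" for z :: "nat \<Rightarrow> 'h"
    proof -
      have x': "(k 1, act V (k 2) (snd x)) \<in> points (RX V)" for k :: "nat \<Rightarrow> 'h" using v by (simp add: lm_facts)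
      show ?thesis
        unfolding tsum_Rc[OF My[of "(z 0, z 1, z 2)"]]
        unfolding fst_conv snd_conv tsum_pt_multilin[OF multilin_Ra]
        unfolding tsum_Ra_push[OF multilin_pt[OF good_V(3)] x']
        by (simp add: P_def lm_facts(7)[OF v])
    qed
    have 2: "multilin \<H> (\<lambda>q. tscale (tail 3 q) (P (a, q 0 * b * S (q 2), q 1 * c)))" for a b c
      by (rule multilin_tail) (auto dest!: less3_cases intro!: Pm mcomps)
    have "ev 3 (\<lambda>z. tsum (Rc x) (?M (z 0, z 1, z 2))) (\<Delta>3 h) =
        ev 3 (\<lambda>k. ev 3 (\<lambda>z. ev 3 (\<lambda>q. P (z 0 * k 0 * S (z 2), q 0 * k 1 * S (q 2), q 1 * k 2)) (\<Delta>3 (z 1))) (\<Delta>3 h)) (cfree (fst x))"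
      unfolding 1
    proof (rule ev_swap[OF Delta3_in(1) cfree_in])
      show "multilin \<H> (\<lambda>z. tscale (tail 3 z) (ev 3 (\<lambda>q. P (z 0 * k 0 * S (z 2), q 0 * k 1 * S (q 2), q 1 * k 2)) (\<Delta>3 (z 1))))" for k :: "nat \<Rightarrow> 'h"
        by (rule multilin_tail) (auto dest!: less3_cases intro!: multilin_ev1 multilin_ev2[OF good_H1 Delta3_in(1)] multilin_Delta3 2[simplified] Pm mcomps)
      show "multilin \<H> (\<lambda>k. tscale (tail 3 k) (ev 3 (\<lambda>q. P (z 0 * k 0 * S (z 2), q 0 * k 1 * S (q 2), q 1 * k 2)) (\<Delta>3 (z 1))))" for z :: "nat \<Rightarrow> 'h"
        by (rule multilin_tail) (auto dest!: less3_cases intro!: multilin_ev1 multilin_ev2[OF good_H1 Delta3_in(1)] multilin_Delta3 2[simplified] Pm mcomps)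
    qed
    also have "\<dots> = ev 3 (\<lambda>k. ev 5 (\<lambda>q. P (q 0 * k 0 * S (q 4), q 1 * k 1 * S (q 3), q 2 * k 2)) (D 1 (D 1 (\<Delta>3 h)))) (cfree (fst x))"
      using ev_Delta3[OF F Delta3_in(2)] by (simp only: fst_conv snd_conv mult.assoc)
    finally show "ev 3 (\<lambda>z. tsum (Rc x) (?M (z 0, z 1, z 2))) (\<Delta>3 h) = ev 3 (\<lambda>k. ev 5 (\<lambda>q. pt (RRX V)
      (q 0 * k 0 * S (q 4), pt (RX V) (q 1 * k 1 * S (q 3), act V (q 2 * k 2) (snd x)))) (D 1 (D 1 (\<Delta>3 h)))) (cfree (fst x))"
      by (simp only: P_def fst_conv snd_conv)
  qed
  finally show ?thesis .
qed

lemma R_obj_sel: "carrier (R_obj Q V) = tens (RX V)" "scale (R_obj Q V) = tscale"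
  by (simp_all add: R_obj_def)

lemma yd_module_R: "yd_module Q (R_obj Q V)"
  unfolding yd_module_def split_def R_obj_sel
proof (intro conjI ballI allI)
  fix t assume t: "t \<in> tens (RX V)"
  show "coact (R_obj Q V) t \<in> tens (RRX V)"
    using coact_R_in[OF t] by (simp add: coact_R t)
  show "tsum (coact (R_obj Q V) t) (\<lambda>p. tsum (coact (R_obj Q V) (snd p)) (\<lambda>pa. pt (H1 Q \<boxtimes> RRX V) (fst p, fst pa, snd pa))) =
      tsum (omega Q) (\<lambda>p. tsum (coact (R_obj Q V) t) (\<lambda>pa. tsum (Delta Q (fst pa)) (\<lambda>pb. pt (H1 Q \<boxtimes> RRX V)
        (fst p * fst pb * snd (snd (snd (snd p))), fst (snd p) * snd pb * fst (snd (snd (snd p))), act (R_obj Q V) (fst (snd (snd p))) (snd pa)))))"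
    using coassoc_R[OF t] by (simp add: coact_R t)
  show "tsum (coact (R_obj Q V) t) (\<lambda>p. pt (vsp tscale (tens (RX V))) (tscale (eps Q (fst p)) (snd p))) = pt (vsp tscale (tens (RX V))) t"
    using counit_R_coact[OF t] by (simp add: coact_R t)
  show "coact (R_obj Q V) (act (R_obj Q V) h t) = tsum (Delta Q h) (\<lambda>p. tsum (Delta Q (fst p)) (\<lambda>pa. tsum (coact (R_obj Q V) t) (\<lambda>pb.
      pt (RRX V) (fst pa * fst pb * S (snd p), act (R_obj Q V) (snd pa) (snd pb)))))" for h
    using compat_left[OF t, of h] compat_right[OF t, of h] act_R_in[OF t, of h] by (simp add: coact_R act_R t)
next
  show "left_module Q (forget (R_obj Q V))" by (rule left_module_R)
  show "linear_on tscale tscale (tens (RX V)) (coact (R_obj Q V))"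
    by (simp add: linear_on_def coact_R tsum_linear)
qed

text \<open>For a Yetter-Drinfeld module M this is the passage from H \<otimes> H \<otimes> M, where
  its coassociativity is stated, to H \<otimes> R(M).\<close>

lemma lin_pt_RRX:
  assumes t: "t \<in> tens (RX V)"
  shows "tsum t (\<lambda>x. pt (RRX V) (b, pt (RX V) x)) = pt (RRX V) (b, t)"
proof -
  have m: "multilin (RX V) (\<lambda>x. pt (RRX V) (b, pt (RX V) x))"
    by (rule multilin_RRX_pt[where F = "pt (RRX V)"]) (rule multilin_pt[OF good_V(3)])
  have "pt (RRX V) (b, tsum t (pt (RX V))) = tsum t (\<lambda>x. pt (RRX V) (b, pt (RX V) x))"
    by (rule linear_on_push[where F = "\<lambda>u. pt (RRX V) (b, u)" and K = "pt (RX V)", OF good_V(2) linear_pt t multilin_pt[OF good_V(2)]])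
      (use m in auto)
  then show ?thesis by (simp add: tsum_pt_right[OF t])
qed

text \<open>The counit followed by the isomorphism of V with its one-factor tensors; equations are
  proved for \<open>ct\<close> and carried back by \<open>counit_R_eq\<close>.\<close>

definition ct where "ct t = tsum t (\<lambda>x. pt (msp V) (scale V (eps Q (fst x)) (snd x)))"

lemma pt_scale: "v \<in> carrier V \<Longrightarrow> pt (msp V) (scale V c v) = tscale c (pt (msp V) v)"
  using multilin_pt[OF good_V(1)] by (simp add: multilin_vsp linear_on_def)

lemma scale_in: "v \<in> carrier V \<Longrightarrow> scale V c v \<in> carrier V"
  using lm_facts(1,2) by (simp add: module.subspace_scale vector_space_def module_def)

lemma multilin_ct:
  assumes F: "multilin (msp V) F" shows "multilin (RX V) (\<lambda>x. F (scale V (eps Q (fst x)) (snd x)))"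
proof -
  have sc: "F (scale V c v) = tscale c (F v)" if "v \<in> carrier V" for c v
    using F that by (simp add: multilin_vsp linear_on_def)
  interpret vector_space "scale V" by (rule lm_facts(1))
  show ?thesis
    unfolding multilin_mprod
  proof (intro conjI ballI)
    fix v assume "v \<in> points (msp V)"
    then show "multilin (H1 Q) (\<lambda>a. F (scale V (eps Q (fst (a, v))) (snd (a, v))))"
      by (simp add: sc multilin_vsp linear_on_def eps_add eps_scal tensor.scale_left_distrib)
  next
    fix a
    have "linear_on (scale V) (scale V) (carrier V) (\<lambda>v. scale V (eps Q a) v)"
      by (simp add: linear_on_def scale_right_distrib mult.commute)
    then show "multilin (msp V) (\<lambda>v. F (scale V (eps Q (fst (a, v))) (snd (a, v))))"
      unfolding fst_conv snd_conv by (rule multilin_comp[OF F _ scale_in])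
  qed
qed

lemma ct_in: "t \<in> tens (RX V) \<Longrightarrow> ct t \<in> tens (msp V)"
  unfolding ct_def by (rule tsum_in[OF _ multilin_ct[OF multilin_pt[OF good_V(1)]]]) (auto intro!: tens_pt scale_in)

lemma counit_R: assumes "t \<in> tens (RX V)"
  shows "counit_R Q V t \<in> carrier V" "pt (msp V) (counit_R Q V t) = ct t"
  using vsp_tens_tval[OF lm_facts(1,2) ct_in[OF assms]] assms by (simp_all add: counit_R_def ct_def split_def)

lemma counit_R_eq: "t \<in> tens (RX V) \<Longrightarrow> v \<in> carrier V \<Longrightarrow> ct t = pt (msp V) v \<Longrightarrow> counit_R Q V t = v"
  by (metis counit_R tval_pt lm_facts(1))

lemma tsum_ct: "multilin (msp V) F \<Longrightarrow> tsum (ct t) F = tsum t (\<lambda>x. F (scale V (eps Q (fst x)) (snd x)))"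
  unfolding ct_def tsum_tsum by (simp add: tsum_pt_multilin)

text \<open>\<epsilon>(h_(1,1) a S(h_(2))) h_(1,2) v = \<epsilon>(a) h v, by \<epsilon>(S(h)) =
  \<epsilon>(h) and the counit axiom in the first and last legs.\<close>

lemma counit_R_act: assumes t: "t \<in> tens (RX V)"
  shows "counit_R Q V (tsum t (Ra h)) = act V h (counit_R Q V t)"
proof (rule counit_R_eq[OF act_R_in[OF t] lm_facts(3)[OF counit_R(1)[OF t]]])
  note p = multilin_pt[OF good_V(1)]
  have "tsum (Ra h x) (\<lambda>x. pt (msp V) (scale V (eps Q (fst x)) (snd x))) = pt (msp V) (act V h (scale V (eps Q (fst x)) (snd x)))" if x: "x \<in> points (RX V)" for x
  proof -
    have v: "snd x \<in> carrier V" using x by auto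
    let ?K = "\<lambda>b. tscale (eps Q (fst x)) (pt (msp V) (act V b (snd x)))"
    have K: "multilin (H1 Q) ?K"
      by (rule multilin_tscale[OF good_H1 multilin_act(2)[OF p v]])
    have e: "multilin (H1 Q) (\<lambda>a. tscale (eps Q a) y)" for y :: "('k, 'b) tensor"
      by (simp add: multilin_vsp linear_on_def eps_add eps_scal tensor.scale_left_distrib)
    have K2: "multilin (H2 Q) (\<lambda>k. tscale (eps Q (snd k)) (?K (fst k)))"
      by (auto simp: multilin_mprod simp del: tensor.scale_scale intro!: multilin_tscale[OF good_H1] multilin_act(2)[OF p v])
        (simp add: multilin_vsp linear_on_def eps_add eps_scal tensor.scale_left_distrib distrib_right mult.assoc)
    have "tsum (Ra h x) (\<lambda>x. pt (msp V) (scale V (eps Q (fst x)) (snd x))) =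
        ev 3 (\<lambda>z. tscale (eps Q (z 0)) (tscale (eps Q (z 2)) (?K (z 1)))) (\<Delta>3 h)"
      unfolding tsum_Ra[OF multilin_ct[OF p] x] using v by (simp add: pt_scale lm_facts eps_mult eps_anti mult.commute mult.left_commute)
    also have "\<dots> = ev 2 (\<lambda>k. tscale (eps Q (k 1)) (?K (k 0))) (\<Delta> h)"
      using ev_Ce(1)[OF K2 Delta3_in(2), of h] Ce_D_same(1)[OF Delta_A, of 0 h] by simp
    also have "\<dots> = ev 1 (\<lambda>k. ?K (k 0)) (j h)"
      using ev_Ce(3)[OF K Delta_W, of h] by (simp add: Ce_Delta[simplified])
    also have "\<dots> = ?K h"
      unfolding j_def by (subst ev_pt[OF multilin_tail1[OF K]]) (auto simp: one_fun_apply split: nat.split)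
    also have "\<dots> = pt (msp V) (act V h (scale V (eps Q (fst x)) (snd x)))"
      using v lm_facts(4)[of h] by (simp add: linear_on_def pt_scale lm_facts)
    finally show ?thesis .
  qed
  then have "ct (tsum t (Ra h)) = tsum t (\<lambda>x. pt (msp V) (act V h (scale V (eps Q (fst x)) (snd x))))"
    unfolding ct_def tsum_tsum by (rule tsum_cong[OF good_V(2) t])
  also have "\<dots> = tsum (ct t) (\<lambda>v. pt (msp V) (act V h v))"
    by (rule tsum_ct[OF multilin_act(1)[OF p], symmetric])
  also have "\<dots> = pt (msp V) (act V h (counit_R Q V t))"
    unfolding counit_R(2)[OF t, symmetric] by (rule tsum_pt_multilin[OF multilin_act(1)[OF p]])
  finally show "ct (tsum t (Ra h)) = pt (msp V) (act V h (counit_R Q V t))" .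
qed

lemma counit_R_linear: "linear_on tscale (scale V) (tens (RX V)) (counit_R Q V)"
proof -
  interpret vector_space "scale V" by (rule lm_facts(1))
  have "pt (msp V) (v + w) = pt (msp V) v + pt (msp V) w" if "v \<in> carrier V" "w \<in> carrier V" for v w
    using multilin_pt[OF good_V(1)] that by (simp add: multilin_vsp linear_on_def)
  then show ?thesis
    unfolding linear_on_def
    by (auto intro!: counit_R_eq simp: counit_R scale_in pt_scale subspace_add[OF lm_facts(2)]) (simp_all add: ct_def tsum_linear)
qed

lemma counit_R_hom: "counit_R Q V \<in> hom_H (forget (R_obj Q V)) V"
  unfolding hom_H_def using counit_R_linear counit_R(1) counit_R_act
  by (auto simp: forget_def R_obj_sel act_R) (simp add: counit_R_def)

text \<open>The counit is applied to the inner copy of R(V), hence to the second leg of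
  \<open>cfree\<close>.\<close>

lemma triangle_R:
  assumes t: "t \<in> tens (RX V)"
  shows "tsum (tsum t Rc) (\<lambda>y. pt (RX V) (fst y, counit_R Q V (snd y))) = t"
proof -
  note p = multilin_RX[OF multilin_pt[OF good_V(2)]]
  have C: "multilin (RRX V) (\<lambda>y. pt (RX V) (fst y, counit_R Q V (snd y)))"
    by (auto simp: multilin_mprod[of "H1 Q" "vsp tscale (tens (RX V))"] counit_R(1)
      intro!: multilin_comp[OF p(2) counit_R_linear] p(1))
  have "tsum (Rc x) (\<lambda>y. pt (RX V) (fst y, counit_R Q V (snd y))) = pt (RX V) x" if "x \<in> points (RX V)" for x
  proof -
    obtain a v where x: "x = (a, v)" "v \<in> carrier V" using \<open>x \<in> points (RX V)\<close> by auto
    have c: "counit_R Q V (pt (RX V) (b, w)) = scale V (eps Q b) w" if "w \<in> carrier V" for b w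
      by (rule counit_R_eq) (use that in \<open>auto intro: scale_in simp: ct_def tsum_pt_multilin[OF multilin_ct[OF multilin_pt[OF good_V(1)]]]\<close>)
    have s: "pt (RX V) (b, scale V d w) = tscale d (pt (RX V) (b, w))" if "w \<in> carrier V" for b d w
      using p(2)[of b] that by (simp add: multilin_vsp linear_on_def)
    have K: "multilin (H2 Q) (\<lambda>k. pt (RX V) (fst k, act V (snd k) v))"
      using x by (auto simp: multilin_mprod[of "H1 Q" "H1 Q"] lm_facts intro!: p multilin_act)
    have "tsum (Rc x) (\<lambda>y. pt (RX V) (fst y, counit_R Q V (snd y))) =
        ev 3 (\<lambda>k. tscale (eps Q (k 1)) (pt (RX V) (k 0, act V (k 2) v))) (cfree a)"
      using x by (simp add: tsum_Rc[OF C] c s lm_facts)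
    also have "\<dots> = ev 2 (\<lambda>k. pt (RX V) (k 0, act V (k 1) v)) (pN (a ## 1 ## 1))"
      using ev_Ce(2)[OF K cfree_W, of a] Ce_cfree(2)[of a] by (simp add: j_def)
    also have "\<dots> = pt (RX V) x"
      using ev_pts(1)[OF multilin_tail2[OF K], of a 1] x by (simp add: lm_facts one_fun_apply)
    finally show ?thesis .
  qed
  then have "tsum (tsum t Rc) (\<lambda>y. pt (RX V) (fst y, counit_R Q V (snd y))) = tsum t (pt (RX V))"
    unfolding tsum_tsum by (rule tsum_cong[OF good_V(2) t])
  then show ?thesis by (simp add: tsum_pt_right t)
qed

end

section \<open>Functoriality and naturality of the counit\<close>

context
  fixes V :: "('k, 'h, 'v::ab_group_add) hmod" and W' :: "('k, 'h, 'w::ab_group_add) hmod" and f :: "'v \<Rightarrow> 'w"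
  assumes V: "left_module Q V" and W': "left_module Q W'" and f: "f \<in> hom_H V W'"
begin

lemma hom_facts:
  "v \<in> carrier V \<Longrightarrow> f v \<in> carrier W'" "linear_on (scale V) (scale W') (carrier V) f"
  "v \<in> carrier V \<Longrightarrow> f (act V h v) = act W' h (f v)" "f \<in> extensional (carrier V)"
  using f by (auto simp: hom_H_def PiE_def)

lemma multilin_map:
  assumes "multilin (RX W') F" shows "multilin (RX V) (\<lambda>x. F (fst x, f (snd x)))"
  using multilin_RX[OF W' assms] hom_facts(1)
  by (auto simp: multilin_mprod intro!: multilin_comp[OF _ hom_facts(2)])

definition Rf where "Rf t = tsum t (\<lambda>x. pt (RX W') (fst x, f (snd x)))"

lemmas multilin_Rf = multilin_map[OF multilin_pt[OF good_V(2)[OF W']]]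

lemma Rf_in: "t \<in> tens (RX V) \<Longrightarrow> Rf t \<in> tens (RX W')"
  unfolding Rf_def by (rule tsum_in[OF _ multilin_Rf]) (auto intro!: tens_pt hom_facts)

lemma R_map_eq: "t \<in> tens (RX V) \<Longrightarrow> R_map Q V W' f t = Rf t"
  by (simp add: R_map_def Rf_def split_def)

lemma tsum_Rf: "multilin (RX W') F \<Longrightarrow> tsum (Rf t) F = tsum t (\<lambda>x. F (fst x, f (snd x)))"
  unfolding Rf_def tsum_tsum by (simp add: tsum_pt_multilin)

lemma Rf_act: assumes t: "t \<in> tens (RX V)" shows "Rf (tsum t (Ra V h)) = tsum (Rf t) (Ra W' h)"
  unfolding tsum_Rf[OF multilin_Ra[OF W']] unfolding Rf_def tsum_tsum
proof (rule tsum_cong[OF good_V(2)[OF V] t])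
  fix x assume x: "x \<in> points (RX V)"
  then have "snd x \<in> carrier V" by auto
  then show "tsum (Ra V h x) (\<lambda>x. pt (RX W') (fst x, f (snd x))) = Ra W' h (fst x, f (snd x))"
    unfolding tsum_Ra[OF V multilin_Rf x] Ra_def[OF W'] by (simp add: hom_facts)
qed

text \<open>R(f) changes only the module entry, and \<open>f\<close> commutes with the third
  component of \<omega> acting there.\<close>

lemma Rf_coact:
  assumes t: "t \<in> tens (RX V)"
  shows "tsum (Rf t) (Rc W') = tsum (tsum t (Rc V)) (\<lambda>y. pt (RRX W') (fst y, R_map Q V W' f (snd y)))"
proof -
  note p = multilin_RRX[OF W' multilin_pt[OF good_V(3)[OF W']]]
  have l: "linear_on tscale tscale (tens (RX V)) Rf"
    by (simp add: linear_on_def Rf_def tsum_linear)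
  have C: "multilin (RRX V) (\<lambda>y. pt (RRX W') (fst y, Rf (snd y)))"
    by (auto simp: multilin_mprod[of "H1 Q" "vsp tscale (tens (RX V))"]
      intro!: multilin_comp[OF p(2) l Rf_in] p(1) Rf_in)
  have "tsum (tsum t (Rc V)) (\<lambda>y. pt (RRX W') (fst y, R_map Q V W' f (snd y))) = tsum (tsum t (Rc V)) (\<lambda>y. pt (RRX W') (fst y, Rf (snd y)))"
    by (rule tsum_cong[OF good_V(3)[OF V] coact_R_in[OF V t]]) (auto simp: R_map_eq)
  also have "\<dots> = tsum (Rf t) (Rc W')"
    unfolding tsum_Rf[OF multilin_Rc[OF W']] tsum_tsum
  proof (rule tsum_cong[OF good_V(2)[OF V] t])
    fix x assume x: "x \<in> points (RX V)"
    then have "snd x \<in> carrier V" by auto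
    then show "tsum (Rc V x) (\<lambda>y. pt (RRX W') (fst y, Rf (snd y))) = Rc W' (fst x, f (snd x))"
      unfolding tsum_Rc[OF V C] Rc_def[OF W'] by (simp add: hom_facts Rf_def tsum_pt_multilin[OF multilin_Rf])
  qed
  finally show ?thesis ..
qed

lemma R_map_hom: "R_map Q V W' f \<in> hom_YD Q (R_obj Q V) (R_obj Q W')"
proof -
  have "R_map Q V W' f \<in> hom_H (forget (R_obj Q V)) (forget (R_obj Q W'))"
    unfolding hom_H_def
    by (auto simp: forget_def R_obj_sel[OF V] R_obj_sel[OF W'] R_map_eq Rf_in act_R[OF V] act_R[OF W'] act_R_in[OF V] Rf_act linear_on_def)
      (auto simp: R_map_def Rf_def tsum_linear)
  then show ?thesis
    unfolding hom_YD_def by (simp add: split_def R_obj_sel[OF V] R_obj_sel[OF W'] coact_R[OF V] coact_R[OF W'] R_map_eq Rf_in Rf_coact)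
qed

lemma counit_R_natural:
  assumes t: "t \<in> tens (RX V)"
  shows "counit_R Q W' (R_map Q V W' f t) = f (counit_R Q V t)"
  unfolding R_map_eq[OF t]
proof (rule counit_R_eq[OF W' Rf_in[OF t] hom_facts(1)[OF counit_R(1)[OF V t]]])
  have m: "multilin (msp V) (\<lambda>v. pt (msp W') (f v))"
    by (rule multilin_comp[OF multilin_pt[OF good_V(1)[OF W']] hom_facts(2,1)])
  have "ct W' (Rf t) = tsum t (\<lambda>x. pt (msp W') (f (scale V (eps Q (fst x)) (snd x))))"
    unfolding ct_def[OF W'] tsum_Rf[OF multilin_ct[OF W' multilin_pt[OF good_V(1)[OF W']]]]
    by (rule tsum_cong[OF good_V(2)[OF V] t]) (use hom_facts(2) in \<open>auto simp: linear_on_def\<close>)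
  also have "\<dots> = tsum (ct V t) (\<lambda>v. pt (msp W') (f v))"
    by (rule tsum_ct[OF V m, symmetric])
  also have "\<dots> = pt (msp W') (f (counit_R Q V t))"
    unfolding counit_R(2)[OF V t, symmetric] by (rule tsum_pt_multilin[OF m])
  finally show "ct W' (Rf t) = pt (msp W') (f (counit_R Q V t))" .
qed

end

lemma R_map_id:
  fixes V :: "('k, 'h, 'v::ab_group_add) hmod"
  assumes V: "left_module Q V"
  shows "R_map Q V V (\<lambda>v\<in>carrier V. v) = (\<lambda>t\<in>carrier (R_obj Q V). t)"
proof -
  have "tsum t (\<lambda>x. pt (RX V) (fst x, restrict (\<lambda>v. v) (carrier V) (snd x))) = t" if t: "t \<in> tens (RX V)" for t
    using tsum_cong[OF good_V(2)[OF V] t, of "\<lambda>x. pt (RX V) (fst x, restrict (\<lambda>v. v) (carrier V) (snd x))" "pt (RX V)"] tsum_pt_right[OF t] by auto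
  then show ?thesis by (auto simp: R_map_def R_obj_sel[OF V] split_def intro!: restrict_ext)
qed

lemma R_map_comp:
  fixes U :: "('k, 'h, 'u::ab_group_add) hmod" and V :: "('k, 'h, 'v::ab_group_add) hmod" and W' :: "('k, 'h, 'w::ab_group_add) hmod"
  assumes U: "left_module Q U" and V: "left_module Q V" and W': "left_module Q W'" and f: "f \<in> hom_H U V" and g: "g \<in> hom_H V W'"
  shows "R_map Q U W' (compose (carrier U) g f) = compose (carrier (R_obj Q U)) (R_map Q V W' g) (R_map Q U V f)"
proof -
  have "tsum t (\<lambda>x. pt (RX W') (fst x, compose (carrier U) g f (snd x))) = R_map Q V W' g (R_map Q U V f t)" if t: "t \<in> tens (RX U)" for t
  proof -
    have "R_map Q V W' g (R_map Q U V f t) = tsum t (\<lambda>x. pt (RX W') (fst x, g (f (snd x))))"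
      using tsum_Rf[OF U V f multilin_Rf[OF V W' g], of t] R_map_eq[OF U V f t] R_map_eq[OF V W' g] Rf_in[OF U V f t]
      by (simp add: Rf_def[OF V W' g])
    also have "\<dots> = tsum t (\<lambda>x. pt (RX W') (fst x, compose (carrier U) g f (snd x)))"
      by (rule tsum_cong[OF good_V(2)[OF U] t]) (auto simp: compose_def)
    finally show ?thesis ..
  qed
  then show ?thesis
    by (auto simp: R_map_def[of Q U W'] compose_def[of "tens (RX U)"] R_obj_sel[OF U] split_def intro!: restrict_ext)
qed

lemma forget_sel: "carrier (forget M) = carrier M" "scale (forget M) = scale M" "act (forget M) = act M"
  by (simp_all add: forget_def)

section \<open>The unit\<close>

context
  fixes M :: "('k, 'h, 'm::ab_group_add) ydmod"
  assumes M: "yd_module Q M"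
begin

lemma yd_facts:
  "left_module Q (forget M)"
  "m \<in> carrier M \<Longrightarrow> coact M m \<in> tens (RX (forget M))"
  "linear_on (scale M) tscale (carrier M) (coact M)"
  "m \<in> carrier M \<Longrightarrow> tsum (coact M m) (\<lambda>x. tsum (coact M (snd x)) (\<lambda>y. pt (H1 Q \<boxtimes> RX (forget M)) (fst x, y))) =
    tsum (omega Q) (\<lambda>z. tsum (coact M m) (\<lambda>x. tsum (Delta Q (fst x)) (\<lambda>w. pt (H1 Q \<boxtimes> RX (forget M))
      (fst z * fst w * snd (snd (snd (snd z))), fst (snd z) * snd w * fst (snd (snd (snd z))), act M (fst (snd (snd z))) (snd x)))))"
  "m \<in> carrier M \<Longrightarrow> tsum (coact M m) (\<lambda>x. pt (msp M) (scale M (eps Q (fst x)) (snd x))) = pt (msp M) m"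
  "m \<in> carrier M \<Longrightarrow> coact M (act M h m) = tsum (Delta Q h) (\<lambda>z. tsum (Delta Q (fst z)) (\<lambda>w. tsum (coact M m) (\<lambda>y.
      pt (RX (forget M)) (fst w * fst y * S (snd z), act M (snd w) (snd y)))))"
  using M unfolding yd_module_def split_def forget_sel by simp_all

lemmas good_M = good_V[OF yd_facts(1)]

lemma unit_in: "m \<in> carrier M \<Longrightarrow> unit_R M m \<in> tens (RX (forget M))"
  using yd_facts(2) by (simp add: unit_R_def)

text \<open>Linearity of the unit is the compatibility axiom of \<open>M\<close>; only the order of
  the sums differs.\<close>

lemma coact_act:
  assumes m: "m \<in> carrier M"
  shows "coact M (act M h m) = tsum (coact M m) (Ra (forget M) h)"
proof -
  let ?F = "\<lambda>z y. pt (RX (forget M)) (fst z * fst y * S (snd (snd z)), act M (fst (snd z)) (snd y))"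
  have z: "multilin (H3 Q) (\<lambda>z. ?F z y)" if "y \<in> points (RX (forget M))" for y
    using multilin_Ra_inner[OF yd_facts(1) multilin_pt[OF good_M(2)], of "snd y" "fst y"] that by (auto simp: forget_sel)
  have y: "multilin (RX (forget M)) (?F z)" for z
    using multilin_RX[OF yd_facts(1) multilin_pt[OF good_M(2)]] lm_facts(3)[OF yd_facts(1)]
    by (auto simp: multilin_mprod forget_sel intro!: mcomps multilin_act(1)[OF yd_facts(1), unfolded forget_sel])
  have "multilin (H3 Q) (\<lambda>z. tsum (coact M m) (?F z))"
    by (rule multilin_tsum2[OF good_H3 good_M(2) yd_facts(2)[OF m]]) (use z y in auto)
  then have "coact M (act M h m) = ev 3 (\<lambda>z. tsum (coact M m) (?F (z 0, z 1, z 2))) (\<Delta>3 h)"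
    unfolding yd_facts(6)[OF m] by (subst tsum_Delta_Delta[symmetric]) simp_all
  also have "\<dots> = tsum (coact M m) (\<lambda>y. ev 3 (\<lambda>z. ?F (z 0, z 1, z 2) y) (\<Delta>3 h))"
    by (rule tsum_ev_swap[symmetric, OF good_M(2) yd_facts(2)[OF m] Delta3_in(1)]) (rule y, rule multilin_3[OF z])
  finally show ?thesis by (simp add: Ra_def[OF yd_facts(1), abs_def] forget_sel)
qed

lemma coact_coact:
  assumes m: "m \<in> carrier M"
  shows "tsum (coact M m) (Rc (forget M)) = tsum (coact M m) (\<lambda>y. pt (RRX (forget M)) (fst y, unit_R M (snd y)))"
proof -
  let ?V = "forget M"
  \<comment> \<open>\<open>?J\<close> passes from H \<otimes> H \<otimes> M to H \<otimes> R(M); the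
    coassociativity axiom of \<open>M\<close> is transported along it.\<close>
  let ?J = "\<lambda>y. pt (RRX ?V) (fst y, pt (RX ?V) (snd y))"
  let ?T = "\<lambda>z x. tsum (Delta Q (fst x)) (\<lambda>w. pt (RRX ?V)
      (fst z * fst w * snd (snd (snd (snd z))), pt (RX ?V) (fst (snd z) * snd w * fst (snd (snd (snd z))), act ?V (fst (snd (snd z))) (snd x))))"
  note V = yd_facts(1) and c = yd_facts(2)[OF m]
  note p = multilin_pt[OF good_M(3)]
  have J: "multilin (H1 Q \<boxtimes> RX ?V) ?J"
    using multilin_RRX(1)[OF V p] multilin_RRX_pt[OF V p]
    unfolding multilin_mprod[of "H1 Q" "RX ?V"] by (simp add: mem_Times_iff)
  note P = multilin_Rc_inner[OF V p]
  have Tz: "multilin (H5 Q) (\<lambda>z. ?T z x)" if "x \<in> points (RX ?V)" for x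
  proof (rule multilin_tsum2[OF good_H5 good_H2 Delta_in])
    have v: "snd x \<in> carrier ?V" using that by auto
    show "multilin (H5 Q) (\<lambda>z. pt (RRX ?V) (fst z * fst w * snd (snd (snd (snd z))),
        pt (RX ?V) (fst (snd z) * snd w * fst (snd (snd (snd z))), act ?V (fst (snd (snd z))) (snd x))))" for w
      using multilin_omega_arg(1)[OF P[OF v], of w] by simp
    show "multilin (H2 Q) (\<lambda>w. pt (RRX ?V) (fst z * fst w * snd (snd (snd (snd z))),
        pt (RX ?V) (fst (snd z) * snd w * fst (snd (snd (snd z))), act ?V (fst (snd (snd z))) (snd x))))" for z
      using multilin_omega_arg(2)[OF P[OF v], of z] by simp
  qed
  have Tx: "multilin (RX ?V) (?T z)" for z
    unfolding multilin_mprod[of "H1 Q" "msp ?V"]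
  proof (intro conjI ballI)
    fix v assume "v \<in> points (msp ?V)"
    show "multilin (H1 Q) (\<lambda>a. ?T z (a, v))"
      unfolding fst_conv snd_conv by (rule multilin_Delta)
  next
    fix a
    have w: "multilin (H2 Q) (\<lambda>w. pt (RRX ?V) (fst z * fst w * snd (snd (snd (snd z))),
        pt (RX ?V) (fst (snd z) * snd w * fst (snd (snd (snd z))), act ?V (fst (snd (snd z))) v)))" if "v \<in> points (msp ?V)" for v
      using multilin_omega_arg(2)[OF P, of v z] that by simp
    have v: "multilin (msp ?V) (\<lambda>v. pt (RRX ?V) (b, pt (RX ?V) (d, act ?V h v)))" for b d h
      using multilin_act(1)[OF V multilin_RX(2)[OF V multilin_RRX_pt[OF V p]]] .
    show "multilin (msp ?V) (\<lambda>v. ?T z (a, v))"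
      unfolding fst_conv snd_conv by (rule multilin_tsum2[OF good_M(1) good_H2 Delta_in v w])
  qed
  have "tsum (coact M m) (Rc ?V) = tsum (coact M m) (\<lambda>x. tsum (omega Q) (\<lambda>z. ?T z x))"
    by (rule tsum_cong[OF good_M(2) c Rc_omega[OF V]])
  also have "\<dots> = tsum (omega Q) (\<lambda>z. tsum (coact M m) (?T z))"
    by (rule tsum_swap[OF good_M(2) good_H5 c omega_in]) (use Tz Tx in auto)
  also have "\<dots> = tsum (tsum (coact M m) (\<lambda>x. tsum (coact M (snd x)) (\<lambda>y. pt (H1 Q \<boxtimes> RX ?V) (fst x, y)))) ?J"
    unfolding yd_facts(4)[OF m] tsum_tsum tsum_pt_multilin[OF J] by (simp only: fst_conv snd_conv forget_sel)
  also have "\<dots> = tsum (coact M m) (\<lambda>x. tsum (coact M (snd x)) (\<lambda>y. pt (RRX ?V) (fst x, pt (RX ?V) y)))"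
    unfolding tsum_tsum tsum_pt_multilin[OF J] by (simp only: fst_conv snd_conv)
  also have "\<dots> = tsum (coact M m) (\<lambda>y. pt (RRX ?V) (fst y, unit_R M (snd y)))"
    by (rule tsum_cong[OF good_M(2) c]) (auto simp: lin_pt_RRX[OF V yd_facts(2), unfolded forget_sel] unit_R_def forget_sel)
  finally show ?thesis .
qed

lemma unit_hom: "unit_R M \<in> hom_YD Q M (R_obj Q (forget M))"
proof -
  note V = yd_facts(1)
  have "unit_R M \<in> hom_H (forget M) (forget (R_obj Q (forget M)))"
    unfolding hom_H_def forget_sel R_obj_sel[OF V]
    using yd_facts(2,3) lm_facts(3)[OF V]
    by (auto simp: unit_R_def act_R[OF V] coact_act linear_on_def forget_sel lm_facts(3)[OF V, unfolded forget_sel])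
      (use lm_facts(1,2)[OF V] in \<open>auto simp: forget_sel module.subspace_add module.subspace_scale vector_space_def module_def\<close>)
  then show ?thesis
    unfolding hom_YD_def split_def R_obj_sel[OF V]
    by (simp add: unit_in coact_R[OF V]) (simp add: unit_R_def[of M] coact_coact[unfolded unit_R_def])
qed

lemma counit_unit: "m \<in> carrier M \<Longrightarrow> counit_R Q (forget M) (unit_R M m) = m"
  using yd_facts(2)[of m] yd_facts(5)[of m]
  by (intro counit_R_eq[OF yd_facts(1)]) (auto simp: ct_def[OF yd_facts(1)] forget_sel unit_R_def)

end

end

theorem theorem5p3:
  fixes Q :: "('k::field, 'h::ring_1) qha"
  assumes "quasi_hopf Q" and "bij (anti Q)"
  shows
    \<comment> \<open>\<open>R\<close> is a functor from left modules to Yetter-Drinfeld modules\<close>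
    "(\<forall>V :: ('k, 'h, 'v::ab_group_add) hmod. left_module Q V \<longrightarrow> yd_module Q (R_obj Q V)) \<and>
    (\<forall>(V :: ('k, 'h, 'v) hmod) (W :: ('k, 'h, 'w::ab_group_add) hmod) f.
      left_module Q V \<longrightarrow> left_module Q W \<longrightarrow> f \<in> hom_H V W \<longrightarrow>
        R_map Q V W f \<in> hom_YD Q (R_obj Q V) (R_obj Q W)) \<and>
    (\<forall>V :: ('k, 'h, 'v) hmod. left_module Q V \<longrightarrow>
        R_map Q V V (\<lambda>v\<in>carrier V. v) = (\<lambda>t\<in>carrier (R_obj Q V). t)) \<and>
    (\<forall>(U :: ('k, 'h, 'u::ab_group_add) hmod) (V :: ('k, 'h, 'v) hmod) (W :: ('k, 'h, 'w) hmod) f g.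
      left_module Q U \<longrightarrow> left_module Q V \<longrightarrow> left_module Q W \<longrightarrow>
      f \<in> hom_H U V \<longrightarrow> g \<in> hom_H V W \<longrightarrow>
        R_map Q U W (compose (carrier U) g f) =
        compose (carrier (R_obj Q U)) (R_map Q V W g) (R_map Q U V f)) \<and>
    \<comment> \<open>the unit is a natural transformation from the identity to \<open>R F\<close>\<close>
    (\<forall>M :: ('k, 'h, 'm::ab_group_add) ydmod. yd_module Q M \<longrightarrow>
        unit_R M \<in> hom_YD Q M (R_obj Q (forget M))) \<and>
    (\<forall>(M :: ('k, 'h, 'm) ydmod) (N :: ('k, 'h, 'n::ab_group_add) ydmod) f.
      yd_module Q M \<longrightarrow> yd_module Q N \<longrightarrow> f \<in> hom_YD Q M N \<longrightarrow>
        compose (carrier M) (R_map Q (forget M) (forget N) f) (unit_R M) =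
        compose (carrier M) (unit_R N) f) \<and>
    \<comment> \<open>the counit is a natural transformation from \<open>F R\<close> to the identity\<close>
    (\<forall>V :: ('k, 'h, 'v) hmod. left_module Q V \<longrightarrow>
        counit_R Q V \<in> hom_H (forget (R_obj Q V)) V) \<and>
    (\<forall>(V :: ('k, 'h, 'v) hmod) (W :: ('k, 'h, 'w) hmod) f.
      left_module Q V \<longrightarrow> left_module Q W \<longrightarrow> f \<in> hom_H V W \<longrightarrow>
        compose (carrier (R_obj Q V)) (counit_R Q W) (R_map Q V W f) =
        compose (carrier (R_obj Q V)) f (counit_R Q V)) \<and>
    \<comment> \<open>triangle identities\<close>
    (\<forall>M :: ('k, 'h, 'm) ydmod. yd_module Q M \<longrightarrow>
        compose (carrier M) (counit_R Q (forget M)) (unit_R M) = (\<lambda>m\<in>carrier M. m)) \<and>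
    (\<forall>V :: ('k, 'h, 'v) hmod. left_module Q V \<longrightarrow>
        compose (carrier (R_obj Q V))
          (R_map Q (forget (R_obj Q V)) V (counit_R Q V)) (unit_R (R_obj Q V)) =
        (\<lambda>t\<in>carrier (R_obj Q V). t))"
proof -
  interpret quasi_hopf_algebra Q by unfold_locales fact
  \<comment> \<open>Naturality of the unit is colinearity of \<open>f\<close>.\<close>
  have nat: "R_map Q (forget M) (forget N) f (unit_R M m) = unit_R N (f m)"
    if M: "yd_module Q M" and N: "yd_module Q N" and f: "f \<in> hom_YD Q M N" and m: "m \<in> carrier M"
    for M :: "('k, 'h, 'm) ydmod" and N :: "('k, 'h, 'n) ydmod" and f m
  proof -
    have "f \<in> hom_H (forget M) (forget N)" using f by (simp add: hom_YD_def)
    then show ?thesis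
      using f m hom_facts(1)[OF yd_facts(1)[OF M] yd_facts(1)[OF N], of f m] yd_facts(2)[OF M m]
      by (simp add: hom_YD_def unit_R_def R_map_def split_def forget_sel)
  qed
  show ?thesis
    apply (intro conjI allI impI)
    subgoal by (rule yd_module_R)
    subgoal by (rule R_map_hom)
    subgoal by (rule R_map_id)
    subgoal by (rule R_map_comp)
    subgoal by (rule unit_hom)
    subgoal by (auto simp: compose_def nat intro!: restrict_ext)
    subgoal by (rule counit_R_hom)
    subgoal by (auto simp: compose_def R_obj_sel counit_R_natural intro!: restrict_ext)
    subgoal by (auto simp: compose_def counit_unit intro!: restrict_ext)
    subgoal for V
      using triangle_R[of V] coact_R_in[of V]
      by (auto simp: compose_def R_obj_sel unit_R_def coact_R R_map_def split_def forget_sel intro!: restrict_ext)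
    done
qed

end
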